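(* Let $v=q^{1/2}$. In the algebra $\mathcal H^{BM}=\bigoplus_{c}\mathcal H^{BM}_c$ the elements $\mathcal F^{(k)}_{\alpha}$ ($\alpha\in\Pi$, $k\in\mathbb N$) satisfy: (1) (divided power relation) $\left(\mathcal F^{(1)}_\alpha\right)^k=[k]_{q_\alpha^{1/2}}!\,\mathcal F^{(k)}_\alpha$ for all $\alpha\in\Pi$, $k\in\mathbb N$; (2) (quantum Serre relations) for all $i\neq j$, $$\sum_{m=0}^{1-a_{ij}}(-1)^m\,\mathcal F^{(m)}_{\alpha_i}\,\mathcal F^{(1)}_{\alpha_j}\,\mathcal F^{(1-a_{ij}-m)}_{\alpha_i}=0 .$$ Thus there is a homomorphism of $\mathbb Z[v^{\pm1}]$-algebras $U_v^{<0}\mathfrak g\to\mathcal H^{BM}$ with $F^{(k)}_\alpha\mapsto\mathcal F^{(k)}_\alpha$ for all $\alpha\in\Pi$ and $k\in\mathbb N$.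
   Context: **Lie data.** $(a_{ij})_{1\le i,j\le l}$ is the Cartan matrix of a semisimple Lie algebra $\mathfrak g$, $d_i$ positive integers with $(d_ia_{ij})$ symmetric positive definite, $\Pi=\{\alpha_1,\dots,\alpha_l\}$ the simple roots, $(\alpha_i,\alpha_j)=d_ia_{ij}$. For $\alpha=\alpha_i$: $d_\alpha=d_i$, $q_\alpha=q^{d_i}$. $[k]_u=\frac{u^k-u^{-k}}{u-u^{-1}}$, $[k]_u!=[k]_u\cdots[1]_u$. $R=\mathbb Z[q^{\pm1/2}]$. **The algebra $U_v^{<0}\mathfrak g$.** With $v=q^{1/2}$, $v_i=v^{d_i}$: take the $\mathbb Q(v)$-algebra generated by $F_{\alpha_1},\dots,F_{\alpha_l}$ with the quantum Serre relations $\sum_{m}(-1)^mF_{\alpha_i}^{(m)}F_{\alpha_j}F_{\alpha_i}^{(1-a_{ij}-m)}=0$ ($i\ne j$, $0\le m\le 1-a_{ij}$), where $F_{\alpha_i}^{(k)}=F_{\alpha_i}^k/[k]_{v_i}!$. Then $U_v^{<0}\mathfrak g$ is its $\mathbb Z[v^{\pm1}]$-subalgebra generated by all $F^{(k)}_{\alpha_i}$, $k\ge0$. **Configuration spaces.** A coloring is a function $c:\Pi\to\mathbb N$, identified with $\sum_\alpha c(\alpha)\alpha\in\mathbb N[\Pi]$; $m_c=\sum_\alpha c(\alpha)$. $D=[-1,1]^2\subset\mathbb C$ (a disk), $\partial^-D$ its two vertical sides. $\mathrm{Conf}_c=\left(D^{m_c}\setminus\bigcup_{i<j}\{z_i=z_j\}\right)/\mathfrak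 S_{c(\alpha_1)}\times\cdots\times\mathfrak S_{c(\alpha_l)}$: configurations $(\mathbf z^{\alpha_1},\dots,\mathbf z^{\alpha_l})$ where $\mathbf z^{\alpha_i}$ is a set of $c(\alpha_i)$ points "colored by $\alpha_i$". $S\subset\mathrm{Conf}_c$ is the set of configurations with at least one point in $\partial^-D$. **Local system.** Put $f(\{z_1,\dots,z_n\})=\prod_{i<j}\left(\frac{z_j-z_i}{|z_j-z_i|}\right)^2$, $g(\{z_i\},\{w_j\})=\prod_{i,j}\left(\frac{w_j-z_i}{|w_j-z_i|}\right)^2$, $\Phi_c(\mathbf z)=\left((f(\mathbf z^{\alpha_i}))_i,(g(\mathbf z^{\alpha_i},\mathbf z^{\alpha_j}))_{i<j}\right)\in(\mathbb S^1)^{l+l(l-1)/2}$, and $W_c=\Phi_c\circ r$ with $r$ the rotation of all points by $\pi/2$. Vertically aligned configurations are sent to $b=(1,\dots,1)$. $R_c$ is the pullback by $W_c$ of the rank one local system of $R$-modules on the torus with fibre $R$ at $b$ and monodromy $-q^{d_i}$ along the $i$-th counterclockwise circle of the $f$-coordinates and $q^{(\alpha_i,\alpha_j)/2}$ along the circle of the $g$-coordinate $(i,j)$. A twisted class is given by an oriented (locally finite) relative cycle $M$ together with a handle, i.e. a path in $\mathrm{Conf}_c$ from a vertically aligned configuration to $M$; for two handles $\eta,\eta'$, $[M,\eta]=\rho_c(W_c(\eta\eta'^{-1}))[M,\eta']$, where $\rho_c$ is the monodromy. **Homology.** $\mathcal H^{BM}_c=H^{BM}_{m_c}(\mathrm{Conf}_c,S;R_c)$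 is twisted relative Borel–Moore homology: $H^{BM}_\bullet(X,Y)=\varprojlim_{K\text{ compact}}H_\bullet(X,Y\cup(X\setminus K))$. **Product.** The product $\mathcal H^{BM}_{c_1}\otimes\mathcal H^{BM}_{c_2}\to\mathcal H^{BM}_{c_1+c_2}$ is given by stacking the disk of the first factor above the disk of the second. Stacking (and rescaling) gives a map $\mathrm{Conf}_{c_1}\times\mathrm{Conf}_{c_2}\to\mathrm{Conf}_{c_1+c_2}$. On chains, $(\Delta_1,H_1)\cdot(\Delta_2,H_2)=(\Delta_1\cdot\Delta_2,H_1\cdot H_2)$, where $\Delta_1\cdot\Delta_2$ is the image of the product chain $\Delta_1\times\Delta_2$ under stacking, $H_i$ is a path in the torus from $b$ to $W_{c_i}(\Delta_i)$, and $H_1\cdot H_2$ is the term by term product of paths. For classes given by cycles with handles, the handle of the product is the union of the two stacked handles, starting at a vertically aligned configuration on the right side. The unit is the empty configuration. **Classes.** $\mathcal F^{(k)}_\alpha\in\mathcal H^{BM}_{k\alpha}$ is $q^{-d_\alpha k(k-1)/4}$ times the class of the simplex $\{0<t_1<\dots<t_k<1\}\to\mathrm{Conf}_{k\alpha}$, $t\mapsto\{(-1+2t_1,0),\dots,(-1+2t_k,0)\}$ (all points colored $\alpha$), oriented by $dt_1\wedge\dots\wedge dt_k$, with handle starting at a configuration on the right side of $D$ above height $0$, the points moving along disjoint paths horizontally to the left above the segment and then vertically down to it, higher starting points ending further left.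
   Formalization: The product of classes carries the extra orientation sign (-1)^(sum over i<j of c_2(α_i)c_1(α_j)), listing coordinates color by color; with the plain product chain (2) fails, e.g. orthogonal roots give F_1F_2 = -F_2F_1, which is nonzero. *)

theory Defs
  imports
    "HOL-Homology.Homology"
    "HOL-Algebra.Module"
    "HOL-Algebra.QuotRing"
    "HOL-Algebra.Algebraic_Closure_Type"
    "HOL-Computational_Algebra.Fraction_Field"
    "HOL-Library.Poly_Mapping"
    "HOL-Library.Set_Algebras"
begin

section \<open>Lie data and the ground ring\<close>

text \<open>The simple roots are the elements of a finite linearly ordered type \<open>'i\<close>; the order is
  the numbering \<open>\<alpha>\<^sub>1, \<dots>, \<alpha>\<^sub>l\<close>. Cartan matrices of semisimple Lie algebras are the integer
  matrices with the following properties; \<open>d i * a i j\<close> is the inner product of the roots \<open>i\<close>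
  and \<open>j\<close>.\<close>

definition cartan_datum :: "('i::finite \<Rightarrow> 'i \<Rightarrow> int) \<Rightarrow> ('i \<Rightarrow> nat) \<Rightarrow> bool" where
  "cartan_datum a d \<longleftrightarrow>
     (\<forall>i. a i i = 2) \<and> (\<forall>i j. i \<noteq> j \<longrightarrow> a i j \<le> 0) \<and> (\<forall>i. d i > 0) \<and>
     (\<forall>i j. int (d i) * a i j = int (d j) * a j i) \<and>
     (\<forall>x :: 'i \<Rightarrow> real. (\<exists>i. x i \<noteq> 0) \<longrightarrow>
        (\<Sum>i\<in>UNIV. \<Sum>j\<in>UNIV. real (d i) * real_of_int (a i j) * x i * x j) > 0)"

text \<open>\<open>\<int>[v\<^sup>\<plusminus>\<^sup>1]\<close> as the group ring of \<open>\<int>\<close>, with \<open>q = v\<^sup>2\<close>.\<close>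

type_synonym laurent = "int \<Rightarrow>\<^sub>0 int"

definition vpow :: "int \<Rightarrow> laurent" where
  "vpow n = Poly_Mapping.single n 1"

text \<open>The quantum integer \<open>[k]\<^sub>u\<close> for \<open>u = v\<^sup>n\<close>, as an element of \<open>\<int>[v\<^sup>\<plusminus>\<^sup>1]\<close>; \<open>qint_quotient\<close>
  below is the usual formula.\<close>

definition qint :: "int \<Rightarrow> nat \<Rightarrow> laurent" where
  "qint n k = (\<Sum>m<k. vpow (n * (int k - 1 - 2 * int m)))"

definition qfact :: "int \<Rightarrow> nat \<Rightarrow> laurent" where
  "qfact n k = (\<Prod>j\<in>{1..k}. qint n j)"

type_synonym qv = "laurent fract"

definition to_qv :: "laurent \<Rightarrow> qv" where
  "to_qv r = Fract r 1"

lemma vpow_add: "vpow (m + n) = vpow m * vpow n"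
  by (simp add: vpow_def mult_single)

lemma vpow_0 [simp]: "vpow 0 = 1"
  by (simp add: vpow_def)

lemma vpow_eq_iff [simp]: "vpow m = vpow n \<longleftrightarrow> m = n"
  by (metis vpow_def lookup_single_eq lookup_single_not_eq one_neq_zero)

lemma qint_times: "qint n k * (vpow n - vpow (- n)) = vpow (n * int k) - vpow (- (n * int k))"
proof -
  let ?g = "\<lambda>m. vpow (n * (int k - 2 * int m))"
  have "qint n k * (vpow n - vpow (- n)) = (\<Sum>m<k. ?g m - ?g (Suc m))"
    unfolding qint_def sum_distrib_right
    by (intro sum.cong refl) (simp add: right_diff_distrib flip: vpow_add, simp add: algebra_simps)
  also have "\<dots> = ?g 0 - ?g k"
    by (rule sum_lessThan_telescope')
  finally show ?thesis
    by (simp add: algebra_simps)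
qed

lemma qint_quotient:
  assumes "n \<noteq> 0"
  defines "u \<equiv> to_qv (vpow n)"
  shows "to_qv (qint n k) = (u ^ k - inverse u ^ k) / (u - inverse u)"
proof -
  have hom: "to_qv (x * y) = to_qv x * to_qv y" "to_qv (x - y) = to_qv x - to_qv y"
    "to_qv 1 = 1" for x y
    by (simp_all add: to_qv_def One_fract_def)
  have inj: "to_qv x = to_qv y \<longleftrightarrow> x = y" for x y
    by (simp add: to_qv_def eq_fract)
  have pow: "to_qv (vpow (m * int k)) = to_qv (vpow m) ^ k" for m k
    by (induction k) (simp_all add: hom distrib_left vpow_add)
  have "to_qv (vpow n) * to_qv (vpow (- n)) = 1"
    by (simp add: hom flip: hom(1) vpow_add)
  then have inv: "inverse u = to_qv (vpow (- n))"
    unfolding u_def by (rule inverse_unique)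
  have "u - inverse u \<noteq> 0"
    unfolding inv using assms(1) by (simp add: u_def inj)
  moreover have "to_qv (qint n k) * (u - inverse u) = u ^ k - inverse u ^ k"
    using arg_cong[OF qint_times[of n k], of to_qv] pow[of "- n" k] pow[of n k]
    unfolding inv by (simp add: hom u_def)
  ultimately show ?thesis
    by (simp add: field_simps)
qed

section \<open>The algebra \<open>U\<^sub>v\<^sup><\<^sup>0\<close>\<close>

datatype 'i word = Word (letters: "'i list")

instantiation word :: (type) monoid_add
begin

definition zero_word :: "'a word" where "0 = Word []"
definition plus_word :: "'a word \<Rightarrow> 'a word \<Rightarrow> 'a word" where
  "u + w = Word (letters u @ letters w)"

instance
  by standard (simp_all add: zero_word_def plus_word_def)

end

text \<open>The free algebra over \<open>\<rat>(v)\<close> is the monoid algebra \<open>'i word \<Rightarrow>\<^sub>0 qv\<close>.\<close>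

definition free_const :: "qv \<Rightarrow> 'i word \<Rightarrow>\<^sub>0 qv" where
  "free_const r = Poly_Mapping.single 0 r"

definition free_gen :: "'i \<Rightarrow> 'i word \<Rightarrow>\<^sub>0 qv" where
  "free_gen i = Poly_Mapping.single (Word [i]) 1"

definition free_divpow :: "('i \<Rightarrow> nat) \<Rightarrow> 'i \<Rightarrow> nat \<Rightarrow> 'i word \<Rightarrow>\<^sub>0 qv" where
  "free_divpow d i k =
     free_const (inverse (to_qv (qfact (int (d i)) k))) * free_gen i ^ k"

definition serre_element ::
  "('i \<Rightarrow> 'i \<Rightarrow> int) \<Rightarrow> ('i \<Rightarrow> nat) \<Rightarrow> 'i \<Rightarrow> 'i \<Rightarrow> 'i word \<Rightarrow>\<^sub>0 qv" where
  "serre_element a d i j =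
     (\<Sum>m\<le>nat (1 - a i j). (- 1) ^ m *
        free_divpow d i m * free_gen j * free_divpow d i (nat (1 - a i j) - m))"

definition serre_ideal ::
  "('i \<Rightarrow> 'i \<Rightarrow> int) \<Rightarrow> ('i \<Rightarrow> nat) \<Rightarrow> ('i word \<Rightarrow>\<^sub>0 qv) set" where
  "serre_ideal a d = Idl\<^bsub>ring_of_type_algebra\<^esub> {serre_element a d i j | i j. i \<noteq> j}"

definition Uq_neg ::
  "('i \<Rightarrow> 'i \<Rightarrow> int) \<Rightarrow> ('i \<Rightarrow> nat) \<Rightarrow> ('i word \<Rightarrow>\<^sub>0 qv) set ring" where
  "Uq_neg a d = ring_of_type_algebra Quot serre_ideal a d"

definition Uq_class ::
  "('i \<Rightarrow> 'i \<Rightarrow> int) \<Rightarrow> ('i \<Rightarrow> nat) \<Rightarrow> ('i word \<Rightarrow>\<^sub>0 qv) \<Rightarrow> ('i word \<Rightarrow>\<^sub>0 qv) set" where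
  "Uq_class a d x = serre_ideal a d +>\<^bsub>ring_of_type_algebra\<^esub> x"

definition Uv_gen ::
  "('i \<Rightarrow> 'i \<Rightarrow> int) \<Rightarrow> ('i \<Rightarrow> nat) \<Rightarrow> 'i \<Rightarrow> nat \<Rightarrow> ('i word \<Rightarrow>\<^sub>0 qv) set" where
  "Uv_gen a d i k = Uq_class a d (free_divpow d i k)"

definition Uq_smult ::
  "('i \<Rightarrow> 'i \<Rightarrow> int) \<Rightarrow> ('i \<Rightarrow> nat) \<Rightarrow> laurent
     \<Rightarrow> ('i word \<Rightarrow>\<^sub>0 qv) set \<Rightarrow> ('i word \<Rightarrow>\<^sub>0 qv) set" where
  "Uq_smult a d r x = Uq_class a d (free_const (to_qv r)) \<otimes>\<^bsub>Uq_neg a d\<^esub> x"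

inductive_set Uv_set ::
  "('i \<Rightarrow> 'i \<Rightarrow> int) \<Rightarrow> ('i \<Rightarrow> nat) \<Rightarrow> ('i word \<Rightarrow>\<^sub>0 qv) set set"
  for a d where
  gen: "Uv_gen a d i k \<in> Uv_set a d"
| one: "\<one>\<^bsub>Uq_neg a d\<^esub> \<in> Uv_set a d"
| add: "x \<in> Uv_set a d \<Longrightarrow> y \<in> Uv_set a d \<Longrightarrow> x \<oplus>\<^bsub>Uq_neg a d\<^esub> y \<in> Uv_set a d"
| mult: "x \<in> Uv_set a d \<Longrightarrow> y \<in> Uv_set a d \<Longrightarrow> x \<otimes>\<^bsub>Uq_neg a d\<^esub> y \<in> Uv_set a d"
| smult: "x \<in> Uv_set a d \<Longrightarrow> Uq_smult a d r x \<in> Uv_set a d"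

definition Uv_neg ::
  "('i \<Rightarrow> 'i \<Rightarrow> int) \<Rightarrow> ('i \<Rightarrow> nat) \<Rightarrow> (laurent, ('i word \<Rightarrow>\<^sub>0 qv) set) module" where
  "Uv_neg a d = \<lparr>carrier = Uv_set a d, monoid.mult = monoid.mult (Uq_neg a d), one = \<one>\<^bsub>Uq_neg a d\<^esub>,
     zero = \<zero>\<^bsub>Uq_neg a d\<^esub>, add = ring.add (Uq_neg a d), module.smult = Uq_smult a d\<rparr>"

definition alg_hom ::
  "(laurent, 'a) module \<Rightarrow> (laurent, 'b) module \<Rightarrow> ('a \<Rightarrow> 'b) set" where
  "alg_hom A B =
     {h \<in> ring_hom A B. \<forall>r. \<forall>x\<in>carrier A. h (r \<odot>\<^bsub>A\<^esub> x) = r \<odot>\<^bsub>B\<^esub> h x}"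

section \<open>Borel-Moore homology with coefficients pulled back from a torus\<close>

text \<open>A space \<open>lspace\<close>, a subset \<open>lsub\<close>, a map \<open>lmap\<close> to the torus with coordinates \<open>lcoords\<close>
  (each in the unit circle of \<open>\<complex>\<close>), and a character \<open>lmono\<close> of the fundamental group
  \<open>\<int>\<^bsup>lcoords\<^esup>\<close> of the torus, which is the monodromy of a rank one local system.\<close>

record ('a, 'j) twisted_space =
  lspace :: "'a topology"
  lsub :: "'a set"
  lcoords :: "'j set"
  lmap :: "'a \<Rightarrow> 'j \<Rightarrow> complex"
  lmono :: "('j \<Rightarrow> int) \<Rightarrow> laurent"

text \<open>The homotopy classes of paths in the torus from \<open>b = (1, \<dots>, 1)\<close> to a given point are the
  points over it in the universal cover \<open>\<real>\<^bsup>lcoords\<^esup>\<close> (endpoints of lifts starting at \<open>0\<close>).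
  Hence a singular simplex \<open>\<Delta>\<close> with a class of paths \<open>H\<close> from \<open>b\<close> to its image in the torus is
  a singular simplex of the following pulled back cover.\<close>

definition torus_cover :: "('a, 'j) twisted_space \<Rightarrow> ('a \<times> ('j \<Rightarrow> real)) topology" where
  "torus_cover T =
     subtopology (prod_topology (lspace T) (product_topology (\<lambda>_. euclideanreal) (lcoords T)))
       {(x, \<theta>). \<forall>k\<in>lcoords T. lmap T x k = cis (\<theta> k)}"

definition deck :: "'j set \<Rightarrow> ('j \<Rightarrow> int) \<Rightarrow> 'a \<times> ('j \<Rightarrow> real) \<Rightarrow> 'a \<times> ('j \<Rightarrow> real)" where
  "deck J n = (\<lambda>(x, \<theta>). (x, \<lambda>k\<in>J. \<theta> k + 2 * pi * of_int (n k)))"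

type_synonym 'e lchain = "((nat \<Rightarrow> real) \<Rightarrow> 'e) \<Rightarrow>\<^sub>0 laurent"

definition lchains :: "nat \<Rightarrow> 'e topology \<Rightarrow> 'e lchain set" where
  "lchains p E = {c. Poly_Mapping.keys c \<subseteq> singular_simplex_set p E}"

definition lscale :: "laurent \<Rightarrow> 'e lchain \<Rightarrow> 'e lchain" where
  "lscale r c = Poly_Mapping.map ((*) r) c"

definition lboundary :: "nat \<Rightarrow> 'e lchain \<Rightarrow> 'e lchain" where
  "lboundary p c = (if p = 0 then 0 else
     (\<Sum>\<sigma>\<in>Poly_Mapping.keys c. \<Sum>k\<le>p.
        Poly_Mapping.single (singular_face p k \<sigma>) ((- 1) ^ k * Poly_Mapping.lookup c \<sigma>)))"

text \<open>The submodule generated by the relations \<open>(\<Delta>, \<gamma>H) = \<rho>(\<gamma>)(\<Delta>, H)\<close> for loops \<open>\<gamma>\<close> at \<open>b\<close>. The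
  quotient of the chains of the cover by it is the chain module with twisted coefficients.\<close>

inductive_set mono_relations :: "('a, 'j) twisted_space \<Rightarrow> nat \<Rightarrow> ('a \<times> ('j \<Rightarrow> real)) lchain set"
  for T p where
  zero: "0 \<in> mono_relations T p"
| step: "c \<in> mono_relations T p \<Longrightarrow> singular_simplex p (torus_cover T) \<sigma> \<Longrightarrow>
    c + (Poly_Mapping.single (restrict (deck (lcoords T) n \<circ> \<sigma>) (standard_simplex p)) r
         - Poly_Mapping.single \<sigma> (lmono T n * r)) \<in> mono_relations T p"

text \<open>Homology of the pair \<open>(lspace T, A)\<close>. Instead of forming the quotient complex we keep
  chains of the cover and count those in \<open>tw_null\<close> as zero. Sums of sets are elementwise.\<close>

definition tw_null ::
  "('a, 'j) twisted_space \<Rightarrow> 'a set \<Rightarrow> nat \<Rightarrow> ('a \<times> ('j \<Rightarrow> real)) lchain set" where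
  "tw_null T A p =
     lchains p (subtopology (torus_cover T) (A \<times> UNIV)) + mono_relations T p"

definition tw_cycles ::
  "('a, 'j) twisted_space \<Rightarrow> 'a set \<Rightarrow> nat \<Rightarrow> ('a \<times> ('j \<Rightarrow> real)) lchain set" where
  "tw_cycles T A p = {c \<in> lchains p (torus_cover T). lboundary p c \<in> tw_null T A (p - 1)}"

definition tw_boundaries ::
  "('a, 'j) twisted_space \<Rightarrow> 'a set \<Rightarrow> nat \<Rightarrow> ('a \<times> ('j \<Rightarrow> real)) lchain set" where
  "tw_boundaries T A p =
     lboundary (Suc p) ` lchains (Suc p) (torus_cover T) + tw_null T A p"

definition tw_class ::
  "('a, 'j) twisted_space \<Rightarrow> 'a set \<Rightarrow> nat \<Rightarrow> ('a \<times> ('j \<Rightarrow> real)) lchain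
     \<Rightarrow> ('a \<times> ('j \<Rightarrow> real)) lchain set" where
  "tw_class T A p c = c +o tw_boundaries T A p"

definition tw_homology ::
  "('a, 'j) twisted_space \<Rightarrow> 'a set \<Rightarrow> nat \<Rightarrow> ('a \<times> ('j \<Rightarrow> real)) lchain set set" where
  "tw_homology T A p = tw_class T A p ` tw_cycles T A p"

text \<open>An element of the inverse limit over compact sets \<open>K\<close> is a compatible family of classes.
  The map from the group for \<open>K'\<close> to that for \<open>K \<subseteq> K'\<close> sends a coset to the coset
  containing it.\<close>

abbreviation compacts :: "('a, 'j) twisted_space \<Rightarrow> 'a set set" where
  "compacts T \<equiv> {K. compactin (lspace T) K}"

definition off :: "('a, 'j) twisted_space \<Rightarrow> 'a set \<Rightarrow> 'a set" where
  "off T K = lsub T \<union> (topspace (lspace T) - K)"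

type_synonym ('a, 'j) bm = "'a set \<Rightarrow> ('a \<times> ('j \<Rightarrow> real)) lchain set"

definition bm_homology :: "('a, 'j) twisted_space \<Rightarrow> nat \<Rightarrow> ('a, 'j) bm set" where
  "bm_homology T p =
     {h \<in> (\<Pi>\<^sub>E K\<in>compacts T. tw_homology T (off T K) p).
        \<forall>K\<in>compacts T. \<forall>K'\<in>compacts T. K \<subseteq> K' \<longrightarrow> h K' \<subseteq> h K}"

definition bm_zero :: "('a, 'j) twisted_space \<Rightarrow> nat \<Rightarrow> ('a, 'j) bm" where
  "bm_zero T p = (\<lambda>K\<in>compacts T. tw_boundaries T (off T K) p)"

definition bm_add ::
  "('a, 'j) twisted_space \<Rightarrow> ('a, 'j) bm \<Rightarrow> ('a, 'j) bm \<Rightarrow> ('a, 'j) bm" where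
  "bm_add T h h' = (\<lambda>K\<in>compacts T. h K + h' K)"

definition bm_smult ::
  "('a, 'j) twisted_space \<Rightarrow> nat \<Rightarrow> laurent \<Rightarrow> ('a, 'j) bm \<Rightarrow> ('a, 'j) bm" where
  "bm_smult T p r h =
     (\<lambda>K\<in>compacts T. lscale r ` h K + tw_boundaries T (off T K) p)"

section \<open>Coloured configuration spaces\<close>

type_synonym 'i conf = "'i \<Rightarrow> complex set"
type_synonym 'i colouring = "'i \<Rightarrow> nat"

definition disk :: "complex set" where
  "disk = {z. \<bar>Re z\<bar> \<le> 1 \<and> \<bar>Im z\<bar> \<le> 1}"

definition degree_of :: "'i::finite colouring \<Rightarrow> nat" where
  "degree_of c = (\<Sum>i\<in>UNIV. c i)"

definition ordered_conf :: "'i colouring \<Rightarrow> ('i \<times> nat \<Rightarrow> complex) topology" where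
  "ordered_conf c =
     subtopology (product_topology (\<lambda>_. top_of_set disk) (SIGMA i:UNIV. {..<c i}))
       {x. inj_on x (SIGMA i:UNIV. {..<c i})}"

definition forget_order :: "'i colouring \<Rightarrow> ('i \<times> nat \<Rightarrow> complex) \<Rightarrow> 'i conf" where
  "forget_order c x = (\<lambda>i. (\<lambda>k. x (i, k)) ` {..<c i})"

text \<open>Two ordered configurations have the same image under \<open>forget_order c\<close> iff they differ by
  colour preserving permutations, so this is the quotient of the ordered configuration space by
  the product of symmetric groups.\<close>

definition conf_space :: "'i colouring \<Rightarrow> 'i conf topology" where
  "conf_space c = topology (\<lambda>U. U \<subseteq> forget_order c ` topspace (ordered_conf c) \<and>
     openin (ordered_conf c) {x \<in> topspace (ordered_conf c). forget_order c x \<in> U})"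

lemma quotient_map_conf_space: "quotient_map (ordered_conf c) (conf_space c) (forget_order c)"
proof -
  let ?X = "ordered_conf c" and ?f = "forget_order c"
  let ?P = "\<lambda>U. U \<subseteq> ?f ` topspace ?X \<and> openin ?X {x \<in> topspace ?X. ?f x \<in> U}"
  have "istopology ?P"
    unfolding istopology_def
  proof (intro conjI allI impI)
    fix S U assume S: "?P S" and U: "?P U"
    then show "S \<inter> U \<subseteq> ?f ` topspace ?X"
      by auto
    have "{x \<in> topspace ?X. ?f x \<in> S \<inter> U}
        = {x \<in> topspace ?X. ?f x \<in> S} \<inter> {x \<in> topspace ?X. ?f x \<in> U}"
      by auto
    then show "openin ?X {x \<in> topspace ?X. ?f x \<in> S \<inter> U}"
      using S U by auto
  next
    fix \<U> assume *: "\<forall>U\<in>\<U>. ?P U"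
    then show "\<Union>\<U> \<subseteq> ?f ` topspace ?X"
      by auto
    have "{x \<in> topspace ?X. ?f x \<in> \<Union>\<U>} = (\<Union>U\<in>\<U>. {x \<in> topspace ?X. ?f x \<in> U})"
      by auto
    then show "openin ?X {x \<in> topspace ?X. ?f x \<in> \<Union>\<U>}"
      using * by auto
  qed
  then have op: "openin (conf_space c) U \<longleftrightarrow> ?P U" for U
    by (simp add: conf_space_def topology_inverse')
  have "{x \<in> topspace ?X. ?f x \<in> ?f ` topspace ?X} = topspace ?X"
    by auto
  then have "openin (conf_space c) (?f ` topspace ?X)"
    by (simp add: op)
  then have "topspace (conf_space c) = ?f ` topspace ?X"
    by (metis op openin_subset openin_topspace subset_antisym)
  then show ?thesis
    by (auto simp: quotient_map_def op)
qed

definition side_conf :: "'i colouring \<Rightarrow> 'i conf set" where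
  "side_conf c = {z \<in> topspace (conf_space c). \<exists>i. \<exists>w\<in>z i. \<bar>Re w\<bar> = 1}"

section \<open>The local system\<close>

definition dir2 :: "complex \<Rightarrow> complex \<Rightarrow> complex" where
  "dir2 z w = ((w - z) / of_real (cmod (w - z))) ^ 2"

text \<open>The pairs \<open>(z\<^sub>i, z\<^sub>j)\<close>, \<open>i < j\<close>, for one numbering of the set (the lexicographic one). It is
  only used for expressions that are symmetric in the two points.\<close>

definition point_pairs :: "complex set \<Rightarrow> (complex \<times> complex) set" where
  "point_pairs A =
     {(z, w). z \<in> A \<and> w \<in> A \<and> (Re z < Re w \<or> Re z = Re w \<and> Im z < Im w)}"

lemma dir2_commute: "dir2 z w = dir2 w z"
proof -
  have "(w - z)\<^sup>2 = (z - w)\<^sup>2" "cmod (w - z) = cmod (z - w)"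
    by (simp_all add: power2_commute norm_minus_commute)
  then show ?thesis
    by (simp add: dir2_def power_divide)
qed

definition f_map :: "complex set \<Rightarrow> complex" where
  "f_map A = (\<Prod>(z, w)\<in>point_pairs A. dir2 z w)"

definition g_map :: "complex set \<Rightarrow> complex set \<Rightarrow> complex" where
  "g_map A B = (\<Prod>(z, w)\<in>A \<times> B. dir2 z w)"

text \<open>Coordinate \<open>(i, i)\<close> of the torus is the \<open>i\<close>-th \<open>f\<close>-coordinate, and \<open>(i, j)\<close> with \<open>i < j\<close>
  is the corresponding \<open>g\<close>-coordinate.\<close>

definition coords :: "('i::linorder \<times> 'i) set" where
  "coords = {(i, j). i \<le> j}"

definition Phi_map :: "'i::linorder conf \<Rightarrow> 'i \<times> 'i \<Rightarrow> complex" where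
  "Phi_map z = (\<lambda>(i, j)\<in>coords. if i = j then f_map (z i) else g_map (z i) (z j))"

definition W_map :: "'i::linorder conf \<Rightarrow> 'i \<times> 'i \<Rightarrow> complex" where
  "W_map z = Phi_map (\<lambda>i. (*) \<i> ` z i)"

text \<open>Monodromy \<open>- q\<^bsup>d\<^sub>i\<^esup>\<close> along the circle \<open>(i, i)\<close> and \<open>q\<^bsup>(\<alpha>\<^sub>i, \<alpha>\<^sub>j) / 2\<^esup>\<close> along \<open>(i, j)\<close>.\<close>

definition conf_mono ::
  "('i::{finite,linorder} \<Rightarrow> 'i \<Rightarrow> int) \<Rightarrow> ('i \<Rightarrow> nat) \<Rightarrow> ('i \<times> 'i \<Rightarrow> int) \<Rightarrow> laurent" where
  "conf_mono a d n =
     (\<Prod>i\<in>UNIV. (if even (n (i, i)) then 1 else - 1) * vpow (2 * int (d i) * n (i, i))) *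
     (\<Prod>(i, j)\<in>{(i, j). i < j}. vpow (int (d i) * a i j * n (i, j)))"

definition conf_twisted ::
  "('i::{finite,linorder} \<Rightarrow> 'i \<Rightarrow> int) \<Rightarrow> ('i \<Rightarrow> nat) \<Rightarrow> 'i colouring
     \<Rightarrow> ('i conf, 'i \<times> 'i) twisted_space" where
  "conf_twisted a d c = \<lparr>lspace = conf_space c, lsub = side_conf c, lcoords = coords,
     lmap = W_map, lmono = conf_mono a d\<rparr>"

type_synonym 'i conf_bm = "('i conf, 'i \<times> 'i) bm"
type_synonym 'i conf_cover = "'i conf \<times> ('i \<times> 'i \<Rightarrow> real)"

definition conf_homology ::
  "('i::{finite,linorder} \<Rightarrow> 'i \<Rightarrow> int) \<Rightarrow> ('i \<Rightarrow> nat) \<Rightarrow> 'i colouring \<Rightarrow> 'i conf_bm set" where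
  "conf_homology a d c = bm_homology (conf_twisted a d c) (degree_of c)"

definition conf_zero ::
  "('i::{finite,linorder} \<Rightarrow> 'i \<Rightarrow> int) \<Rightarrow> ('i \<Rightarrow> nat) \<Rightarrow> 'i colouring \<Rightarrow> 'i conf_bm" where
  "conf_zero a d c = bm_zero (conf_twisted a d c) (degree_of c)"

section \<open>The product\<close>

text \<open>The upper disk is rescaled into height \<open>[1/3, 1]\<close> and the lower one into \<open>[-1, -1/3]\<close>. The
  gap keeps points on the bottom of the first disk apart from points on the top of the second.\<close>

definition upper :: "complex \<Rightarrow> complex" where
  "upper z = Complex (Re z) ((Im z + 2) / 3)"

definition lower :: "complex \<Rightarrow> complex" where
  "lower z = Complex (Re z) ((Im z - 2) / 3)"

definition stack :: "'i conf \<Rightarrow> 'i conf \<Rightarrow> 'i conf" where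
  "stack z w = (\<lambda>i. upper ` z i \<union> lower ` w i)"

text \<open>The product of paths \<open>H\<^sub>1\<close>, \<open>H\<^sub>2\<close> ending at \<open>W(z)\<close>, \<open>W(w)\<close> ends at \<open>W(z) W(w)\<close>, which
  differs from \<open>W(stack z w)\<close> by the effect of the rescaling on directions within a disk and by
  the directions between the two disks. Each of these factors is \<open>cis (2 * Arg u)\<close> with
  \<open>Re u > 0\<close>; adding the angles \<open>2 * Arg u\<close> is the unique continuous way to complete the product
  path that is trivial for vertically aligned configurations, and on classes with handles it gives
  the union of the stacked handles.\<close>

definition rescale_angle :: "(complex \<Rightarrow> complex) \<Rightarrow> 'i conf \<Rightarrow> 'i \<times> 'i \<Rightarrow> real" where
  "rescale_angle s z = (\<lambda>(i, j).
     (\<Sum>(p, p')\<in>(if i = j then point_pairs (z i) else z i \<times> z j).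
        2 * Arg ((s p' - s p) / (p' - p))))"

definition cross_angle :: "'i conf \<Rightarrow> 'i conf \<Rightarrow> 'i \<times> 'i \<Rightarrow> real" where
  "cross_angle z w = (\<lambda>(i, j).
     let A = (\<lambda>i j. \<Sum>(p, p')\<in>z i \<times> w j. 2 * Arg (\<i> * (lower p' - upper p)))
     in if i = j then A i i else A i j + A j i)"

definition stack_cover ::
  "'i::linorder conf_cover \<Rightarrow> 'i conf_cover \<Rightarrow> 'i conf_cover" where
  "stack_cover = (\<lambda>(z, \<theta>) (w, \<phi>). (stack z w,
     \<lambda>k\<in>coords. \<theta> k + \<phi> k + rescale_angle upper z k + rescale_angle lower w k
       + cross_angle z w k))"

text \<open>The product chain of simplices of dimensions \<open>p\<close> and \<open>q\<close> is the sum of the signed simplices of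
  the standard triangulation of \<open>\<Delta>\<^sup>p \<times> \<Delta>\<^sup>q\<close>. These correspond to shuffles, given by the set
  \<open>A \<subseteq> {..<p + q}\<close> of the steps that go in the first direction: the \<open>k\<close>-th vertex is sent to the
  pair of vertices with the numbers \<open>card (A \<inter> {..<k})\<close> and \<open>card ({..<k} - A)\<close>.\<close>

definition shuffles_of :: "nat \<Rightarrow> nat \<Rightarrow> nat set set" where
  "shuffles_of p q = {A. A \<subseteq> {..<p + q} \<and> card A = p}"

definition shuffle_sign :: "nat \<Rightarrow> nat set \<Rightarrow> laurent" where
  "shuffle_sign n A = (- 1) ^ card {(m, m'). m \<in> A \<and> m' \<in> {..<n} - A \<and> m' < m}"

definition vertex_map :: "nat \<Rightarrow> (nat \<Rightarrow> nat) \<Rightarrow> (nat \<Rightarrow> real) \<Rightarrow> nat \<Rightarrow> real" where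
  "vertex_map n v x = (\<lambda>j. \<Sum>k | k \<le> n \<and> v k = j. x k)"

definition stack_simplex ::
  "nat \<Rightarrow> nat set \<Rightarrow> ((nat \<Rightarrow> real) \<Rightarrow> 'i::linorder conf_cover) \<Rightarrow> ((nat \<Rightarrow> real) \<Rightarrow> 'i conf_cover)
     \<Rightarrow> (nat \<Rightarrow> real) \<Rightarrow> 'i conf_cover" where
  "stack_simplex n A \<sigma> \<tau> = (\<lambda>x\<in>standard_simplex n.
     stack_cover (\<sigma> (vertex_map n (\<lambda>k. card (A \<inter> {..<k})) x))
                 (\<tau> (vertex_map n (\<lambda>k. card ({..<k} - A)) x)))"

definition stack_chain ::
  "nat \<Rightarrow> nat \<Rightarrow> 'i::linorder conf_cover lchain \<Rightarrow> 'i conf_cover lchain \<Rightarrow> 'i conf_cover lchain" where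
  "stack_chain p q x y =
     (\<Sum>\<sigma>\<in>Poly_Mapping.keys x. \<Sum>\<tau>\<in>Poly_Mapping.keys y. \<Sum>A\<in>shuffles_of p q.
        Poly_Mapping.single (stack_simplex (p + q) A \<sigma> \<tau>)
          (shuffle_sign (p + q) A * Poly_Mapping.lookup x \<sigma> * Poly_Mapping.lookup y \<tau>))"

text \<open>Orientation of a product. In \<open>Conf\<^sub>c\<close> the points are listed colour by colour (it is a
  quotient of a subspace of \<open>D\<^bsup>c(\<alpha>\<^sub>1)\<^esup> \<times> \<cdots> \<times> D\<^bsup>c(\<alpha>\<^sub>l)\<^esup>\<close>), and \<open>\<Delta>\<^sub>1 \<cdot> \<Delta>\<^sub>2\<close> carries the product orientation
  with the coordinates listed in this order: for each colour in turn first the points of the upper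
  disk, then those of the lower one. The sign compares this with the order in which all points of
  the upper disk come first. Points of the same colour do not contribute to it. The sign is
  necessary: with the monodromies given above, orthogonal roots satisfy
  \<open>F\<^sub>i F\<^sub>j = F\<^sub>j F\<^sub>i\<close> only in this convention, and \<open>F\<^sub>i F\<^sub>j = - F\<^sub>j F\<^sub>i\<close> without it.\<close>

definition colour_sign :: "'i::{finite,linorder} colouring \<Rightarrow> 'i colouring \<Rightarrow> laurent" where
  "colour_sign c c' = (- 1) ^ (\<Sum>(i, j)\<in>{(i, j). i < j}. c' i * c j)"

text \<open>The value at \<open>K\<close> of a product of two families only depends on their values at the compact
  sets of upper and of lower parts of the stacked configurations in \<open>K\<close>.\<close>

definition conf_mult ::
  "('i::{finite,linorder} \<Rightarrow> 'i \<Rightarrow> int) \<Rightarrow> ('i \<Rightarrow> nat) \<Rightarrow> 'i colouring \<Rightarrow> 'i colouring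
     \<Rightarrow> 'i conf_bm \<Rightarrow> 'i conf_bm \<Rightarrow> 'i conf_bm" where
  "conf_mult a d c c' h h' =
     (let T = conf_twisted a d (\<lambda>i. c i + c' i); p = degree_of c; q = degree_of c' in
      (\<lambda>K\<in>compacts T.
        let K\<^sub>1 = {z \<in> topspace (conf_space c). \<exists>w \<in> topspace (conf_space c'). stack z w \<in> K};
            K\<^sub>2 = {w \<in> topspace (conf_space c'). \<exists>z \<in> topspace (conf_space c). stack z w \<in> K}
        in \<Union>x\<in>h K\<^sub>1. \<Union>y\<in>h' K\<^sub>2.
             tw_class T (off T K) (p + q) (lscale (colour_sign c c') (stack_chain p q x y))))"

text \<open>Elements of the direct sum are families \<open>x\<close> of finite support.\<close>

definition H_mult ::
  "('i::{finite,linorder} \<Rightarrow> 'i \<Rightarrow> int) \<Rightarrow> ('i \<Rightarrow> nat)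
     \<Rightarrow> ('i colouring \<Rightarrow> 'i conf_bm) \<Rightarrow> ('i colouring \<Rightarrow> 'i conf_bm)
     \<Rightarrow> 'i colouring \<Rightarrow> 'i conf_bm" where
  "H_mult a d x y = (\<lambda>c. \<lambda>K\<in>compacts (conf_twisted a d c).
     \<Sum>c'\<in>{c'. c' \<le> c}. conf_mult a d c' (\<lambda>i. c i - c' i) (x c') (y (\<lambda>i. c i - c' i)) K)"

definition H_single ::
  "('i::{finite,linorder} \<Rightarrow> 'i \<Rightarrow> int) \<Rightarrow> ('i \<Rightarrow> nat) \<Rightarrow> 'i colouring \<Rightarrow> 'i conf_bm
     \<Rightarrow> 'i colouring \<Rightarrow> 'i conf_bm" where
  "H_single a d c h = (\<lambda>c'. if c' = c then h else conf_zero a d c')"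

definition empty_class ::
  "('i::{finite,linorder} \<Rightarrow> 'i \<Rightarrow> int) \<Rightarrow> ('i \<Rightarrow> nat) \<Rightarrow> 'i conf_bm" where
  "empty_class a d = (let T = conf_twisted a d (\<lambda>_. 0) in (\<lambda>K\<in>compacts T. tw_class T (off T K) 0
     (Poly_Mapping.single (\<lambda>x\<in>standard_simplex 0. (\<lambda>_. {}, \<lambda>k\<in>coords. 0)) 1)))"

definition H_BM ::
  "('i::{finite,linorder} \<Rightarrow> 'i \<Rightarrow> int) \<Rightarrow> ('i \<Rightarrow> nat)
     \<Rightarrow> (laurent, 'i colouring \<Rightarrow> 'i conf_bm) module" where
  "H_BM a d = \<lparr>
     carrier = {x. (\<forall>c. x c \<in> conf_homology a d c) \<and> finite {c. x c \<noteq> conf_zero a d c}},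
     monoid.mult = H_mult a d,
     one = H_single a d (\<lambda>_. 0) (empty_class a d),
     zero = conf_zero a d,
     add = (\<lambda>x y c. bm_add (conf_twisted a d c) (x c) (y c)),
     module.smult = (\<lambda>r x c. bm_smult (conf_twisted a d c) (degree_of c) r (x c))\<rparr>"

section \<open>The classes \<open>\<F>\<^sub>\<alpha>\<^sup>k\<close>\<close>

definition coloured :: "'i \<Rightarrow> nat \<Rightarrow> (nat \<Rightarrow> complex) \<Rightarrow> 'i conf" where
  "coloured \<alpha> k P = (\<lambda>i. if i = \<alpha> then P ` {..<k} else {})"

text \<open>The open simplex \<open>0 < t\<^sub>1 < \<dots> < t\<^sub>k < 1\<close> is a locally finite cycle; relative to the complement
  of a given compact set and to the side configurations it is represented by the closed simplex
  \<open>0 \<le> t\<^sub>1\<close>, \<open>t\<^sub>i + \<epsilon> \<le> t\<^sub>i\<^sub>+\<^sub>1\<close>, \<open>t\<^sub>k \<le> 1\<close> for all small \<open>\<epsilon> > 0\<close>. The functions \<open>seg_param\<close> are its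
  affine coordinates, numbered from \<open>0\<close>, in terms of barycentric coordinates \<open>x\<close>. With
  respect to \<open>dt\<^sub>1 \<and> \<dots> \<and> dt\<^sub>k\<close> this parametrization by the standard simplex has orientation
  \<open>(-1)\<^sup>k\<close>, because of \<open>dt\<^sub>j = - (dx\<^sub>j + \<dots> + dx\<^sub>k)\<close> up to a positive factor.\<close>

definition seg_param :: "nat \<Rightarrow> real \<Rightarrow> (nat \<Rightarrow> real) \<Rightarrow> nat \<Rightarrow> real" where
  "seg_param k \<epsilon> x j = real j * \<epsilon> + (1 - (real k - 1) * \<epsilon>) * (\<Sum>m\<le>j. x m)"

definition seg_conf :: "'i \<Rightarrow> nat \<Rightarrow> (nat \<Rightarrow> real) \<Rightarrow> 'i conf" where
  "seg_conf \<alpha> k t = coloured \<alpha> k (\<lambda>j. Complex (- 1 + 2 * t j) 0)"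

text \<open>A handle ending at \<open>seg_conf \<alpha> k t\<close>. The points start on the right side at the heights
  \<open>(k - j) / (k + 1)\<close>, move horizontally for \<open>s \<le> 1/2\<close> and vertically afterwards.\<close>

definition seg_handle :: "'i \<Rightarrow> nat \<Rightarrow> (nat \<Rightarrow> real) \<Rightarrow> real \<Rightarrow> 'i conf" where
  "seg_handle \<alpha> k t s = coloured \<alpha> k (\<lambda>j.
     let y = (real k - real j) / (real k + 1) in
     if s \<le> 1 / 2 then Complex (1 - 2 * s * (2 - 2 * t j)) y
     else Complex (- 1 + 2 * t j) ((2 - 2 * s) * y))"

definition lift_end ::
  "('a, 'j) twisted_space \<Rightarrow> (real \<Rightarrow> 'a) \<Rightarrow> ('j \<Rightarrow> real) \<Rightarrow> bool" where
  "lift_end T \<eta> \<theta> \<longleftrightarrow> (\<exists>\<phi>.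
     continuous_map (top_of_set {0..1}) (product_topology (\<lambda>_. euclideanreal) (lcoords T)) \<phi> \<and>
     (\<forall>s\<in>{0..1}. \<forall>k\<in>lcoords T. lmap T (\<eta> s) k = cis (\<phi> s k)) \<and>
     \<phi> 0 = (\<lambda>k\<in>lcoords T. 0) \<and> \<phi> 1 = \<theta>)"

text \<open>The twisted simplex given by a simplex \<open>\<sigma>\<close> and a handle \<open>\<eta>\<close> that ends at \<open>\<sigma> b\<close>.\<close>

definition handle_simplex ::
  "('a, 'j) twisted_space \<Rightarrow> nat \<Rightarrow> ((nat \<Rightarrow> real) \<Rightarrow> 'a) \<Rightarrow> (real \<Rightarrow> 'a) \<Rightarrow> (nat \<Rightarrow> real)
     \<Rightarrow> (nat \<Rightarrow> real) \<Rightarrow> 'a \<times> ('j \<Rightarrow> real)" where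
  "handle_simplex T p \<sigma> \<eta> b = (THE \<tau>. singular_simplex p (torus_cover T) \<tau> \<and>
     (\<forall>x\<in>standard_simplex p. fst (\<tau> x) = \<sigma> x) \<and> lift_end T \<eta> (snd (\<tau> b)))"

definition barycentre :: "nat \<Rightarrow> nat \<Rightarrow> real" where
  "barycentre k = (\<lambda>i. if i \<le> k then 1 / (real k + 1) else 0)"

definition mono_colouring :: "'i \<Rightarrow> nat \<Rightarrow> 'i colouring" where
  "mono_colouring \<alpha> k = (\<lambda>i. if i = \<alpha> then k else 0)"

text \<open>The exponent is that of \<open>q\<^bsup>- d k (k - 1) / 4\<^esup> = v\<^bsup>- d k (k - 1) / 2\<^esup>\<close>.\<close>

definition F_chain ::
  "('i::{finite,linorder} \<Rightarrow> 'i \<Rightarrow> int) \<Rightarrow> ('i \<Rightarrow> nat) \<Rightarrow> 'i \<Rightarrow> nat \<Rightarrow> real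
     \<Rightarrow> 'i conf_cover lchain" where
  "F_chain a d \<alpha> k \<epsilon> = Poly_Mapping.single
     (handle_simplex (conf_twisted a d (mono_colouring \<alpha> k)) k
        (\<lambda>x. seg_conf \<alpha> k (seg_param k \<epsilon> x))
        (seg_handle \<alpha> k (seg_param k \<epsilon> (barycentre k))) (barycentre k))
     ((- 1) ^ k * vpow (- int (d \<alpha> * (k * (k - 1) div 2))))"

definition F_class ::
  "('i::{finite,linorder} \<Rightarrow> 'i \<Rightarrow> int) \<Rightarrow> ('i \<Rightarrow> nat) \<Rightarrow> 'i \<Rightarrow> nat \<Rightarrow> 'i conf_bm" where
  "F_class a d \<alpha> k = (let T = conf_twisted a d (mono_colouring \<alpha> k) in
     (\<lambda>K\<in>compacts T. {x. \<forall>\<^sub>F \<epsilon> in at_right 0. x \<in> tw_class T (off T K) k (F_chain a d \<alpha> k \<epsilon>)}))"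

definition F_div ::
  "('i::{finite,linorder} \<Rightarrow> 'i \<Rightarrow> int) \<Rightarrow> ('i \<Rightarrow> nat) \<Rightarrow> 'i \<Rightarrow> nat
     \<Rightarrow> 'i colouring \<Rightarrow> 'i conf_bm" where
  "F_div a d \<alpha> k = H_single a d (mono_colouring \<alpha> k) (F_class a d \<alpha> k)"

end

theory Submission
  imports Defs "HOL-Analysis.Complex_Transcendental"
begin

text \<open>Moving the points of a configuration apart horizontally and squeezing it vertically shows that a class
 is determined by its value on the compact sets of configurations with separated real parts, where it is a
 combination of the cells of configurations whose colours from left to right spell a given word. The
 coefficients form the symbol of the class. Moving the upper factor of a stacked pair of cells through the
 lower one subdivides the product by shuffles of the two words, and a point passing another one multiplies by
 \<open>v\<close> to the power \<open>- (\<alpha>\<^sub>i, \<alpha>\<^sub>j)\<close>. So the symbol of a product is the quantum shuffle product of the symbols,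
 and that of a divided power is a power of \<open>v\<close> at the constant word. Since symbols determine classes, the
 relations can be checked in the quantum shuffle algebra, by recursion on the first letter, and the
 homomorphism is the one from the free algebra over \<open>\<rat>(v)\<close> to that algebra.\<close>

text \<open>An equality of Borel-Moore classes is an equality of cosets for every compact set, so
  the relations cannot be checked there directly. What makes symbols decisive is a flow. For m
  points put \<beta> = 2 / (m + 1); in \<open>spread c \<beta>\<close> the inequalities force the
  real parts to be equally spaced. If two classes agree there, their difference is carried, up to
  boundaries, by chains away from the equal spacing, and expanding about it drives such chains out
  of any given compact set. The flow must be continuous across changes of the left to right order,
  must keep points on a side there and close points close, and must lift to the angles: hence the
  soft ranks, the maximum that controls the speed, and the scalar product estimates. Signs are the
  second obstacle: the monodromy -q^d, the signs of shuffles, the colour order in the orientation of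
  products and the orientation of barycentric coordinates all enter, and they cancel after
  normalisation by \<open>wsign\<close>. Finally, quantum factorials are inverted in \<rat>(v),
  while symbols of classes lie over \<int>[v, 1/v]; divided powers have integral symbols, so both
  sides can be compared inside \<rat>(v).\<close>

abbreviation "lookup \<equiv> Poly_Mapping.lookup"
abbreviation "keys \<equiv> Poly_Mapping.keys"
abbreviation "single \<equiv> Poly_Mapping.single"

section \<open>Linear maps between free modules\<close>

text \<open>The operation \<open>lscale\<close> for arbitrary index types: it is also applied to
  formal sums of lattice paths, which are not singular chains.\<close>

definition smul :: "laurent => ('k \<Rightarrow>\<^sub>0 laurent) => 'k \<Rightarrow>\<^sub>0 laurent" where
 "smul r c = Poly_Mapping.map ((*) r) c"

lemma lscale_eq_smul: "lscale = smul" by (simp add: fun_eq_iff lscale_def smul_def)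

lemma lookup_smul [simp]: "lookup (smul r c) \<sigma> = r * lookup c \<sigma>"
 unfolding smul_def by transfer (simp add: when_def)

lemma smul_simps [simp]:
 "smul r 0 = 0" "smul 0 c = 0" "smul 1 c = c" "smul r (smul s c) = smul (r * s) c"
 "smul r (single \<sigma> s) = single \<sigma> (r * s)"
 by (auto intro!: poly_mapping_eqI simp: lookup_single when_def mult.assoc)

lemma smul_add: "smul r (c + c') = smul r c + smul r c'" and smul_diff: "smul r (c - c') = smul r c - smul r c'"
 and smul_add_left: "smul (r + s) c = smul r c + smul s c"
 by (auto intro!: poly_mapping_eqI simp: lookup_add lookup_minus algebra_simps)

lemma smul_minus_left: "smul (- r) c = - smul r c" by (auto intro!: poly_mapping_eqI)

lemma smul_sum: "smul r (sum f A) = (\<Sum>x\<in>A. smul r (f x))"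
 by (induction A rule: infinite_finite_induct) (simp_all add: smul_add)

lemma keys_smul: "keys (smul r c) \<subseteq> keys c" by (auto simp: in_keys_iff)

text \<open>Linear extension of a map given on basis elements. Boundaries, products and pushforwards
  are all written in this form, so that their linearity needs no separate argument.\<close>

definition lext :: "('k => 'l \<Rightarrow>\<^sub>0 laurent) => ('k \<Rightarrow>\<^sub>0 laurent) => 'l \<Rightarrow>\<^sub>0 laurent" where
 "lext f c = (\<Sum>\<sigma>\<in>keys c. smul (lookup c \<sigma>) (f \<sigma>))"

lemma lext_superset: assumes "finite A" "keys c \<subseteq> A"
 shows "lext f c = (\<Sum>\<sigma>\<in>A. smul (lookup c \<sigma>) (f \<sigma>))"
 unfolding lext_def by (rule sum.mono_neutral_left) (use assms in \<open>auto simp: in_keys_iff\<close>)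

lemma lext_add: "lext f (c + c') = lext f c + lext f c'"
proof -
 have "lext f x = (\<Sum>\<sigma>\<in>keys c \<union> keys c'. smul (lookup x \<sigma>) (f \<sigma>))"
  if "keys x \<subseteq> keys c \<union> keys c'" for x by (rule lext_superset) (use that in auto)
 then show ?thesis by (simp add: keys_add lookup_add smul_add_left sum.distrib)
qed

lemma lext_0 [simp]: "lext f 0 = 0" by (simp add: lext_def)

lemma lext_single [simp]: "lext f (single \<sigma> r) = smul r (f \<sigma>)" by (cases "r = 0") (simp_all add: lext_def)

lemma lext_smul: "lext f (smul r c) = smul r (lext f c)"
 by (subst lext_superset[of "keys c"]) (simp_all add: keys_smul lext_def smul_sum)

lemma lext_minus: "lext f (- c) = - lext f c" by (metis add_eq_0_iff2 lext_0 lext_add)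

lemma lext_diff: "lext f (c - c') = lext f c - lext f c'" by (metis diff_conv_add_uminus lext_add lext_minus)

lemma lext_sum: "lext f (sum g A) = (\<Sum>x\<in>A. lext f (g x))"
 by (induction A rule: infinite_finite_induct) (simp_all add: lext_add)

lemma sum_monomials: "c = (\<Sum>\<sigma>\<in>keys c. single \<sigma> (lookup c \<sigma>))"
 by (rule poly_mapping_eqI) (simp add: lookup_sum lookup_single when_def in_keys_iff)

text \<open>Additivity suffices, since an element is the sum of its monomials. Only monomials over
  \<open>keys c\<close> have to be checked, which lets later proofs use what is known about the
  simplices or paths that occur in \<open>c\<close>.\<close>

lemma additive_eqI:
 fixes F G :: "('k \<Rightarrow>\<^sub>0 laurent) => 'l::ab_group_add"
 assumes F: "\<And>x y. F (x + y) = F x + F y" and G: "\<And>x y. G (x + y) = G x + G y"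
  and eq: "\<And>\<sigma> r. \<sigma> \<in> keys c ==> F (single \<sigma> r) = G (single \<sigma> r)" shows "F c = G c"
proof -
 have 0: "F 0 = 0" "G 0 = 0" using F[of 0 0] G[of 0 0] by simp_all
 have "F (\<Sum>\<sigma>\<in>A. single \<sigma> (lookup c \<sigma>)) = G (\<Sum>\<sigma>\<in>A. single \<sigma> (lookup c \<sigma>))"
  if "finite A" "A \<subseteq> keys c" for A using that by (induction A) (simp_all add: 0 F G eq)
 from this[of "keys c"] show ?thesis unfolding sum_monomials[symmetric] by simp
qed

lemma lext_cong: "(\<And>\<sigma>. \<sigma> \<in> keys c ==> f \<sigma> = g \<sigma>) ==> lext f c = lext g c"
 by (simp add: lext_def)

lemma lext_lext: "lext f (lext g c) = lext (\<lambda>\<sigma>. lext f (g \<sigma>)) c"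
 by (rule additive_eqI) (simp_all add: lext_add lext_smul)

lemma lext_id: "(\<And>\<sigma>. \<sigma> \<in> keys c ==> f \<sigma> = single \<sigma> 1) ==> lext f c = c"
 by (rule additive_eqI) (simp_all add: lext_add)

lemma keys_lext: "keys (lext f c) \<subseteq> (\<Union>\<sigma>\<in>keys c. keys (f \<sigma>))"
proof -
 have "keys (lext f c) \<subseteq> (\<Union>\<sigma>\<in>keys c. keys (smul (lookup c \<sigma>) (f \<sigma>)))"
  unfolding lext_def by (rule keys_sum)
 also have "\<dots> \<subseteq> (\<Union>\<sigma>\<in>keys c. keys (f \<sigma>))" by (intro UN_mono keys_smul order_refl)
 finally show ?thesis .
qed

lemma lboundary_lext:
 "lboundary p = lext (\<lambda>\<sigma>. if p = 0 then 0 else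
   (\<Sum>k\<le>p. single (singular_face p k \<sigma>) ((- 1) ^ k)))"
proof
 fix c :: "'e lchain"
 show "lboundary p c = lext (\<lambda>\<sigma>. if p = 0 then 0 else
   (\<Sum>k\<le>p. single (singular_face p k \<sigma>) ((- 1) ^ k))) c"
  by (auto simp: lboundary_def lext_def smul_sum mult.commute intro!: sum.cong)
qed

lemma lboundary_single:
 "lboundary p (single \<sigma> r) = (if p = 0 then 0 else
   (\<Sum>k\<le>p. single (singular_face p k \<sigma>) (r * (- 1) ^ k)))" by (simp add: lboundary_lext smul_sum)

lemma lboundary_simps [simp]: "lboundary p 0 = 0" "lboundary 0 c = 0" by (simp_all add: lboundary_def)

lemma lboundary_add: "lboundary p (x + y) = lboundary p x + lboundary p y"
 and lboundary_diff: "lboundary p (x - y) = lboundary p x - lboundary p y"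
 and lboundary_smul: "lboundary p (smul r x) = smul r (lboundary p x)"
 unfolding lboundary_lext by (rule lext_add lext_diff lext_smul)+

section \<open>The boundary of a product of simplices\<close>

text \<open>A list of lattice points stands for the simplex with these vertices, in this order,
  inside a product of two simplices. With formal sums of such lists the boundary of a product
  becomes a computation independent of the simplices multiplied.\<close>

type_synonym grid = "(nat \<times> nat) list \<Rightarrow>\<^sub>0 laurent"

definition omit :: "nat => 'k list => 'k list" where
 "omit k L = take k L @ drop (Suc k) L"

definition snocs :: "nat \<times> nat => grid => grid" where
 "snocs v = lext (\<lambda>L. single (L @ [v]) 1)"

text \<open>This is the augmented boundary: a single vertex has boundary \<open>[]\<close>.\<close>

definition gbd :: "grid => grid" where
 "gbd = lext (\<lambda>L. \<Sum>k<length L. single (omit k L) ((- 1) ^ k))"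

text \<open>The coface map: it numbers the vertices of the \<open>j\<close>-th face as vertices of
  the whole simplex.\<close>

definition skip :: "nat => nat => nat" where
 "skip j v = (if v < j then v else Suc v)"

definition hskip :: "nat => grid => grid" where
 "hskip j = lext (\<lambda>L. single (map (apfst (skip j)) L) 1)"

definition vskip :: "nat => grid => grid" where
 "vskip j = lext (\<lambda>L. single (map (apsnd (skip j)) L) 1)"

lemmas grid_defs = snocs_def gbd_def hskip_def vskip_def

lemma grid_add: "snocs v (x + y) = snocs v x + snocs v y" "gbd (x + y) = gbd x + gbd y"
  "hskip j (x + y) = hskip j x + hskip j y" "vskip j (x + y) = vskip j x + vskip j y"
 by (simp_all add: grid_defs lext_add)

lemma grid_smul: "snocs v (smul r y) = smul r (snocs v y)" "gbd (smul r y) = smul r (gbd y)"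
  "hskip j (smul r y) = smul r (hskip j y)" "vskip j (smul r y) = smul r (vskip j y)"
 by (simp_all add: grid_defs lext_smul)

lemma grid_sum: "snocs v (sum f A) = (\<Sum>x\<in>A. snocs v (f x))"
  "hskip j (sum f A) = (\<Sum>x\<in>A. hskip j (f x))" "vskip j (sum f A) = (\<Sum>x\<in>A. vskip j (f x))"
 by (simp_all add: grid_defs lext_sum)

text \<open>The sum of the monotone lattice paths from \<open>(0, 0)\<close> to \<open>(p, q)\<close> with the signs of the
 corresponding shuffles, by recursion on the last step.\<close>

fun paths :: "nat => nat => grid" where
 "paths 0 0 = single [(0, 0)] 1"
| "paths (Suc p) 0 = snocs (Suc p, 0) (paths p 0)"
| "paths 0 (Suc q) = snocs (0, Suc q) (paths 0 q)"
| "paths (Suc p) (Suc q) = snocs (Suc p, Suc q) (smul ((- 1) ^ Suc q) (paths p (Suc q)) + paths (Suc p) q)"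

lemma keys_snocsE: assumes "L \<in> keys (snocs v x)" obtains L' where "L' \<in> keys x" "L = L' @ [v]"
proof -
 from assms have "L \<in> (\<Union>L'\<in>keys x. keys (single (L' @ [v]) (1 :: laurent)))"
  unfolding snocs_def by (rule subsetD[OF keys_lext])
 then show thesis using that by auto
qed

lemma keys_paths:
 "L \<in> keys (paths p q) ==> length L = Suc (p + q) \<and> (\<forall>(u, v)\<in>set L. u \<le> p \<and> v \<le> q)"
proof (induction p q arbitrary: L rule: paths.induct)
 case 1
 then show ?case by simp
next
 case (2 p)
 then obtain L' where "L' \<in> keys (paths p 0)" "L = L' @ [(Suc p, 0)]" by (auto elim: keys_snocsE)
 then show ?case using 2(1)[of L'] by auto
next
 case (3 q)
 then obtain L' where "L' \<in> keys (paths 0 q)" "L = L' @ [(0, Suc q)]" by (auto elim: keys_snocsE)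
 then show ?case using 3(1)[of L'] by auto
next
 case (4 p q)
 then obtain L' where "L' \<in> keys (smul ((- 1) ^ Suc q) (paths p (Suc q)) + paths (Suc p) q)"
   "L = L' @ [(Suc p, Suc q)]" by (auto elim: keys_snocsE)
 moreover from this have "L' \<in> keys (paths p (Suc q)) \<or> L' \<in> keys (paths (Suc p) q)"
  by (meson UnE keys_add keys_smul subsetD)
 ultimately show ?case using 4(1)[of L'] 4(2)[of L'] by fastforce
qed

text \<open>Boundary of a cone with apex \<open>v\<close>: omitting an old vertex commutes with
  adding the apex, and omitting the apex, which has position \<open>n\<close>, gives back the base
  with the sign of that position.\<close>

lemma gbd_snocs: assumes "\<And>L. L \<in> keys x ==> length L = n"
 shows "gbd (snocs v x) = snocs v (gbd x) + smul ((- 1) ^ n) x"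
proof (rule additive_eqI[of "\<lambda>x. gbd (snocs v x)" "\<lambda>x. snocs v (gbd x) + smul ((- 1) ^ n) x"])
 fix L r assume "L \<in> keys x"
 then have n: "length L = n" using assms by simp
 have "gbd (snocs v (single L 1)) = (\<Sum>k<Suc n. single (omit k (L @ [v])) ((- 1) ^ k))"
  by (simp add: gbd_def snocs_def n del: sum.lessThan_Suc)
 also have "\<dots> = (\<Sum>k<n. single (omit k L @ [v]) ((- 1) ^ k)) + single L ((- 1) ^ n)" by (simp add: omit_def n)
 also have "\<dots> = snocs v (gbd (single L 1)) + smul ((- 1) ^ n) (single L 1)"
  by (simp add: gbd_def snocs_def n lext_sum)
 finally have *: "gbd (snocs v (single L 1)) = \<dots>" .
 have "single L r = smul r (single L 1)" by simp
 then show "gbd (snocs v (single L r)) =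
   snocs v (gbd (single L r)) + smul ((- 1) ^ n) (single L r)"
  unfolding grid_smul using * by (simp only: grid_smul smul_add) (simp add: mult.commute)
qed (simp_all add: grid_add smul_add)

lemma hskip_snocs: "hskip j (snocs (u, v) x) = snocs (skip j u, v) (hskip j x)"
 and vskip_snocs: "vskip j (snocs (u, v) x) = snocs (u, skip j v) (vskip j x)" by (simp_all add: grid_defs lext_lext)

lemma hskip_paths: "p < j ==> hskip j (paths p q) = paths p q"
 and vskip_paths: "q < j ==> vskip j (paths p q) = paths p q"
proof -
 have "map (apfst (skip j)) L = L" if "L \<in> keys (paths p q)" "p < j" for L
  using keys_paths[OF that(1)] that(2) by (intro map_idI) (auto simp: skip_def)
 then show "p < j ==> hskip j (paths p q) = paths p q" unfolding hskip_def by (intro lext_id) simp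
 have "map (apsnd (skip j)) L = L" if "L \<in> keys (paths p q)" "q < j" for L
  using keys_paths[OF that(1)] that(2) by (intro map_idI) (auto simp: skip_def)
 then show "q < j ==> vskip j (paths p q) = paths p q" unfolding vskip_def by (intro lext_id) simp
qed

text \<open>The path sums of the product of the boundary of the first simplex with the second
  simplex, re-embedded by the coface maps. The value 0 at \<open>p = 0\<close> agrees with
  \<open>lboundary 0\<close>, although \<open>gbd\<close> itself is augmented.\<close>

definition hfaces :: "nat => nat => grid" where
 "hfaces p q = (if p = 0 then 0 else \<Sum>j\<le>p. smul ((- 1) ^ j) (hskip j (paths (p - 1) q)))"

definition vfaces :: "nat => nat => grid" where
 "vfaces p q = (if q = 0 then 0 else \<Sum>j\<le>q. smul ((- 1) ^ j) (vskip j (paths p (q - 1))))"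

text \<open>The last face separates because it only omits the largest vertex number, so its coface
  map does not change the labels of the paths.\<close>

lemma hfaces_Suc:
 "hfaces (Suc p) q = (\<Sum>j\<le>p. smul ((- 1) ^ j) (hskip j (paths p q))) + smul ((- 1) ^ Suc p) (paths p q)"
 by (simp add: hfaces_def hskip_paths)

lemma vfaces_Suc:
 "vfaces p (Suc q) = (\<Sum>j\<le>q. smul ((- 1) ^ j) (vskip j (paths p q))) + smul ((- 1) ^ Suc q) (paths p q)"
 by (simp add: vfaces_def vskip_paths)

text \<open>For \<open>j \<le> p\<close> the coface map sends the end point of every path to
  \<open>(Suc p, Suc q)\<close>. Splitting off this point leaves the recursion of
  \<open>paths\<close>.\<close>

lemma hskip_paths_Suc:
 "(\<Sum>j\<le>p. smul ((- 1) ^ j) (hskip j (paths p (Suc q)))) =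
   snocs (Suc p, Suc q) (smul ((- 1) ^ Suc q) (hfaces p (Suc q)) +
    (\<Sum>j\<le>p. smul ((- 1) ^ j) (hskip j (paths p q))))"
proof (cases p)
 case 0
 then show ?thesis by (simp add: hskip_snocs hfaces_def skip_def)
next
 case (Suc p')
 have "hskip j (paths p (Suc q)) = snocs (Suc p, Suc q)
   (smul ((- 1) ^ Suc q) (hskip j (paths p' (Suc q))) + hskip j (paths p q))" if "j \<le> p" for j
  using that by (simp add: Suc hskip_snocs grid_add grid_smul skip_def)
 then show ?thesis by (simp add: Suc hfaces_def grid_add grid_smul grid_sum smul_add smul_sum sum.distrib mult.commute
    del: sum.atMost_Suc)
qed

lemma vskip_paths_Suc:
 "(\<Sum>j\<le>q. smul ((- 1) ^ j) (vskip j (paths (Suc p) q))) =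
   snocs (Suc p, Suc q) (smul ((- 1) ^ q) (\<Sum>j\<le>q. smul ((- 1) ^ j) (vskip j (paths p q))) +
    vfaces (Suc p) q)"
proof (cases q)
 case 0
 then show ?thesis by (simp add: vskip_snocs vfaces_def skip_def)
next
 case (Suc q')
 have "vskip j (paths (Suc p) q) = snocs (Suc p, Suc q)
   (smul ((- 1) ^ q) (vskip j (paths p q)) + vskip j (paths (Suc p) q'))" if "j \<le> q" for j
  using that by (simp add: Suc vskip_snocs grid_add grid_smul skip_def)
 then show ?thesis by (simp add: Suc vfaces_def grid_add grid_smul grid_sum smul_add smul_sum sum.distrib mult.commute
    del: sum.atMost_Suc)
qed

lemma hskip_paths_0:
 "(\<Sum>j\<le>Suc p. smul ((- 1) ^ j) (hskip j (paths (Suc p) 0))) = snocs (Suc (Suc p), 0) (hfaces (Suc p) 0)"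
 by (simp add: hskip_snocs hfaces_def grid_sum grid_smul skip_def del: sum.atMost_Suc)

lemma vskip_paths_0:
 "(\<Sum>j\<le>Suc q. smul ((- 1) ^ j) (vskip j (paths 0 (Suc q)))) = snocs (0, Suc (Suc q)) (vfaces 0 (Suc q))"
proof -
 have "vskip j (paths 0 (Suc q)) = snocs (0, Suc (Suc q)) (vskip j (paths 0 q))" if "j \<le> Suc q" for j
  using that by (simp add: vskip_snocs skip_def)
 then show ?thesis by (simp add: vfaces_def grid_sum grid_smul del: sum.atMost_Suc paths.simps)
qed

text \<open>Leibniz rule in universal form. A face that omits an inner corner of a staircase belongs
  to two staircases with opposite signs; in the recursion this is the cancellation of the two copies
  of \<open>paths p q\<close> coming from \<open>hfaces_Suc\<close> and \<open>vfaces_Suc\<close>.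
  Deleting the end point yields the last horizontal and the last vertical face.\<close>

theorem gbd_paths: assumes "(p, q) \<noteq> (0, 0)" shows "gbd (paths p q) = hfaces p q + smul ((- 1) ^ p) (vfaces p q)"
 using assms
proof (induction p q rule: paths.induct)
 case (2 p)
 have "snocs (Suc p, 0) (gbd (paths p 0)) = (\<Sum>j\<le>p. smul ((- 1) ^ j) (hskip j (paths p 0)))"
 proof (cases p)
  case 0
  then show ?thesis by (simp add: grid_defs skip_def omit_def)
 next
  case (Suc p')
  then show ?thesis using 2 by (simp add: hskip_paths_0 vfaces_def del: sum.atMost_Suc paths.simps)
 qed
 moreover have "gbd (paths (Suc p) 0) = snocs (Suc p, 0) (gbd (paths p 0)) + smul ((- 1) ^ Suc p) (paths p 0)"
  unfolding paths.simps by (rule gbd_snocs) (use keys_paths[of _ p 0] in auto)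
 ultimately show ?case by (simp add: hfaces_Suc vfaces_def)
next
 case (3 q)
 have "snocs (0, Suc q) (gbd (paths 0 q)) = (\<Sum>j\<le>q. smul ((- 1) ^ j) (vskip j (paths 0 q)))"
 proof (cases q)
  case 0
  then show ?thesis by (simp add: grid_defs skip_def omit_def)
 next
  case (Suc q')
  then show ?thesis using 3 by (simp add: vskip_paths_0 hfaces_def del: sum.atMost_Suc paths.simps)
 qed
 moreover have "gbd (paths 0 (Suc q)) = snocs (0, Suc q) (gbd (paths 0 q)) + smul ((- 1) ^ Suc q) (paths 0 q)"
  unfolding paths.simps by (rule gbd_snocs) (use keys_paths[of _ 0 q] in auto)
 ultimately show ?case by (simp add: vfaces_Suc hfaces_def)
next
 case (4 p q)
 let ?v = "(Suc p, Suc q)" and ?s = "(- 1) ^ Suc q :: laurent"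
 let ?H = "\<Sum>j\<le>p. smul ((- 1) ^ j) (hskip j (paths p q))"
 let ?V = "\<Sum>j\<le>q. smul ((- 1) ^ j) (vskip j (paths p q))"
 have "gbd (paths (Suc p) (Suc q)) =
   snocs ?v (gbd (smul ?s (paths p (Suc q)) + paths (Suc p) q)) +
   smul ((- 1) ^ Suc (p + Suc q)) (smul ?s (paths p (Suc q)) + paths (Suc p) q)" unfolding paths.simps
 proof (rule gbd_snocs)
  fix L assume "L \<in> keys (smul ?s (paths p (Suc q)) + paths (Suc p) q)"
  then have "L \<in> keys (paths p (Suc q)) \<or> L \<in> keys (paths (Suc p) q)"
   by (meson UnE keys_add keys_smul subsetD)
  then show "length L = Suc (p + Suc q)" using keys_paths[of L] by auto
 qed
 also have "gbd (smul ?s (paths p (Suc q)) + paths (Suc p) q) =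
   smul ?s (hfaces p (Suc q) + smul ((- 1) ^ p) (vfaces p (Suc q))) +
   (hfaces (Suc p) q + smul ((- 1) ^ Suc p) (vfaces (Suc p) q))" using 4 by (simp add: grid_add grid_smul)
 finally have L: "gbd (paths (Suc p) (Suc q)) =
   snocs ?v (smul ?s (hfaces p (Suc q) + smul ((- 1) ^ p) (vfaces p (Suc q))) +
   (hfaces (Suc p) q + smul ((- 1) ^ Suc p) (vfaces (Suc p) q))) +
   smul ((- 1) ^ Suc (p + Suc q)) (smul ?s (paths p (Suc q)) + paths (Suc p) q)" .
 have s: "(- 1) ^ n * ((- 1) ^ n * x) = x" for n and x :: laurent by (simp flip: power_add mult.assoc)
 show ?case unfolding L hfaces_Suc[of p "Suc q"] vfaces_Suc[of "Suc p" q] hskip_paths_Suc vskip_paths_Suc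
  unfolding hfaces_Suc[of p q] vfaces_Suc[of p q] by (rule poly_mapping_eqI)
   (simp add: grid_add grid_smul lookup_add smul_add algebra_simps power_add s)
qed simp

section \<open>Lattice paths as shuffles\<close>

definition path_of :: "nat => nat set => (nat \<times> nat) list" where
 "path_of n A = map (\<lambda>k. (card (A \<inter> {..<k}), card ({..<k} - A))) [0..<Suc n]"

lemma path_of_Suc: "path_of (Suc n) A = path_of n (A \<inter> {..<n}) @ [(card (A \<inter> {..<Suc n}), card ({..<Suc n} - A))]"
proof -
 have "A \<inter> {..<n} \<inter> {..<k} = A \<inter> {..<k}" "{..<k} - A \<inter> {..<n} = {..<k} - A" if "k \<le> n" for k
  using that by auto
 then show ?thesis unfolding path_of_def by simp
qed

lemma shuffles_of_0: "shuffles_of 0 q = {{}}" "shuffles_of p 0 = {{..<p}}"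
proof -
 show "shuffles_of 0 q = {{}}" by (auto simp: shuffles_of_def dest: finite_subset)
 have "A = {..<p}" if "A \<subseteq> {..<p}" "card A = p" for A
  using that by (metis card_lessThan card_subset_eq finite_lessThan)
 then show "shuffles_of p 0 = {{..<p}}" by (auto simp: shuffles_of_def)
qed

lemma finite_shuffles_of [simp]: "finite (shuffles_of p q)"
 unfolding shuffles_of_def by (rule finite_subset[of _ "Pow {..<p + q}"]) auto

lemma shuffles_of_Suc:
 "shuffles_of (Suc p) (Suc q) = insert (p + Suc q) ` shuffles_of p (Suc q) \<union> shuffles_of (Suc p) q" (is "?L = ?R")
proof
 show "?L \<subseteq> ?R"
 proof
  fix A assume "A \<in> ?L"
  then have A: "A \<subseteq> {..<Suc (p + Suc q)}" "card A = Suc p" "finite A"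
   by (auto simp: shuffles_of_def dest: finite_subset)
  show "A \<in> ?R"
  proof (cases "p + Suc q \<in> A")
   case True
   then have "A = insert (p + Suc q) (A - {p + Suc q})" by auto
   moreover have "A - {p + Suc q} \<in> shuffles_of p (Suc q)" using A True by (auto simp: shuffles_of_def less_Suc_eq)
   ultimately show ?thesis by blast
  next
   case False
   then have "A \<subseteq> {..<p + Suc q}" using A(1) by (auto simp: less_Suc_eq subset_iff)
   then show ?thesis using A by (simp add: shuffles_of_def)
  qed
 qed
 show "?R \<subseteq> ?L"
 proof (safe)
  fix A assume "A \<in> shuffles_of p (Suc q)"
  then have A: "A \<subseteq> {..<p + Suc q}" "card A = p" "finite A" "p + Suc q \<notin> A"
   by (auto simp: shuffles_of_def dest: finite_subset)
  then show "insert (p + Suc q) A \<in> ?L" by (auto simp: shuffles_of_def)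
 qed (auto simp: shuffles_of_def)
qed

lemma shuffle_sign_insert: assumes "A \<subseteq> {..<n}"
 shows "shuffle_sign (Suc n) (insert n A) = (- 1) ^ (n - card A) * shuffle_sign n A"
  and "shuffle_sign (Suc n) A = shuffle_sign n A"
proof -
 let ?S = "\<lambda>n A. {(m, m'). m \<in> A \<and> m' \<in> {..<n} - A \<and> m' < m}"
 have fin: "finite (?S n A)" if "A \<subseteq> {..<n}" for n and A :: "nat set"
  by (rule finite_subset[of _ "{..<n} \<times> {..<n}"]) (use that in auto)
 have "?S (Suc n) (insert n A) = ?S n A \<union> {n} \<times> ({..<n} - A)" using assms by auto
 moreover have "?S n A \<inter> {n} \<times> ({..<n} - A) = {}" using assms by auto
 moreover have "card ({..<n} - A) = n - card A" using assms by (simp add: card_Diff_subset finite_subset)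
 ultimately have "card (?S (Suc n) (insert n A)) = card (?S n A) + (n - card A)"
  using fin[OF assms] by (simp add: card_Un_disjoint)
 then show "shuffle_sign (Suc n) (insert n A) = (- 1) ^ (n - card A) * shuffle_sign n A"
  by (simp add: shuffle_sign_def power_add mult.commute)
 have "?S (Suc n) A = ?S n A" using assms by auto
 then show "shuffle_sign (Suc n) A = shuffle_sign n A" by (simp add: shuffle_sign_def)
qed

lemma snocs_single [simp]: "snocs v (single L r) = single (L @ [v]) r" by (simp add: snocs_def)

text \<open>Recursion on the last step. A horizontal last step is inverted with each of the
  \<open>Suc q\<close> vertical steps before it, which is the sign in the last equation of
  \<open>paths\<close>; a vertical last step adds no inversion.\<close>

theorem paths_eq_shuffles:
 "paths p q = (\<Sum>A\<in>shuffles_of p q. single (path_of (p + q) A) (shuffle_sign (p + q) A))"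
proof (induction p q rule: paths.induct)
 case 1
 then show ?case by (simp add: shuffles_of_0 path_of_def shuffle_sign_def)
next
 case (2 p)
 then show ?case using shuffle_sign_insert(1)[of "{..<p}" p]
  by (simp add: shuffles_of_0 path_of_Suc lessThan_Suc[symmetric]) (simp add: lessThan_Suc Int_absorb1 Int_absorb2)
next
 case (3 q)
 then show ?case using shuffle_sign_insert(2)[of "{}" q] by (simp add: shuffles_of_0 path_of_Suc)
next
 case (4 p q)
 define n where "n = p + Suc q"
 let ?v = "(Suc p, Suc q)"
 have n: "Suc p + q = n" "Suc p + Suc q = Suc n" by (simp_all add: n_def)
 have A: "A \<subseteq> {..<n}" "finite A" "card A = p" "n \<notin> A" "card ({..<n} - A) = Suc q"
  if "A \<in> shuffles_of p (Suc q)" for A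
 proof -
  show *: "A \<subseteq> {..<n}" "finite A" "card A = p" "n \<notin> A"
   using that by (auto simp: shuffles_of_def n_def dest: finite_subset)
  show "card ({..<n} - A) = Suc q" using * by (subst card_Diff_subset) (auto simp: n_def)
 qed
 have B: "B \<subseteq> {..<n}" "finite B" "card B = Suc p" "card ({..<Suc n} - B) = Suc q"
  if "B \<in> shuffles_of (Suc p) q" for B
 proof -
  show *: "B \<subseteq> {..<n}" "finite B" "card B = Suc p"
   using that by (auto simp: shuffles_of_def n_def dest: finite_subset)
  show "card ({..<Suc n} - B) = Suc q" using * by (subst card_Diff_subset) (auto simp: n_def)
 qed
 have pA: "path_of (Suc n) (insert n A) = path_of n A @ [?v]" if "A \<in> shuffles_of p (Suc q)" for A
 proof -
  have "insert n A \<inter> {..<n} = A" "insert n A \<inter> {..<Suc n} = insert n A"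
   "{..<Suc n} - insert n A = {..<n} - A" using A[OF that] by auto
  then show ?thesis using A[OF that] by (simp add: path_of_Suc)
 qed
 have sA: "shuffle_sign (Suc n) (insert n A) = (- 1) ^ Suc q * shuffle_sign n A" if "A \<in> shuffles_of p (Suc q)" for A
  using A[OF that] by (simp add: shuffle_sign_insert n_def)
 have pB: "path_of (Suc n) B = path_of n B @ [?v]" if "B \<in> shuffles_of (Suc p) q" for B
 proof -
  have "B \<inter> {..<n} = B" "B \<inter> {..<Suc n} = B" using B[OF that] by auto
  then show ?thesis using B[OF that] by (simp add: path_of_Suc)
 qed
 have sB: "shuffle_sign (Suc n) B = shuffle_sign n B" if "B \<in> shuffles_of (Suc p) q" for B
  using B[OF that] by (simp add: shuffle_sign_insert)
 have IH: "paths p (Suc q) = (\<Sum>A\<in>shuffles_of p (Suc q). single (path_of n A) (shuffle_sign n A))"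
  "paths (Suc p) q = (\<Sum>A\<in>shuffles_of (Suc p) q. single (path_of n A) (shuffle_sign n A))"
  using 4 by (simp_all add: n_def)
 have inj: "inj_on (insert n) (shuffles_of p (Suc q))" using A(4) by (intro inj_onI) (metis insert_ident)
 have disj: "insert n ` shuffles_of p (Suc q) \<inter> shuffles_of (Suc p) q = {}" using B(1) by blast
 have 1: "(\<Sum>A\<in>insert n ` shuffles_of p (Suc q). single (path_of (Suc n) A) (shuffle_sign (Suc n) A))
   = smul ((- 1) ^ Suc q) (snocs ?v (paths p (Suc q)))"
  unfolding IH sum.reindex[OF inj] by (auto intro!: sum.cong simp: grid_sum smul_sum pA sA)
 have 2: "(\<Sum>A\<in>shuffles_of (Suc p) q. single (path_of (Suc n) A) (shuffle_sign (Suc n) A))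
   = snocs ?v (paths (Suc p) q)" unfolding IH by (auto intro!: sum.cong simp: grid_sum pB sB)
 show ?case unfolding shuffles_of_Suc paths.simps(4) n
  unfolding n_def[symmetric] sum.union_disjoint[OF finite_imageI[OF finite_shuffles_of] finite_shuffles_of disj] 1 2
  by (simp add: grid_add grid_smul)
qed

section \<open>Products of singular chains along a map of two variables\<close>

definition grid_simplex ::
 "('a => 'b => 'c) => ((nat => real) => 'a) => ((nat => real) => 'b) => (nat \<times> nat) list
   => (nat => real) => 'c" where
 "grid_simplex \<mu> \<sigma> \<tau> L = (let n = length L - 1 in (\<lambda>x\<in>standard_simplex n.
   \<mu> (\<sigma> (vertex_map n (\<lambda>k. fst (L ! k)) x)) (\<tau> (vertex_map n (\<lambda>k. snd (L ! k)) x))))"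

text \<open>The map \<open>\<mu>\<close> stays general because the construction serves twice: with
  \<open>stack_cover\<close> it is the product of classes, and with a homotopy
  \<open>\<mu> e t\<close>, where the second factor is the interval, it is the prism
  operator.\<close>

definition cross ::
 "('a => 'b => 'c) => nat => nat => 'a lchain => 'b lchain => 'c lchain" where
 "cross \<mu> p q x y =
   lext (\<lambda>\<sigma>. lext (\<lambda>\<tau>. lext (\<lambda>L. single (grid_simplex \<mu> \<sigma> \<tau> L) 1) (paths p q)) y) x"

lemma cross_add: "cross \<mu> p q (x + x') y = cross \<mu> p q x y + cross \<mu> p q x' y"
  "cross \<mu> p q x (y + y') = cross \<mu> p q x y + cross \<mu> p q x y'"
proof -
 show "cross \<mu> p q (x + x') y = cross \<mu> p q x y + cross \<mu> p q x' y" by (simp add: cross_def lext_add)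
 show "cross \<mu> p q x (y + y') = cross \<mu> p q x y + cross \<mu> p q x y'"
  by (simp add: cross_def lext_add lext_def[of _ x] smul_add sum.distrib)
qed

lemma cross_smul: "cross \<mu> p q (smul r x) y = smul r (cross \<mu> p q x y)"
  "cross \<mu> p q x (smul r y) = smul r (cross \<mu> p q x y)"
proof -
 show "cross \<mu> p q (smul r x) y = smul r (cross \<mu> p q x y)" by (simp add: cross_def lext_smul)
 show "cross \<mu> p q x (smul r y) = smul r (cross \<mu> p q x y)"
  by (simp add: cross_def lext_smul lext_def[of _ x] smul_sum mult.commute)
qed

lemma cross_0 [simp]: "cross \<mu> p q 0 y = 0" "cross \<mu> p q x 0 = 0"
 by (simp add: cross_def) (use cross_smul(2)[of \<mu> p q x 0 0] in simp)

lemma cross_diff: "cross \<mu> p q (x - x') y = cross \<mu> p q x y - cross \<mu> p q x' y"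
  "cross \<mu> p q x (y - y') = cross \<mu> p q x y - cross \<mu> p q x y'"
 using cross_add(1)[of \<mu> p q "x - x'" x' y] cross_add(2)[of \<mu> p q x "y - y'" y'] by (simp_all add: algebra_simps)

lemma cross_sum: "cross \<mu> p q (sum f A) y = (\<Sum>a\<in>A. cross \<mu> p q (f a) y)"
  "cross \<mu> p q x (sum g B) = (\<Sum>b\<in>B. cross \<mu> p q x (g b))"
proof -
 show "cross \<mu> p q (sum f A) y = (\<Sum>a\<in>A. cross \<mu> p q (f a) y)"
  by (induction A rule: infinite_finite_induct) (simp_all add: cross_add)
 show "cross \<mu> p q x (sum g B) = (\<Sum>b\<in>B. cross \<mu> p q x (g b))"
  by (induction B rule: infinite_finite_induct) (simp_all add: cross_add)
qed

lemma cross_single: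
 "cross \<mu> p q (single \<sigma> r) (single \<tau> s) =
   smul (r * s) (lext (\<lambda>L. single (grid_simplex \<mu> \<sigma> \<tau> L) 1) (paths p q))" by (simp add: cross_def)

lemma nth_path_of: "k \<le> n ==> path_of n A ! k = (card (A \<inter> {..<k}), card ({..<k} - A))"
 by (simp add: path_of_def del: upt_Suc)

lemma length_path_of [simp]: "length (path_of n A) = Suc n" by (simp add: path_of_def)

lemma vertex_map_cong: "(\<And>k. k \<le> n ==> f k = g k) ==> vertex_map n f x = vertex_map n g x"
 unfolding vertex_map_def by (intro ext sum.cong) auto

lemma stack_simplex_eq: "stack_simplex n A \<sigma> \<tau> = grid_simplex stack_cover \<sigma> \<tau> (path_of n A)"
proof -
 have "vertex_map n (\<lambda>k. card (A \<inter> {..<k})) x = vertex_map n (\<lambda>k. fst (path_of n A ! k)) x"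
  "vertex_map n (\<lambda>k. card ({..<k} - A)) x = vertex_map n (\<lambda>k. snd (path_of n A ! k)) x" for x
  by (auto simp: nth_path_of intro: vertex_map_cong)
 then show ?thesis by (simp add: stack_simplex_def grid_simplex_def)
qed

lemma cross_single_shuffles:
 "cross stack_cover p q (single \<sigma> r) (single \<tau> s) = (\<Sum>A\<in>shuffles_of p q.
   single (stack_simplex (p + q) A \<sigma> \<tau>) (shuffle_sign (p + q) A * (r * s)))"
 by (simp add: cross_single paths_eq_shuffles lext_sum smul_sum stack_simplex_eq mult_ac)

lemma stack_chain_eq: "stack_chain p q x y = cross stack_cover p q x y"
proof -
 have "cross stack_cover p q x y = cross stack_cover p q
   (\<Sum>\<sigma>\<in>keys x. single \<sigma> (lookup x \<sigma>)) (\<Sum>\<tau>\<in>keys y. single \<tau> (lookup y \<tau>))"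
  by (simp flip: sum_monomials)
 also have "\<dots> = stack_chain p q x y"
  unfolding cross_sum cross_single_shuffles stack_chain_def mult.assoc by (rule sum.swap)
 finally show ?thesis ..
qed

lemma vertex_map_in_simplex: assumes "x \<in> standard_simplex n" "\<And>k. k \<le> n ==> f k \<le> p"
 shows "vertex_map n f x \<in> standard_simplex p"
proof -
 have x: "0 \<le> x i" "(\<Sum>i\<le>n. x i) = 1" for i using assms(1) by (auto simp: standard_simplex_def)
 have sum: "(\<Sum>j\<le>p. vertex_map n f x j) = 1"
 proof -
  have "(\<Sum>j\<le>p. vertex_map n f x j) = (\<Sum>j\<in>{..p}. \<Sum>k\<in>{k\<in>{..n}. f k = j}. x k)"
   by (simp add: vertex_map_def)
  also have "\<dots> = (\<Sum>k\<le>n. x k)" by (rule sum.group) (use assms(2) in auto)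
  finally show ?thesis using x by simp
 qed
 have nonneg: "0 \<le> vertex_map n f x j" for j unfolding vertex_map_def using x by (simp add: sum_nonneg)
 moreover have "vertex_map n f x j = 0" if "j > p" for j
  unfolding vertex_map_def by (rule sum.neutral) (use assms(2) that in force)
 moreover have "vertex_map n f x j \<le> 1" for j
 proof (cases "j \<le> p")
  case True
  then show ?thesis using member_le_sum[of j "{..p}" "vertex_map n f x"] nonneg sum by simp
 next
  case False
  then show ?thesis using calculation(2)[of j] by simp
 qed
 ultimately show ?thesis using sum by (simp add: standard_simplex_def)
qed

lemma nth_omit: "k < length L ==> j < length L - 1 ==> omit k L ! j = L ! skip k j"
 by (auto simp: omit_def skip_def nth_append min_def)

lemma length_omit [simp]: "k < length L ==> length (omit k L) = length L - 1" by (simp add: omit_def)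

lemma inj_skip: "inj (skip k)" by (auto simp: inj_def skip_def split: if_splits)

text \<open>On the \<open>k\<close>-th face the coordinate with number \<open>k\<close> is 0, so the
  sum over a fibre of \<open>f\<close> may be restricted to the image of
  \<open>skip k\<close>.\<close>

lemma vertex_map_simplical_face: assumes "k \<le> n" "n > 0"
 shows "vertex_map n f (simplical_face k x) = vertex_map (n - 1) (\<lambda>j. f (skip k j)) x"
proof
 fix v
 have "(\<Sum>i | i \<le> n \<and> f i = v. simplical_face k x i) =
   (\<Sum>i\<in>skip k ` {j. j \<le> n - 1 \<and> f (skip k j) = v}. simplical_face k x i)"
 proof (rule sum.mono_neutral_right)
  show "\<forall>i\<in>{i. i \<le> n \<and> f i = v} - skip k ` {j. j \<le> n - 1 \<and> f (skip k j) = v}. simplical_face k x i = 0"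
  proof
   fix i assume i: "i \<in> {i. i \<le> n \<and> f i = v} - skip k ` {j. j \<le> n - 1 \<and> f (skip k j) = v}"
   have "i = k"
   proof (rule ccontr)
    assume "i \<noteq> k"
    define j where "j = (if i < k then i else i - 1)"
    have "i = skip k j" "j \<le> n - 1" using \<open>i \<noteq> k\<close> i assms by (auto simp: j_def skip_def)
    then show False using i by auto
   qed
   then show "simplical_face k x i = 0" by (simp add: simplical_face_def)
  qed
 qed (use assms in \<open>auto simp: skip_def\<close>)
 also have "\<dots> = (\<Sum>j | j \<le> n - 1 \<and> f (skip k j) = v. x j)"
  by (subst sum.reindex) (auto intro: inj_on_subset[OF inj_skip] simp: simplical_face_def skip_def intro!: sum.cong)
 finally show "vertex_map n f (simplical_face k x) v = vertex_map (n - 1) (\<lambda>j. f (skip k j)) x v"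
  by (simp add: vertex_map_def)
qed

lemma simplical_face_vertex_map:
 "simplical_face j (vertex_map n f x) = vertex_map n (\<lambda>k. skip j (f k)) x"
proof
 fix i
 show "simplical_face j (vertex_map n f x) i = vertex_map n (\<lambda>k. skip j (f k)) x i"
 proof -
  consider "i < j" | "i = j" | i' where "i = Suc i'" "j \<le> i'"
   by (metis less_Suc_eq_le linorder_neqE_nat Suc_lessE less_imp_Suc_add not_less_eq)
  then show ?thesis
  proof cases
   case 1
   then have "skip j m = i \<longleftrightarrow> m = i" for m by (auto simp: skip_def)
   then show ?thesis using 1 by (simp add: simplical_face_def vertex_map_def)
  next
   case 2
   then have "skip j m \<noteq> i" for m by (auto simp: skip_def)
   then show ?thesis using 2 by (simp add: simplical_face_def vertex_map_def)
  next
   case 3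
   then have "skip j m = i \<longleftrightarrow> m = i'" for m by (auto simp: skip_def)
   then show ?thesis using 3 by (simp add: simplical_face_def vertex_map_def)
  qed
 qed
qed

lemma singular_face_grid_simplex: assumes "length L = Suc n" "n > 0" "k \<le> n"
 shows "singular_face n k (grid_simplex \<mu> \<sigma> \<tau> L) = grid_simplex \<mu> \<sigma> \<tau> (omit k L)"
proof
 fix x
 have "vertex_map (n - 1) (\<lambda>j. g (L ! skip k j)) x = vertex_map (n - 1) (\<lambda>j. g (omit k L ! j)) x"
  for g :: "nat \<times> nat => nat" by (rule vertex_map_cong) (use assms in \<open>simp add: nth_omit\<close>)
 then show "singular_face n k (grid_simplex \<mu> \<sigma> \<tau> L) x = grid_simplex \<mu> \<sigma> \<tau> (omit k L) x"
  using assms simplical_face_in_standard_simplex[of n k x]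
  by (auto simp: singular_face_def grid_simplex_def Let_def vertex_map_simplical_face restrict_def)
qed

text \<open>The bound on the labels keeps the vertex map inside the smaller simplex; beyond it a
  singular face has the value \<open>undefined\<close>.\<close>

lemma grid_simplex_face_left:
 assumes "p > 0" "j \<le> p" "L \<noteq> []" "\<And>u v. (u, v) \<in> set L ==> u \<le> p - 1"
 shows "grid_simplex \<mu> (singular_face p j \<sigma>) \<tau> L = grid_simplex \<mu> \<sigma> \<tau> (map (apfst (skip j)) L)"
proof
 fix x
 let ?n = "length L - 1"
 have *: "vertex_map ?n (\<lambda>k. fst (L ! k)) x \<in> standard_simplex (p - 1)" if "x \<in> standard_simplex ?n"
 proof (rule vertex_map_in_simplex[OF that])
  fix k assume "k \<le> ?n"
  then have "L ! k \<in> set L" using assms(3) by (intro nth_mem) (cases L; simp)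
  then show "fst (L ! k) \<le> p - 1" using assms(4)[of "fst (L ! k)" "snd (L ! k)"] by simp
 qed
 have "vertex_map ?n (\<lambda>k. skip j (fst (L ! k))) x = vertex_map ?n (\<lambda>k. fst (map (apfst (skip j)) L ! k)) x"
  "vertex_map ?n (\<lambda>k. snd (L ! k)) x = vertex_map ?n (\<lambda>k. snd (map (apfst (skip j)) L ! k)) x"
  using assms(3) by (cases L; auto intro!: vertex_map_cong simp: less_Suc_eq_le simp del: nth_Cons_Suc list.map)+
 then show "grid_simplex \<mu> (singular_face p j \<sigma>) \<tau> L x = grid_simplex \<mu> \<sigma> \<tau> (map (apfst (skip j)) L) x"
  using * by (auto simp: grid_simplex_def Let_def singular_face_def simplical_face_vertex_map restrict_def)
qed

lemma grid_simplex_face_right: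
 assumes "q > 0" "j \<le> q" "L \<noteq> []" "\<And>u v. (u, v) \<in> set L ==> v \<le> q - 1"
 shows "grid_simplex \<mu> \<sigma> (singular_face q j \<tau>) L = grid_simplex \<mu> \<sigma> \<tau> (map (apsnd (skip j)) L)"
proof
 fix x
 let ?n = "length L - 1"
 have *: "vertex_map ?n (\<lambda>k. snd (L ! k)) x \<in> standard_simplex (q - 1)" if "x \<in> standard_simplex ?n"
 proof (rule vertex_map_in_simplex[OF that])
  fix k assume "k \<le> ?n"
  then have "L ! k \<in> set L" using assms(3) by (intro nth_mem) (cases L; simp)
  then show "snd (L ! k) \<le> q - 1" using assms(4)[of "fst (L ! k)" "snd (L ! k)"] by simp
 qed
 have "vertex_map ?n (\<lambda>k. skip j (snd (L ! k))) x = vertex_map ?n (\<lambda>k. snd (map (apsnd (skip j)) L ! k)) x"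
  "vertex_map ?n (\<lambda>k. fst (L ! k)) x = vertex_map ?n (\<lambda>k. fst (map (apsnd (skip j)) L ! k)) x"
  using assms(3) by (cases L; auto intro!: vertex_map_cong simp: less_Suc_eq_le simp del: nth_Cons_Suc list.map)+
 then show "grid_simplex \<mu> \<sigma> (singular_face q j \<tau>) L x = grid_simplex \<mu> \<sigma> \<tau> (map (apsnd (skip j)) L) x"
  using * by (auto simp: grid_simplex_def Let_def singular_face_def simplical_face_vertex_map restrict_def)
qed

text \<open>The linear map from staircases to singular simplices carries \<open>gbd_paths\<close> to
  this rule: deleting a vertex becomes a face, and relabelling by a coface map becomes a face of one
  factor. The truncated \<open>p - 1\<close> at \<open>p = 0\<close> is harmless because
  \<open>lboundary 0\<close> is 0.\<close>

theorem lboundary_cross: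
 "lboundary (p + q) (cross \<mu> p q x y) =
   cross \<mu> (p - 1) q (lboundary p x) y + smul ((- 1) ^ p) (cross \<mu> p (q - 1) x (lboundary q y))"
proof -
 have *: "lboundary (p + q) (cross \<mu> p q (single \<sigma> 1) (single \<tau> 1)) =
   cross \<mu> (p - 1) q (lboundary p (single \<sigma> 1)) (single \<tau> 1) +
   smul ((- 1) ^ p) (cross \<mu> p (q - 1) (single \<sigma> 1) (lboundary q (single \<tau> 1)))" for \<sigma> \<tau>
 proof (cases "(p, q) = (0, 0)")
  case False
  let ?R = "\<lambda>\<sigma> \<tau>. lext (\<lambda>L. single (grid_simplex \<mu> \<sigma> \<tau> L) 1)"
  have "lboundary (p + q) (?R \<sigma> \<tau> (paths p q)) = ?R \<sigma> \<tau> (gbd (paths p q))"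
   unfolding gbd_def lboundary_lext lext_lext
  proof (rule lext_cong)
   fix L assume "L \<in> keys (paths p q)"
   then have L: "length L = Suc (p + q)" using keys_paths by blast
   then show "lext (\<lambda>\<sigma>. if p + q = 0 then 0 else
      \<Sum>k\<le>p + q. single (singular_face (p + q) k \<sigma>) ((- 1) ^ k)) (single (grid_simplex \<mu> \<sigma> \<tau> L) 1) =
     ?R \<sigma> \<tau> (\<Sum>k<length L. single (omit k L) ((- 1) ^ k))"
    using False by (auto simp: lext_sum lessThan_Suc_atMost singular_face_grid_simplex)
  qed
  also have "\<dots> = ?R \<sigma> \<tau> (hfaces p q) + smul ((- 1) ^ p) (?R \<sigma> \<tau> (vfaces p q))"
   using gbd_paths[OF False] by (simp add: lext_add lext_smul)
  also have "?R \<sigma> \<tau> (hfaces p q) = cross \<mu> (p - 1) q (lboundary p (single \<sigma> 1)) (single \<tau> 1)"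
  proof (cases "p = 0")
   case False
   have "?R \<sigma> \<tau> (hskip j (paths (p - 1) q)) = ?R (singular_face p j \<sigma>) \<tau> (paths (p - 1) q)" if "j \<le> p" for j
    unfolding hskip_def lext_lext
   proof (rule lext_cong)
    fix L assume "L \<in> keys (paths (p - 1) q)"
    then have "L \<noteq> []" "\<And>u v. (u, v) \<in> set L ==> u \<le> p - 1" using keys_paths by fastforce+
    then show "?R \<sigma> \<tau> (single (map (apfst (skip j)) L) 1) = single (grid_simplex \<mu> (singular_face p j \<sigma>) \<tau> L) 1"
     using False that by (subst grid_simplex_face_left) simp_all
   qed
   then show ?thesis using False by (simp add: hfaces_def lext_sum lext_smul lboundary_single cross_sum cross_single
      del: sum.atMost_Suc)
  qed (simp add: hfaces_def)
  also have "?R \<sigma> \<tau> (vfaces p q) = cross \<mu> p (q - 1) (single \<sigma> 1) (lboundary q (single \<tau> 1))"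
  proof (cases "q = 0")
   case False
   have "?R \<sigma> \<tau> (vskip j (paths p (q - 1))) = ?R \<sigma> (singular_face q j \<tau>) (paths p (q - 1))" if "j \<le> q" for j
    unfolding vskip_def lext_lext
   proof (rule lext_cong)
    fix L assume "L \<in> keys (paths p (q - 1))"
    then have "L \<noteq> []" "\<And>u v. (u, v) \<in> set L ==> v \<le> q - 1" using keys_paths by fastforce+
    then show "?R \<sigma> \<tau> (single (map (apsnd (skip j)) L) 1) = single (grid_simplex \<mu> \<sigma> (singular_face q j \<tau>) L) 1"
     using False that by (subst grid_simplex_face_right) simp_all
   qed
   then show ?thesis using False by (simp add: vfaces_def lext_sum lext_smul lboundary_single cross_sum cross_single
      del: sum.atMost_Suc)
  qed (simp add: vfaces_def)
  finally show ?thesis by (simp add: cross_single)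
 qed simp
 have sm: "single \<sigma> r = smul r (single \<sigma> 1)" for \<sigma> :: "'k" and r by simp
 have **: "lboundary (p + q) (cross \<mu> p q (single \<sigma> r) (single \<tau> s)) =
   cross \<mu> (p - 1) q (lboundary p (single \<sigma> r)) (single \<tau> s) +
   smul ((- 1) ^ p) (cross \<mu> p (q - 1) (single \<sigma> r) (lboundary q (single \<tau> s)))" for \<sigma> \<tau> r s
  unfolding sm[of \<sigma> r] sm[of \<tau> s] lboundary_smul cross_smul * by (simp only: smul_add smul_simps mult_ac)
 have ***: "lboundary (p + q) (cross \<mu> p q (single \<sigma> r) y) =
   cross \<mu> (p - 1) q (lboundary p (single \<sigma> r)) y +
   smul ((- 1) ^ p) (cross \<mu> p (q - 1) (single \<sigma> r) (lboundary q y))" for \<sigma> r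
  by (rule additive_eqI[of "\<lambda>y. lboundary (p + q) (cross \<mu> p q (single \<sigma> r) y)"
     "\<lambda>y. cross \<mu> (p - 1) q (lboundary p (single \<sigma> r)) y +
       smul ((- 1) ^ p) (cross \<mu> p (q - 1) (single \<sigma> r) (lboundary q y))"])
    (simp_all only: lboundary_add cross_add smul_add ** add_ac)
 show ?thesis by (rule additive_eqI[of "\<lambda>x. lboundary (p + q) (cross \<mu> p q x y)"
     "\<lambda>x. cross \<mu> (p - 1) q (lboundary p x) y +
       smul ((- 1) ^ p) (cross \<mu> p (q - 1) x (lboundary q y))"])
    (simp_all only: lboundary_add cross_add smul_add *** add_ac)
qed

section \<open>Twisted chains\<close>

text \<open>Null chains, cycles and boundaries are submodules of the chains of the cover, and
  classes are cosets; equality of classes is always treated as membership of a difference in such a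
  submodule.\<close>

definition submod :: "('k \<Rightarrow>\<^sub>0 laurent) set => bool" where
 "submod B \<longleftrightarrow> 0 \<in> B \<and> (\<forall>x\<in>B. \<forall>y\<in>B. x + y \<in> B) \<and> (\<forall>r. \<forall>x\<in>B. smul r x \<in> B)"

lemma submodI:
 assumes "0 \<in> B" "\<And>x y. x \<in> B ==> y \<in> B ==> x + y \<in> B" "\<And>r x. x \<in> B ==> smul r x \<in> B"
 shows "submod B" using assms by (auto simp: submod_def)

context
 fixes B :: "('k \<Rightarrow>\<^sub>0 laurent) set" assumes B: "submod B"
begin

lemma submod_0: "0 \<in> B" and submod_add: "x \<in> B ==> y \<in> B ==> x + y \<in> B"
 and submod_smul: "x \<in> B ==> smul r x \<in> B" using B by (auto simp: submod_def)

lemma submod_minus: "x \<in> B ==> - x \<in> B" using submod_smul[of x "- 1"] by (simp add: smul_minus_left)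

lemma submod_diff: "x \<in> B ==> y \<in> B ==> x - y \<in> B" using submod_add[of x "- y"] submod_minus[of y] by simp

lemma submod_sum: "(\<And>i. i \<in> I ==> f i \<in> B) ==> sum f I \<in> B"
 by (induction I rule: infinite_finite_induct) (auto intro: submod_0 submod_add)

lemma submod_diff_commute: "x - y \<in> B ==> y - x \<in> B" using submod_minus[of "x - y"] by simp

lemma submod_diff_trans: "x - y \<in> B ==> y - z \<in> B ==> x - z \<in> B" using submod_add[of "x - y" "y - z"] by simp

lemma mem_coset: "y \<in> x +o B \<longleftrightarrow> y - x \<in> B"
 by (auto simp: elt_set_plus_def intro!: bexI[of _ "y - x"])

lemma coset_eq_iff: "x +o B = y +o B \<longleftrightarrow> x - y \<in> B"
proof
 assume "x +o B = y +o B"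
 then have "x \<in> y +o B" using submod_0 mem_coset[of x x] by auto
 then show "x - y \<in> B" by (simp add: mem_coset)
next
 assume *: "x - y \<in> B"
 show "x +o B = y +o B"
 proof (intro Set.set_eqI)
  fix z
  have "z - x \<in> B \<longleftrightarrow> z - y \<in> B"
   using submod_add[OF _ *, of "z - x"] submod_diff[OF _ *, of "z - y"] by auto
  then show "z \<in> x +o B \<longleftrightarrow> z \<in> y +o B" by (simp add: mem_coset)
 qed
qed

lemma coset_add: "(x +o B) + (y +o B) = (x + y) +o B"
proof (intro Set.set_eqI iffI)
 fix z assume "z \<in> (x +o B) + (y +o B)"
 then obtain a b where "z = a + b" "a - x \<in> B" "b - y \<in> B" by (auto simp: set_plus_def mem_coset)
 then show "z \<in> (x + y) +o B" using submod_add[of "a - x" "b - y"] by (simp add: mem_coset algebra_simps)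
next
 fix z assume "z \<in> (x + y) +o B"
 then have "z - x \<in> y +o B" by (simp add: mem_coset algebra_simps)
 moreover have "x \<in> x +o B" by (simp add: mem_coset submod_0)
 moreover have "z = x + (z - x)" by simp
 ultimately show "z \<in> (x +o B) + (y +o B)" by (metis set_plus_intro)
qed

text \<open>The summand \<open>B\<close> restores a full coset: a scalar that is not invertible maps
  a coset only to a part of one.\<close>

lemma coset_smul: "smul r ` (x +o B) + B = smul r x +o B"
proof (intro Set.set_eqI iffI)
 fix z assume "z \<in> smul r ` (x +o B) + B"
 then obtain a b where "z = smul r a + b" "a - x \<in> B" "b \<in> B" by (auto simp: set_plus_def mem_coset)
 then show "z \<in> smul r x +o B"
  using submod_add[of "smul r (a - x)" b] submod_smul[of "a - x" r] by (simp add: mem_coset smul_diff algebra_simps)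
next
 fix z assume "z \<in> smul r x +o B"
 then have "z - smul r x \<in> B" by (simp add: mem_coset)
 moreover have "x \<in> x +o B" by (simp add: mem_coset submod_0)
 moreover have "z = smul r x + (z - smul r x)" by simp
 ultimately show "z \<in> smul r ` (x +o B) + B" by (metis set_plus_intro image_eqI)
qed

end

lemma submod_plus: "submod A ==> submod B ==> submod (A + B)"
proof (rule submodI)
 assume A: "submod A" and B: "submod B"
 show "0 \<in> A + B" using set_plus_intro[OF submod_0[OF A] submod_0[OF B]] by simp
 show "x + y \<in> A + B" if "x \<in> A + B" "y \<in> A + B" for x y
 proof -
  from that obtain a b a' b' where "x = a + b" "y = a' + b'" "a \<in> A" "a' \<in> A" "b \<in> B" "b' \<in> B"
   by (auto simp: set_plus_def)
  moreover have "a + b + (a' + b') = (a + a') + (b + b')" by simp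
  ultimately show ?thesis using submod_add[OF A] submod_add[OF B] by (metis set_plus_intro)
 qed
 show "smul r x \<in> A + B" if "x \<in> A + B" for r x
 proof -
  from that obtain a b where "x = a + b" "a \<in> A" "b \<in> B" by (auto simp: set_plus_def)
  then show ?thesis using submod_smul[OF A] submod_smul[OF B] by (auto simp: smul_add intro!: set_plus_intro)
 qed
qed

lemma submod_lchains: "submod (lchains p E)"
proof (rule submodI)
 show "x + y \<in> lchains p E" if "x \<in> lchains p E" "y \<in> lchains p E" for x y
  using that keys_add[of x y] by (auto simp: lchains_def)
 show "smul r x \<in> lchains p E" if "x \<in> lchains p E" for r x
  using that keys_smul[of r x] by (auto simp: lchains_def)
qed (simp add: lchains_def)

lemma single_in_lchains: "singular_simplex p E \<sigma> ==> single \<sigma> r \<in> lchains p E"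
 by (auto simp: lchains_def)

lemma lchains_singular: "c \<in> lchains p E ==> \<sigma> \<in> keys c ==> singular_simplex p E \<sigma>"
 by (auto simp: lchains_def)

lemma lext_in_submod: assumes "submod B" "\<And>\<sigma>. \<sigma> \<in> keys c ==> f \<sigma> \<in> B"
 shows "lext f c \<in> B" unfolding lext_def using assms by (intro submod_sum submod_smul)

lemma lboundary_in_lchains: assumes "c \<in> lchains p E" shows "lboundary p c \<in> lchains (p - 1) E"
 unfolding lboundary_lext
proof (rule lext_in_submod[OF submod_lchains])
 fix \<sigma> assume "\<sigma> \<in> keys c"
 then have "singular_simplex p E \<sigma>" by (rule lchains_singular[OF assms])
 then show "(if p = 0 then 0 else \<Sum>k\<le>p. single (singular_face p k \<sigma>) ((- 1) ^ k)) \<in> lchains (p - 1) E"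
  by (auto intro!: submod_sum[OF submod_lchains] submod_0[OF submod_lchains] single_in_lchains
    singular_simplex_singular_face)
qed

lemma lchains_subtopology:
 "c \<in> lchains p (subtopology E S) \<longleftrightarrow> c \<in> lchains p E \<and> (\<forall>\<sigma>\<in>keys c. \<sigma> ` standard_simplex p \<subseteq> S)"
 unfolding lchains_def mem_Collect_eq subset_eq[of "keys c"] singular_simplex_subtopology ball_conj_distrib by (rule refl)

lemma lchains_subtopology_mono: "S \<subseteq> S' ==> lchains p (subtopology E S) \<subseteq> lchains p (subtopology E S')"
 unfolding lchains_def by (auto intro: singular_simplex_mono)

subsection \<open>The boundary of a boundary\<close>

text \<open>Extension of scalars from integral singular chains, for which the vanishing of the
  double boundary is known.\<close>

definition emb :: "('k \<Rightarrow>\<^sub>0 int) => 'k \<Rightarrow>\<^sub>0 laurent" where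
 "emb c = Poly_Mapping.map of_int c"

lemma lookup_emb [simp]: "lookup (emb c) \<sigma> = of_int (lookup c \<sigma>)"
 unfolding emb_def by transfer (simp add: when_def)

lemma emb_simps: "emb 0 = 0" "emb (c + c') = emb c + emb c'" "emb (frag_cmul k c) = smul (of_int k) (emb c)"
  "emb (frag_of \<sigma>) = single \<sigma> 1" by (auto intro!: poly_mapping_eqI simp: lookup_add lookup_single when_def)

lemma emb_sum: "emb (sum f A) = (\<Sum>x\<in>A. emb (f x))"
 by (induction A rule: infinite_finite_induct) (simp_all add: emb_simps)

lemma lboundary_emb_of: "lboundary p (single \<sigma> 1) = emb (chain_boundary p (frag_of \<sigma>))"
 by (simp add: lboundary_single chain_boundary_of emb_sum emb_simps)

lemma lboundary_sum: "lboundary p (sum f A) = (\<Sum>x\<in>A. lboundary p (f x))" by (simp add: lboundary_lext lext_sum)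

lemma lboundary_lboundary: assumes "c \<in> lchains p E" shows "lboundary (p - 1) (lboundary p c) = 0"
proof (rule additive_eqI[of "\<lambda>c. lboundary (p - 1) (lboundary p c)" "\<lambda>_. 0"])
 fix \<sigma> r assume "\<sigma> \<in> keys c"
 then have \<sigma>: "singular_simplex p E \<sigma>" by (rule lchains_singular[OF assms])
 have "lboundary (p - 1) (lboundary p (single \<sigma> 1)) = emb (chain_boundary (p - 1) (chain_boundary p (frag_of \<sigma>)))"
 proof (cases "p = 0")
  case False
  then have "lboundary (p - 1) (lboundary p (single \<sigma> 1)) =
    (\<Sum>k\<le>p. smul ((- 1) ^ k) (lboundary (p - 1) (single (singular_face p k \<sigma>) 1)))"
   by (simp add: lboundary_single[of p] lboundary_sum del: sum.atMost_Suc) (simp flip: lboundary_smul)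
  also have "\<dots> = emb (chain_boundary (p - 1) (chain_boundary p (frag_of \<sigma>)))"
   using False by (simp add: lboundary_emb_of chain_boundary_of[of p] chain_boundary_sum
     chain_boundary_cmul emb_sum emb_simps o_def del: sum.atMost_Suc)
  finally show ?thesis .
 qed (simp add: emb_simps chain_boundary_def)
 also have "chain_boundary (p - 1) (chain_boundary p (frag_of \<sigma>)) = 0"
  using chain_boundary_boundary[of p E "frag_of \<sigma>"] \<sigma> by (simp add: singular_chain_of)
 finally have 0: "lboundary (p - 1) (lboundary p (single \<sigma> 1)) = 0" by (simp add: emb_simps)
 have "single \<sigma> r = smul r (single \<sigma> 1)" by simp
 then show "lboundary (p - 1) (lboundary p (single \<sigma> r)) = 0"
  unfolding \<open>single \<sigma> r = _\<close> lboundary_smul 0 by simp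
qed (simp_all add: lboundary_add)

subsection \<open>Deck transformations\<close>

lemma topspace_torus_cover: "topspace (torus_cover T) =
  {(x, \<theta>). x \<in> topspace (lspace T) \<and> \<theta> \<in> extensional (lcoords T) \<and> (\<forall>k\<in>lcoords T. lmap T x k = cis (\<theta> k))}"
 by (auto simp: torus_cover_def PiE_def)

lemma continuous_map_torus_cover:
 "continuous_map Y (torus_cover T) f \<longleftrightarrow>
   continuous_map Y (lspace T) (\<lambda>x. fst (f x)) \<and>
   (\<forall>k\<in>lcoords T. continuous_map Y euclideanreal (\<lambda>x. snd (f x) k)) \<and>
   (\<forall>x\<in>topspace Y. f x \<in> topspace (torus_cover T))" (is "?L \<longleftrightarrow> ?R")
proof
 assume L: ?L
 then show ?R using continuous_map_image_subset_topspace[OF L]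
  unfolding torus_cover_def continuous_map_in_subtopology continuous_map_pairwise
   continuous_map_componentwise comp_def by auto
next
 assume R: ?R
 have "snd (f x) \<in> extensional (lcoords T) \<and> (\<forall>k\<in>lcoords T. lmap T (fst (f x)) k = cis (snd (f x) k))"
  if "x \<in> topspace Y" for x using R that unfolding topspace_torus_cover by fastforce
 with R show ?L unfolding torus_cover_def continuous_map_in_subtopology continuous_map_pairwise
   continuous_map_componentwise comp_def by (auto simp: split_beta)
qed

lemma fst_deck [simp]: "fst (deck J n e) = fst e" by (simp add: deck_def split_beta)

lemma deck_in_cover: assumes "e \<in> topspace (torus_cover T)"
 shows "deck (lcoords T) n e \<in> topspace (torus_cover T)"
proof -
 have "cis (t + 2 * pi * of_int m) = cis t" for t m by (simp add: cis_mult[symmetric])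
 then show ?thesis using assms by (auto simp: topspace_torus_cover deck_def)
qed

lemma continuous_map_deck: "continuous_map (torus_cover T) (torus_cover T) (deck (lcoords T) n)"
proof -
 have *: "continuous_map (torus_cover T) (lspace T) (\<lambda>x. fst x)"
   "continuous_map (torus_cover T) euclideanreal (\<lambda>x. snd x k)" if "k \<in> lcoords T" for k
  using continuous_map_id[of "torus_cover T"] that unfolding continuous_map_torus_cover id_def by auto
 have "continuous_map (torus_cover T) (lspace T) (\<lambda>x. fst x)"
  using continuous_map_id[of "torus_cover T"] unfolding continuous_map_torus_cover id_def by auto
 moreover have "continuous_map (torus_cover T) euclideanreal (\<lambda>x. snd (deck (lcoords T) n x) k)"
  if "k \<in> lcoords T" for k using that *(2)[OF that] by (simp add: deck_def split_beta continuous_map_add)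
 ultimately show ?thesis unfolding continuous_map_torus_cover by (auto simp: deck_in_cover)
qed

lemma singular_simplex_deck:
 "singular_simplex p (torus_cover T) \<sigma> ==>
   singular_simplex p (torus_cover T) (simplex_map p (deck (lcoords T) n) \<sigma>)"
 by (rule singular_simplex_simplex_map[OF _ continuous_map_deck])

definition mono_gen ::
 "('a, 'j) twisted_space => nat => ('j => int) => ((nat => real) => 'a \<times> ('j => real)) => laurent
   => ('a \<times> ('j => real)) lchain" where
 "mono_gen T p n \<sigma> r = single (simplex_map p (deck (lcoords T) n) \<sigma>) r - single \<sigma> (lmono T n * r)"

lemma mono_relations_step:
 "c \<in> mono_relations T p ==> singular_simplex p (torus_cover T) \<sigma> ==> c + mono_gen T p n \<sigma> r \<in> mono_relations T p"
 unfolding mono_gen_def simplex_map_def by (rule mono_relations.step)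

lemma mono_relations_gen:
 "singular_simplex p (torus_cover T) \<sigma> ==> mono_gen T p n \<sigma> r \<in> mono_relations T p"
 using mono_relations_step[OF mono_relations.zero] by fastforce

lemma mono_relations_induct [consumes 1, case_names zero step]: assumes "c \<in> mono_relations T p" "P 0"
  "\<And>c \<sigma> n r. c \<in> mono_relations T p ==> P c ==> singular_simplex p (torus_cover T) \<sigma> ==> P (c + mono_gen T p n \<sigma> r)"
 shows "P c" using assms by (induction rule: mono_relations.induct) (auto simp: mono_gen_def simplex_map_def)

lemma smul_mono_gen: "smul s (mono_gen T p n \<sigma> r) = mono_gen T p n \<sigma> (s * r)"
 by (simp add: mono_gen_def smul_diff mult_ac)

lemma submod_mono_relations: "submod (mono_relations T p)"
proof (rule submodI)
 show "x + y \<in> mono_relations T p" if "x \<in> mono_relations T p" "y \<in> mono_relations T p" for x y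
  using that(2,1) by (induction rule: mono_relations_induct) (simp_all add: mono_relations_step flip: add.assoc)
 show "smul s x \<in> mono_relations T p" if "x \<in> mono_relations T p" for s x
  using that by (induction rule: mono_relations_induct)
   (simp_all add: mono_relations.zero mono_relations_step smul_add smul_mono_gen)
qed (rule mono_relations.zero)

lemma additive_mono_relations: assumes B: "submod B" and add: "\<And>x y. F (x + y) = F x + F y"
  and gen: "\<And>n \<sigma> r. singular_simplex p (torus_cover T) \<sigma> ==> F (mono_gen T p n \<sigma> r) \<in> B"
  and c: "c \<in> mono_relations T p" shows "F c \<in> B" using c
proof (induction rule: mono_relations_induct)
 case zero
 have "F 0 = 0" using add[of 0 0] by simp
 then show ?case using submod_0[OF B] by simp
next
 case (step c \<sigma> n r)
 then show ?case using add gen submod_add[OF B] by simp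
qed

lemma mono_relations_lchains: "mono_relations T p \<subseteq> lchains p (torus_cover T)"
proof
 fix c assume "c \<in> mono_relations T p"
 then show "c \<in> lchains p (torus_cover T)" using additive_mono_relations[OF submod_lchains, of "\<lambda>x. x"]
  by (metis mono_gen_def single_in_lchains singular_simplex_deck submod_diff submod_lchains)
qed

text \<open>Deck transformations commute with taking faces, so the boundary of a generating relation
  is a sum of generating relations.\<close>

lemma lboundary_mono_relations: assumes "c \<in> mono_relations T p" shows "lboundary p c \<in> mono_relations T (p - 1)"
proof (rule additive_mono_relations[OF submod_mono_relations _ _ assms])
 fix n \<sigma> r assume \<sigma>: "singular_simplex p (torus_cover T) \<sigma>"
 show "lboundary p (mono_gen T p n \<sigma> r) \<in> mono_relations T (p - 1)"
 proof (cases "p = 0")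
  case False
  have "singular_face p k (simplex_map p (deck (lcoords T) n) \<sigma>) =
    simplex_map (p - 1) (deck (lcoords T) n) (singular_face p k \<sigma>)" if "k \<le> p" for k
  proof -
   have "singular_face p k (simplex_map p (deck (lcoords T) n) \<sigma>) =
     simplex_map (p - 1) (deck (lcoords T) n) (\<sigma> \<circ> simplical_face k)"
    using that False by (simp add: singular_face_simplex_map)
   also have "\<dots> = simplex_map (p - 1) (deck (lcoords T) n) (singular_face p k \<sigma>)"
    by (auto simp: simplex_map_def singular_face_def)
   finally show ?thesis .
  qed
  then have "lboundary p (mono_gen T p n \<sigma> r) = (\<Sum>k\<le>p. mono_gen T (p - 1) n (singular_face p k \<sigma>) (r * (- 1) ^ k))"
   using False by (simp add: mono_gen_def lboundary_diff lboundary_single sum_subtractf mult.assoc del: sum.atMost_Suc)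
  also have "\<dots> \<in> mono_relations T (p - 1)"
   using \<sigma> False by (intro submod_sum submod_mono_relations mono_relations_gen)
    (simp_all add: singular_simplex_singular_face)
  finally show ?thesis .
 qed (simp add: mono_relations.zero)
qed (rule lboundary_add)

subsection \<open>Relative cycles and boundaries\<close>

lemma submod_tw_null: "submod (tw_null T A p)"
 unfolding tw_null_def by (intro submod_plus submod_lchains submod_mono_relations)

lemma tw_null_lchains: "tw_null T A p \<subseteq> lchains p (torus_cover T)"
proof
 fix x assume "x \<in> tw_null T A p"
 then obtain c c' where "x = c + c'" "c \<in> lchains p (torus_cover T)" "c' \<in> lchains p (torus_cover T)"
  using mono_relations_lchains by (fastforce simp: tw_null_def set_plus_def lchains_subtopology)
 then show "x \<in> lchains p (torus_cover T)" by (simp add: submod_add[OF submod_lchains])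
qed

lemma tw_nullI1: "c \<in> lchains p (subtopology (torus_cover T) (A \<times> UNIV)) ==> c \<in> tw_null T A p"
 using set_plus_intro[OF _ mono_relations.zero[of T p]] by (fastforce simp: tw_null_def)

lemma tw_nullI2: "c \<in> mono_relations T p ==> c \<in> tw_null T A p"
 using set_plus_intro[OF submod_0[OF submod_lchains]] by (fastforce simp: tw_null_def)

lemma tw_null_mono: "A \<subseteq> A' ==> tw_null T A p \<subseteq> tw_null T A' p"
 unfolding tw_null_def by (intro set_plus_mono2 order_refl lchains_subtopology_mono) auto

text \<open>Used to show that products and homotopies preserve null chains: it separates the
  geometric part over \<open>A\<close> from the algebraic part given by the monodromy.\<close>

lemma additive_tw_null: assumes B: "submod B" and add: "\<And>x y. F (x + y) = F x + F y"
  and "\<And>c. c \<in> lchains p (subtopology (torus_cover T) (A \<times> UNIV)) ==> F c \<in> B"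
  and "\<And>c. c \<in> mono_relations T p ==> F c \<in> B" and "c \<in> tw_null T A p" shows "F c \<in> B"
 using assms submod_add[OF B] by (auto simp: tw_null_def set_plus_def)

lemma lboundary_tw_null: assumes "c \<in> tw_null T A p" shows "lboundary p c \<in> tw_null T A (p - 1)"
 by (rule additive_tw_null[OF submod_tw_null _ _ _ assms])
   (simp_all add: lboundary_add tw_nullI1 tw_nullI2 lboundary_mono_relations lboundary_in_lchains del: One_nat_def)

lemma submod_tw_boundaries: "submod (tw_boundaries T A p)" unfolding tw_boundaries_def
proof (rule submod_plus[OF _ submod_tw_null], rule submodI)
 let ?C = "lchains (Suc p) (torus_cover T)" and ?d = "lboundary (Suc p)"
 show "0 \<in> ?d ` ?C" using submod_0[OF submod_lchains, of "Suc p" "torus_cover T"] by (force simp: image_iff)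
 show "x + y \<in> ?d ` ?C" if "x \<in> ?d ` ?C" "y \<in> ?d ` ?C" for x y
  using that by (auto simp flip: lboundary_add intro!: imageI submod_add[OF submod_lchains])
 show "smul r x \<in> ?d ` ?C" if "x \<in> ?d ` ?C" for r x
  using that by (auto simp flip: lboundary_smul intro!: imageI submod_smul[OF submod_lchains])
qed

lemma tw_null_boundaries: "tw_null T A p \<subseteq> tw_boundaries T A p"
proof
 fix x assume "x \<in> tw_null T A p"
 moreover have "0 \<in> lboundary (Suc p) ` lchains (Suc p) (torus_cover T)"
  using submod_0[OF submod_lchains, of "Suc p" "torus_cover T"] by (force simp: image_iff)
 ultimately show "x \<in> tw_boundaries T A p" unfolding tw_boundaries_def using set_plus_intro[of 0 _ x] by fastforce
qed

lemma lboundary_in_tw_boundaries: assumes "c \<in> lchains (Suc p) (torus_cover T)"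
 shows "lboundary (Suc p) c \<in> tw_boundaries T A p"
 using set_plus_intro[OF imageI[OF assms, of "lboundary (Suc p)"] submod_0[OF submod_tw_null[of T A p]]]
 by (simp add: tw_boundaries_def)

lemma tw_boundariesE: assumes "x \<in> tw_boundaries T A p"
 obtains b n where "b \<in> lchains (Suc p) (torus_cover T)" "n \<in> tw_null T A p" "x = lboundary (Suc p) b + n"
 using assms by (auto simp: tw_boundaries_def set_plus_def)

lemma tw_boundaries_mono: "A \<subseteq> A' ==> tw_boundaries T A p \<subseteq> tw_boundaries T A' p"
 unfolding tw_boundaries_def by (intro set_plus_mono2 order_refl tw_null_mono)

lemma tw_boundaries_cycles: "tw_boundaries T A p \<subseteq> tw_cycles T A p"
proof
 fix x assume "x \<in> tw_boundaries T A p"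
 then obtain b n where b: "b \<in> lchains (Suc p) (torus_cover T)" "n \<in> tw_null T A p" "x = lboundary (Suc p) b + n"
  by (rule tw_boundariesE)
 have "lboundary p (lboundary (Suc p) b) = 0" using lboundary_lboundary[OF b(1)] by simp
 moreover have "n \<in> lchains p (torus_cover T)" using b tw_null_lchains by blast
 moreover have "lboundary (Suc p) b \<in> lchains p (torus_cover T)" using lboundary_in_lchains[OF b(1)] by simp
 ultimately show "x \<in> tw_cycles T A p"
  using b lboundary_tw_null[OF b(2)] by (simp add: tw_cycles_def lboundary_add submod_add[OF submod_lchains])
qed

lemma submod_tw_cycles: "submod (tw_cycles T A p)"
 by (rule submodI) (auto simp: tw_cycles_def lboundary_add lboundary_smul submod_0[OF submod_tw_null]
   submod_0[OF submod_lchains] intro: submod_add[OF submod_lchains] submod_smul[OF submod_lchains]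
   submod_add[OF submod_tw_null] submod_smul[OF submod_tw_null])

lemma tw_class_eq_iff: "tw_class T A p x = tw_class T A p y \<longleftrightarrow> x - y \<in> tw_boundaries T A p"
 and mem_tw_class: "y \<in> tw_class T A p x \<longleftrightarrow> y - x \<in> tw_boundaries T A p"
 and tw_class_add: "tw_class T A p x + tw_class T A p y = tw_class T A p (x + y)"
 and tw_class_smul: "smul r ` tw_class T A p x + tw_boundaries T A p = tw_class T A p (smul r x)" unfolding tw_class_def
 by (rule coset_eq_iff mem_coset coset_add coset_smul, rule submod_tw_boundaries)+

lemma tw_class_self: "x \<in> tw_class T A p x" by (simp add: mem_tw_class submod_0[OF submod_tw_boundaries])

lemma tw_class_0: "tw_class T A p 0 = tw_boundaries T A p" by (auto simp: mem_tw_class)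

section \<open>Borel-Moore classes\<close>

lemma off_antimono: "K \<subseteq> K' ==> off T K' \<subseteq> off T K" by (auto simp: off_def)

lemma tw_boundaries_off:
 "K \<subseteq> K' ==> x \<in> tw_boundaries T (off T K') p ==> x \<in> tw_boundaries T (off T K) p"
 using tw_boundaries_mono[OF off_antimono] by blast

lemma bm_homology_iff:
 "h \<in> bm_homology T p \<longleftrightarrow> h \<in> extensional (compacts T) \<and>
   (\<forall>K\<in>compacts T. \<exists>x\<in>tw_cycles T (off T K) p. h K = tw_class T (off T K) p x) \<and>
   (\<forall>K\<in>compacts T. \<forall>K'\<in>compacts T. K \<subseteq> K' \<longrightarrow> h K' \<subseteq> h K)"
 unfolding bm_homology_def tw_homology_def PiE_iff image_iff by blast

text \<open>Compatibility can be tested on one common element: the boundaries for the larger compact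
  set are contained in those for the smaller, and a coset of the former that meets a coset of the
  latter lies inside it.\<close>

lemma bm_homologyI:
 assumes "\<And>K. K \<in> compacts T ==> \<exists>x \<in> tw_cycles T (off T K) p. h K = tw_class T (off T K) p x"
  and "\<And>K K'. K \<in> compacts T ==> K' \<in> compacts T ==> K \<subseteq> K' ==> h K' \<inter> h K \<noteq> {}"
  and ext: "h \<in> extensional (compacts T)" shows "h \<in> bm_homology T p"
proof -
 have "h K' \<subseteq> h K" if K: "K \<in> compacts T" "K' \<in> compacts T" "K \<subseteq> K'" for K K'
 proof -
  obtain x x' where x: "h K = tw_class T (off T K) p x" "h K' = tw_class T (off T K') p x'" using assms(1) K by metis
  obtain y where "y \<in> h K" "y \<in> h K'" using assms(2)[OF K] by blast
  then have "h K = tw_class T (off T K) p y" "h K' = tw_class T (off T K') p y"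
   unfolding x mem_tw_class tw_class_eq_iff by (auto intro: submod_diff_commute[OF submod_tw_boundaries])
  then show ?thesis using tw_boundaries_off[OF K(3)] by (metis mem_tw_class subsetI)
 qed
 then show ?thesis using assms(1) ext unfolding bm_homology_iff by blast
qed

text \<open>Any element may serve as representative: boundaries are cycles, so the whole coset of a
  cycle consists of cycles.\<close>

lemma bm_homology_class: assumes "h \<in> bm_homology T p" "K \<in> compacts T" "x \<in> h K"
 shows "h K = tw_class T (off T K) p x" "x \<in> tw_cycles T (off T K) p"
proof -
 obtain y where y: "y \<in> tw_cycles T (off T K) p" "h K = tw_class T (off T K) p y"
  using assms(1,2) unfolding bm_homology_iff by blast
 then have xy: "x - y \<in> tw_boundaries T (off T K) p" using assms(3) by (simp add: mem_tw_class)
 then show "h K = tw_class T (off T K) p x"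
  unfolding y(2) tw_class_eq_iff by (rule submod_diff_commute[OF submod_tw_boundaries])
 have "y + (x - y) \<in> tw_cycles T (off T K) p"
  using xy y(1) tw_boundaries_cycles by (intro submod_add[OF submod_tw_cycles]) auto
 then show "x \<in> tw_cycles T (off T K) p" by simp
qed

lemma bm_homology_nonempty: assumes "h \<in> bm_homology T p" "K \<in> compacts T" obtains x where "x \<in> h K"
 using assms tw_class_self unfolding bm_homology_iff by metis

lemma bm_homology_antimono:
 assumes "h \<in> bm_homology T p" "K \<in> compacts T" "K' \<in> compacts T" "K \<subseteq> K'"
 shows "h K' \<subseteq> h K" using assms unfolding bm_homology_iff by blast

lemma bm_homology_extensional: "h \<in> bm_homology T p ==> h \<in> extensional (compacts T)"
 by (simp add: bm_homology_iff)

lemma bm_zero_in: "bm_zero T p \<in> bm_homology T p"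
proof (rule bm_homologyI)
 show "\<exists>x \<in> tw_cycles T (off T K) p. bm_zero T p K = tw_class T (off T K) p x" if "K \<in> compacts T" for K
  using that by (intro bexI[of _ 0]) (simp_all add: bm_zero_def tw_class_0 submod_0[OF submod_tw_cycles])
 show "bm_zero T p K' \<inter> bm_zero T p K \<noteq> {}" if "K \<in> compacts T" "K' \<in> compacts T" for K K'
  using that submod_0[OF submod_tw_boundaries] by (fastforce simp: bm_zero_def)
qed (simp add: bm_zero_def)

lemma bm_add_in: assumes h: "h \<in> bm_homology T p" and h': "h' \<in> bm_homology T p"
 shows "bm_add T h h' \<in> bm_homology T p"
proof (rule bm_homologyI)
 fix K assume K: "K \<in> compacts T"
 obtain x y where xy: "x \<in> h K" "y \<in> h' K"
  using bm_homology_nonempty[OF h K] bm_homology_nonempty[OF h' K] by metis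
 then show "\<exists>z \<in> tw_cycles T (off T K) p. bm_add T h h' K = tw_class T (off T K) p z"
  using bm_homology_class[OF h K xy(1)] bm_homology_class[OF h' K xy(2)] K
  by (intro bexI[of _ "x + y"]) (simp_all add: bm_add_def tw_class_add submod_add[OF submod_tw_cycles])
next
 fix K K' assume K: "K \<in> compacts T" "K' \<in> compacts T" "K \<subseteq> K'"
 obtain x y where "x \<in> h K'" "y \<in> h' K'"
  using bm_homology_nonempty[OF h K(2)] bm_homology_nonempty[OF h' K(2)] by metis
 then have "x + y \<in> bm_add T h h' K'" "x + y \<in> bm_add T h h' K"
  using bm_homology_antimono[OF h K] bm_homology_antimono[OF h' K] K by (auto simp: bm_add_def)
 then show "bm_add T h h' K' \<inter> bm_add T h h' K \<noteq> {}" by blast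
qed (simp add: bm_add_def)

lemma bm_smult_eq: assumes h: "h \<in> bm_homology T p" and K: "K \<in> compacts T" and x: "x \<in> h K"
 shows "bm_smult T p r h K = tw_class T (off T K) p (smul r x)"
 using K bm_homology_class(1)[OF assms] by (simp add: bm_smult_def lscale_eq_smul tw_class_smul)

lemma bm_smult_in: assumes h: "h \<in> bm_homology T p" shows "bm_smult T p r h \<in> bm_homology T p"
proof (rule bm_homologyI)
 fix K assume K: "K \<in> compacts T"
 obtain x where x: "x \<in> h K" using bm_homology_nonempty[OF h K] .
 then show "\<exists>z \<in> tw_cycles T (off T K) p. bm_smult T p r h K = tw_class T (off T K) p z"
  using bm_homology_class(2)[OF h K x] bm_smult_eq[OF h K x] submod_smul[OF submod_tw_cycles] by blast
next
 fix K K' assume K: "K \<in> compacts T" "K' \<in> compacts T" "K \<subseteq> K'"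
 obtain x where x: "x \<in> h K'" using bm_homology_nonempty[OF h K(2)] .
 then have "x \<in> h K" using bm_homology_antimono[OF h K] by blast
 then show "bm_smult T p r h K' \<inter> bm_smult T p r h K \<noteq> {}"
  using bm_smult_eq[OF h K(1)] bm_smult_eq[OF h K(2) x] tw_class_self by blast
qed (simp add: bm_smult_def)

section \<open>Products of twisted chains\<close>

abbreviation simplex_top :: "nat => (nat => real) topology" where
 "simplex_top n \<equiv> subtopology (powertop_real UNIV) (standard_simplex n)"

lemma continuous_map_vertex_map: assumes "\<And>k. k \<le> n ==> f k \<le> p"
 shows "continuous_map (simplex_top n) (simplex_top p) (vertex_map n f)"
proof -
 have "continuous_map (simplex_top n) euclideanreal (\<lambda>x. vertex_map n f x j)" for j unfolding vertex_map_def
  by (intro continuous_map_sum continuous_map_from_subtopology continuous_map_product_projection) auto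
 then show ?thesis using vertex_map_in_simplex[OF _ assms]
  by (auto simp: continuous_map_in_subtopology continuous_map_componentwise_UNIV)
qed

lemma paths_nth_le: assumes "L \<in> keys (paths p q)" "k \<le> p + q" shows "fst (L ! k) \<le> p" "snd (L ! k) \<le> q"
proof -
 have "L ! k \<in> set L" using keys_paths[OF assms(1)] assms(2) by (intro nth_mem) simp
 then show "fst (L ! k) \<le> p" "snd (L ! k) \<le> q" using keys_paths[OF assms(1)] by (auto simp: case_prod_unfold)
qed

lemma grid_simplex_apply: assumes "L \<in> keys (paths p q)" "x \<in> standard_simplex (p + q)"
 shows "vertex_map (p + q) (\<lambda>k. fst (L ! k)) x \<in> standard_simplex p"
  "vertex_map (p + q) (\<lambda>k. snd (L ! k)) x \<in> standard_simplex q"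
  "grid_simplex \<mu> \<sigma> \<tau> L x = \<mu> (\<sigma> (vertex_map (p + q) (\<lambda>k. fst (L ! k)) x))
   (\<tau> (vertex_map (p + q) (\<lambda>k. snd (L ! k)) x))"
proof -
 have L: "length L - 1 = p + q" using keys_paths[OF assms(1)] by simp
 show "vertex_map (p + q) (\<lambda>k. fst (L ! k)) x \<in> standard_simplex p"
  "vertex_map (p + q) (\<lambda>k. snd (L ! k)) x \<in> standard_simplex q"
  using vertex_map_in_simplex[OF assms(2)] paths_nth_le[OF assms(1)] by auto
 show "grid_simplex \<mu> \<sigma> \<tau> L x = \<mu> (\<sigma> (vertex_map (p + q) (\<lambda>k. fst (L ! k)) x))
   (\<tau> (vertex_map (p + q) (\<lambda>k. snd (L ! k)) x))"
  using assms(2) by (simp add: grid_simplex_def Let_def L[simplified])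
qed

lemma singular_simplex_grid: assumes cont: "continuous_map (prod_topology E F) Z (\<lambda>(x, y). \<mu> x y)"
  and \<sigma>: "singular_simplex p E \<sigma>" and \<tau>: "singular_simplex q F \<tau>" and L: "L \<in> keys (paths p q)"
 shows "singular_simplex (p + q) Z (grid_simplex \<mu> \<sigma> \<tau> L)"
proof -
 have len: "length L - 1 = p + q" using keys_paths[OF L] by simp
 let ?f = "vertex_map (p + q) (\<lambda>k. fst (L ! k))" and ?g = "vertex_map (p + q) (\<lambda>k. snd (L ! k))"
 have "continuous_map (simplex_top (p + q)) E (\<lambda>x. \<sigma> (?f x))"
  using continuous_map_compose[OF continuous_map_vertex_map[of "p + q" "\<lambda>k. fst (L ! k)" p]] \<sigma> paths_nth_le[OF L]
  by (force simp: singular_simplex_def o_def)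
 moreover have "continuous_map (simplex_top (p + q)) F (\<lambda>x. \<tau> (?g x))"
  using continuous_map_compose[OF continuous_map_vertex_map[of "p + q" "\<lambda>k. snd (L ! k)" q]] \<tau> paths_nth_le[OF L]
  by (force simp: singular_simplex_def o_def)
 ultimately have "continuous_map (simplex_top (p + q)) (prod_topology E F) (\<lambda>x. (\<sigma> (?f x), \<tau> (?g x)))"
  by (simp add: continuous_map_pairedI)
 from continuous_map_compose[OF this cont]
 have "continuous_map (simplex_top (p + q)) Z (\<lambda>x. \<mu> (\<sigma> (?f x)) (\<tau> (?g x)))" by (simp add: o_def)
 then have "continuous_map (simplex_top (p + q)) Z (grid_simplex \<mu> \<sigma> \<tau> L)"
  by (rule continuous_map_eq) (simp add: grid_simplex_def Let_def len[simplified])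
 then show ?thesis by (simp add: singular_simplex_def) (simp add: grid_simplex_def Let_def len[simplified])
qed

lemma cross_in_submod: assumes "submod B"
  and "\<And>\<sigma> \<tau> L. \<sigma> \<in> keys x ==> \<tau> \<in> keys y ==> L \<in> keys (paths p q) ==> single (grid_simplex \<mu> \<sigma> \<tau> L) 1 \<in> B"
 shows "cross \<mu> p q x y \<in> B" unfolding cross_def by (intro lext_in_submod assms)

lemma cross_lchains_subtopology: assumes cont: "continuous_map (prod_topology E F) Z (\<lambda>(x, y). \<mu> x y)"
  and x: "x \<in> lchains p (subtopology E S)" and y: "y \<in> lchains q (subtopology F S')"
  and S: "\<And>a b. a \<in> topspace E ==> a \<in> S ==> b \<in> topspace F ==> b \<in> S' ==> \<mu> a b \<in> S''"
 shows "cross \<mu> p q x y \<in> lchains (p + q) (subtopology Z S'')"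
proof (rule cross_in_submod[OF submod_lchains], rule single_in_lchains)
 fix \<sigma> \<tau> L assume *: "\<sigma> \<in> keys x" "\<tau> \<in> keys y" and L: "L \<in> keys (paths p q)"
 then have \<sigma>: "singular_simplex p E \<sigma>" "\<sigma> ` standard_simplex p \<subseteq> S"
  and \<tau>: "singular_simplex q F \<tau>" "\<tau> ` standard_simplex q \<subseteq> S'"
  using lchains_singular[OF x] lchains_singular[OF y] by (auto simp: singular_simplex_subtopology)
 have top: "\<sigma> a \<in> topspace E" if "a \<in> standard_simplex p" for a
  using \<sigma>(1) that by (auto simp: singular_simplex_def continuous_map_def)
 have top': "\<tau> b \<in> topspace F" if "b \<in> standard_simplex q" for b
  using \<tau>(1) that by (auto simp: singular_simplex_def continuous_map_def)
 have "grid_simplex \<mu> \<sigma> \<tau> L z \<in> S''" if z: "z \<in> standard_simplex (p + q)" for z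
  unfolding grid_simplex_apply(3)[OF L z]
  using S[OF top[OF grid_simplex_apply(1)[OF L z]] _ top'[OF grid_simplex_apply(2)[OF L z]]]
   grid_simplex_apply(1,2)[OF L z] \<sigma>(2) \<tau>(2) by blast
 then show "singular_simplex (p + q) (subtopology Z S'') (grid_simplex \<mu> \<sigma> \<tau> L)"
  using singular_simplex_grid[OF cont \<sigma>(1) \<tau>(1) L] by (auto simp: singular_simplex_subtopology)
qed

lemma cross_lchains:
 assumes "continuous_map (prod_topology E F) Z (\<lambda>(x, y). \<mu> x y)" "x \<in> lchains p E" "y \<in> lchains q F"
 shows "cross \<mu> p q x y \<in> lchains (p + q) Z"
 using cross_lchains_subtopology[OF assms(1), of x p UNIV y q UNIV UNIV] assms(2,3) by simp

lemma lext_fun_diff: "lext (\<lambda>\<sigma>. f \<sigma> - g \<sigma>) c = lext f c - lext g c"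
 by (simp add: lext_def smul_diff sum_subtractf)

lemma lext_fun_smul: "lext (\<lambda>\<sigma>. smul r (f \<sigma>)) c = smul r (lext f c)"
 by (simp add: lext_def smul_sum mult.commute)

lemma grid_simplex_deck: assumes "L \<in> keys (paths p q)"
 shows "(\<And>a b. a \<in> standard_simplex p ==> b \<in> standard_simplex q ==> \<mu> (f (\<sigma> a)) (\<tau> b) = g (\<mu> (\<sigma> a) (\<tau> b))) ==>
   grid_simplex \<mu> (simplex_map p f \<sigma>) \<tau> L = simplex_map (p + q) g (grid_simplex \<mu> \<sigma> \<tau> L)"
  and "(\<And>a b. a \<in> standard_simplex p ==> b \<in> standard_simplex q ==> \<mu> (\<sigma> a) (f' (\<tau> b)) = g (\<mu> (\<sigma> a) (\<tau> b))) ==>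
   grid_simplex \<mu> \<sigma> (simplex_map q f' \<tau>) L = simplex_map (p + q) g (grid_simplex \<mu> \<sigma> \<tau> L)"
proof -
 have len: "length L - 1 = p + q" using keys_paths[OF assms] by simp
 have out: "grid_simplex \<mu> \<sigma> \<tau> L x = undefined" if "x \<notin> standard_simplex (p + q)" for x \<mu> \<sigma> \<tau>
  using that by (simp add: grid_simplex_def Let_def len[simplified])
 show "grid_simplex \<mu> (simplex_map p f \<sigma>) \<tau> L = simplex_map (p + q) g (grid_simplex \<mu> \<sigma> \<tau> L)"
  if *: "\<And>a b. a \<in> standard_simplex p ==> b \<in> standard_simplex q ==> \<mu> (f (\<sigma> a)) (\<tau> b) = g (\<mu> (\<sigma> a) (\<tau> b))"
 proof
  fix x
  show "grid_simplex \<mu> (simplex_map p f \<sigma>) \<tau> L x = simplex_map (p + q) g (grid_simplex \<mu> \<sigma> \<tau> L) x"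
  proof (cases "x \<in> standard_simplex (p + q)")
   case True
   then show ?thesis using True by (simp add: simplex_map_def grid_simplex_apply[OF assms True] *)
  qed (simp add: out simplex_map_def)
 qed
 show "grid_simplex \<mu> \<sigma> (simplex_map q f' \<tau>) L = simplex_map (p + q) g (grid_simplex \<mu> \<sigma> \<tau> L)"
  if *: "\<And>a b. a \<in> standard_simplex p ==> b \<in> standard_simplex q ==> \<mu> (\<sigma> a) (f' (\<tau> b)) = g (\<mu> (\<sigma> a) (\<tau> b))"
 proof
  fix x
  show "grid_simplex \<mu> \<sigma> (simplex_map q f' \<tau>) L x = simplex_map (p + q) g (grid_simplex \<mu> \<sigma> \<tau> L) x"
  proof (cases "x \<in> standard_simplex (p + q)")
   case True
   then show ?thesis using True by (simp add: simplex_map_def grid_simplex_apply[OF assms True] *)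
  qed (simp add: out simplex_map_def)
 qed
qed

lemma singular_simplex_in_topspace:
 "singular_simplex p E \<sigma> ==> a \<in> standard_simplex p ==> \<sigma> a \<in> topspace E"
 by (auto simp: singular_simplex_def continuous_map_def)

text \<open>Equivariance of \<open>\<mu>\<close> turns a deck transformation of the first factor
  into the same one on the product, so a monodromy relation times any simplex is a sum of monodromy
  relations with the same character.\<close>

lemma cross_mono_relations_left:
 assumes cont: "continuous_map (prod_topology (torus_cover T1) F) (torus_cover T) (\<lambda>(x, y). \<mu> x y)"
  and lmono: "lmono T1 = lmono T" and deck: "\<And>a b n. a \<in> topspace (torus_cover T1) ==> b \<in> topspace F ==>
    \<mu> (deck (lcoords T1) n a) b = deck (lcoords T) n (\<mu> a b)"
  and x: "x \<in> mono_relations T1 p" and y: "y \<in> lchains q F"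
 shows "cross \<mu> p q x y \<in> mono_relations T (p + q)"
proof (rule additive_mono_relations[OF submod_mono_relations _ _ x])
 fix n \<sigma> r assume \<sigma>: "singular_simplex p (torus_cover T1) \<sigma>"
 have "cross \<mu> p q (mono_gen T1 p n \<sigma> r) y =
   lext (\<lambda>\<tau>. lext (\<lambda>L. mono_gen T (p + q) n (grid_simplex \<mu> \<sigma> \<tau> L) r) (paths p q)) y"
 proof -
  have *: "grid_simplex \<mu> (simplex_map p (deck (lcoords T1) n) \<sigma>) \<tau> L =
    simplex_map (p + q) (deck (lcoords T) n) (grid_simplex \<mu> \<sigma> \<tau> L)"
   if "\<tau> \<in> keys y" "L \<in> keys (paths p q)" for \<tau> L
   by (rule grid_simplex_deck(1)[OF that(2), where f = "deck (lcoords T1) n"])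
    (use \<sigma> lchains_singular[OF y that(1)] in \<open>auto intro!: deck singular_simplex_in_topspace\<close>)
  have "lext (\<lambda>\<tau>. lext (\<lambda>L. mono_gen T (p + q) n (grid_simplex \<mu> \<sigma> \<tau> L) r) (paths p q)) y =
    lext (\<lambda>\<tau>. lext (\<lambda>L. smul r (single (grid_simplex \<mu> (simplex_map p (deck (lcoords T1) n) \<sigma>) \<tau> L) 1) -
     smul (lmono T n * r) (single (grid_simplex \<mu> \<sigma> \<tau> L) 1)) (paths p q)) y"
   by (intro lext_cong) (simp add: mono_gen_def *)
  also have "\<dots> = cross \<mu> p q (mono_gen T1 p n \<sigma> r) y"
   unfolding lext_fun_diff lext_fun_smul by (simp add: mono_gen_def cross_def lext_diff lmono)
  finally show ?thesis ..
 qed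
 also have "\<dots> \<in> mono_relations T (p + q)"
  by (intro lext_in_submod submod_mono_relations mono_relations_gen singular_simplex_grid[OF cont \<sigma>])
   (auto intro: lchains_singular[OF y])
 finally show "cross \<mu> p q (mono_gen T1 p n \<sigma> r) y \<in> mono_relations T (p + q)" .
qed (rule cross_add)

lemma cross_mono_relations_right:
 assumes cont: "continuous_map (prod_topology F (torus_cover T1)) (torus_cover T) (\<lambda>(x, y). \<mu> x y)"
  and lmono: "lmono T1 = lmono T" and deck: "\<And>a b n. a \<in> topspace F ==> b \<in> topspace (torus_cover T1) ==>
    \<mu> a (deck (lcoords T1) n b) = deck (lcoords T) n (\<mu> a b)"
  and x: "x \<in> lchains p F" and y: "y \<in> mono_relations T1 q"
 shows "cross \<mu> p q x y \<in> mono_relations T (p + q)"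
proof (rule additive_mono_relations[OF submod_mono_relations _ _ y])
 fix n \<tau> r assume \<tau>: "singular_simplex q (torus_cover T1) \<tau>"
 have "cross \<mu> p q x (mono_gen T1 q n \<tau> r) =
   lext (\<lambda>\<sigma>. lext (\<lambda>L. mono_gen T (p + q) n (grid_simplex \<mu> \<sigma> \<tau> L) r) (paths p q)) x"
 proof -
  have *: "grid_simplex \<mu> \<sigma> (simplex_map q (deck (lcoords T1) n) \<tau>) L =
    simplex_map (p + q) (deck (lcoords T) n) (grid_simplex \<mu> \<sigma> \<tau> L)"
   if "\<sigma> \<in> keys x" "L \<in> keys (paths p q)" for \<sigma> L
   by (rule grid_simplex_deck(2)[OF that(2), where f' = "deck (lcoords T1) n"])
    (use \<tau> lchains_singular[OF x that(1)] in \<open>auto intro!: deck singular_simplex_in_topspace\<close>)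
  have "lext (\<lambda>\<sigma>. lext (\<lambda>L. mono_gen T (p + q) n (grid_simplex \<mu> \<sigma> \<tau> L) r) (paths p q)) x =
    lext (\<lambda>\<sigma>. lext (\<lambda>L. smul r (single (grid_simplex \<mu> \<sigma> (simplex_map q (deck (lcoords T1) n) \<tau>) L) 1) -
     smul (lmono T n * r) (single (grid_simplex \<mu> \<sigma> \<tau> L) 1)) (paths p q)) x"
   by (intro lext_cong) (simp add: mono_gen_def *)
  also have "\<dots> = cross \<mu> p q x (mono_gen T1 q n \<tau> r)"
   unfolding lext_fun_diff lext_fun_smul by (simp add: mono_gen_def cross_def lext_diff lext_fun_diff lext_fun_smul lmono)
  finally show ?thesis ..
 qed
 also have "\<dots> \<in> mono_relations T (p + q)"
  by (intro lext_in_submod submod_mono_relations mono_relations_gen singular_simplex_grid[OF cont _ \<tau>])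
   (auto intro: lchains_singular[OF x])
 finally show "cross \<mu> p q x (mono_gen T1 q n \<tau> r) \<in> mono_relations T (p + q)" .
qed (rule cross_add)

section \<open>Homotopies\<close>

definition push :: "nat => ('a => 'b) => 'a lchain => 'b lchain" where
 "push p f = lext (\<lambda>\<sigma>. single (simplex_map p f \<sigma>) 1)"

text \<open>The tautological 1-simplex of the interval, with its start at 0 and its end at
  1.\<close>

definition unit_chain :: "real lchain" where
 "unit_chain = single (\<lambda>x\<in>standard_simplex 1. x 1) 1"

lemma unit_chain_in: "unit_chain \<in> lchains 1 (top_of_set {0..1::real})"
proof -
 have "continuous_map (simplex_top 1) euclideanreal (\<lambda>x. x 1)"
  by (intro continuous_map_from_subtopology continuous_map_product_projection) auto
 then have "continuous_map (simplex_top 1) (top_of_set {0..1::real}) (\<lambda>x. x 1)"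
  by (auto simp: continuous_map_in_subtopology standard_simplex_def)
 then have "continuous_map (simplex_top 1) (top_of_set {0..1::real}) (\<lambda>x\<in>standard_simplex 1. x 1)"
  by (rule continuous_map_eq) simp
 then show ?thesis unfolding unit_chain_def by (intro single_in_lchains) (simp add: singular_simplex_def)
qed

lemma lboundary_unit_chain:
 "lboundary 1 unit_chain = single (\<lambda>x\<in>standard_simplex 0. 1) 1 - single (\<lambda>x\<in>standard_simplex 0. 0) 1"
proof -
 have "singular_face 1 0 (\<lambda>x\<in>standard_simplex 1. x 1) = (\<lambda>x\<in>standard_simplex 0. 1::real)"
  "singular_face 1 1 (\<lambda>x\<in>standard_simplex 1. x 1) = (\<lambda>x\<in>standard_simplex 0. 0::real)"
  using simplical_face_in_standard_simplex[of 1 0] simplical_face_in_standard_simplex[of 1 1]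
  by (auto simp: singular_face_def simplical_face_def standard_simplex_0 fun_eq_iff restrict_def)
 then show ?thesis by (simp add: unit_chain_def lboundary_single single_uminus numeral_2_eq_2)
qed

text \<open>Against a 0-simplex there is just one staircase, with all steps horizontal and sign 1,
  and its vertex map is the identity.\<close>

lemma cross_point: assumes "x \<in> lchains p E"
 shows "cross \<mu> p 0 x (single (\<lambda>x\<in>standard_simplex 0. t) 1) = push p (\<lambda>e. \<mu> e t) x"
proof -
 have "grid_simplex \<mu> \<sigma> (\<lambda>x\<in>standard_simplex 0. t) (path_of p {..<p}) = simplex_map p (\<lambda>e. \<mu> e t) \<sigma>"
  if \<sigma>: "\<sigma> \<in> extensional (standard_simplex p)" for \<sigma>
 proof
  fix z
  have 1: "vertex_map p (\<lambda>k. fst (path_of p {..<p} ! k)) z = z" if "z \<in> standard_simplex p"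
  proof -
   have "vertex_map p (\<lambda>k. fst (path_of p {..<p} ! k)) z = vertex_map p (\<lambda>k. k) z"
    by (rule vertex_map_cong) (simp add: nth_path_of Int_absorb1)
   also have "\<dots> = z"
   proof
    fix j
    have "{k. k \<le> p \<and> k = j} = (if j \<le> p then {j} else {})" by auto
    then show "vertex_map p (\<lambda>k. k) z j = z j" using that by (auto simp: vertex_map_def standard_simplex_def)
   qed
   finally show ?thesis .
  qed
  have "{..<k} - {..<p} = {}" if "k \<le> p" for k using that by auto
  then have 2: "vertex_map p (\<lambda>k. snd (path_of p {..<p} ! k)) z \<in> standard_simplex 0" if "z \<in> standard_simplex p"
   by (intro vertex_map_in_simplex[OF that]) (simp add: nth_path_of)
  show "grid_simplex \<mu> \<sigma> (\<lambda>x\<in>standard_simplex 0. t) (path_of p {..<p}) z = simplex_map p (\<lambda>e. \<mu> e t) \<sigma> z"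
   using 1 2 by (simp add: grid_simplex_def simplex_map_def restrict_def)
 qed
 moreover have "{(m, m'). m \<in> {..<p} \<and> m' \<in> {..<p} - {..<p} \<and> m' < m} = {}" by auto
 then have "paths p 0 = single (path_of p {..<p}) 1"
  unfolding paths_eq_shuffles by (simp add: shuffles_of_0 shuffle_sign_def)
 ultimately show ?thesis unfolding cross_def push_def
  by (intro lext_cong) (use lchains_singular[OF assms] in \<open>simp add: singular_simplex_def\<close>)
qed

text \<open>The prism formula as a special case of the Leibniz rule, the boundary of
  \<open>unit_chain\<close> being its end minus its start.\<close>

theorem homotopy_difference: assumes "x \<in> lchains p E"
 shows "push p (\<lambda>e. \<mu> e 1) x - push p (\<lambda>e. \<mu> e 0) x =
   smul ((- 1) ^ p) (lboundary (Suc p) (cross \<mu> p 1 x unit_chain) - cross \<mu> (p - 1) 1 (lboundary p x) unit_chain)"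
 using lboundary_cross[of p 1 \<mu> x unit_chain] unfolding lboundary_unit_chain cross_diff cross_point[OF assms]
 by (simp add: cross_diff cross_point[OF assms] flip: power_add mult.assoc)

text \<open>In relative homology the sides of the prism, which are the homotopy applied to the
  boundary of \<open>x\<close>, must be null throughout the motion and not only at its ends.\<close>

corollary homotopy_boundaries:
 assumes cont: "continuous_map (prod_topology E (top_of_set {0..1::real})) (torus_cover T) (\<lambda>(x, t). \<mu> x t)"
  and x: "x \<in> lchains p E" and null: "p > 0 ==> cross \<mu> (p - 1) 1 (lboundary p x) unit_chain \<in> tw_null T A p"
 shows "push p (\<lambda>e. \<mu> e 1) x - push p (\<lambda>e. \<mu> e 0) x \<in> tw_boundaries T A p"
proof -
 have "cross \<mu> p 1 x unit_chain \<in> lchains (Suc p) (torus_cover T)"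
  using cross_lchains[OF cont x unit_chain_in] by simp
 moreover have "cross \<mu> (p - 1) 1 (lboundary p x) unit_chain \<in> tw_null T A p"
  using null submod_0[OF submod_tw_null] by (cases "p = 0") auto
 ultimately show ?thesis unfolding homotopy_difference[OF x] using tw_null_boundaries
  by (intro submod_smul submod_diff submod_tw_boundaries lboundary_in_tw_boundaries) auto
qed

text \<open>\<open>homotopy_boundaries\<close> applied to the identity simplex of the standard
  simplex, whose boundary lies on the faces \<open>x k = 0\<close>. So a family of maps on the
  simplex is enough, without a homotopy of the space.\<close>

corollary simplex_homotopy:
 assumes cont: "continuous_map (prod_topology (simplex_top p) (top_of_set {0..1::real})) (torus_cover T) (\<lambda>(x, t). \<mu> x t)"
  and face: "\<And>x t k. x \<in> standard_simplex p ==> k \<le> p ==> x k = 0 ==> 0 \<le> t ==> t \<le> 1 ==> fst (\<mu> x t) \<in> A"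
 shows "single (\<lambda>x\<in>standard_simplex p. \<mu> x 1) r - single (\<lambda>x\<in>standard_simplex p. \<mu> x 0) r \<in> tw_boundaries T A p"
proof -
 let ?\<iota> = "\<lambda>x\<in>standard_simplex p. x" and ?F = "{x. \<exists>k\<le>p. x k = 0} :: (nat => real) set"
 have "continuous_map (simplex_top p) (simplex_top p) ?\<iota>" by (rule continuous_map_eq[OF continuous_map_id]) simp
 then have \<iota>: "singular_simplex p (simplex_top p) ?\<iota>" by (simp add: singular_simplex_def)
 have "push p (\<lambda>e. \<mu> e 1) (single ?\<iota> 1) - push p (\<lambda>e. \<mu> e 0) (single ?\<iota> 1) \<in> tw_boundaries T A p"
 proof (rule homotopy_boundaries[OF cont single_in_lchains[OF \<iota>]])
  assume p: "p > 0"
  have "singular_simplex (p - 1) (subtopology (simplex_top p) ?F) (singular_face p k ?\<iota>)" if "k \<le> p" for k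
  proof -
   have "singular_simplex (p - 1) (simplex_top p) (singular_face p k ?\<iota>)"
    using singular_simplex_singular_face[OF \<iota>] p that by simp
   moreover have "singular_face p k ?\<iota> x k = 0" if "x \<in> standard_simplex (p - 1)" for x
    using that p \<open>k \<le> p\<close> simplical_face_in_standard_simplex[of p k x]
    by (simp add: singular_face_def) (simp add: simplical_face_def)
   ultimately show ?thesis using that by (auto simp: singular_simplex_subtopology)
  qed
  then have "lboundary p (single ?\<iota> 1) \<in> lchains (p - 1) (subtopology (simplex_top p) ?F)"
   unfolding lboundary_single using p by (auto intro!: submod_sum[OF submod_lchains] single_in_lchains)
  then have "cross \<mu> (p - 1) 1 (lboundary p (single ?\<iota> 1)) unit_chain
    \<in> lchains (p - 1 + 1) (subtopology (torus_cover T) (A \<times> UNIV))"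
   using unit_chain_in by (intro cross_lchains_subtopology[OF cont, where S' = UNIV])
    (auto simp: mem_Times_iff intro!: face)
  then show "cross \<mu> (p - 1) 1 (lboundary p (single ?\<iota> 1)) unit_chain \<in> tw_null T A p"
   using p by (intro tw_nullI1) simp
 qed
 moreover have "push p (\<lambda>e. \<mu> e t) (single ?\<iota> 1) = single (\<lambda>x\<in>standard_simplex p. \<mu> x t) 1" for t
  by (simp add: push_def simplex_map_def restrict_def o_def cong: if_cong)
 ultimately have "single (\<lambda>x\<in>standard_simplex p. \<mu> x 1) 1 - single (\<lambda>x\<in>standard_simplex p. \<mu> x 0) 1
   \<in> tw_boundaries T A p" by simp
 from submod_smul[OF submod_tw_boundaries this, of r] show ?thesis by (simp add: smul_diff)
qed

section \<open>Topology of coloured configuration spaces\<close>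

abbreviation (input) OConf :: "'i colouring => ('i \<times> nat => complex) set" where
 "OConf c \<equiv> topspace (ordered_conf c)"

abbreviation (input) Conf :: "'i colouring => 'i conf set" where
 "Conf c \<equiv> topspace (conf_space c)"

definition Ind :: "'i colouring => ('i \<times> nat) set" where
 "Ind c = (SIGMA i:UNIV. {..<c i})"

lemma mem_Ind: "r \<in> Ind c \<longleftrightarrow> snd r < c (fst r)" by (cases r) (simp add: Ind_def)

lemma finite_Ind [simp]: "finite (Ind (c :: 'i::finite colouring))" unfolding Ind_def by (intro finite_SigmaI) auto

text \<open>Points arise indexed by pairs, by disjoint sums and by positions in a word. Labelling by
  an arbitrary set \<open>I\<close> with a colour map \<open>col\<close> treats these cases at
  once.\<close>

definition lab :: "'r set => ('r => 'i) => ('r => complex) => 'i conf" where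
 "lab I col P = (\<lambda>i. P ` {r \<in> I. col r = i})"

definition pts :: "'i conf => complex set" where
 "pts z = (\<Union>i. z i)"

lemma pts_lab [simp]: "pts (lab I col P) = P ` I" by (auto simp: pts_def lab_def)

lemma forget_order_lab: "forget_order c x = lab (Ind c) fst x"
 by (force simp: forget_order_def lab_def fun_eq_iff mem_Ind)

lemma topspace_ordered_conf:
 "x \<in> OConf c \<longleftrightarrow> x \<in> extensional (Ind c) \<and> (\<forall>r\<in>Ind c. x r \<in> disk) \<and> inj_on x (Ind c)"
 unfolding ordered_conf_def Ind_def[symmetric] by (auto simp: PiE_def Pi_def)

lemma topspace_conf_space: "Conf c = forget_order c ` OConf c"
 using quotient_imp_surjective_map[OF quotient_map_conf_space] by blast

lemma continuous_map_forget_order: "continuous_map (ordered_conf c) (conf_space c) (forget_order c)"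
 by (rule quotient_imp_continuous_map[OF quotient_map_conf_space])

lemma continuous_map_ordered_conf:
 "continuous_map Y (ordered_conf c) g \<longleftrightarrow>
   (\<forall>r\<in>Ind c. continuous_map Y euclidean (\<lambda>y. g y r)) \<and> (\<forall>y\<in>topspace Y. g y \<in> OConf c)"
 (is "?L \<longleftrightarrow> ?R")
proof
 assume L: ?L
 then show ?R using continuous_map_image_subset_topspace[OF L]
  unfolding ordered_conf_def Ind_def[symmetric] continuous_map_in_subtopology continuous_map_componentwise by auto
next
 assume R: ?R
 then show ?L unfolding topspace_ordered_conf
  unfolding ordered_conf_def Ind_def[symmetric] continuous_map_in_subtopology continuous_map_componentwise by auto
qed

lemma continuous_map_ordered_coord:
 "r \<in> Ind c ==> continuous_map (ordered_conf c) euclidean (\<lambda>x. x r)"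
 using continuous_map_id[of "ordered_conf c"] unfolding continuous_map_ordered_conf by simp

text \<open>Both orderings are injective, so matching indices of equal colour and position gives
  mutually inverse maps of the index set.\<close>

lemma forget_order_eq_permute: assumes x: "x \<in> OConf c" and u: "u \<in> OConf c"
  and eq: "forget_order c x = forget_order c u"
 obtains \<pi> where "bij_betw \<pi> (Ind c) (Ind c)" "\<forall>r\<in>Ind c. fst (\<pi> r) = fst r" "u = (\<lambda>r\<in>Ind c. x (\<pi> r))"
proof -
 have "\<exists>s. s \<in> Ind c \<and> fst s = fst r \<and> x s = u r" if "r \<in> Ind c" for r
 proof -
  have "u r \<in> forget_order c u (fst r)" using that by (cases r) (auto simp: forget_order_def mem_Ind)
  then show ?thesis unfolding eq[symmetric] by (auto simp: forget_order_def mem_Ind)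
 qed
 then obtain \<pi> where \<pi>: "\<And>r. r \<in> Ind c ==> \<pi> r \<in> Ind c \<and> fst (\<pi> r) = fst r \<and> x (\<pi> r) = u r"
  by metis
 have "\<exists>r. r \<in> Ind c \<and> fst r = fst s \<and> u r = x s" if "s \<in> Ind c" for s
 proof -
  have "x s \<in> forget_order c x (fst s)" using that by (cases s) (auto simp: forget_order_def mem_Ind)
  then show ?thesis unfolding eq by (auto simp: forget_order_def mem_Ind)
 qed
 then obtain \<rho> where \<rho>: "\<And>s. s \<in> Ind c ==> \<rho> s \<in> Ind c \<and> fst (\<rho> s) = fst s \<and> u (\<rho> s) = x s"
  by metis
 have injx: "inj_on x (Ind c)" and inju: "inj_on u (Ind c)" using x u by (simp_all add: topspace_ordered_conf)
 have "\<pi> (\<rho> s) = s" if "s \<in> Ind c" for s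
  using that \<rho>[OF that] \<pi>[of "\<rho> s"] by (intro inj_onD[OF injx]) auto
 moreover have "\<rho> (\<pi> r) = r" if "r \<in> Ind c" for r
  using that \<pi>[OF that] \<rho>[of "\<pi> r"] by (intro inj_onD[OF inju]) auto
 ultimately have "bij_betw \<pi> (Ind c) (Ind c)" using \<pi> \<rho> by (intro bij_betw_byWitness[where f' = \<rho>]) auto
 moreover have "u = (\<lambda>r\<in>Ind c. x (\<pi> r))"
  using u \<pi> by (auto simp: topspace_ordered_conf extensional_def restrict_def fun_eq_iff)
 ultimately show thesis by (intro that[of \<pi>]) (use \<pi> in auto)
qed

lemma forget_order_permute:
 assumes \<pi>: "bij_betw \<pi> (Ind c) (Ind c)" "\<And>r. r \<in> Ind c ==> fst (\<pi> r) = fst r"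
 shows "forget_order c (\<lambda>r\<in>Ind c. x (\<pi> r)) = forget_order c x"
proof
 fix i
 have "\<pi> ` {r \<in> Ind c. fst r = i} = {r \<in> Ind c. fst r = i}"
 proof
  show "\<pi> ` {r \<in> Ind c. fst r = i} \<subseteq> {r \<in> Ind c. fst r = i}"
   using \<pi> bij_betwE[OF \<pi>(1)] by auto
  show "{r \<in> Ind c. fst r = i} \<subseteq> \<pi> ` {r \<in> Ind c. fst r = i}"
  proof
   fix s assume s: "s \<in> {r \<in> Ind c. fst r = i}"
   then have "s \<in> \<pi> ` Ind c" using \<pi>(1) by (simp add: bij_betw_def)
   then obtain r where "r \<in> Ind c" "s = \<pi> r" by blast
   then show "s \<in> \<pi> ` {r \<in> Ind c. fst r = i}" using s \<pi>(2)[of r] by auto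
  qed
 qed
 then have "x ` {r \<in> Ind c. fst r = i} = (\<lambda>r. x (\<pi> r)) ` {r \<in> Ind c. fst r = i}"
  by (metis image_image)
 also have "\<dots> = (\<lambda>r\<in>Ind c. x (\<pi> r)) ` {r \<in> Ind c. fst r = i}" by (rule image_cong) auto
 finally show "forget_order c (\<lambda>r\<in>Ind c. x (\<pi> r)) i = forget_order c x i"
  unfolding forget_order_lab lab_def by simp
qed

lemma permute_in_ordered: assumes "bij_betw \<pi> (Ind c) (Ind c)" "x \<in> OConf c"
 shows "(\<lambda>r\<in>Ind c. x (\<pi> r)) \<in> OConf c"
proof -
 have "inj_on (x \<circ> \<pi>) (Ind c)"
  using assms by (intro comp_inj_on) (auto simp: bij_betw_def topspace_ordered_conf)
 then have "inj_on (\<lambda>r\<in>Ind c. x (\<pi> r)) (Ind c)" by (simp add: inj_on_def)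
 then show ?thesis using assms bij_betwE[OF assms(1)] by (auto simp: topspace_ordered_conf)
qed

text \<open>The saturation of an open set is the union of its preimages under the finitely many
  colour preserving permutations, each of which acts continuously.\<close>

lemma open_map_forget_order: "open_map (ordered_conf c) (conf_space c) (forget_order c)" unfolding open_map_def
proof (intro allI impI)
 fix U assume U: "openin (ordered_conf c) U"
 let ?P = "{\<pi>. bij_betw \<pi> (Ind c) (Ind c) \<and> (\<forall>r\<in>Ind c. fst (\<pi> r) = fst r)}"
 let ?m = "\<lambda>\<pi> x. \<lambda>r\<in>Ind c. x (\<pi> r) :: complex"
 have sub: "U \<subseteq> OConf c" using openin_subset[OF U] .
 have eq: "{x \<in> OConf c. forget_order c x \<in> forget_order c ` U} =
   (\<Union>\<pi>\<in>?P. {x \<in> OConf c. ?m \<pi> x \<in> U})" (is "?A = ?B")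
 proof
  show "?A \<subseteq> ?B"
  proof
   fix x assume "x \<in> ?A"
   then obtain u where u: "u \<in> U" "forget_order c x = forget_order c u" "x \<in> OConf c" by auto
   obtain \<pi> where "bij_betw \<pi> (Ind c) (Ind c)" "\<forall>r\<in>Ind c. fst (\<pi> r) = fst r" "u = ?m \<pi> x"
    by (rule forget_order_eq_permute[OF u(3) subsetD[OF sub u(1)] u(2)])
   then show "x \<in> ?B" by (intro UN_I[of \<pi>]) (use u in auto)
  qed
  show "?B \<subseteq> ?A"
  proof
   fix x assume "x \<in> ?B"
   then obtain \<pi> where \<pi>: "bij_betw \<pi> (Ind c) (Ind c)" "\<And>r. r \<in> Ind c ==> fst (\<pi> r) = fst r"
    and x: "x \<in> OConf c" "?m \<pi> x \<in> U" by auto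
   show "x \<in> ?A" using imageI[OF x(2), of "forget_order c"] x(1) by (simp add: forget_order_permute[OF \<pi>, of x])
  qed
 qed
 have op: "openin (ordered_conf c) ?B"
 proof (rule openin_Union, safe)
  fix \<pi> assume \<pi>: "bij_betw \<pi> (Ind c) (Ind c)" "\<forall>r\<in>Ind c. fst (\<pi> r) = fst r"
  have "continuous_map (ordered_conf c) (ordered_conf c) (?m \<pi>)" unfolding continuous_map_ordered_conf
   using permute_in_ordered[OF \<pi>(1)] bspec[OF bij_betwE[OF \<pi>(1)]] by (simp add: continuous_map_ordered_coord)
  then show "openin (ordered_conf c) {x \<in> OConf c. ?m \<pi> x \<in> U}"
   by (rule openin_continuous_map_preimage[OF _ U])
 qed
 have sub': "forget_order c ` U \<subseteq> Conf c" using sub by (auto simp: topspace_conf_space)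
 have q: "openin (ordered_conf c) {x \<in> OConf c. forget_order c x \<in> V} = openin (conf_space c) V"
  if "V \<subseteq> Conf c" for V using quotient_map_conf_space[of c] that unfolding quotient_map_def by simp
 show "openin (conf_space c) (forget_order c ` U)" using op unfolding eq[symmetric] q[OF sub'] .
qed

lemma open_map_pair: assumes f: "open_map A A' f" and g: "open_map B B' g"
 shows "open_map (prod_topology A B) (prod_topology A' B') (\<lambda>(x, y). (f x, g y))" unfolding open_map_def
proof (intro allI impI)
 fix U assume U: "openin (prod_topology A B) U"
 show "openin (prod_topology A' B') ((\<lambda>(x, y). (f x, g y)) ` U)" unfolding openin_prod_topology_alt
 proof (intro allI impI)
  fix x' y' assume "(x', y') \<in> (\<lambda>(x, y). (f x, g y)) ` U"
  then obtain x y where xy: "(x, y) \<in> U" "x' = f x" "y' = g y" by auto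
  then obtain C D where "openin A C" "openin B D" "x \<in> C" "y \<in> D" "C \<times> D \<subseteq> U"
   using U unfolding openin_prod_topology_alt by metis
  then have "openin A' (f ` C)" "openin B' (g ` D)" "x' \<in> f ` C" "y' \<in> g ` D"
    "f ` C \<times> g ` D \<subseteq> (\<lambda>(x, y). (f x, g y)) ` U" using f g xy by (auto simp: open_map_def)
  then show "\<exists>C D. openin A' C \<and> openin B' D \<and> x' \<in> C \<and> y' \<in> D \<and> C \<times> D \<subseteq> (\<lambda>(x, y). (f x, g y)) ` U"
   by blast
 qed
qed

text \<open>A product of quotient maps can fail to be a quotient map, but a product of continuous
  open surjections is one; this is the use of \<open>open_map_forget_order\<close>.\<close>

lemma quotient_map_pair: assumes "continuous_map A A' f" "open_map A A' f" "f ` topspace A = topspace A'"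
  and "continuous_map B B' g" "open_map B B' g" "g ` topspace B = topspace B'"
 shows "quotient_map (prod_topology A B) (prod_topology A' B') (\<lambda>(x, y). (f x, g y))"
proof (rule continuous_open_imp_quotient_map)
 show "continuous_map (prod_topology A B) (prod_topology A' B') (\<lambda>(x, y). (f x, g y))"
  using assms(1,4) by (auto simp: continuous_map_prod_top)
 show "(\<lambda>(x, y). (f x, g y)) ` topspace (prod_topology A B) = topspace (prod_topology A' B')"
  using assms(3,6) by (auto simp: image_iff) (metis image_iff)+
qed (rule open_map_pair assms)+

lemma continuous_map_conf_prod_conf: assumes "continuous_map (prod_topology (ordered_conf c) (ordered_conf c')) Z
   (\<lambda>(x, y). h (forget_order c x, forget_order c' y))"
 shows "continuous_map (prod_topology (conf_space c) (conf_space c')) Z h"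
proof -
 have "quotient_map (prod_topology (ordered_conf c) (ordered_conf c'))
   (prod_topology (conf_space c) (conf_space c')) (\<lambda>(x, y). (forget_order c x, forget_order c' y))"
  by (intro quotient_map_pair continuous_map_forget_order open_map_forget_order) (simp_all add: topspace_conf_space)
 from continuous_compose_quotient_map[OF this] assms show ?thesis by (simp add: o_def case_prod_unfold)
qed

lemma continuous_map_conf_prod:
 assumes "continuous_map (prod_topology (ordered_conf c) Y) Z (\<lambda>(x, y). h (forget_order c x, y))"
 shows "continuous_map (prod_topology (conf_space c) Y) Z h"
proof -
 have "open_map Y Y (\<lambda>y. y)" by (simp add: open_map_def)
 then have "quotient_map (prod_topology (ordered_conf c) Y)
   (prod_topology (conf_space c) Y) (\<lambda>(x, y). (forget_order c x, y))"
  by (intro quotient_map_pair continuous_map_forget_order open_map_forget_order continuous_map_id[unfolded id_def])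
   (simp_all add: topspace_conf_space)
 from continuous_compose_quotient_map[OF this] assms show ?thesis by (simp add: o_def case_prod_unfold)
qed

lemma continuous_map_conf: assumes "continuous_map (ordered_conf c) Z (\<lambda>x. h (forget_order c x))"
 shows "continuous_map (conf_space c) Z h"
 using continuous_compose_quotient_map[OF quotient_map_conf_space] assms by (simp add: o_def)

subsection \<open>Labelled configurations\<close>

text \<open>One bijection \<open>b\<close> works for all position maps \<open>P\<close>. Therefore a
  family of labelled configurations lifts continuously to ordered ones.\<close>

lemma labelled_ordered: assumes "finite I" "\<And>i. card {r \<in> I. col r = i} = c i"
 obtains b where "bij_betw b (Ind c) I" "\<forall>P. lab I col P = forget_order c (\<lambda>s\<in>Ind c. P (b s))"
proof -
 have "\<exists>f. bij_betw f {..<c i} {r \<in> I. col r = i}" for i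
  using ex_bij_betw_nat_finite[of "{r \<in> I. col r = i}"] assms by (simp add: atLeast0LessThan)
 then obtain f where f: "\<And>i. bij_betw (f i) {..<c i} {r \<in> I. col r = i}" by metis
 define b where "b = (\<lambda>(i, k). f i k)"
 have inI: "f i k \<in> I \<and> col (f i k) = i" if "k < c i" for i k using bij_betwE[OF f[of i]] that by auto
 have "inj_on b (Ind c)"
 proof (rule inj_onI)
  fix r s assume rs: "r \<in> Ind c" "s \<in> Ind c" and eq: "b r = b s"
  have col: "col (b t) = fst t" if "t \<in> Ind c" for t using inI that by (simp add: b_def mem_Ind split_beta)
  have fst: "fst r = fst s" using col[OF rs(1)] col[OF rs(2)] eq by simp
  have "snd r = snd s" using rs eq f[of "fst r"] by (intro inj_onD[of "f (fst r)" "{..<c (fst r)}"])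
    (simp_all add: fst b_def mem_Ind split_beta bij_betw_def)
  with fst show "r = s" by (rule prod_eqI)
 qed
 moreover have im: "f i ` {..<c i} = {r \<in> I. col r = i}" for i using f by (simp add: bij_betw_def)
 moreover have "b ` Ind c = I"
 proof
  show "b ` Ind c \<subseteq> I" using inI by (auto simp: b_def mem_Ind)
  show "I \<subseteq> b ` Ind c"
  proof
   fix r assume "r \<in> I"
   then obtain k where "k < c (col r)" "r = f (col r) k" using equalityD2[OF im[of "col r"]] by blast
   then show "r \<in> b ` Ind c" by (intro image_eqI[of _ _ "(col r, k)"]) (simp_all add: b_def mem_Ind)
  qed
 qed
 ultimately have "bij_betw b (Ind c) I" by (simp add: bij_betw_def)
 moreover have "lab I col P = forget_order c (\<lambda>s\<in>Ind c. P (b s))" for P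
 proof
  fix i
  have "lab I col P i = P ` f i ` {..<c i}" by (simp add: lab_def im)
  also have "\<dots> = forget_order c (\<lambda>s\<in>Ind c. P (b s)) i"
   by (auto simp: forget_order_def b_def image_image mem_Ind intro!: image_cong)
  finally show "lab I col P i = forget_order c (\<lambda>s\<in>Ind c. P (b s)) i" .
 qed
 ultimately show thesis using that by blast
qed

lemma continuous_map_lab: assumes I: "finite I" "\<And>i. card {r \<in> I. col r = i} = c i"
  and cont: "\<And>r. r \<in> I ==> continuous_map Y euclidean (P r)"
  and disk: "\<And>r y. r \<in> I ==> y \<in> topspace Y ==> P r y \<in> disk"
  and inj: "\<And>y. y \<in> topspace Y ==> inj_on (\<lambda>r. P r y) I"
 shows "continuous_map Y (conf_space c) (\<lambda>y. lab I col (\<lambda>r. P r y))"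
proof -
 obtain b where b: "bij_betw b (Ind c) I" "\<forall>P. lab I col P = forget_order c (\<lambda>s\<in>Ind c. P (b s))"
  by (rule labelled_ordered[OF I])
 have "inj_on (\<lambda>s. P (b s) y) (Ind c)" if "y \<in> topspace Y" for y
  using comp_inj_on[of b "Ind c" "\<lambda>r. P r y"] b(1) inj[OF that] by (simp add: bij_betw_def o_def)
 then have "continuous_map Y (ordered_conf c) (\<lambda>y. \<lambda>s\<in>Ind c. P (b s) y)"
  unfolding continuous_map_ordered_conf topspace_ordered_conf
  using bij_betwE[OF b(1)] cont disk by (auto simp: inj_on_def)
 from continuous_map_compose[OF this continuous_map_forget_order] show ?thesis by (simp add: b(2)[rule_format] o_def)
qed

lemma lab_in_conf: assumes I: "finite I" "\<And>i. card {r \<in> I. col r = i} = c i"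
  and "P ` I \<subseteq> disk" "inj_on P I" shows "lab I col P \<in> Conf c"
proof -
 obtain b where b: "bij_betw b (Ind c) I" "\<forall>P. lab I col P = forget_order c (\<lambda>s\<in>Ind c. P (b s))"
  by (rule labelled_ordered[OF I])
 have "inj_on (\<lambda>s. P (b s)) (Ind c)"
  using comp_inj_on[of b "Ind c" P] b(1) assms(4) by (simp add: bij_betw_def o_def)
 then have "(\<lambda>s\<in>Ind c. P (b s)) \<in> OConf c"
  unfolding topspace_ordered_conf using bij_betwE[OF b(1)] assms(3) by (auto simp: inj_on_def)
 then show ?thesis by (auto simp: topspace_conf_space b(2)[rule_format])
qed

lemma conf_lab: assumes "z \<in> Conf c"
 obtains x where "z = lab (Ind c) fst x" "x \<in> OConf c" "inj_on x (Ind c)" "x ` Ind c \<subseteq> disk"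
proof -
 from assms obtain x where "x \<in> OConf c" "z = forget_order c x" unfolding topspace_conf_space by blast
 then show thesis by (intro that[of x]) (auto simp: topspace_ordered_conf forget_order_lab)
qed

lemma card_Ind_fst: "card {r \<in> Ind c. fst r = i} = c i"
proof -
 have "{r \<in> Ind c. fst r = i} = Pair i ` {..<c i}" by (auto simp: mem_Ind)
 then show ?thesis by (simp add: card_image inj_on_def)
qed

lemma lab_in_conf_Ind:
 "x ` Ind c \<subseteq> disk ==> inj_on x (Ind c) ==> lab (Ind c) fst x \<in> Conf (c :: 'i::finite colouring)"
 by (rule lab_in_conf) (simp_all add: card_Ind_fst)

lemma pts_conf: assumes "z \<in> Conf (c :: 'i::finite colouring)" shows "finite (pts z)" "pts z \<subseteq> disk"
 using assms by (auto elim!: conf_lab)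

subsection \<open>Separation and compactness\<close>

lemma continuous_map_complex_mult:
 fixes f g :: "'a => complex" assumes "continuous_map Y euclidean f" "continuous_map Y euclidean g"
 shows "continuous_map Y euclidean (\<lambda>x. f x * g x)" using assms by (simp add: continuous_map_atin tendsto_mult)

lemma continuous_map_complex_prod:
 fixes f :: "'k => 'a => complex" assumes "\<And>k. k \<in> I ==> continuous_map Y euclidean (f k)"
 shows "continuous_map Y euclidean (\<lambda>x. \<Prod>k\<in>I. f k x)"
 using assms by (induction I rule: infinite_finite_induct) (auto intro: continuous_map_complex_mult)

text \<open>Configurations that differ in colour \<open>i\<close> are separated by the value at a
  point \<open>u\<close> of the monic polynomial whose roots are the points of this colour. The
  value is symmetric in the roots, so it is continuous on the quotient.\<close>

lemma Hausdorff_conf_space: "Hausdorff_space (conf_space (c :: 'i::finite colouring))" unfolding Hausdorff_space_def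
proof (intro allI impI)
 fix z w assume zw: "z \<in> Conf c \<and> w \<in> Conf c \<and> z \<noteq> w"
 have fin: "finite (z' i)" if "z' \<in> Conf c" for z' i
  using pts_conf(1)[OF that] by (rule finite_subset[rotated]) (auto simp: pts_def)
 obtain i where "z i \<noteq> w i" using zw by blast
 then obtain u where u: "(u \<in> z i) \<noteq> (u \<in> w i)" by auto
 let ?f = "\<lambda>z'. \<Prod>p\<in>z' i. u - p"
 have "continuous_map (ordered_conf c) euclidean (\<lambda>x. \<Prod>k<c i. u - x (i, k))"
  by (intro continuous_map_complex_prod continuous_map_diff continuous_map_ordered_coord) (auto simp: mem_Ind)
 then have "continuous_map (ordered_conf c) euclidean (\<lambda>x. ?f (forget_order c x))"
 proof (rule continuous_map_eq)
  fix x assume "x \<in> OConf c"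
  then have "inj_on (\<lambda>k. x (i, k)) {..<c i}"
   by (intro inj_onI) (auto simp: topspace_ordered_conf mem_Ind dest: inj_onD)
  then show "(\<Prod>k<c i. u - x (i, k)) = ?f (forget_order c x)"
   unfolding forget_order_def by (subst prod.reindex) simp_all
 qed
 then have cont: "continuous_map (conf_space c) euclidean ?f" by (rule continuous_map_conf)
 have "?f z' = 0 \<longleftrightarrow> u \<in> z' i" if "z' \<in> Conf c" for z' using fin[OF that, of i] by auto
 then have "?f z \<noteq> ?f w" using u zw by metis
 then obtain U V where UV: "open U" "open V" "?f z \<in> U" "?f w \<in> V" "U \<inter> V = {}"
  using separation_t2[of "?f z" "?f w"] by auto
 let ?p = "\<lambda>U. {z' \<in> Conf c. ?f z' \<in> U}"
 have "openin (conf_space c) (?p U)" "openin (conf_space c) (?p V)"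
  using UV by (auto intro!: openin_continuous_map_preimage[OF cont])
 moreover have "z \<in> ?p U" "w \<in> ?p V" "disjnt (?p U) (?p V)" using UV zw by (auto simp: disjnt_def)
 ultimately show "\<exists>U V. openin (conf_space c) U \<and> openin (conf_space c) V \<and> z \<in> U \<and> w \<in> V \<and> disjnt U V"
  by blast
qed

lemma compact_disk: "compact disk"
proof -
 have "disk = cbox (- 1 - \<i>) (1 + \<i>)" by (auto simp: disk_def in_cbox_complex_iff abs_le_iff)
 then show ?thesis by (metis compact_cbox)
qed

abbreviation disk_power :: "'i colouring => ('i \<times> nat => complex) topology" where
 "disk_power c \<equiv> product_topology (\<lambda>_. top_of_set disk) (Ind c)"

text \<open>Closed conditions on the compact power of the disk: if they exclude collisions, the set
  that they define lies in the ordered configuration space, and its image is compact.\<close>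

lemma compactin_conf: assumes cont: "\<And>a. a \<in> A ==> continuous_map (disk_power c) euclideanreal (f a)"
  and inj: "\<And>x. x \<in> topspace (disk_power c) ==> (\<forall>a\<in>A. 0 \<le> f a x) ==> inj_on x (Ind c)"
 shows "compactin (conf_space c) (forget_order c ` {x \<in> topspace (disk_power c). \<forall>a\<in>A. 0 \<le> f a x})"
  (is "compactin _ (_ ` ?S)")
proof -
 have "compact_space (disk_power c)"
  using compact_disk by (simp add: compact_space_product_topology compact_space_subtopology compactin_euclidean_iff)
 moreover have "closedin (disk_power c) ?S"
 proof -
  have "closedin (disk_power c) {x \<in> topspace (disk_power c). f a x \<in> {0..}}" if "a \<in> A" for a
   by (rule closedin_continuous_map_preimage[OF cont[OF that]]) (simp flip: closed_closedin)
  moreover have "?S = topspace (disk_power c) \<inter> (\<Inter>a\<in>A. {x \<in> topspace (disk_power c). f a x \<in> {0..}})"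
   by auto
  ultimately show ?thesis
   using closedin_topspace[of "disk_power c"] by (cases "A = {}") (auto intro!: closedin_Int closedin_Inter)
 qed
 ultimately have "compactin (disk_power c) ?S" by (simp add: closedin_compact_space)
 then have "compactin (ordered_conf c) ?S"
  unfolding ordered_conf_def Ind_def[symmetric] compactin_subtopology using inj by auto
 then show ?thesis by (rule image_compactin[OF _ continuous_map_forget_order])
qed

text \<open>For positive bounds these sets are compact, and every compact set lies in one of them;
  they replace general compact sets in all estimates.\<close>

definition far :: "'i colouring => real => 'i conf set" where
 "far c \<eta> = {z \<in> Conf c. \<forall>p\<in>pts z. \<forall>q\<in>pts z. p \<noteq> q \<longrightarrow> \<eta> \<le> dist p q}"

text \<open>For a positive bound the real parts stay away from the sides and from each other, so the
  left to right order of the colours is locally constant on this set.\<close>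

definition spread :: "'i colouring => real => 'i conf set" where
 "spread c \<eta> = {z \<in> Conf c. (\<forall>p\<in>pts z. \<bar>Re p\<bar> \<le> 1 - \<eta>) \<and>
   (\<forall>p\<in>pts z. \<forall>q\<in>pts z. p \<noteq> q \<longrightarrow> \<eta> \<le> \<bar>Re p - Re q\<bar>)}"

lemma pairs_image: assumes "inj_on x I"
 shows "(\<forall>p\<in>x ` I. \<forall>q\<in>x ` I. p \<noteq> q \<longrightarrow> R p q) \<longleftrightarrow> (\<forall>r\<in>I. \<forall>s\<in>I. r \<noteq> s \<longrightarrow> R (x r) (x s))"
 using assms by (auto simp: inj_on_def)

lemma far_antimono: "\<eta> \<le> \<eta>' ==> far c \<eta>' \<subseteq> far c \<eta>" by (force simp: far_def)

lemma spread_far: "spread c \<eta> \<subseteq> far c \<eta>"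
proof -
 have le: "\<eta> \<le> dist p q" if "\<eta> \<le> \<bar>Re p - Re q\<bar>" for p q
  using abs_Re_le_cmod[of "p - q"] that by (simp add: dist_norm)
 then show ?thesis unfolding spread_def far_def by (intro Collect_mono) blast
qed

lemma continuous_map_disk_power: "r \<in> Ind c ==> continuous_map (disk_power c) euclidean (\<lambda>x. x r)"
 using continuous_map_product_projection[of r "Ind c" "\<lambda>_. top_of_set disk"]
 by (simp add: continuous_map_in_subtopology)

lemma continuous_map_Re: "continuous_map Y euclidean f ==> continuous_map Y euclideanreal (\<lambda>y. Re (f y))"
 and continuous_map_Im: "continuous_map Y euclidean f ==> continuous_map Y euclideanreal (\<lambda>y. Im (f y))"
 by (simp_all add: continuous_map_atin tendsto_Re tendsto_Im)

lemma conf_set_eq_image: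
 assumes B: "\<And>x. x \<in> topspace (disk_power c) ==> B x \<longleftrightarrow> inj_on x (Ind c) \<and> A (forget_order c x)"
 shows "{z \<in> Conf c. A z} = forget_order c ` {x \<in> topspace (disk_power c). B x}"
proof -
 have "OConf c = {x \<in> topspace (disk_power c). inj_on x (Ind c)}"
  unfolding ordered_conf_def Ind_def[symmetric] by auto
 then show ?thesis using B by (auto simp: topspace_conf_space)
qed

text \<open>As \<open>h\<close> is negative on the diagonal, two indices with the same point would
  violate the closed inequality. The diagonal pairs of indices carry the condition \<open>g\<close>
  instead.\<close>

lemma compactin_pairwise:
 fixes g :: "complex => real" and c :: "'i::finite colouring"
 assumes neg: "\<And>p. h p p < 0" and g: "continuous_map euclidean euclideanreal g"
  and h: "continuous_map (prod_topology euclidean euclidean) euclideanreal (\<lambda>(p, q). h p q)"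
 shows "compactin (conf_space c) {z \<in> Conf c.
  (\<forall>p\<in>pts z. 0 \<le> g p) \<and> (\<forall>p\<in>pts z. \<forall>q\<in>pts z. p \<noteq> q \<longrightarrow> 0 \<le> h p q)}"
proof -
 let ?f = "\<lambda>a x. if fst a = snd a then g (x (fst a)) else h (x (fst a)) (x (snd a))"
 let ?B = "\<lambda>x. \<forall>a\<in>Ind c \<times> Ind c. 0 \<le> ?f a x"
 have inj: "inj_on x (Ind c)" if x: "?B x" for x
 proof (rule inj_onI, rule ccontr)
  fix r s assume rs: "r \<in> Ind c" "s \<in> Ind c" "x r = x s" "r \<noteq> s"
  then have "0 \<le> h (x s) (x s)" using bspec[OF x, of "(r, s)"] by simp
  then show False using neg[of "x s"] by simp
 qed
 have *: "?B x \<longleftrightarrow> inj_on x (Ind c) \<and> (\<forall>p\<in>pts (forget_order c x). 0 \<le> g p) \<and>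
   (\<forall>p\<in>pts (forget_order c x). \<forall>q\<in>pts (forget_order c x). p \<noteq> q \<longrightarrow> 0 \<le> h p q)" for x
 proof (cases "inj_on x (Ind c)")
  case True
  have "?B x \<longleftrightarrow> (\<forall>r\<in>Ind c. 0 \<le> g (x r)) \<and> (\<forall>r\<in>Ind c. \<forall>s\<in>Ind c. r \<noteq> s \<longrightarrow> 0 \<le> h (x r) (x s))"
   (is "_ \<longleftrightarrow> ?R")
  proof
   assume B: "?B x"
   have "0 \<le> g (x r)" if "r \<in> Ind c" for r using bspec[OF B, of "(r, r)"] that by simp
   moreover have "0 \<le> h (x r) (x s)" if "r \<in> Ind c" "s \<in> Ind c" "r \<noteq> s" for r s
    using bspec[OF B, of "(r, s)"] that by simp
   ultimately show ?R by (intro conjI ballI impI)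
  next
   assume ?R
   then show "?B x" by (intro ballI) (simp add: mem_Times_iff)
  qed
  then show ?thesis unfolding forget_order_lab pts_lab pairs_image[OF True]
   unfolding ball_simps using True by (simp only: simp_thms)
 qed (use inj in blast)
 have "compactin (conf_space c) (forget_order c ` {x \<in> topspace (disk_power c). ?B x})"
 proof (rule compactin_conf)
  fix a assume "a \<in> Ind c \<times> Ind c"
  then have a: "continuous_map (disk_power c) euclidean (\<lambda>x. x (fst a))" "continuous_map (disk_power c) euclidean (\<lambda>x. x (snd a))"
   by (auto intro: continuous_map_disk_power)
  then show "continuous_map (disk_power c) euclideanreal (?f a)"
   using continuous_map_compose[OF a(1) g] continuous_map_compose[OF continuous_map_pairedI[OF a] h]
   by (cases "fst a = snd a") (simp_all add: o_def)
 qed (rule inj)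
 then show ?thesis unfolding conf_set_eq_image[of c ?B, OF *] .
qed

lemma compactin_far: "0 < \<eta> ==> compactin (conf_space (c :: 'i::finite colouring)) (far c \<eta>)"
 using compactin_pairwise[of "\<lambda>p q. dist p q - \<eta>" "\<lambda>_. 0" c]
 by (simp add: far_def case_prod_beta continuous_intros)

lemma compactin_spread: "0 < \<eta> ==> compactin (conf_space (c :: 'i::finite colouring)) (spread c \<eta>)"
 using compactin_pairwise[of "\<lambda>p q. \<bar>Re p - Re q\<bar> - \<eta>" "\<lambda>p. 1 - \<eta> - \<bar>Re p\<bar>" c]
 by (simp add: spread_def case_prod_beta continuous_intros le_diff_eq add.commute)

lemma continuous_map_Max:
 fixes f :: "'k => 'a => real" assumes "finite I" "\<And>i. i \<in> I ==> continuous_map Y euclideanreal (f i)"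
 shows "continuous_map Y euclideanreal (\<lambda>y. Max (insert \<delta> ((\<lambda>i. f i y) ` I)))" using assms
proof (induction I)
 case (insert i I)
 have "Max (insert \<delta> ((\<lambda>i. f i y) ` insert i I)) = max (f i y) (Max (insert \<delta> ((\<lambda>i. f i y) ` I)))" for y
  using insert(1) by (simp add: insert_commute[of \<delta>])
 then show ?case using insert by (simp add: continuous_map_real_max)
qed simp

text \<open>Serves for the minimal distance in \<open>compact_subset_far\<close> and for
  \<open>crowd\<close>. The set of pairs of points does not depend on the labels, so the maximum is
  a function of the unordered configuration.\<close>

lemma continuous_map_Max_pairs:
 fixes c :: "'i::finite colouring" assumes x: "\<And>r. r \<in> Ind c ==> continuous_map Y euclidean (x r)"
  and inj: "\<And>y. y \<in> topspace Y ==> inj_on (\<lambda>r. x r y) (Ind c)"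
  and g: "continuous_map euclidean euclideanreal g"
  and h: "continuous_map (prod_topology euclidean euclidean) euclideanreal (\<lambda>(p, q). h p q)"
 shows "continuous_map Y euclideanreal (\<lambda>y. Max (insert \<delta>
  ((\<lambda>(p, q). if p = q then g p else h p q) ` ((\<lambda>r. x r y) ` Ind c \<times> (\<lambda>r. x r y) ` Ind c))))"
proof -
 let ?f = "\<lambda>k y. if fst k = snd k then g (x (fst k) y) else h (x (fst k) y) (x (snd k) y)"
 have "continuous_map Y euclideanreal (\<lambda>y. Max (insert \<delta> ((\<lambda>k. ?f k y) ` (Ind c \<times> Ind c))))"
 proof (rule continuous_map_Max)
  fix k assume "k \<in> Ind c \<times> Ind c"
  then have k: "continuous_map Y euclidean (x (fst k))" "continuous_map Y euclidean (x (snd k))" using x by auto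
  then show "continuous_map Y euclideanreal (?f k)"
   using continuous_map_compose[OF k(1) g] continuous_map_compose[OF continuous_map_pairedI[OF k] h]
   by (cases "fst k = snd k") (simp_all add: o_def)
 qed simp
 then show ?thesis
 proof (rule continuous_map_eq)
  fix y assume y: "y \<in> topspace Y"
  have "(\<lambda>k. ?f k y) ` (Ind c \<times> Ind c) = (\<lambda>k. (\<lambda>(p, q). if p = q then g p else h p q) (x (fst k) y, x (snd k) y)) ` (Ind c \<times> Ind c)"
   using inj_on_eq_iff[OF inj[OF y]] by (intro image_cong) auto
  also have "\<dots> = (\<lambda>(p, q). if p = q then g p else h p q) ` ((\<lambda>r. x r y) ` Ind c \<times> (\<lambda>r. x r y) ` Ind c)"
   by force
  finally show "Max (insert \<delta> ((\<lambda>k. ?f k y) ` (Ind c \<times> Ind c))) = Max (insert \<delta>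
   ((\<lambda>(p, q). if p = q then g p else h p q) ` ((\<lambda>r. x r y) ` Ind c \<times> (\<lambda>r. x r y) ` Ind c)))" by simp
 qed
qed

lemma compact_subset_far:
 fixes c :: "'i::finite colouring" assumes K: "compactin (conf_space c) K"
 obtains \<eta> where "0 < \<eta>" "K \<subseteq> far c \<eta>"
proof (cases "K = {}")
 case True
 then show thesis using that[of 1] by simp
next
 case False
 let ?D = "\<lambda>z. (\<lambda>(p, q). if p = q then - 1 else - dist p q) ` (pts z \<times> pts z)"
 \<comment> \<open>Minus the minimal distance, cut off at -1 so that the maximum exists also for
   fewer than two points. It is continuous and negative, and its largest value on \<open>K\<close>
   gives the bound.\<close>
 define G where "G = (\<lambda>z :: 'i conf. Max (insert (- 1) (?D z)))"
 have "continuous_map (conf_space c) euclideanreal G" unfolding G_def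
 proof (rule continuous_map_conf, unfold forget_order_lab pts_lab, rule continuous_map_Max_pairs)
  show "continuous_map (prod_topology euclidean euclidean) euclideanreal (\<lambda>(p, q). - dist p q :: real)"
   by (simp add: case_prod_beta continuous_intros)
 qed (auto simp: continuous_map_ordered_coord topspace_ordered_conf)
 from image_compactin[OF K this] have "compact (G ` K)" by simp
 from compact_attains_sup[OF this] False obtain z where z: "z \<in> K" "\<forall>y\<in>K. G y \<le> G z"
  by (auto simp: image_iff)
 have top: "y \<in> Conf c" if "y \<in> K" for y using that K compactin_subset_topspace by blast
 have fin: "finite (insert (- 1) (?D y))" if "y \<in> K" for y using pts_conf(1)[OF top[OF that]] by simp
 have "G z < 0" unfolding G_def using fin[OF z(1)] by (auto simp: Max_less_iff)
 moreover have "y \<in> far c (- G z)" if y: "y \<in> K" for y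
 proof -
  have "- G z \<le> dist p q" if "p \<in> pts y" "q \<in> pts y" "p \<noteq> q" for p q
  proof -
   have "- dist p q \<in> ?D y" using that by force
   then have "- dist p q \<le> G y" unfolding G_def using fin[OF y] by (intro Max_ge) auto
   then show ?thesis using bspec[OF z(2) y] by linarith
  qed
  then show ?thesis using top[OF y] by (simp add: far_def)
 qed
 ultimately show thesis by (intro that[of "- G z"]) auto
qed

section \<open>The local system\<close>

text \<open>A choice of one order for each pair of labels. Sums and products of symmetric
  expressions do not depend on it, so the lexicographic choice in \<open>point_pairs\<close> can be
  exchanged for one suited to the labels; \<open>lab_angle\<close> does depend on it.\<close>

definition tournament :: "'r set => ('r \<times> 'r) set => bool" where
 "tournament I Q \<longleftrightarrow> Q \<subseteq> I \<times> I \<and> (\<forall>r\<in>I. \<forall>s\<in>I. r \<noteq> s \<longrightarrow> ((r, s) \<in> Q) \<noteq> ((s, r) \<in> Q)) \<and> (\<forall>r. (r, r) \<notin> Q)"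

lemma tournament_sub: "tournament I Q ==> J \<subseteq> I ==> tournament J (Q \<inter> J \<times> J)"
 unfolding tournament_def by blast

lemma tournament_point_pairs: "tournament A (point_pairs A)"
proof -
 have "(Re z < Re w \<or> Re z = Re w \<and> Im z < Im w) \<noteq> (Re w < Re z \<or> Re w = Re z \<and> Im w < Im z)"
  if "z \<noteq> w" for z w using that by (auto simp: complex_eq_iff)
 then show ?thesis unfolding tournament_def point_pairs_def by blast
qed

lemma tournament_in: "tournament I Q ==> (r, s) \<in> Q ==> r \<in> I \<and> s \<in> I \<and> r \<noteq> s \<and> (s, r) \<notin> Q"
 unfolding tournament_def by (metis mem_Sigma_iff subsetD)

lemma tournament_cases: "tournament I Q ==> r \<in> I ==> s \<in> I ==> r \<noteq> s ==> (r, s) \<notin> Q ==> (s, r) \<in> Q"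
 unfolding tournament_def by blast

text \<open>Both assignments of the colours occur, because the tournament orders two points without
  regard to the order of their colours.\<close>

definition colour_pairs :: "('r => 'i) => ('r \<times> 'r) set => 'i => 'i => ('r \<times> 'r) set" where
 "colour_pairs col Q i j = {(r, s) \<in> Q. col r = i \<and> col s = j \<or> col r = j \<and> col s = i}"

lemma (in comm_monoid_set) tournament_eq: assumes Q: "tournament I Q" and Q': "tournament I Q'"
  and sym: "\<And>r s. r \<in> I ==> s \<in> I ==> g r s = g s r"
 shows "F (\<lambda>(r, s). g r s) Q = F (\<lambda>(r, s). g r s) Q'"
proof -
 have 1: "(b, a) \<in> Q'" if "(a, b) \<in> Q" "(a, b) \<notin> Q'" for a b
  using tournament_in[OF Q that(1)] tournament_cases[OF Q', of a b] that(2) by blast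
 have 2: "(b, a) \<in> Q" if "(a, b) \<in> Q'" "(a, b) \<notin> Q" for a b
  using tournament_in[OF Q' that(1)] tournament_cases[OF Q, of a b] that(2) by blast
 have 3: "g b a = g a b" if "(a, b) \<in> Q" for a b using tournament_in[OF Q that] sym by blast
 show ?thesis by (rule reindex_bij_witness[where j = "\<lambda>(r, s). if (r, s) \<in> Q' then (r, s) else (s, r)"
    and i = "\<lambda>(r, s). if (r, s) \<in> Q then (r, s) else (s, r)"])
   (auto split: if_splits simp: 1 2 3 dest: tournament_in[OF Q] tournament_in[OF Q'])
qed

text \<open>For \<open>i = j\<close> this is a change of tournament. For \<open>i \<noteq> j\<close>
  each pair of points has exactly one order in \<open>Q\<close>, and symmetry of \<open>g\<close>
  allows it to be reversed.\<close>

lemma (in comm_monoid_set) pairs_lab: assumes inj: "inj_on P I" and Q: "tournament I Q"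
  and sym: "\<And>p q. p \<in> P ` I ==> q \<in> P ` I ==> g p q = g q p"
 shows "F (\<lambda>(p, q). g p q) (if i = j then point_pairs (lab I col P i) else lab I col P i \<times> lab I col P j) =
   F (\<lambda>(r, s). g (P r) (P s)) (colour_pairs col Q i j)"
proof -
 define Ii where "Ii = (\<lambda>i. {r \<in> I. col r = i})"
 have sub: "Ii i \<subseteq> I" and injI: "inj_on P (Ii i)" for i using inj by (auto simp: Ii_def inj_on_def)
 have symI: "g (P b) (P a) = g (P a) (P b)" if "a \<in> I" "b \<in> I" for a b using that by (intro sym) auto
 have lab: "lab I col P i = P ` Ii i" for i by (simp add: lab_def Ii_def)
 show ?thesis
 proof (cases "i = j")
  case True
  define Q' where "Q' = {(r, s). r \<in> Ii i \<and> s \<in> Ii i \<and> (P r, P s) \<in> point_pairs (P ` Ii i)}"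
  have "point_pairs (P ` Ii i) = map_prod P P ` Q'"
   unfolding Q'_def point_pairs_def by (auto simp: image_iff map_prod_def)
  moreover have "inj_on (map_prod P P) Q'" using injI[of i] by (auto simp: inj_on_def Q'_def)
  ultimately have "F (\<lambda>(p, q). g p q) (point_pairs (P ` Ii i)) = F (\<lambda>(r, s). g (P r) (P s)) Q'"
   by (simp add: reindex o_def split_beta)
  also have "\<dots> = F (\<lambda>(r, s). g (P r) (P s)) (Q \<inter> Ii i \<times> Ii i)"
  proof (rule tournament_eq[of "Ii i"])
   show "tournament (Ii i) Q'"
   proof -
    have "P r \<noteq> P s" if "r \<in> Ii i" "s \<in> Ii i" "r \<noteq> s" for r s
     using injI[of i] that by (auto dest: inj_onD)
    with tournament_point_pairs[of "P ` Ii i"] show ?thesis unfolding tournament_def Q'_def by blast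
   qed
   show "tournament (Ii i) (Q \<inter> Ii i \<times> Ii i)" using tournament_sub[OF Q sub] .
   show "g (P r) (P s) = g (P s) (P r)" if "r \<in> Ii i" "s \<in> Ii i" for r s using that sub[of i] by (intro sym) auto
  qed
  also have "Q \<inter> Ii i \<times> Ii i = colour_pairs col Q i j"
   using True tournament_in[OF Q] by (auto simp: colour_pairs_def Ii_def)
  finally show ?thesis using True by (simp add: lab)
 next
  case False
  have "P ` Ii i \<times> P ` Ii j = map_prod P P ` (Ii i \<times> Ii j)" by auto
  moreover have "inj_on (map_prod P P) (Ii i \<times> Ii j)" using injI[of i] injI[of j] by (auto simp: inj_on_def)
  ultimately have "F (\<lambda>(p, q). g p q) (P ` Ii i \<times> P ` Ii j) = F (\<lambda>(r, s). g (P r) (P s)) (Ii i \<times> Ii j)"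
   by (simp add: reindex o_def split_beta)
  also have "\<dots> = F (\<lambda>(r, s). g (P r) (P s)) (colour_pairs col Q i j)"
   by (rule reindex_bij_witness[where i = "\<lambda>(r, s). if col r = i then (r, s) else (s, r)"
      and j = "\<lambda>(r, s). if (r, s) \<in> Q then (r, s) else (s, r)"])
     (use False in \<open>auto split: if_splits simp: colour_pairs_def Ii_def dest: tournament_in[OF Q]
      intro: symI tournament_cases[OF Q]\<close>)
  finally show ?thesis using False by (simp add: lab)
 qed
qed

text \<open>A branch of the doubled angle of the direction after the quarter turn. It is 0 if
  \<open>q\<close> lies vertically below \<open>p\<close>, and it lies in [0, 2 pi] if
  \<open>p\<close> is not to the right of \<open>q\<close>.\<close>

definition ang :: "complex => complex => real" where
 "ang p q = 2 * Arg (\<i> * (q - p))"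

lemma cis_double_Arg: "u \<noteq> 0 ==> cis (2 * Arg u) = (u / of_real (cmod u)) ^ 2"
 using Complex.DeMoivre[of "Arg u" 2] by (simp add: cis_Arg sgn_eq)

lemma dir2_ang: "p \<noteq> q ==> dir2 (\<i> * p) (\<i> * q) = cis (ang p q)"
proof -
 have "\<i> * q - \<i> * p = \<i> * (q - p)" by (simp add: algebra_simps)
 then show "p \<noteq> q ==> dir2 (\<i> * p) (\<i> * q) = cis (ang p q)"
  unfolding dir2_def ang_def by (subst cis_double_Arg) simp_all
qed

lemma dir2_rescale: assumes "p \<noteq> q" "p' \<noteq> q'"
 shows "dir2 (\<i> * p') (\<i> * q') = dir2 (\<i> * p) (\<i> * q) * cis (2 * Arg ((q' - p') / (q - p)))"
proof -
 have "cis (2 * Arg (u * v)) = cis (2 * Arg u) * cis (2 * Arg v)" if "u \<noteq> 0" "v \<noteq> 0" for u v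
  using that by (simp add: cis_double_Arg norm_mult power_mult_distrib power_divide)
 from this[of "\<i> * (q - p)" "(q' - p') / (q - p)"]
 have "cis (2 * Arg (\<i> * (q' - p'))) = cis (2 * Arg (\<i> * (q - p))) * cis (2 * Arg ((q' - p') / (q - p)))"
  using assms by simp
 then show ?thesis unfolding dir2_ang[OF assms(1)] dir2_ang[OF assms(2)] ang_def .
qed

lemma cis_sum: "finite A ==> cis (sum f A) = (\<Prod>x\<in>A. cis (f x))"
 by (induction A rule: finite_induct) (simp_all flip: cis_mult)

lemma finite_colour_pairs: "finite I ==> tournament I Q ==> finite (colour_pairs col Q i j)"
 by (rule finite_subset[of _ "I \<times> I"]) (auto simp: colour_pairs_def tournament_def)

lemma colour_pairs_in: "tournament I Q ==> (r, s) \<in> colour_pairs col Q i j ==> r \<in> I \<and> s \<in> I \<and> r \<noteq> s"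
 using tournament_in by (fastforce simp: colour_pairs_def)

lemma colour_pairs_neq: assumes "tournament I Q" "(r, s) \<in> colour_pairs col Q i j" "inj_on P I"
 shows "P r \<noteq> P s" using colour_pairs_in[OF assms(1,2)] inj_onD[OF assms(3)] by blast

lemma W_lab: assumes "inj_on P I" "tournament I Q" "(i, j) \<in> coords"
 shows "W_map (lab I col P) (i, j) = (\<Prod>(r, s)\<in>colour_pairs col Q i j. dir2 (\<i> * P r) (\<i> * P s))"
proof -
 have rot: "(\<lambda>i. (*) \<i> ` lab I col P i) = lab I col (\<lambda>r. \<i> * P r)"
  by (auto simp: lab_def image_image)
 have "inj_on (\<lambda>r. \<i> * P r) I" using assms(1) by (simp add: inj_on_def)
 from prod.pairs_lab[OF this assms(2), of dir2 i j col] show ?thesis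
  using assms(3) by (auto simp: W_map_def Phi_map_def rot f_map_def g_map_def dir2_commute)
qed

definition lab_angle :: "'r set => ('r \<times> 'r) set => ('r => 'i) => ('r => complex) => 'i \<times> 'i => real" where
 "lab_angle I Q col P = (\<lambda>(i, j). \<Sum>(r, s)\<in>colour_pairs col Q i j. ang (P r) (P s))"

lemma W_lab_angle: assumes "finite I" "inj_on P I" "tournament I Q" "k \<in> coords"
 shows "W_map (lab I col P) k = cis (lab_angle I Q col P k)"
proof (cases k)
 case (Pair i j)
 have "W_map (lab I col P) (i, j) = (\<Prod>(r, s)\<in>colour_pairs col Q i j. cis (ang (P r) (P s)))"
  unfolding W_lab[OF assms(2,3) assms(4)[unfolded Pair]] by (intro prod.cong refl)
   (simp add: case_prod_unfold dir2_ang colour_pairs_neq[OF assms(3) _ assms(2), of _ _ col i j])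
 also have "\<dots> = cis (lab_angle I Q col P (i, j))"
  using finite_colour_pairs[OF assms(1,3), of col i j] by (simp add: lab_angle_def cis_sum case_prod_unfold)
 finally show ?thesis using Pair by simp
qed

lemma rescale_angle_lab: assumes "inj_on P I" "tournament I Q" shows "rescale_angle s (lab I col P) (i, j) =
   (\<Sum>(r, r')\<in>colour_pairs col Q i j. 2 * Arg ((s (P r') - s (P r)) / (P r' - P r)))"
proof -
 have "(s q - s p) / (q - p) = (s p - s q) / (p - q)" for p q by (metis minus_diff_eq minus_divide_divide)
 then show ?thesis unfolding rescale_angle_def split by (subst sum.pairs_lab[OF assms]) auto
qed

text \<open>Directions multiply, so the motion changes each factor by the square of the normalised
  quotient of the difference vectors. If these quotients avoid the cut of \<open>Arg\<close>, the
  angles on the right form the continuous lift of the motion.\<close>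

lemma W_move: assumes "finite I" "inj_on P I" "inj_on (\<lambda>r. s (P r)) I" "tournament I Q" "k \<in> coords"
 shows "W_map (lab I col (\<lambda>r. s (P r))) k = W_map (lab I col P) k * cis (rescale_angle s (lab I col P) k)"
proof (cases k)
 case (Pair i j)
 have "W_map (lab I col (\<lambda>r. s (P r))) (i, j) =
   (\<Prod>(r, r')\<in>colour_pairs col Q i j. dir2 (\<i> * P r) (\<i> * P r') * cis (2 * Arg ((s (P r') - s (P r)) / (P r' - P r))))"
  unfolding W_lab[OF assms(3,4) assms(5)[unfolded Pair]]
  by (intro prod.cong refl, simp only: case_prod_unfold, rule dir2_rescale)
   (simp_all add: colour_pairs_neq[OF assms(4) _ assms(2), of _ _ col i j]
    colour_pairs_neq[OF assms(4) _ assms(3), of _ _ col i j])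
 also have "\<dots> = W_map (lab I col P) (i, j) * cis (rescale_angle s (lab I col P) (i, j))"
  unfolding W_lab[OF assms(2,4) assms(5)[unfolded Pair]] rescale_angle_lab[OF assms(2,4)]
  using finite_colour_pairs[OF assms(1,4), of col i j] by (simp add: cis_sum prod.distrib case_prod_unfold)
 finally show ?thesis using Pair by simp
qed

lemma inj_upper: "inj upper" and inj_lower: "inj lower" by (auto simp: inj_def upper_def lower_def complex_eq_iff)

lemma upper_neq_lower: assumes "p \<in> disk" "q \<in> disk" shows "upper p \<noteq> lower q"
 using assms by (auto simp: disk_def upper_def lower_def abs_le_iff)

lemma upper_in_disk: "p \<in> disk ==> upper p \<in> disk" and lower_in_disk: "p \<in> disk ==> lower p \<in> disk"
 by (auto simp: disk_def upper_def lower_def abs_le_iff)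

text \<open>In a mixed pair the point of the upper disk comes first, in accordance with
  \<open>cross_angle\<close>.\<close>

definition stack_pairs :: "'r set => ('r \<times> 'r) set => 's set => ('s \<times> 's) set => (('r + 's) \<times> ('r + 's)) set" where
 "stack_pairs I Q I' Q' = map_prod Inl Inl ` Q \<union> map_prod Inr Inr ` Q' \<union> Inl ` I \<times> Inr ` I'"

lemma stack_pairs_simps [simp]:
 "(Inl a, Inl b) \<in> stack_pairs I Q I' Q' \<longleftrightarrow> (a, b) \<in> Q"
 "(Inr c, Inr d) \<in> stack_pairs I Q I' Q' \<longleftrightarrow> (c, d) \<in> Q'"
 "(Inl a, Inr d) \<in> stack_pairs I Q I' Q' \<longleftrightarrow> a \<in> I \<and> d \<in> I'"
 "(Inr c, Inl b) \<notin> stack_pairs I Q I' Q'" unfolding stack_pairs_def map_prod_def image_iff by auto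

lemma tournament_stack: assumes Q: "tournament I Q" and Q': "tournament I' Q'"
 shows "tournament (I <+> I') (stack_pairs I Q I' Q')"
proof -
 have "stack_pairs I Q I' Q' \<subseteq> (I <+> I') \<times> (I <+> I')"
  using Q Q' unfolding tournament_def stack_pairs_def by auto
 moreover have "((r, s) \<in> stack_pairs I Q I' Q') \<noteq> ((s, r) \<in> stack_pairs I Q I' Q')"
  if "r \<in> I <+> I'" "s \<in> I <+> I'" "r \<noteq> s" for r s
 proof -
  consider a b where "r = Inl a" "s = Inl b" "a \<in> I" "b \<in> I" | a b where "r = Inr a" "s = Inr b" "a \<in> I'" "b \<in> I'"
   | a b where "r = Inl a" "s = Inr b" "a \<in> I" "b \<in> I'" | a b where "r = Inr a" "s = Inl b" "a \<in> I'" "b \<in> I"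
   using \<open>r \<in> I <+> I'\<close> \<open>s \<in> I <+> I'\<close> by blast
  then show ?thesis
  proof cases
   case 1
   with \<open>r \<noteq> s\<close> show ?thesis using Q unfolding 1(1,2) stack_pairs_simps tournament_def by blast
  next
   case 2
   with \<open>r \<noteq> s\<close> show ?thesis using Q' unfolding 2(1,2) stack_pairs_simps tournament_def by blast
  qed simp_all
 qed
 moreover have "(r, r) \<notin> stack_pairs I Q I' Q'" for r
  using tournament_in[OF Q] tournament_in[OF Q'] by (cases r) auto
 ultimately show ?thesis unfolding tournament_def by blast
qed

lemma stack_lab:
 "stack (lab I col P) (lab I' col' P') =
   lab (I <+> I') (case_sum col col') (case_sum (\<lambda>r. upper (P r)) (\<lambda>s. lower (P' s)))"
proof
 fix i
 have "{t \<in> I <+> I'. case_sum col col' t = i} = Inl ` {r \<in> I. col r = i} \<union> Inr ` {s \<in> I'. col' s = i}"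
  by auto
 then show "stack (lab I col P) (lab I' col' P') i =
   lab (I <+> I') (case_sum col col') (case_sum (\<lambda>r. upper (P r)) (\<lambda>s. lower (P' s))) i"
  by (simp add: stack_def lab_def image_Un image_image)
qed

lemma cross_angle_lab: assumes "finite I" "finite I'" "inj_on P I" "inj_on P' I'"
 shows "cross_angle (lab I col P) (lab I' col' P') (i, j) =
   (\<Sum>(r, s)\<in>{(r, s) \<in> I \<times> I'. col r = i \<and> col' s = j \<or> col r = j \<and> col' s = i}. ang (upper (P r)) (lower (P' s)))"
proof -
 let ?S = "\<lambda>i j. {r \<in> I. col r = i} \<times> {s \<in> I'. col' s = j}"
 have A: "(\<Sum>(p, p')\<in>lab I col P i \<times> lab I' col' P' j. 2 * Arg (\<i> * (lower p' - upper p))) =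
   (\<Sum>(r, s)\<in>?S i j. ang (upper (P r)) (lower (P' s)))" for i j
 proof -
  have "lab I col P i \<times> lab I' col' P' j = map_prod P P' ` ?S i j" by (auto simp: lab_def)
  moreover have "inj_on (map_prod P P') (?S i j)" using assms by (auto simp: inj_on_def)
  ultimately show ?thesis by (simp add: sum.reindex o_def split_beta ang_def)
 qed
 have fin: "finite (?S i j)" for i j using assms by auto
 have "{(r, s) \<in> I \<times> I'. col r = i \<and> col' s = j \<or> col r = j \<and> col' s = i} = ?S i j \<union> ?S j i"
  by auto
 then show ?thesis unfolding cross_angle_def split Let_def A
  by (cases "i = j", simp) (simp, subst sum.union_disjoint[OF fin fin], auto)
qed

lemma mem_map_prod_image: "(u, v) \<in> map_prod f g ` A \<longleftrightarrow> (\<exists>a b. (a, b) \<in> A \<and> u = f a \<and> v = g b)"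
 by (auto intro: map_prod_imageI)

lemma inj_on_stack: assumes inj: "inj_on P I" "inj_on P' I'" and disk: "P ` I \<subseteq> disk" "P' ` I' \<subseteq> disk"
 shows "inj_on (case_sum (\<lambda>r. upper (P r)) (\<lambda>s. lower (P' s))) (I <+> I')" (is "inj_on ?P _")
proof (rule inj_onI)
 have ul: "upper (P a) \<noteq> lower (P' b)" if "a \<in> I" "b \<in> I'" for a b
  using that disk by (intro upper_neq_lower) auto
  fix r s assume rs: "r \<in> I <+> I'" "s \<in> I <+> I'" "?P r = ?P s"
  from rs(1,2) consider a b where "r = Inl a" "s = Inl b" "a \<in> I" "b \<in> I"
   | a b where "r = Inr a" "s = Inr b" "a \<in> I'" "b \<in> I'"
   | a b where "r = Inl a" "s = Inr b" "a \<in> I" "b \<in> I'" | a b where "r = Inr a" "s = Inl b" "a \<in> I'" "b \<in> I"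
   by blast
  then show "r = s"
  proof cases
   case 1
   then have "P a = P b" using rs(3) injD[OF inj_upper] by simp
   then show ?thesis using 1 inj_onD[OF inj(1)] by simp
  next
   case 2
   then have "P' a = P' b" using rs(3) injD[OF inj_lower] by simp
   then show ?thesis using 2 inj_onD[OF inj(2)] by simp
  next
   case 3
   then show ?thesis using rs(3) ul[of a b] by simp
  next
   case 4
   then show ?thesis using rs(3) ul[of b a] by simp
  qed
qed

text \<open>The pairs of points split into those within the upper disk, those within the lower disk
  and the mixed ones. They are responsible for the three kinds of correction angles in
  \<open>stack_cover\<close>.\<close>

lemma W_stack:
 fixes I :: "'r set" and I' :: "'s set"
 assumes fin: "finite I" "finite I'" and inj: "inj_on P I" "inj_on P' I'" and disk: "P ` I \<subseteq> disk" "P' ` I' \<subseteq> disk"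
  and Q: "tournament I Q" "tournament I' Q'" and k: "k \<in> coords"
 shows "W_map (stack (lab I col P) (lab I' col' P')) k =
   W_map (lab I col P) k * W_map (lab I' col' P') k * cis (rescale_angle upper (lab I col P) k +
    rescale_angle lower (lab I' col' P') k + cross_angle (lab I col P) (lab I' col' P') k)"
proof (cases k)
 case (Pair i j)
 let ?col = "case_sum col col'" and ?P = "case_sum (\<lambda>r. upper (P r)) (\<lambda>s. lower (P' s))"
 let ?Q = "stack_pairs I Q I' Q'" and ?g = "\<lambda>(r, s). dir2 (\<i> * ?P r) (\<i> * ?P s)"
 let ?M = "{(r, s) \<in> I \<times> I'. col r = i \<and> col' s = j \<or> col r = j \<and> col' s = i}"
 have ul: "upper (P a) \<noteq> lower (P' b)" if "a \<in> I" "b \<in> I'" for a b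
  using that disk by (intro upper_neq_lower) auto
 have injP: "inj_on ?P (I <+> I')" by (rule inj_on_stack[OF inj disk])
 have ij: "(i, j) \<in> coords" using k Pair by simp
 have split: "colour_pairs ?col ?Q i j = map_prod Inl Inl ` colour_pairs col Q i j \<union>
   map_prod Inr Inr ` colour_pairs col' Q' i j \<union> map_prod Inl Inr ` ?M" (is "?L = ?R")
 proof (rule Set.set_eqI)
  fix x :: "('r + 's) \<times> ('r + 's)"
  obtain r s where x: "x = (r, s)" by (cases x)
  show "x \<in> ?L \<longleftrightarrow> x \<in> ?R" unfolding x Un_iff mem_map_prod_image
   by (cases r; cases s) (simp_all add: colour_pairs_def)
 qed
 have finM: "finite ?M" by (rule finite_subset[of _ "I \<times> I'"]) (use fin in auto)
 have inj': "inj_on (map_prod Inl Inl) A" "inj_on (map_prod Inr Inr) B" "inj_on (map_prod Inl Inr) C"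
  for A B C by (auto simp: inj_on_def)
 have iu: "inj_on (\<lambda>r. upper (P r)) I" and il: "inj_on (\<lambda>r. lower (P' r)) I'"
  using comp_inj_on[OF inj(1) inj_on_subset[OF inj_upper subset_UNIV]]
   comp_inj_on[OF inj(2) inj_on_subset[OF inj_lower subset_UNIV]] by (simp_all add: o_def)
 have "W_map (stack (lab I col P) (lab I' col' P')) (i, j) = prod ?g (colour_pairs ?col ?Q i j)"
  unfolding stack_lab by (rule W_lab[OF injP tournament_stack[OF Q] ij])
 also have "\<dots> = prod ?g (map_prod Inl Inl ` colour_pairs col Q i j) *
   prod ?g (map_prod Inr Inr ` colour_pairs col' Q' i j) * prod ?g (map_prod Inl Inr ` ?M)"
 proof -
  let ?A = "map_prod Inl Inl ` colour_pairs col Q i j :: (('r + 's) \<times> ('r + 's)) set"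
  let ?B = "map_prod Inr Inr ` colour_pairs col' Q' i j :: (('r + 's) \<times> ('r + 's)) set"
  have fA: "finite ?A" and fB: "finite ?B"
   using finite_colour_pairs[OF fin(1) Q(1), of col i j] finite_colour_pairs[OF fin(2) Q(2), of col' i j] by simp_all
  have fM: "finite (map_prod Inl Inr ` ?M :: (('r + 's) \<times> ('r + 's)) set)" using finM by simp
  have dAB: "?A \<inter> ?B = {}" and dM: "(?A \<union> ?B) \<inter> map_prod Inl Inr ` ?M = {}" by auto
  show ?thesis unfolding split prod.union_disjoint[OF finite_UnI[OF fA fB] fM dM] prod.union_disjoint[OF fA fB dAB] ..
 qed
 also have "prod ?g (map_prod Inl Inl ` colour_pairs col Q i j) = W_map (lab I col (\<lambda>r. upper (P r))) (i, j)"
  by (simp add: prod.reindex[OF inj'(1)] o_def split_beta W_lab[OF iu Q(1) ij])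
 also have "prod ?g (map_prod Inr Inr ` colour_pairs col' Q' i j) = W_map (lab I' col' (\<lambda>r. lower (P' r))) (i, j)"
  by (simp add: prod.reindex[OF inj'(2)] o_def split_beta W_lab[OF il Q(2) ij])
 also have "prod ?g (map_prod Inl Inr ` ?M) = cis (cross_angle (lab I col P) (lab I' col' P') (i, j))"
 proof -
  have "prod ?g (map_prod Inl Inr ` ?M) = (\<Prod>(r, s)\<in>?M. dir2 (\<i> * upper (P r)) (\<i> * lower (P' s)))"
   by (simp add: prod.reindex[OF inj'(3)] o_def split_beta)
  also have "\<dots> = (\<Prod>(r, s)\<in>?M. cis (ang (upper (P r)) (lower (P' s))))"
   by (intro prod.cong refl) (auto simp: dir2_ang ul)
  finally show ?thesis unfolding cross_angle_lab[OF fin inj] using finM by (simp add: cis_sum case_prod_unfold)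
 qed
 finally show ?thesis unfolding Pair W_move[OF fin(1) inj(1) iu Q(1) ij] W_move[OF fin(2) inj(2) il Q(2) ij]
  by (simp add: mult_ac flip: cis_mult)
qed

definition ind_pairs :: "'i::linorder colouring => (('i \<times> nat) \<times> ('i \<times> nat)) set" where
 "ind_pairs c = {(r, s). r \<in> Ind c \<and> s \<in> Ind c \<and> (fst r < fst s \<or> fst r = fst s \<and> snd r < snd s)}"

lemma tournament_ind_pairs: "tournament (Ind c) (ind_pairs c)"
 unfolding tournament_def ind_pairs_def by (auto simp: prod_eq_iff)

subsection \<open>Continuity of angles\<close>

lemma continuous_map_Arg: assumes "continuous_map Y euclidean f" "\<And>y. y \<in> topspace Y ==> 0 < Re (f y)"
 shows "continuous_map Y euclideanreal (\<lambda>y. Arg (f y))"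
proof -
 have "continuous_map (top_of_set {z. 0 < Re z}) euclideanreal Arg"
  by (simp, rule continuous_on_subset[OF continuous_on_Arg]) (auto simp: complex_nonpos_Reals_iff)
 moreover have "continuous_map Y (top_of_set {z. 0 < Re z}) f" using assms by (auto simp: continuous_map_in_subtopology)
 ultimately show ?thesis using continuous_map_compose[of Y _ f _ Arg] by (simp add: o_def)
qed

text \<open>In the closed upper half plane without 0 the cut of \<open>Arg\<close> is approached
  from one side only; \<open>Arg\<close> agrees there with \<open>Arg2pi\<close>, which is
  continuous on this set.\<close>

lemma continuous_map_Arg_upper:
 assumes "continuous_map Y euclidean f" "\<And>y. y \<in> topspace Y ==> 0 \<le> Im (f y) \<and> f y \<noteq> 0"
 shows "continuous_map Y euclideanreal (\<lambda>y. Arg (f y))"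
proof -
 have "Arg z = Arg2pi z" if "0 \<le> Im z" "z \<noteq> 0" for z using that Arg2pi_le_pi[of z] Arg2pi[of z]
  by (intro Arg_unique[of "cmod z"]) (auto simp: is_Arg_def intro: order.strict_trans2[of _ 0])
 then have "continuous_on ({z. 0 \<le> Im z} - {0}) Arg"
  using continuous_on_upperhalf_Arg2pi by (rule_tac continuous_on_cong[THEN iffD1, rotated 2]) auto
 then have "continuous_map (top_of_set ({z. 0 \<le> Im z} - {0})) euclideanreal Arg" by simp
 moreover have "continuous_map Y (top_of_set ({z. 0 \<le> Im z} - {0})) f"
  using assms by (auto simp: continuous_map_in_subtopology)
 ultimately show ?thesis using continuous_map_compose[of Y _ f _ Arg] by (simp add: o_def)
qed

lemma continuous_map_complex_divide:
 fixes f g :: "'a => complex"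
 assumes "continuous_map Y euclidean f" "continuous_map Y euclidean g" "\<And>y. y \<in> topspace Y ==> g y \<noteq> 0"
 shows "continuous_map Y euclidean (\<lambda>x. f x / g x)"
 using assms by (auto simp: continuous_map_atin intro!: tendsto_divide)

text \<open>The positivity hypothesis says that difference vectors turn by less than a right angle,
  which keeps each \<open>Arg\<close> off its cut.\<close>

lemma continuous_map_rescale_angle:
 fixes x :: "'i::{finite,linorder} \<times> nat => 'a => complex"
 assumes x: "\<And>r. r \<in> Ind c ==> continuous_map Y euclidean (x r)"
  and s: "\<And>r. r \<in> Ind c ==> continuous_map Y euclidean (\<lambda>y. s y (x r y))"
  and inj: "\<And>y. y \<in> topspace Y ==> inj_on (\<lambda>r. x r y) (Ind c)"
  and pos: "\<And>y r r'. y \<in> topspace Y ==> r \<in> Ind c ==> r' \<in> Ind c ==> r \<noteq> r' ==>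
    0 < Re ((s y (x r' y) - s y (x r y)) / (x r' y - x r y))"
 shows "continuous_map Y euclideanreal (\<lambda>y. rescale_angle (s y) (lab (Ind c) fst (\<lambda>r. x r y)) (i, j))"
proof -
 have 1: "continuous_map Y euclideanreal (\<lambda>y. \<Sum>q\<in>colour_pairs fst (ind_pairs c) i j.
   2 * Arg ((s y (x (snd q) y) - s y (x (fst q) y)) / (x (snd q) y - x (fst q) y)))"
 proof (intro continuous_map_sum continuous_map_real_mult_left continuous_map_Arg continuous_map_complex_divide
   continuous_map_diff x s)
  fix q assume "q \<in> colour_pairs fst (ind_pairs c) i j"
  then have q: "fst q \<in> Ind c" "snd q \<in> Ind c" "fst q \<noteq> snd q"
   using colour_pairs_in[OF tournament_ind_pairs[of c], of "fst q" "snd q" fst i j] by auto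
  then show "fst q \<in> Ind c" "snd q \<in> Ind c" "fst q \<in> Ind c" "snd q \<in> Ind c" by auto
  show "0 < Re ((s y (x (snd q) y) - s y (x (fst q) y)) / (x (snd q) y - x (fst q) y))" if "y \<in> topspace Y" for y
   by (rule pos[OF that q])
  show "x (snd q) y - x (fst q) y \<noteq> 0" if "y \<in> topspace Y" for y
   using inj_onD[OF inj[OF that], of "snd q" "fst q"] q by auto
 qed (rule finite_colour_pairs[OF finite_Ind tournament_ind_pairs])
 show ?thesis
  by (rule continuous_map_eq[OF 1]) (simp add: rescale_angle_lab[OF inj tournament_ind_pairs] case_prod_unfold)
qed

section \<open>Stacking\<close>

abbreviation cov :: "('i::{finite,linorder} => 'i => int) => ('i => nat) => 'i colouring => 'i conf_cover topology" where
 "cov a d c \<equiv> torus_cover (conf_twisted a d c)"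

lemma continuous_map_prod_fst: "continuous_map Y Z f ==> continuous_map (prod_topology Y Y') Z (\<lambda>y. f (fst y))"
 and continuous_map_prod_snd: "continuous_map Y' Z g ==> continuous_map (prod_topology Y Y') Z (\<lambda>y. g (snd y))"
 using continuous_map_compose[OF continuous_map_fst] continuous_map_compose[OF continuous_map_snd] by (auto simp: o_def)

lemma conf_twisted_simps [simp]:
 "lspace (conf_twisted a d c) = conf_space c" "lsub (conf_twisted a d c) = side_conf c"
 "lcoords (conf_twisted a d c) = coords" "lmap (conf_twisted a d c) = W_map"
 "lmono (conf_twisted a d c) = conf_mono a d" by (simp_all add: conf_twisted_def)

lemma topspace_cov: "e \<in> topspace (cov a d c) \<longleftrightarrow>
  fst e \<in> Conf c \<and> snd e \<in> extensional coords \<and> (\<forall>k\<in>coords. W_map (fst e) k = cis (snd e k))"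
 by (cases e) (simp add: topspace_torus_cover)

lemma continuous_map_cov_fst: "continuous_map (cov a d c) (conf_space c) fst"
 and continuous_map_cov_snd: "k \<in> coords ==> continuous_map (cov a d c) euclideanreal (\<lambda>e. snd e k)"
 using continuous_map_id[of "cov a d c"] unfolding continuous_map_torus_cover id_def by auto

lemma continuous_map_Complex: assumes "continuous_map Y euclideanreal f" "continuous_map Y euclideanreal g"
 shows "continuous_map Y euclidean (\<lambda>y. Complex (f y) (g y))"
 using assms by (simp add: continuous_map_atin tendsto_Complex)

lemma continuous_map_upper: "continuous_map Y euclidean f ==> continuous_map Y euclidean (\<lambda>y. upper (f y))"
 and continuous_map_lower: "continuous_map Y euclidean f ==> continuous_map Y euclidean (\<lambda>y. lower (f y))"
 unfolding upper_def lower_def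
 by (intro continuous_map_Complex continuous_map_Re continuous_map_real_divide continuous_map_add continuous_map_diff
   continuous_map_Im; simp)+

lemma Re_divide_pos: "0 < Re u * Re v + Im u * Im v ==> 0 < Re (u / v)"
proof -
 assume *: "0 < Re u * Re v + Im u * Im v"
 then have "v \<noteq> 0" by auto
 then have "0 < (Re v)\<^sup>2 + (Im v)\<^sup>2" by (simp add: complex_eq_iff sum_power2_gt_zero_iff)
 with * show ?thesis by (simp add: Re_divide)
qed

text \<open>Both maps fix real parts and divide differences of heights by 3, so old and new
  difference vectors have positive scalar product.\<close>

lemma rescale_pos: assumes "p \<noteq> q"
 shows "0 < Re ((upper q - upper p) / (q - p))" "0 < Re ((lower q - lower p) / (q - p))"
proof -
 have "Re q \<noteq> Re p \<or> Im q \<noteq> Im p" using assms by (auto simp: complex_eq_iff)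
 then have "0 < (Re q - Re p)\<^sup>2 + (Im q - Im p)\<^sup>2 / 3" by (auto intro: add_pos_nonneg add_nonneg_pos)
 moreover have "Re (upper q - upper p) * Re (q - p) + Im (upper q - upper p) * Im (q - p) = (Re q - Re p)\<^sup>2 + (Im q - Im p)\<^sup>2 / 3"
  "Re (lower q - lower p) * Re (q - p) + Im (lower q - lower p) * Im (q - p) = (Re q - Re p)\<^sup>2 + (Im q - Im p)\<^sup>2 / 3"
  by (simp_all add: upper_def lower_def power2_eq_square field_simps)
 ultimately show "0 < Re ((upper q - upper p) / (q - p))" "0 < Re ((lower q - lower p) / (q - p))"
  by (simp_all only: Re_divide_pos)
qed

lemma card_Plus_col: assumes "finite I" "finite I'"
 shows "card {t \<in> I <+> I'. case_sum col col' t = i} = card {r \<in> I. col r = i} + card {s \<in> I'. col' s = i}"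
proof -
 have "{t \<in> I <+> I'. case_sum col col' t = i} = {r \<in> I. col r = i} <+> {s \<in> I'. col' s = i}" by auto
 then show ?thesis using assms by (simp add: card_Plus)
qed

lemma continuous_map_stack:
 fixes c c' :: "'i::{finite,linorder} colouring"
 shows "continuous_map (prod_topology (conf_space c) (conf_space c')) (conf_space (\<lambda>i. c i + c' i)) (\<lambda>(z, w). stack z w)"
proof (rule continuous_map_conf_prod_conf)
 let ?Y = "prod_topology (ordered_conf c) (ordered_conf c')"
 have "continuous_map ?Y (conf_space (\<lambda>i. c i + c' i)) (\<lambda>y. lab (Ind c <+> Ind c') (case_sum fst fst)
   (\<lambda>t. case_sum (\<lambda>r. upper (fst y r)) (\<lambda>s. lower (snd y s)) t))"
 proof (rule continuous_map_lab)
  fix t assume "t \<in> Ind c <+> Ind c'"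
  then show "continuous_map ?Y euclidean (\<lambda>y. case_sum (\<lambda>r. upper (fst y r)) (\<lambda>s. lower (snd y s)) t)"
   by (auto intro!: continuous_map_upper continuous_map_lower continuous_map_ordered_coord
     continuous_map_prod_fst[where f = "\<lambda>x. x _"] continuous_map_prod_snd[where g = "\<lambda>x. x _"])
 next
  fix t y assume "t \<in> Ind c <+> Ind c'" "y \<in> topspace ?Y"
  then show "case_sum (\<lambda>r. upper (fst y r)) (\<lambda>s. lower (snd y s)) t \<in> disk"
   by (auto simp: topspace_ordered_conf intro!: upper_in_disk lower_in_disk)
 next
  fix y assume "y \<in> topspace ?Y"
  then show "inj_on (\<lambda>t. case_sum (\<lambda>r. upper (fst y r)) (\<lambda>s. lower (snd y s)) t) (Ind c <+> Ind c')"
   by (intro inj_on_stack) (auto simp: topspace_ordered_conf)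
 qed (simp_all add: card_Plus_col card_Ind_fst)
 then show "continuous_map ?Y (conf_space (\<lambda>i. c i + c' i))
   (\<lambda>(x, y). case (forget_order c x, forget_order c' y) of (z, w) => stack z w)"
  by (simp add: forget_order_lab stack_lab case_prod_unfold)
qed

lemma
 fixes c :: "'i::{finite,linorder} colouring"
 shows continuous_map_rescale_upper: "continuous_map (conf_space c) euclideanreal (\<lambda>z. rescale_angle upper z k)"
 and continuous_map_rescale_lower:
 "continuous_map (conf_space c) euclideanreal (\<lambda>z. rescale_angle lower z k)"
proof -
 have "continuous_map (ordered_conf c) euclideanreal (\<lambda>y. rescale_angle s (lab (Ind c) fst (\<lambda>r. y r)) (i, j))"
  if pos: "\<And>p q. p \<noteq> q ==> 0 < Re ((s q - s p) / (q - p))"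
   and cont: "\<And>f. continuous_map (ordered_conf c) euclidean f ==> continuous_map (ordered_conf c) euclidean (\<lambda>y. s (f y))"
  for s :: "complex => complex" and i j
 proof (rule continuous_map_rescale_angle[where x = "\<lambda>r y. y r" and s = "\<lambda>_. s"])
  fix r assume r: "r \<in> Ind c"
  show "continuous_map (ordered_conf c) euclidean (\<lambda>y. y r)" by (rule continuous_map_ordered_coord[OF r])
  show "continuous_map (ordered_conf c) euclidean (\<lambda>y. s (y r))"
   by (rule cont[OF continuous_map_ordered_coord[OF r]])
 next
  fix y r r' assume "y \<in> OConf c" "r \<in> Ind c" "r' \<in> Ind c" "r \<noteq> r'"
  then have "y r \<noteq> y r'" unfolding topspace_ordered_conf by (auto dest: inj_onD)
  then show "0 < Re ((s (y r') - s (y r)) / (y r' - y r))" by (rule pos)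
 qed (simp add: topspace_ordered_conf)
 note * = this
 obtain i j where k: "k = (i, j)" by (cases k)
 show "continuous_map (conf_space c) euclideanreal (\<lambda>z. rescale_angle upper z k)"
  unfolding k by (rule continuous_map_conf) (simp add: forget_order_lab *[OF rescale_pos(1) continuous_map_upper])
 show "continuous_map (conf_space c) euclideanreal (\<lambda>z. rescale_angle lower z k)"
  unfolding k by (rule continuous_map_conf) (simp add: forget_order_lab *[OF rescale_pos(2) continuous_map_lower])
qed

lemma Re_upper_lower: "p \<in> disk ==> q \<in> disk ==> 0 < Re (\<i> * (lower q - upper p))"
 by (auto simp: disk_def upper_def lower_def abs_le_iff)

lemma continuous_map_cross_angle:
 fixes c c' :: "'i::{finite,linorder} colouring"
 shows "continuous_map (prod_topology (conf_space c) (conf_space c')) euclideanreal (\<lambda>(z, w). cross_angle z w k)"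
proof -
 obtain i j where k: "k = (i, j)" by (cases k)
 let ?Y = "prod_topology (ordered_conf c) (ordered_conf c')"
 let ?M = "{(r, s) \<in> Ind c \<times> Ind c'. fst r = i \<and> fst s = j \<or> fst r = j \<and> fst s = i}"
 have 1: "continuous_map ?Y euclideanreal (\<lambda>y. \<Sum>t\<in>?M. ang (upper (fst y (fst t))) (lower (snd y (snd t))))"
  unfolding ang_def
 proof (intro continuous_map_sum continuous_map_real_mult_left continuous_map_Arg continuous_map_complex_mult
   continuous_map_diff continuous_map_upper continuous_map_lower)
  show "finite ?M" by (rule finite_subset[of _ "Ind c \<times> Ind c'"]) auto
  fix t assume t: "t \<in> ?M"
  then show "continuous_map ?Y euclidean (\<lambda>y. fst y (fst t))" "continuous_map ?Y euclidean (\<lambda>y. snd y (snd t))"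
   by (auto intro!: continuous_map_ordered_coord
     continuous_map_prod_fst[where f = "\<lambda>x. x _"] continuous_map_prod_snd[where g = "\<lambda>x. x _"])
  show "0 < Re (\<i> * (lower (snd y (snd t)) - upper (fst y (fst t))))" if "y \<in> topspace ?Y" for y
   using that t by (intro Re_upper_lower) (auto simp: topspace_ordered_conf)
 qed auto
 have "continuous_map ?Y euclideanreal
   (\<lambda>(x, y). case (forget_order c x, forget_order c' y) of (z, w) => cross_angle z w k)"
  by (rule continuous_map_eq[OF 1]) (auto simp: forget_order_lab k cross_angle_lab topspace_ordered_conf case_prod_unfold)
 then show ?thesis by (rule continuous_map_conf_prod_conf)
qed

lemma stack_cover_simps: "fst (stack_cover e f) = stack (fst e) (fst f)"
 "snd (stack_cover e f) = (\<lambda>k\<in>coords. snd e k + snd f k + rescale_angle upper (fst e) k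
   + rescale_angle lower (fst f) k + cross_angle (fst e) (fst f) k)" by (simp_all add: stack_cover_def split_beta)

lemma stack_cover_in: assumes e: "e \<in> topspace (cov a d c)" and f: "f \<in> topspace (cov a d c')"
 shows "stack_cover e f \<in> topspace (cov a d (\<lambda>i. c i + c' i))"
proof -
 have z: "fst e \<in> Conf c" and w: "fst f \<in> Conf c'" using e f by (simp_all add: topspace_cov)
 obtain x where x: "fst e = lab (Ind c) fst x" "inj_on x (Ind c)" "x ` Ind c \<subseteq> disk" by (rule conf_lab[OF z])
 obtain y where y: "fst f = lab (Ind c') fst y" "inj_on y (Ind c')" "y ` Ind c' \<subseteq> disk" by (rule conf_lab[OF w])
 have "W_map (stack (fst e) (fst f)) k = cis (snd (stack_cover e f) k)" if "k \<in> coords" for k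
  unfolding x(1) y(1) W_stack[OF finite_Ind finite_Ind x(2) y(2) x(3) y(3) tournament_ind_pairs tournament_ind_pairs that]
  unfolding x(1)[symmetric] y(1)[symmetric] using e f that by (simp add: topspace_cov stack_cover_simps cis_mult add_ac)
 moreover have "stack (fst e) (fst f) \<in> Conf (\<lambda>i. c i + c' i)"
  using continuous_map_image_subset_topspace[OF continuous_map_stack[of c c']] z w by auto
 ultimately show ?thesis by (simp add: topspace_cov stack_cover_simps(1)) (simp add: stack_cover_simps(2))
qed

lemma continuous_map_stack_cover:
 "continuous_map (prod_topology (cov a d c) (cov a d c')) (cov a d (\<lambda>i. c i + c' i)) (\<lambda>(e, f). stack_cover e f)"
proof -
 let ?Y = "prod_topology (cov a d c) (cov a d c')"
 have F: "continuous_map ?Y (conf_space c) (\<lambda>y. fst (fst y))" "continuous_map ?Y (conf_space c') (\<lambda>y. fst (snd y))"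
  by (intro continuous_map_prod_fst continuous_map_prod_snd continuous_map_cov_fst)+
 have FF: "continuous_map ?Y (prod_topology (conf_space c) (conf_space c')) (\<lambda>y. (fst (fst y), fst (snd y)))"
  by (intro continuous_map_pairedI F)
 have "continuous_map ?Y (conf_space (\<lambda>i. c i + c' i)) (\<lambda>y. stack (fst (fst y)) (fst (snd y)))"
  using continuous_map_compose[OF FF continuous_map_stack] by (simp add: o_def)
 moreover have "continuous_map ?Y euclideanreal (\<lambda>y. snd (stack_cover (fst y) (snd y)) k)" if k: "k \<in> coords" for k
 proof -
  have "continuous_map ?Y euclideanreal (\<lambda>y. snd (fst y) k)" "continuous_map ?Y euclideanreal (\<lambda>y. snd (snd y) k)"
   using continuous_map_prod_fst[OF continuous_map_cov_snd[OF k]]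
    continuous_map_prod_snd[OF continuous_map_cov_snd[OF k]] by auto
  moreover have "continuous_map ?Y euclideanreal (\<lambda>y. rescale_angle upper (fst (fst y)) k)"
    "continuous_map ?Y euclideanreal (\<lambda>y. rescale_angle lower (fst (snd y)) k)"
   using continuous_map_compose[OF F(1) continuous_map_rescale_upper[of c k]]
    continuous_map_compose[OF F(2) continuous_map_rescale_lower[of c' k]] by (simp_all add: o_def)
  moreover have "continuous_map ?Y euclideanreal (\<lambda>y. cross_angle (fst (fst y)) (fst (snd y)) k)"
   using continuous_map_compose[OF FF continuous_map_cross_angle[of c c' k]] by (simp add: o_def)
  ultimately show ?thesis using k by (simp add: stack_cover_simps(2) continuous_map_add)
 qed
 ultimately show ?thesis
  unfolding continuous_map_torus_cover by (auto simp: stack_cover_simps(1) split_beta stack_cover_in)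
qed

lemma stack_cover_deck:
 "stack_cover (deck coords n e) f = deck coords n (stack_cover e f)"
 "stack_cover e (deck coords n f) = deck coords n (stack_cover e f)"
 by (auto simp: stack_cover_def deck_def split_beta fun_eq_iff)

subsection \<open>Compact sets of parts\<close>

definition upper_part :: "'i::{finite,linorder} colouring => 'i colouring => 'i conf set => 'i conf set" where
 "upper_part c c' K = {z \<in> Conf c. \<exists>w \<in> Conf c'. stack z w \<in> K}"

definition lower_part :: "'i::{finite,linorder} colouring => 'i colouring => 'i conf set => 'i conf set" where
 "lower_part c c' K = {w \<in> Conf c'. \<exists>z \<in> Conf c. stack z w \<in> K}"

lemma pts_stack: "pts (stack z w) = upper ` pts z \<union> lower ` pts w" by (auto simp: pts_def stack_def)

lemma dist_upper: "dist (upper p) (upper q) \<le> dist p q" and dist_lower: "dist (lower p) (lower q) \<le> dist p q"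
proof -
 have *: "Im (upper p - upper q) = (Im p - Im q) / 3" "Im (lower p - lower q) = (Im p - Im q) / 3"
  "Re (upper p - upper q) = Re p - Re q" "Re (lower p - lower q) = Re p - Re q"
  by (simp_all add: upper_def lower_def field_simps)
 have "((Im p - Im q) / 3)\<^sup>2 \<le> (Im p - Im q)\<^sup>2" by (simp add: power_divide)
 then show "dist (upper p) (upper q) \<le> dist p q" "dist (lower p) (lower q) \<le> dist p q"
  unfolding dist_norm cmod_def * by simp_all
qed

text \<open>The pairs that stack into \<open>K\<close> form a closed set. Since \<open>upper\<close>
  and \<open>lower\<close> do not increase distances, it lies in a product of two compact sets
  \<open>far\<close>, and the parts are its projections.\<close>

lemma compactin_parts:
 fixes c c' :: "'i::{finite,linorder} colouring" assumes K: "compactin (conf_space (\<lambda>i. c i + c' i)) K"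
 shows "compactin (conf_space c) (upper_part c c' K)" "compactin (conf_space c') (lower_part c c' K)"
proof -
 let ?Y = "prod_topology (conf_space c) (conf_space c')"
 let ?P = "{y \<in> topspace ?Y. (\<lambda>(z, w). stack z w) y \<in> K}"
 obtain \<eta> where \<eta>: "0 < \<eta>" "K \<subseteq> far (\<lambda>i. c i + c' i) \<eta>"
  by (rule compact_subset_far[OF K])
 have cl: "closedin ?Y ?P" by (rule closedin_continuous_map_preimage[OF continuous_map_stack])
    (rule compactin_imp_closedin[OF Hausdorff_conf_space K])
 have sub: "?P \<subseteq> far c \<eta> \<times> far c' \<eta>"
 proof
  fix y assume y: "y \<in> ?P"
  obtain z w where zw: "y = (z, w)" by (cases y)
  have top: "z \<in> Conf c" "w \<in> Conf c'" "stack z w \<in> far (\<lambda>i. c i + c' i) \<eta>"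
   using y zw \<eta>(2) by auto
  have "\<eta> \<le> dist p q" if "p \<in> pts z" "q \<in> pts z" "p \<noteq> q" for p q
  proof -
   have "upper p \<in> pts (stack z w)" "upper q \<in> pts (stack z w)" "upper p \<noteq> upper q"
    using that by (simp_all add: pts_stack inj_eq[OF inj_upper])
   then have "\<eta> \<le> dist (upper p) (upper q)" using top(3) by (simp add: far_def)
   from this dist_upper show ?thesis by (rule order_trans)
  qed
  moreover have "\<eta> \<le> dist p q" if "p \<in> pts w" "q \<in> pts w" "p \<noteq> q" for p q
  proof -
   have "lower p \<in> pts (stack z w)" "lower q \<in> pts (stack z w)" "lower p \<noteq> lower q"
    using that by (simp_all add: pts_stack inj_eq[OF inj_lower])
   then have "\<eta> \<le> dist (lower p) (lower q)" using top(3) by (simp add: far_def)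
   from this dist_lower show ?thesis by (rule order_trans)
  qed
  ultimately show "y \<in> far c \<eta> \<times> far c' \<eta>" using top(1,2) by (simp add: far_def zw)
 qed
 have cpt: "compactin ?Y (far c \<eta> \<times> far c' \<eta>)"
  using compactin_far[OF \<eta>(1), of c] compactin_far[OF \<eta>(1), of c'] by (simp add: compactin_Times)
 have P: "compactin ?Y ?P" by (rule closed_compactin[OF cpt sub cl])
 have "fst ` ?P = upper_part c c' K"
 proof (intro equalityI subsetI)
  fix z assume "z \<in> upper_part c c' K"
  then obtain w where "(z, w) \<in> ?P" by (auto simp: upper_part_def)
  then show "z \<in> fst ` ?P" by (rule image_eqI[rotated]) simp
 qed (auto simp: upper_part_def)
 moreover have "snd ` ?P = lower_part c c' K"
 proof (intro equalityI subsetI)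
  fix w assume "w \<in> lower_part c c' K"
  then obtain z where "(z, w) \<in> ?P" by (auto simp: lower_part_def)
  then show "w \<in> snd ` ?P" by (rule image_eqI[rotated]) simp
 qed (auto simp: lower_part_def)
 ultimately show "compactin (conf_space c) (upper_part c c' K)" "compactin (conf_space c') (lower_part c c' K)"
  using image_compactin[OF P continuous_map_fst] image_compactin[OF P continuous_map_snd] by simp_all
qed

subsection \<open>The product of Borel-Moore classes\<close>

context
 fixes a :: "'i::{finite,linorder} => 'i => int" and d :: "'i => nat" and c c' :: "'i colouring" and K :: "'i conf set"
begin

private abbreviation "T1 \<equiv> conf_twisted a d c"
private abbreviation "T2 \<equiv> conf_twisted a d c'"
private abbreviation "T3 \<equiv> conf_twisted a d (\<lambda>i. c i + c' i)"
private abbreviation "A1 \<equiv> off T1 (upper_part c c' K)"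
private abbreviation "A2 \<equiv> off T2 (lower_part c c' K)"
private abbreviation "A3 \<equiv> off T3 K"

lemma side_stack: assumes "z \<in> Conf c" "w \<in> Conf c'" and "z \<in> side_conf c \<or> w \<in> side_conf c'"
 shows "stack z w \<in> side_conf (\<lambda>i. c i + c' i)"
proof -
 have "stack z w \<in> Conf (\<lambda>i. c i + c' i)"
  using continuous_map_image_subset_topspace[OF continuous_map_stack[of c c']] assms(1,2) by auto
 moreover have "Re (upper p) = Re p" "Re (lower p) = Re p" for p by (simp_all add: upper_def lower_def)
 moreover have "\<exists>i. \<exists>p\<in>stack z w i. \<bar>Re p\<bar> = 1" using assms(3)
 proof
  assume "z \<in> side_conf c"
  then obtain i p where "p \<in> z i" "\<bar>Re p\<bar> = 1" unfolding side_conf_def by blast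
  then have "upper p \<in> stack z w i" "\<bar>Re (upper p)\<bar> = 1" by (simp_all add: stack_def upper_def)
  then show ?thesis by blast
 next
  assume "w \<in> side_conf c'"
  then obtain i p where "p \<in> w i" "\<bar>Re p\<bar> = 1" unfolding side_conf_def by blast
  then have "lower p \<in> stack z w i" "\<bar>Re (lower p)\<bar> = 1" by (simp_all add: stack_def lower_def)
  then show ?thesis by blast
 qed
 ultimately show ?thesis by (simp add: side_conf_def)
qed

text \<open>A factor outside its part cannot be completed to a configuration in \<open>K\<close>,
  and a factor with a point on a side puts the stacked configuration on a side.\<close>

lemma stack_off:
 assumes e: "e \<in> topspace (cov a d c)" and f: "f \<in> topspace (cov a d c')" and "fst e \<in> A1 \<or> fst f \<in> A2"
 shows "fst (stack_cover e f) \<in> A3"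
proof -
 have z: "fst e \<in> Conf c" and w: "fst f \<in> Conf c'" using e f by (simp_all add: topspace_cov)
 have top: "stack (fst e) (fst f) \<in> Conf (\<lambda>i. c i + c' i)"
  using stack_cover_in[OF e f] by (simp add: topspace_cov stack_cover_simps)
 show ?thesis
 proof (cases "fst e \<in> side_conf c \<or> fst f \<in> side_conf c'")
  case True
  then show ?thesis using side_stack[OF z w] by (simp add: off_def stack_cover_simps)
 next
  case False
  then have "fst e \<notin> upper_part c c' K \<or> fst f \<notin> lower_part c c' K"
   using assms(3) by (auto simp: off_def)
  then have "stack (fst e) (fst f) \<notin> K" using z w by (auto simp: upper_part_def lower_part_def)
  then show ?thesis using top by (simp add: off_def stack_cover_simps)
 qed
qed

lemma cross_null_left: assumes x: "x \<in> tw_null T1 A1 p" and y: "y \<in> lchains q (cov a d c')"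
 shows "cross stack_cover p q x y \<in> tw_null T3 A3 (p + q)"
proof (rule additive_tw_null[OF submod_tw_null cross_add(1) _ _ x])
 show "cross stack_cover p q x y \<in> tw_null T3 A3 (p + q)"
  if "x \<in> lchains p (subtopology (cov a d c) (A1 \<times> UNIV))" for x
  using y by (intro tw_nullI1 cross_lchains_subtopology[OF continuous_map_stack_cover that, where S' = UNIV])
   (auto simp: mem_Times_iff intro: stack_off)
 show "cross stack_cover p q x y \<in> tw_null T3 A3 (p + q)" if "x \<in> mono_relations T1 p" for x
  by (rule tw_nullI2, rule cross_mono_relations_left[OF continuous_map_stack_cover _ _ that y])
   (simp_all add: stack_cover_deck)
qed

lemma cross_null_right: assumes x: "x \<in> lchains p (cov a d c)" and y: "y \<in> tw_null T2 A2 q"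
 shows "cross stack_cover p q x y \<in> tw_null T3 A3 (p + q)"
proof (rule additive_tw_null[OF submod_tw_null cross_add(2) _ _ y])
 show "cross stack_cover p q x y \<in> tw_null T3 A3 (p + q)"
  if "y \<in> lchains q (subtopology (cov a d c') (A2 \<times> UNIV))" for y
  using x by (intro tw_nullI1 cross_lchains_subtopology[OF continuous_map_stack_cover _ that, where S = UNIV])
   (auto simp: mem_Times_iff intro: stack_off)
 show "cross stack_cover p q x y \<in> tw_null T3 A3 (p + q)" if "y \<in> mono_relations T2 q" for y
  by (rule tw_nullI2, rule cross_mono_relations_right[OF continuous_map_stack_cover _ _ x that])
   (simp_all add: stack_cover_deck)
qed

lemma cross_cycles: assumes x: "x \<in> tw_cycles T1 A1 p" and y: "y \<in> tw_cycles T2 A2 q"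
 shows "cross stack_cover p q x y \<in> tw_cycles T3 A3 (p + q)"
proof -
 have X: "x \<in> lchains p (cov a d c)" "lboundary p x \<in> tw_null T1 A1 (p - 1)"
  and Y: "y \<in> lchains q (cov a d c')" "lboundary q y \<in> tw_null T2 A2 (q - 1)"
  using x y by (simp_all add: tw_cycles_def)
 have "cross stack_cover (p - 1) q (lboundary p x) y \<in> tw_null T3 A3 (p + q - 1)"
  using cross_null_left[OF X(2) Y(1)] submod_0[OF submod_tw_null] by (cases p) simp_all
 moreover have "cross stack_cover p (q - 1) x (lboundary q y) \<in> tw_null T3 A3 (p + q - 1)"
  using cross_null_right[OF X(1) Y(2)] submod_0[OF submod_tw_null] by (cases q) simp_all
 ultimately have "lboundary (p + q) (cross stack_cover p q x y) \<in> tw_null T3 A3 (p + q - 1)"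
  unfolding lboundary_cross by (intro submod_add submod_smul submod_tw_null)
 then show ?thesis using cross_lchains[OF continuous_map_stack_cover X(1) Y(1)] by (simp add: tw_cycles_def)
qed

text \<open>By the Leibniz rule the product of a boundary with a relative cycle is a boundary up to
  a product with the boundary of that cycle, which is null.\<close>

lemma cross_boundaries_left: assumes x: "x \<in> tw_boundaries T1 A1 p" and y: "y \<in> tw_cycles T2 A2 q"
 shows "cross stack_cover p q x y \<in> tw_boundaries T3 A3 (p + q)"
proof -
 obtain b n where b: "b \<in> lchains (Suc p) (cov a d c)" "n \<in> tw_null T1 A1 p" "x = lboundary (Suc p) b + n"
  by (rule tw_boundariesE[OF x])
 have Y: "y \<in> lchains q (cov a d c')" "lboundary q y \<in> tw_null T2 A2 (q - 1)"
  using y by (simp_all add: tw_cycles_def)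
 have "cross stack_cover (Suc p) (q - 1) b (lboundary q y) \<in> tw_null T3 A3 (p + q)"
  using cross_null_right[OF b(1) Y(2)] submod_0[OF submod_tw_null] by (cases q) simp_all
 moreover have "lboundary (Suc (p + q)) (cross stack_cover (Suc p) q b y) \<in> tw_boundaries T3 A3 (p + q)"
  using cross_lchains[OF continuous_map_stack_cover b(1) Y(1)] by (intro lboundary_in_tw_boundaries) simp
 moreover have "cross stack_cover p q (lboundary (Suc p) b) y = lboundary (Suc (p + q)) (cross stack_cover (Suc p) q b y) -
   smul ((- 1) ^ Suc p) (cross stack_cover (Suc p) (q - 1) b (lboundary q y))"
  using lboundary_cross[of "Suc p" q stack_cover b y] by simp
 moreover have "cross stack_cover p q n y \<in> tw_null T3 A3 (p + q)" by (rule cross_null_left[OF b(2) Y(1)])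
 ultimately show ?thesis unfolding b(3) cross_add using tw_null_boundaries[of T3 A3 "p + q"]
  by (auto intro!: submod_add[OF submod_tw_boundaries] submod_diff[OF submod_tw_boundaries] submod_smul[OF submod_tw_boundaries]
    simp del: power_Suc)
qed

lemma cross_boundaries_right: assumes x: "x \<in> tw_cycles T1 A1 p" and y: "y \<in> tw_boundaries T2 A2 q"
 shows "cross stack_cover p q x y \<in> tw_boundaries T3 A3 (p + q)"
proof -
 obtain b n where b: "b \<in> lchains (Suc q) (cov a d c')" "n \<in> tw_null T2 A2 q" "y = lboundary (Suc q) b + n"
  by (rule tw_boundariesE[OF y])
 have X: "x \<in> lchains p (cov a d c)" "lboundary p x \<in> tw_null T1 A1 (p - 1)"
  using x by (simp_all add: tw_cycles_def)
 have "cross stack_cover (p - 1) (Suc q) (lboundary p x) b \<in> tw_null T3 A3 (p + q)"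
  using cross_null_left[OF X(2) b(1)] submod_0[OF submod_tw_null] by (cases p) simp_all
 moreover have "lboundary (Suc (p + q)) (cross stack_cover p (Suc q) x b) \<in> tw_boundaries T3 A3 (p + q)"
  using cross_lchains[OF continuous_map_stack_cover X(1) b(1)] by (intro lboundary_in_tw_boundaries) simp
 moreover have "cross stack_cover p q x (lboundary (Suc q) b) = smul ((- 1) ^ p)
   (lboundary (Suc (p + q)) (cross stack_cover p (Suc q) x b) - cross stack_cover (p - 1) (Suc q) (lboundary p x) b)"
  using lboundary_cross[of p "Suc q" stack_cover x b] by (simp flip: power_add mult.assoc)
 moreover have "cross stack_cover p q x n \<in> tw_null T3 A3 (p + q)" by (rule cross_null_right[OF X(1) b(2)])
 ultimately show ?thesis unfolding b(3) cross_add using tw_null_boundaries[of T3 A3 "p + q"]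
  by (auto intro!: submod_add[OF submod_tw_boundaries] submod_diff[OF submod_tw_boundaries] submod_smul[OF submod_tw_boundaries])
qed

end

lemma degree_of_add: "degree_of (\<lambda>i. c i + c' i) = degree_of c + degree_of c'"
 by (simp add: degree_of_def sum.distrib)

text \<open>The union over all representatives in \<open>conf_mult\<close> collapses to one coset,
  because changing a representative changes the product by a boundary.\<close>

lemma conf_mult_class: assumes h: "h \<in> conf_homology a d c" and h': "h' \<in> conf_homology a d c'"
  and K: "K \<in> compacts (conf_twisted a d (\<lambda>i. c i + c' i))"
  and x: "x \<in> h (upper_part c c' K)" and y: "y \<in> h' (lower_part c c' K)"
 shows "conf_mult a d c c' h h' K = tw_class (conf_twisted a d (\<lambda>i. c i + c' i)) (off (conf_twisted a d (\<lambda>i. c i + c' i)) K)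
   (degree_of c + degree_of c') (smul (colour_sign c c') (cross stack_cover (degree_of c) (degree_of c') x y))"
  and "smul (colour_sign c c') (cross stack_cover (degree_of c) (degree_of c') x y) \<in>
   tw_cycles (conf_twisted a d (\<lambda>i. c i + c' i)) (off (conf_twisted a d (\<lambda>i. c i + c' i)) K) (degree_of c + degree_of c')"
proof -
 let ?T1 = "conf_twisted a d c" and ?T2 = "conf_twisted a d c'" and ?T = "conf_twisted a d (\<lambda>i. c i + c' i)"
 let ?p = "degree_of c" and ?q = "degree_of c'" and ?s = "smul (colour_sign c c')"
 let ?K1 = "upper_part c c' K" and ?K2 = "lower_part c c' K" and ?cl = "tw_class ?T (off ?T K) (degree_of c + degree_of c')"
 have K1: "?K1 \<in> compacts ?T1" and K2: "?K2 \<in> compacts ?T2" using compactin_parts[of c c' K] K by simp_all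
 note H = bm_homology_class[OF h[unfolded conf_homology_def] K1] and H' = bm_homology_class[OF h'[unfolded conf_homology_def] K2]
 have eq: "?cl (?s (cross stack_cover ?p ?q x' y')) = ?cl (?s (cross stack_cover ?p ?q x y))"
  if "x' \<in> h ?K1" "y' \<in> h' ?K2" for x' y'
 proof -
  have "x' - x \<in> tw_boundaries ?T1 (off ?T1 ?K1) ?p" "y' - y \<in> tw_boundaries ?T2 (off ?T2 ?K2) ?q"
   using that H(1)[OF x] H'(1)[OF y] by (simp_all add: mem_tw_class)
  from cross_boundaries_left[OF this(1) H'(2)[OF that(2)]] cross_boundaries_right[OF H(2)[OF x] this(2)]
  have "cross stack_cover ?p ?q x' y' - cross stack_cover ?p ?q x y \<in> tw_boundaries ?T (off ?T K) (?p + ?q)"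
   unfolding cross_diff by (rule submod_diff_trans[OF submod_tw_boundaries])
  from submod_smul[OF submod_tw_boundaries this, of "colour_sign c c'"] show ?thesis
   by (simp add: tw_class_eq_iff smul_diff)
 qed
 have "conf_mult a d c c' h h' K = (\<Union>x'\<in>h ?K1. \<Union>y'\<in>h' ?K2. ?cl (?s (cross stack_cover ?p ?q x' y')))"
  using K by (simp add: conf_mult_def Let_def upper_part_def lower_part_def stack_chain_eq lscale_eq_smul)
 also have "\<dots> = (\<Union>x'\<in>h ?K1. \<Union>y'\<in>h' ?K2. ?cl (?s (cross stack_cover ?p ?q x y)))"
  using eq by (intro SUP_cong refl)
 also have "\<dots> = ?cl (?s (cross stack_cover ?p ?q x y))" using x y by blast
 finally show "conf_mult a d c c' h h' K = ?cl (?s (cross stack_cover ?p ?q x y))" .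
 show "?s (cross stack_cover ?p ?q x y) \<in> tw_cycles ?T (off ?T K) (?p + ?q)"
  by (intro submod_smul submod_tw_cycles cross_cycles H(2)[OF x] H'(2)[OF y])
qed

lemma part_mono: "K \<subseteq> K' ==> upper_part c c' K \<subseteq> upper_part c c' K'" "K \<subseteq> K' ==> lower_part c c' K \<subseteq> lower_part c c' K'"
 by (auto simp: upper_part_def lower_part_def)

text \<open>The parts grow with the compact set, so one pair of representatives chosen for the
  larger set serves for both; this is the common element that \<open>bm_homologyI\<close> asks
  for.\<close>

theorem conf_mult_in: assumes h: "h \<in> conf_homology a d c" and h': "h' \<in> conf_homology a d c'"
 shows "conf_mult a d c c' h h' \<in> conf_homology a d (\<lambda>i. c i + c' i)"
 unfolding conf_homology_def degree_of_add
proof (rule bm_homologyI)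
 let ?T = "conf_twisted a d (\<lambda>i. c i + c' i)"
 have ex: "\<exists>x y. x \<in> h (upper_part c c' K) \<and> y \<in> h' (lower_part c c' K)" if "K \<in> compacts ?T" for K
 proof -
  have K: "upper_part c c' K \<in> compacts (conf_twisted a d c)" "lower_part c c' K \<in> compacts (conf_twisted a d c')"
   using compactin_parts[of c c' K] that by simp_all
  obtain x where "x \<in> h (upper_part c c' K)" by (rule bm_homology_nonempty[OF h[unfolded conf_homology_def] K(1)])
  moreover obtain y where "y \<in> h' (lower_part c c' K)"
   by (rule bm_homology_nonempty[OF h'[unfolded conf_homology_def] K(2)])
  ultimately show ?thesis by blast
 qed
 show "\<exists>x\<in>tw_cycles ?T (off ?T K) (degree_of c + degree_of c').
   conf_mult a d c c' h h' K = tw_class ?T (off ?T K) (degree_of c + degree_of c') x" if K: "K \<in> compacts ?T" for K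
 proof -
  obtain x y where "x \<in> h (upper_part c c' K)" "y \<in> h' (lower_part c c' K)" using ex[OF K] by blast
  from conf_mult_class[OF h h' K this] show ?thesis by (intro bexI)
 qed
 show "conf_mult a d c c' h h' K' \<inter> conf_mult a d c c' h h' K \<noteq> {}"
  if K: "K \<in> compacts ?T" "K' \<in> compacts ?T" "K \<subseteq> K'" for K K'
 proof -
  obtain x y where xy: "x \<in> h (upper_part c c' K')" "y \<in> h' (lower_part c c' K')" using ex[OF K(2)] by blast
  have c: "upper_part c c' K \<in> compacts (conf_twisted a d c)" "upper_part c c' K' \<in> compacts (conf_twisted a d c)"
   "lower_part c c' K \<in> compacts (conf_twisted a d c')" "lower_part c c' K' \<in> compacts (conf_twisted a d c')"
   using compactin_parts[of c c' K] compactin_parts[of c c' K'] K by simp_all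
  have xy': "x \<in> h (upper_part c c' K)" "y \<in> h' (lower_part c c' K)"
   using xy bm_homology_antimono[OF h[unfolded conf_homology_def] c(1,2) part_mono(1)[OF K(3)]]
    bm_homology_antimono[OF h'[unfolded conf_homology_def] c(3,4) part_mono(2)[OF K(3)]] by blast+
  let ?z = "smul (colour_sign c c') (cross stack_cover (degree_of c) (degree_of c') x y)"
  have "?z \<in> conf_mult a d c c' h h' K'" "?z \<in> conf_mult a d c c' h h' K"
   unfolding conf_mult_class(1)[OF h h' K(1) xy'] conf_mult_class(1)[OF h h' K(2) xy] by (rule tw_class_self)+
  then show ?thesis by blast
 qed
qed (simp add: conf_mult_def Let_def)

section \<open>Simplices of words\<close>

abbreviation wt :: "'i list => 'i colouring" where
 "wt w \<equiv> count_list w"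

lemma degree_of_wt: "degree_of (wt w) = length w"
proof (induction w)
 case (Cons i w)
 have "degree_of (wt (i # w)) = (\<Sum>j\<in>UNIV. wt w j + (if j = i then 1 else 0))"
  unfolding degree_of_def by (intro sum.cong) auto
 also have "\<dots> = degree_of (wt w) + 1" by (simp add: degree_of_def sum.distrib)
 finally show ?case unfolding Cons.IH by (simp only: list.size)
qed (simp add: degree_of_def)

lemma card_letters: "card {r. r < length w \<and> w ! r = i} = wt w i"
proof -
 have "wt w i = card {r. r < length w \<and> i = w ! r}"
  by (simp add: count_list_eq_length_filter length_filter_conv_card)
 moreover have "{r. r < length w \<and> w ! r = i} = {r. r < length w \<and> i = w ! r}" by auto
 ultimately show ?thesis by simp
qed

definition wpairs :: "nat => (nat \<times> nat) set" where
 "wpairs n = {(r, s). r < s \<and> s < n}"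

lemma tournament_wpairs: "tournament {..<n} (wpairs n)" by (auto simp: tournament_def wpairs_def)

text \<open>The points are numbered from left to right, so each of the angles lies in \<open>[0, 2 * pi]\<close>.\<close>

definition wcover :: "'i::linorder list => (nat => complex) => 'i conf_cover" where
 "wcover w P = (lab {..<length w} ((!) w) P,
   \<lambda>k\<in>coords. lab_angle {..<length w} (wpairs (length w)) ((!) w) P k)"

lemma fst_wcover [simp]: "fst (wcover w P) = lab {..<length w} ((!) w) P" by (simp add: wcover_def)

lemma wcover_in: assumes "\<And>r. r < length w ==> P r \<in> disk" "inj_on P {..<length w}"
 shows "wcover w P \<in> topspace (cov a d (wt w))"
proof -
 have "lab {..<length w} ((!) w) P \<in> Conf (wt w)" using assms by (intro lab_in_conf) (auto simp: card_letters)
 then show ?thesis using assms(2) by (simp add: topspace_cov) (simp add: wcover_def W_lab_angle tournament_wpairs)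
qed

text \<open>Points ordered from left to right, with equal real parts allowed, have rotated
  difference vectors in the closed upper half plane, where \<open>Arg\<close> is continuous. Hence
  the angles are given by one global formula and no path lifting is required.\<close>

lemma continuous_map_wcover:
 fixes w :: "'i::{finite,linorder} list" and P :: "nat => 'b => complex"
 assumes cont: "\<And>r. r < length w ==> continuous_map Y euclidean (P r)"
  and disk: "\<And>r y. r < length w ==> y \<in> topspace Y ==> P r y \<in> disk"
  and ord: "\<And>r s y. r < s ==> s < length w ==> y \<in> topspace Y ==> Re (P r y) \<le> Re (P s y) \<and> P r y \<noteq> P s y"
 shows "continuous_map Y (cov a d (wt w)) (\<lambda>y. wcover w (\<lambda>r. P r y))"
proof -
 have inj: "inj_on (\<lambda>r. P r y) {..<length w}" if "y \<in> topspace Y" for y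
 proof (rule inj_onI, rule ccontr)
  fix r s assume "r \<in> {..<length w}" "s \<in> {..<length w}" "P r y = P s y" "r \<noteq> s"
  then show False using ord[of r s y] ord[of s r y] that by (cases "r < s") auto
 qed
 have "continuous_map Y (conf_space (wt w)) (\<lambda>y. lab {..<length w} ((!) w) (\<lambda>r. P r y))"
  by (rule continuous_map_lab) (use cont disk inj in \<open>auto simp: card_letters\<close>)
 moreover have "continuous_map Y euclideanreal (\<lambda>y. snd (wcover w (\<lambda>r. P r y)) k)" if k: "k \<in> coords" for k :: "'i \<times> 'i"
 proof -
  obtain i j where ij: "k = (i, j)" by (cases k)
  have "continuous_map Y euclideanreal (\<lambda>y. \<Sum>q\<in>colour_pairs ((!) w) (wpairs (length w)) i j.
    ang (P (fst q) y) (P (snd q) y))" unfolding ang_def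
  proof (intro continuous_map_sum continuous_map_real_mult_left continuous_map_Arg_upper continuous_map_complex_mult
    continuous_map_diff)
   show "finite (colour_pairs ((!) w) (wpairs (length w)) i j)" by (rule finite_colour_pairs[OF _ tournament_wpairs]) simp
   fix q assume "q \<in> colour_pairs ((!) w) (wpairs (length w)) i j"
   then have q: "fst q < snd q" "snd q < length w" by (auto simp: colour_pairs_def wpairs_def)
   then show "continuous_map Y euclidean (P (fst q))" "continuous_map Y euclidean (P (snd q))" by (auto intro: cont)
   show "0 \<le> Im (\<i> * (P (snd q) y - P (fst q) y)) \<and> \<i> * (P (snd q) y - P (fst q) y) \<noteq> 0" if "y \<in> topspace Y" for y
    using ord[OF q that] by auto
  qed (simp add: continuous_map_const)
  then show ?thesis using k by (simp add: wcover_def lab_angle_def ij case_prod_unfold)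
 qed
 ultimately show ?thesis unfolding continuous_map_torus_cover using wcover_in[OF disk inj] by auto
qed

definition wsimp :: "'i::linorder list => (nat => (nat => real) => complex) => (nat => real) => 'i conf_cover" where
 "wsimp w P = (\<lambda>x\<in>standard_simplex (length w). wcover w (\<lambda>r. P r x))"

lemma singular_simplex_wsimp: assumes "\<And>r. r < length w ==> continuous_map (simplex_top (length w)) euclidean (P r)"
  and "\<And>r x. r < length w ==> x \<in> standard_simplex (length w) ==> P r x \<in> disk"
  and "\<And>r s x. r < s ==> s < length w ==> x \<in> standard_simplex (length w) ==> Re (P r x) \<le> Re (P s x) \<and> P r x \<noteq> P s x"
 shows "singular_simplex (length w) (cov a d (wt w)) (wsimp w P)"
proof -
 have "continuous_map (simplex_top (length w)) (cov a d (wt w)) (\<lambda>x. wcover w (\<lambda>r. P r x))"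
  by (rule continuous_map_wcover) (use assms in auto)
 then have "continuous_map (simplex_top (length w)) (cov a d (wt w)) (wsimp w P)"
  by (rule continuous_map_eq) (simp add: wsimp_def)
 then show ?thesis by (simp add: singular_simplex_def wsimp_def)
qed

lemma wsimp_homotopy:
 assumes "\<And>r. r < length w ==> continuous_map (prod_topology (simplex_top (length w)) (top_of_set {0..1::real})) euclidean (\<lambda>y. P r (fst y) (snd y))"
  and "\<And>r x t. r < length w ==> x \<in> standard_simplex (length w) ==> 0 \<le> t ==> t \<le> 1 ==> P r x t \<in> disk"
  and "\<And>r s x t. r < s ==> s < length w ==> x \<in> standard_simplex (length w) ==> 0 \<le> t ==> t \<le> 1 ==>
    Re (P r x t) \<le> Re (P s x t) \<and> P r x t \<noteq> P s x t"
  and face: "\<And>x t k. x \<in> standard_simplex (length w) ==> k \<le> length w ==> x k = 0 ==> 0 \<le> t ==> t \<le> 1 ==>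
    lab {..<length w} ((!) w) (\<lambda>r. P r x t) \<in> A"
 shows "single (wsimp w (\<lambda>r x. P r x 1)) c - single (wsimp w (\<lambda>r x. P r x 0)) c
   \<in> tw_boundaries (conf_twisted a d (wt w)) A (length w)" unfolding wsimp_def
proof (rule simplex_homotopy)
 have "continuous_map (prod_topology (simplex_top (length w)) (top_of_set {0..1})) (cov a d (wt w))
   (\<lambda>y. wcover w (\<lambda>r. P r (fst y) (snd y)))" by (rule continuous_map_wcover) (use assms(1-3) in auto)
 then show "continuous_map (prod_topology (simplex_top (length w)) (top_of_set {0..1})) (cov a d (wt w))
   (\<lambda>(x, t). wcover w (\<lambda>r. P r x t))" by (simp add: case_prod_unfold)
qed (simp add: face)

subsection \<open>Changing the heights\<close>

text \<open>Partial sums turn barycentric coordinates into increasing numbers in [0, 1]. A vanishing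
  coordinate means contact with an end or between neighbours.\<close>

definition psum :: "nat => (nat => real) => real" where
 "psum r x = (\<Sum>j\<le>r. x j)"

text \<open>The closed cell on which the colours from left to right spell \<open>w\<close>. Points
  may have equal real parts on its faces, and distinct heights \<open>Y\<close> keep them
  apart.\<close>

definition hsimp :: "'i::linorder list => (nat => real) => (nat => real) => 'i conf_cover" where
 "hsimp w Y = wsimp w (\<lambda>r x. Complex (- 1 + 2 * psum r x) (Y r))"

lemma psum_mono: "x \<in> standard_simplex n ==> r \<le> s ==> psum r x \<le> psum s x"
 unfolding psum_def by (intro sum_mono2) (auto simp: standard_simplex_def)

lemma psum_bounds: assumes "x \<in> standard_simplex n" "r \<le> n" shows "0 \<le> psum r x" "psum r x \<le> 1"
proof -
 show "0 \<le> psum r x" using assms unfolding psum_def by (intro sum_nonneg) (auto simp: standard_simplex_def)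
 have "psum n x = 1" using assms(1) by (simp add: psum_def standard_simplex_def)
 then show "psum r x \<le> 1" using psum_mono[OF assms] by simp
qed

lemma psum_face: assumes "x \<in> standard_simplex n" "x k = 0" "k \<le> n"
 shows "k = 0 ==> psum 0 x = 0" "0 < k ==> psum k x = psum (k - 1) x" "k = n ==> 0 < n ==> psum (n - 1) x = 1"
proof -
 show "k = 0 ==> psum 0 x = 0" using assms by (simp add: psum_def)
 show *: "psum k x = psum (k - 1) x" if "0 < k" using that assms(2) by (cases k) (simp_all add: psum_def)
 have "psum n x = 1" using assms(1) by (simp add: psum_def standard_simplex_def)
 then show "k = n ==> 0 < n ==> psum (n - 1) x = 1" using * by simp
qed

lemma continuous_map_psum: "continuous_map (simplex_top n) euclideanreal (psum r)" unfolding psum_def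
 by (intro continuous_map_sum continuous_map_from_subtopology continuous_map_product_projection) auto

lemma not_spreadI: assumes "z \<in> Conf c"
  and "(\<exists>p\<in>pts z. 1 - \<epsilon> < \<bar>Re p\<bar>) \<or> (\<exists>p\<in>pts z. \<exists>q\<in>pts z. p \<noteq> q \<and> \<bar>Re p - Re q\<bar> < \<epsilon>)"
 shows "z \<in> off (conf_twisted a d c) (spread c \<epsilon>)"
proof -
 have "z \<notin> spread c \<epsilon>" using assms(2) unfolding spread_def by (auto simp: not_less[symmetric])
 then show ?thesis using assms(1) by (simp add: off_def)
qed

lemma singular_simplex_hsimp: assumes "inj_on Y {..<length w}" "\<And>r. r < length w ==> \<bar>Y r\<bar> \<le> 1"
 shows "singular_simplex (length w) (cov a d (wt w)) (hsimp w Y)" unfolding hsimp_def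
proof (rule singular_simplex_wsimp)
 fix r s x assume *: "r < s" "s < length w" "x \<in> standard_simplex (length w)"
 then have "Y r \<noteq> Y s" using inj_onD[OF assms(1), of r s] by auto
 then show "Re (Complex (- 1 + 2 * psum r x) (Y r)) \<le> Re (Complex (- 1 + 2 * psum s x) (Y s)) \<and>
   Complex (- 1 + 2 * psum r x) (Y r) \<noteq> Complex (- 1 + 2 * psum s x) (Y s)"
  using psum_mono[OF *(3), of r s] *(1) by auto
next
 fix r x assume *: "r < length w" "x \<in> standard_simplex (length w)"
 then show "Complex (- 1 + 2 * psum r x) (Y r) \<in> disk"
  using psum_bounds[OF *(2), of r] assms(2)[of r] by (auto simp: disk_def abs_le_iff)
qed (intro continuous_map_Complex continuous_map_add continuous_map_real_mult_left continuous_map_psum; simp)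

text \<open>While the heights are moved, the simplex is shrunk towards the configuration with equal gaps, which
 keeps points from colliding.\<close>

lemma hsimp_heights:
 fixes Y Y' :: "nat => real" assumes Y: "inj_on Y {..<length w}" "\<And>r. r < length w ==> \<bar>Y r\<bar> \<le> 1"
  and Y': "inj_on Y' {..<length w}" "\<And>r. r < length w ==> \<bar>Y' r\<bar> \<le> 1" and \<epsilon>: "0 < \<epsilon>"
 shows "single (hsimp w Y') c - single (hsimp w Y) c
   \<in> tw_boundaries (conf_twisted a d (wt w)) (off (conf_twisted a d (wt w)) (spread (wt w) \<epsilon>)) (length w)"
proof -
 let ?n = "length w"
 define \<delta> where "\<delta> = min 1 \<epsilon>"
 \<comment> \<open>The amount of shrinking: 0 at both ends of the motion, where the given simplices
   must appear, positive in between, and at most \<open>\<delta> / 4\<close>.\<close>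
 define \<sigma> where "\<sigma> = (\<lambda>t::real. \<delta> * (t * (1 - t)))"
 \<comment> \<open>The configuration with equal gaps. Shrinking towards it makes the real parts
   strictly increasing, so heights may cross during the motion.\<close>
 define b where "b = (\<lambda>r::nat. real (r + 1) / real (?n + 1))"
 define S where "S = (\<lambda>r x t. (1 - \<sigma> t) * psum r x + \<sigma> t * b r)"
 define P where "P = (\<lambda>r x t. Complex (- 1 + 2 * S r x t) ((1 - t) * Y r + t * Y' r))"
 have \<delta>: "0 < \<delta>" "\<delta> \<le> 1" "\<delta> \<le> \<epsilon>" using \<epsilon> by (auto simp: \<delta>_def)
 have \<sigma>: "0 \<le> \<sigma> t" "\<sigma> t \<le> 1" "2 * \<sigma> t < \<epsilon>" "0 < t ==> t < 1 ==> 0 < \<sigma> t" if t: "0 \<le> t" "t \<le> 1" for t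
 proof -
  have "0 \<le> (t - 1 / 2)\<^sup>2" by simp
  then have le: "t * (1 - t) \<le> 1 / 4" by (simp add: power2_eq_square field_simps)
  have "0 \<le> t * (1 - t)" using t by simp
  then show "0 \<le> \<sigma> t" using \<delta> by (simp add: \<sigma>_def)
  have *: "\<sigma> t \<le> \<delta> * (1 / 4)" unfolding \<sigma>_def using le \<delta>(1) by (intro mult_left_mono) auto
  show "\<sigma> t \<le> 1" "2 * \<sigma> t < \<epsilon>" using * \<delta> by linarith+
  show "0 < t ==> t < 1 ==> 0 < \<sigma> t" using \<delta> by (simp add: \<sigma>_def)
 qed
 have b: "0 \<le> b r" "b r \<le> 1" if "r < ?n" for r using that by (auto simp: b_def field_simps)
 have b_Suc: "b (Suc r) = b r + 1 / real (?n + 1)" for r by (simp add: b_def flip: add_divide_distrib)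
 have b_less: "b r < b s" if "r < s" for r s unfolding b_def using that by (intro divide_strict_right_mono) auto
 have S01: "0 \<le> S r x t \<and> S r x t \<le> 1" if "r < ?n" "x \<in> standard_simplex ?n" "0 \<le> t" "t \<le> 1" for r x t
  using psum_bounds[OF that(2), of r] b[OF that(1)] \<sigma>[OF that(3,4)] that(1)
   convex_bound_le[of "psum r x" 1 "b r" "1 - \<sigma> t" "\<sigma> t"] by (auto simp: S_def)
 have S_mono: "S r x t \<le> S s x t" "0 < \<sigma> t ==> S r x t < S s x t"
  if "r < s" "x \<in> standard_simplex ?n" "0 \<le> t" "t \<le> 1" for r s x t
 proof -
  have 1: "(1 - \<sigma> t) * psum r x \<le> (1 - \<sigma> t) * psum s x"
   using psum_mono[OF that(2), of r s] that(1) \<sigma>[OF that(3,4)] by (intro mult_left_mono) auto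
  have 2: "\<sigma> t * b r \<le> \<sigma> t * b s"
   using b_less[OF that(1)] \<sigma>[OF that(3,4)] by (intro mult_left_mono) auto
  show "S r x t \<le> S s x t" using 1 2 by (simp add: S_def)
  show "S r x t < S s x t" if "0 < \<sigma> t"
   using 1 mult_strict_left_mono[OF b_less[OF \<open>r < s\<close>] that] by (simp add: S_def)
 qed
 have P_neq: "P r x t \<noteq> P s x t" if rs: "r < s" "s < ?n" "x \<in> standard_simplex ?n" "0 \<le> t" "t \<le> 1" for r s x t
 proof -
  consider "t = 0" | "t = 1" | "0 < t" "t < 1" using rs by linarith
  then show ?thesis
  proof cases
   case 1
   then show ?thesis using inj_onD[OF Y(1), of r s] rs by (auto simp: P_def)
  next
   case 2
   then show ?thesis using inj_onD[OF Y'(1), of r s] rs by (auto simp: P_def)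
  next
   case 3
   then show ?thesis using S_mono(2)[OF rs(1,3-5)] \<sigma>(4)[OF rs(4,5)] by (auto simp: P_def)
  qed
 qed
 have P_disk: "P r x t \<in> disk" if "r < ?n" "x \<in> standard_simplex ?n" "0 \<le> t" "t \<le> 1" for r x t
 proof -
  have "\<bar>(1 - t) * Y r + t * Y' r\<bar> \<le> 1"
  proof -
   have "\<bar>(1 - t) * Y r + t * Y' r\<bar> \<le> (1 - t) * \<bar>Y r\<bar> + t * \<bar>Y' r\<bar>"
    using that by (intro order_trans[OF abs_triangle_ineq]) (simp add: abs_mult)
   also have "\<dots> \<le> 1"
    using convex_bound_le[of "\<bar>Y r\<bar>" 1 "\<bar>Y' r\<bar>" "1 - t" t] Y(2)[OF that(1)] Y'(2)[OF that(1)] that by simp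
   finally show ?thesis .
  qed
  then show ?thesis using S01[OF that] by (auto simp: P_def disk_def abs_le_iff)
 qed
 have "single (wsimp w (\<lambda>r x. P r x 1)) c - single (wsimp w (\<lambda>r x. P r x 0)) c
   \<in> tw_boundaries (conf_twisted a d (wt w)) (off (conf_twisted a d (wt w)) (spread (wt w) \<epsilon>)) ?n"
 proof (rule wsimp_homotopy)
  fix r
  have 1: "continuous_map (prod_topology (simplex_top ?n) (top_of_set {0..1})) euclideanreal (\<lambda>y. psum r (fst y))"
   by (rule continuous_map_prod_fst[OF continuous_map_psum])
  have 2: "continuous_map (prod_topology (simplex_top ?n) (top_of_set {0..1})) euclideanreal (\<lambda>y. snd y)"
   by (rule continuous_map_prod_snd[where g = "\<lambda>t. t"]) simp
  show "continuous_map (prod_topology (simplex_top ?n) (top_of_set {0..1})) euclidean (\<lambda>y. P r (fst y) (snd y))"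
   unfolding P_def S_def \<sigma>_def
   by (intro continuous_map_Complex continuous_map_add continuous_map_diff continuous_map_real_mult 1 2; simp)
 next
  fix t :: real and x :: "nat => real" and k assume *: "x \<in> standard_simplex ?n" "k \<le> ?n" "x k = 0" "0 \<le> t" "t \<le> 1"
  let ?z = "lab {..<?n} ((!) w) (\<lambda>r. P r x t)"
  have "inj_on (\<lambda>r. P r x t) {..<?n}" using P_neq[OF _ _ *(1,4,5)] by (intro linorder_inj_onI) auto
  then have "?z \<in> Conf (wt w)"
   using P_disk[OF _ *(1,4,5)] wcover_in[of w "\<lambda>r. P r x t"] by (simp add: topspace_cov)
  have n: "0 < ?n"
  proof (rule ccontr)
   assume "\<not> 0 < ?n"
   then have "?n = 0" by simp
   then show False using *(1-3) unfolding standard_simplex_def by simp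
  qed
  define u where "u = 1 / real (?n + 1)"
  have small: "2 * (\<sigma> t * u) < \<epsilon>"
  proof -
   have "\<sigma> t * u \<le> \<sigma> t * 1"
    using \<sigma>(1)[OF *(4,5)] by (intro mult_left_mono) (auto simp: u_def field_simps)
   then show ?thesis using \<sigma>(3)[OF *(4,5)] by linarith
  qed
  \<comment> \<open>A face is displaced only slightly: an extreme point gets the distance
    \<open>2 * (\<sigma> t * u)\<close> from its side, or two neighbours get this horizontal
    distance, which is less than \<open>\<epsilon>\<close>. So the face stays outside
    \<open>spread\<close>.\<close>
  consider "k = 0" | "k = ?n" | "0 < k" "k < ?n" using *(2) by linarith
  then have "(\<exists>p\<in>pts ?z. 1 - \<epsilon> < \<bar>Re p\<bar>) \<or> (\<exists>p\<in>pts ?z. \<exists>q\<in>pts ?z. p \<noteq> q \<and> \<bar>Re p - Re q\<bar> < \<epsilon>)"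
  proof cases
   case 1
   have "Re (P 0 x t) = - 1 + 2 * (\<sigma> t * u)"
    using psum_face(1)[OF *(1,3,2) 1] by (simp add: P_def S_def b_def u_def)
   then have "1 - \<epsilon> < \<bar>Re (P 0 x t)\<bar>" using small by linarith
   then show ?thesis using n by auto
  next
   case 2
   have "Re (P (?n - 1) x t) = 1 - 2 * (\<sigma> t * u)"
   proof -
    obtain k where "?n = Suc k" using n by (cases "?n") auto
    then have "b (?n - 1) = 1 - u" by (simp add: u_def b_def field_simps)
    then have "Re (P (?n - 1) x t) = - 1 + 2 * ((1 - \<sigma> t) * 1 + \<sigma> t * (1 - u))"
     using psum_face(3)[OF *(1,3,2) 2 n] by (simp add: P_def S_def)
    also have "\<dots> = 1 - 2 * (\<sigma> t * u)" by (simp add: right_diff_distrib)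
    finally show ?thesis .
   qed
   then have "1 - \<epsilon> < \<bar>Re (P (?n - 1) x t)\<bar>" using small by linarith
   then show ?thesis using n by auto
  next
   case 3
   have "b k = b (k - 1) + u" using b_Suc[of "k - 1"] 3(1) by (simp add: u_def)
   then have "Re (P k x t) - Re (P (k - 1) x t) = 2 * (\<sigma> t * u)"
    using psum_face(2)[OF *(1,3,2) 3(1)] by (simp add: P_def S_def algebra_simps)
   then have "\<bar>Re (P k x t) - Re (P (k - 1) x t)\<bar> < \<epsilon>" using small \<sigma>(1)[OF *(4,5)] by (simp add: u_def)
   moreover have "P k x t \<noteq> P (k - 1) x t" using P_neq[of "k - 1" k x t] 3 * by auto
   moreover have "P k x t \<in> pts ?z" "P (k - 1) x t \<in> pts ?z" using 3 by auto
   ultimately show ?thesis by blast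
  qed
  then show "?z \<in> off (conf_twisted a d (wt w)) (spread (wt w) \<epsilon>)"
   by (rule not_spreadI[OF \<open>?z \<in> Conf (wt w)\<close>])
 next
  fix r s and t :: real and x :: "nat => real" assume "r < s" "s < ?n" "x \<in> standard_simplex ?n" "0 \<le> t" "t \<le> 1"
  then show "Re (P r x t) \<le> Re (P s x t) \<and> P r x t \<noteq> P s x t"
   using S_mono(1)[of r s x t] P_neq[of r s x t] by (simp add: P_def)
 qed (rule P_disk)
 moreover have "wsimp w (\<lambda>r x. P r x 1) = hsimp w Y'" "wsimp w (\<lambda>r x. P r x 0) = hsimp w Y"
  by (simp_all add: hsimp_def P_def S_def \<sigma>_def)
 ultimately show ?thesis by simp
qed

section \<open>Shuffles of words\<close>

text \<open>For \<open>r \<in> A\<close> the position of the letter \<open>r\<close> in the subword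
  on \<open>A\<close>; for every \<open>r\<close> the number of the vertex of the first factor at
  step \<open>r\<close> of the staircase of \<open>A\<close>.\<close>

definition rank_in :: "nat set => nat => nat" where
 "rank_in A r = card (A \<inter> {..<r})"

lemma rank_in_Suc: "rank_in A (Suc r) = rank_in A r + (if r \<in> A then 1 else 0)"
proof -
 have "A \<inter> {..<Suc r} = (if r \<in> A then insert r (A \<inter> {..<r}) else A \<inter> {..<r})"
  by (auto simp: less_Suc_eq)
 then show ?thesis by (simp add: rank_in_def)
qed

lemma rank_in_Compl: "rank_in (- A) r = card ({..<r} - A)" unfolding rank_in_def by (rule arg_cong[where f = card]) auto

lemma rank_in_mono: "r \<le> s ==> rank_in A r \<le> rank_in A s" unfolding rank_in_def by (intro card_mono) auto

lemma rank_in_less: "r \<in> A ==> r < s ==> rank_in A r < rank_in A s"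
 using rank_in_mono[of "Suc r" s A] by (simp add: rank_in_Suc)

lemma rank_in_le_iff: "r \<in> A ==> rank_in A k \<le> rank_in A r \<longleftrightarrow> k \<le> r"
 using rank_in_less[of r A k] rank_in_mono[of k r A] by linarith

lemma bij_rank_in: "bij_betw (rank_in A) (A \<inter> {..<n}) {..<rank_in A n}"
proof -
 have inj: "inj_on (rank_in A) (A \<inter> {..<n})" by (rule linorder_inj_onI) (auto dest: rank_in_less)
 have "rank_in A ` (A \<inter> {..<n}) \<subseteq> {..<rank_in A n}" by (auto intro: rank_in_less)
 moreover have "card (rank_in A ` (A \<inter> {..<n})) = card {..<rank_in A n}"
  using card_image[OF inj] by (simp add: rank_in_def)
 ultimately show ?thesis using inj by (simp add: bij_betw_def card_subset_eq)
qed

lemma length_nths_rank: "length (nths W A) = rank_in A (length W)"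
 unfolding length_nths rank_in_def by (rule arg_cong[where f = card]) auto

lemma nth_nths_rank: "r \<in> A ==> r < length W ==> nths W A ! rank_in A r = W ! r"
proof (induction W rule: rev_induct)
 case (snoc x W)
 show ?case
 proof (cases "r < length W")
  case True
  then have "rank_in A r < length (nths W A)" using snoc.prems by (simp add: length_nths_rank rank_in_less)
  then show ?thesis using True snoc by (simp add: nths_append nth_append)
 next
  case False
  then have "r = length W" using snoc.prems by simp
  then show ?thesis using snoc.prems by (simp add: nths_append nth_append length_nths_rank)
 qed
qed simp

lemma wt_nths: "wt (nths W A) i + wt (nths W (- A)) i = wt W i"
 by (induction W arbitrary: A) (auto simp: nths_Cons Collect_neg_eq)

text \<open>Inverse to splitting a word into its subwords on \<open>A\<close> and on the complement
  of \<open>A\<close>.\<close>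

definition merge :: "nat => nat set => 'a list => 'a list => 'a list" where
 "merge n A w u = map (\<lambda>r. if r \<in> A then w ! rank_in A r else u ! rank_in (- A) r) [0..<n]"

lemma length_merge [simp]: "length (merge n A w u) = n" by (simp add: merge_def)

lemma merge_nths: "merge (length W) A (nths W A) (nths W (- A)) = W"
 by (rule nth_equalityI) (auto simp: merge_def nth_nths_rank)

lemma nths_merge:
 "length w = rank_in A n ==> nths (merge n A w u) A = w"
 "length u = rank_in (- A) n ==> nths (merge n A w u) (- A) = u"
proof -
 have *: "nths (merge n A w u) B = v"
  if l: "length v = rank_in B n" and B: "\<And>r. r \<in> B ==> r < n ==> merge n A w u ! r = v ! rank_in B r" for B v
 proof (rule nth_equalityI)
  show "length (nths (merge n A w u) B) = length v" by (simp add: length_nths_rank l)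
  fix k assume "k < length (nths (merge n A w u) B)"
  then have "k \<in> rank_in B ` (B \<inter> {..<n})"
   using bij_rank_in[of B n] by (simp add: length_nths_rank bij_betw_def)
  then obtain r where r: "r \<in> B" "r < n" "k = rank_in B r" by auto
  then show "nths (merge n A w u) B ! k = v ! k" using B by (simp add: nth_nths_rank)
 qed
 show "length w = rank_in A n ==> nths (merge n A w u) A = w" by (rule *) (auto simp: merge_def)
 show "length u = rank_in (- A) n ==> nths (merge n A w u) (- A) = u" by (rule *) (auto simp: merge_def)
qed

definition inv_pairs :: "nat => nat set => (nat \<times> nat) set" where
 "inv_pairs n A = {(m, m'). m \<in> A \<and> m < n \<and> m' \<notin> A \<and> m' < m}"

lemma finite_inv_pairs [simp]: "finite (inv_pairs n A)"
 by (rule finite_subset[of _ "{..<n} \<times> {..<n}"]) (auto simp: inv_pairs_def)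

lemma shuffle_sign_inv: "A \<subseteq> {..<n} ==> shuffle_sign n A = (- 1) ^ card (inv_pairs n A)"
proof -
 assume "A \<subseteq> {..<n}"
 then have "{(m, m'). m \<in> A \<and> m' \<in> {..<n} - A \<and> m' < m} = inv_pairs n A" by (force simp: inv_pairs_def)
 then show ?thesis by (simp add: shuffle_sign_def)
qed

definition tw :: "('i => 'i => 'r::comm_ring_1) => 'i => 'i list => 'r" where
 "tw b i u = (\<Prod>j\<leftarrow>u. b j i)"

text \<open>The quantum shuffle product on functions of words, by recursion on the first letter. A
  first letter that belongs to the second factor has passed all letters of the first factor, which
  costs the factor \<open>tw\<close>.\<close>

fun shp :: "('i => 'i => 'r::comm_ring_1) => ('i list => 'r) => ('i list => 'r) => 'i list => 'r" where
 "shp b f g [] = f [] * g []"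
| "shp b f g (i # W) = shp b (\<lambda>u. f (i # u)) g W + shp b (\<lambda>u. tw b i u * f u) (\<lambda>w. g (i # w)) W"

lemma prod_inv_pairs_Cons:
 "(\<Prod>(m, m')\<in>inv_pairs (Suc n) A. h m m') =
   (if 0 \<in> A then 1 else \<Prod>m\<in>{m. Suc m \<in> A \<and> m < n}. h (Suc m) 0) *
   (\<Prod>(m, m')\<in>inv_pairs n {j. Suc j \<in> A}. h (Suc m) (Suc m'))"
proof -
 let ?f = "\<lambda>m. (Suc m, 0 :: nat)" and ?s = "map_prod Suc Suc"
 let ?B = "{j. Suc j \<in> A}" and ?C = "if 0 \<in> A then {} else {m. Suc m \<in> A \<and> m < n}"
 have C: "finite ?C" by simp
 have "inv_pairs (Suc n) A = ?f ` ?C \<union> ?s ` inv_pairs n ?B" (is "?L = ?R")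
 proof (rule Set.set_eqI)
  fix x :: "nat \<times> nat"
  obtain m m' where x: "x = (m, m')" by (cases x)
  show "x \<in> ?L \<longleftrightarrow> x \<in> ?R"
   unfolding x by (cases m; cases m') (force simp: inv_pairs_def image_iff)+
 qed
 moreover have "inj_on ?f ?C" "inj_on ?s (inv_pairs n ?B)" "?f ` ?C \<inter> ?s ` inv_pairs n ?B = {}"
  by (auto simp: inj_on_def)
 ultimately have "(\<Prod>(m, m')\<in>inv_pairs (Suc n) A. h m m') =
   (\<Prod>m\<in>?C. h (Suc m) 0) * (\<Prod>x\<in>inv_pairs n ?B. (\<lambda>(m, m'). h m m') (?s x))"
  using prod.union_disjoint[of "?f ` ?C" "?s ` inv_pairs n ?B" "\<lambda>(m, m'). h m m'"] C
   prod.reindex[of ?f ?C "\<lambda>(m, m'). h m m'"] prod.reindex[of ?s "inv_pairs n ?B" "\<lambda>(m, m'). h m m'"]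
  by (simp only: o_def split finite_imageI finite_inv_pairs)
 then show ?thesis by (simp add: split_beta map_prod_def)
qed

lemma prod_list_nths: "(\<Prod>j\<leftarrow>nths W A. h j) = (\<Prod>m\<in>{m. m \<in> A \<and> m < length W}. h (W ! m))"
proof (induction W rule: rev_induct)
 case (snoc x W)
 have "{m. m \<in> A \<and> m < Suc (length W)} = (if length W \<in> A then insert (length W) {m. m \<in> A \<and> m < length W} else {m. m \<in> A \<and> m < length W})"
  by (auto simp: less_Suc_eq)
 moreover have "(\<Prod>m | m \<in> A \<and> m < length W. h ((W @ [x]) ! m)) = (\<Prod>m | m \<in> A \<and> m < length W. h (W ! m))"
  by (intro prod.cong) (auto simp: nth_append)
 ultimately show ?case using snoc.IH by (simp add: nths_append mult.commute)
qed simp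

lemma sum_Pow_Suc: "(\<Sum>A\<in>Pow {..<Suc n}. F A) =
  (\<Sum>A\<in>Pow {..<n}. F (insert 0 (Suc ` A))) + (\<Sum>A\<in>Pow {..<n}. F (Suc ` A))"
proof -
 have "Pow {..<Suc n} = (\<lambda>A. insert 0 (Suc ` A)) ` Pow {..<n} \<union> (`) Suc ` Pow {..<n}" (is "?L = ?R")
 proof (rule Set.set_eqI)
  fix A :: "nat set"
  let ?B = "{j. Suc j \<in> A}"
  have A: "A = (if 0 \<in> A then insert 0 (Suc ` ?B) else Suc ` ?B)" by (auto simp: image_iff) (metis not0_implies_Suc)+
  show "A \<in> ?L \<longleftrightarrow> A \<in> ?R"
  proof
   assume "A \<in> ?L"
   then have "?B \<in> Pow {..<n}" by auto
   then show "A \<in> ?R" using A by (auto split: if_splits)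
  qed auto
 qed
 moreover have "inj_on (\<lambda>A. insert 0 (Suc ` A)) (Pow {..<n})" "inj_on ((`) Suc) (Pow {..<n})"
  by (auto simp: inj_on_def)+
 moreover have "(\<lambda>A. insert 0 (Suc ` A)) ` Pow {..<n} \<inter> (`) Suc ` Pow {..<n} = {}" by auto
 ultimately show ?thesis by (simp add: sum.union_disjoint sum.reindex)
qed

text \<open>Links the two uses of \<open>shp\<close>: stacking of cells produces the sum over
  subsets \<open>A\<close>, the positions of the letters of the first factor, while the algebraic
  identities use the recursion.\<close>

lemma shp_sum:
 "shp b f g W = (\<Sum>A\<in>Pow {..<length W}. f (nths W A) * g (nths W (- A)) *
   (\<Prod>(m, m')\<in>inv_pairs (length W) A. b (W ! m) (W ! m')))"
proof (induction W arbitrary: f g)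
 case (Cons i W)
 have 1: "{j. Suc j \<in> insert 0 (Suc ` A)} = A" "{j. Suc j \<notin> Suc ` A} = - A"
  "{j. Suc j \<in> - insert 0 (Suc ` A)} = - A" "{j. Suc j \<in> Suc ` A} = A" "{j. Suc j \<in> - Suc ` A} = - A" for A
  by auto
 show ?case
  unfolding shp.simps Cons list.size add_Suc_right add_0_right sum_Pow_Suc prod_inv_pairs_Cons nths_Cons 1 tw_def prod_list_nths
  by (intro arg_cong2[where f = "(+)"] sum.cong) (auto simp: mult_ac image_iff)
qed (simp add: inv_pairs_def)

section \<open>The product of word simplices\<close>

text \<open>Up to the vertex \<open>rank_in A r\<close> the vertex map collects exactly the
  coordinates with numbers at most \<open>r\<close>. So each point of a factor keeps the real part
  that its letter has in the merged word.\<close>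

lemma psum_vertex_map: assumes "r \<in> A" "r < n" shows "psum (rank_in A r) (vertex_map n (rank_in A) x) = psum r x"
proof -
 have "psum (rank_in A r) (vertex_map n (rank_in A) x) =
   (\<Sum>k\<in>(\<Union>j\<in>{..rank_in A r}. {k. k \<le> n \<and> rank_in A k = j}). x k)"
  unfolding psum_def vertex_map_def by (subst sum.UNION_disjoint) auto
 also have "(\<Union>j\<in>{..rank_in A r}. {k. k \<le> n \<and> rank_in A k = j}) = {..r}"
  using assms by (auto simp: rank_in_le_iff)
 finally show ?thesis by (simp add: psum_def)
qed

text \<open>No wrapping occurs: a nonnegative argument is changed by less than pi / 2, and the
  product again lies in the closed upper half plane.\<close>

lemma Arg_mult_upper: assumes "0 \<le> Im u" "u \<noteq> 0" "0 < Re v" "0 \<le> Im (u * v)"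
 shows "Arg (u * v) = Arg u + Arg v"
proof -
 have v: "v \<noteq> 0" using assms(3) by auto
 have "0 \<le> Arg u" "0 \<le> Arg (u * v)" "\<bar>Arg v\<bar> < pi / 2"
  using assms(1,4) by (simp_all only: Arg_less_0) (use assms(3) Arg_Re_pos in blast)
 then show ?thesis using Arg_times'[OF assms(2) v] Arg_le_pi[of u] by (auto simp: Let_def split: if_splits)
qed

lemma ang_rescale: assumes "p \<noteq> q" "Re p \<le> Re q" "Re (s p) \<le> Re (s q)" "0 < Re ((s q - s p) / (q - p))"
 shows "ang (s p) (s q) = ang p q + 2 * Arg ((s q - s p) / (q - p))"
proof -
 have "\<i> * (q - p) * ((s q - s p) / (q - p)) = \<i> * (s q - s p)" using assms(1) by simp
 then show ?thesis using Arg_mult_upper[of "\<i> * (q - p)" "(s q - s p) / (q - p)"] assms by (simp add: ang_def)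
qed

text \<open>The rotated vector from \<open>p\<close> to \<open>q\<close> has negative real part and
  nonnegative imaginary part; passing to its negative lowers \<open>Arg\<close> by pi, and
  \<open>ang\<close> doubles angles.\<close>

lemma ang_swap: assumes "Re p \<le> Re q" "Im p < Im q" shows "ang p q = ang q p + 2 * pi"
proof -
 let ?u = "\<i> * (q - p)"
 have u: "0 \<le> Im ?u" "Re ?u < 0" using assms by simp_all
 then have "0 < Arg ?u" unfolding Arg_pos_iff by linarith
 moreover have "?u \<noteq> 0" using u(2) by auto
 ultimately have "Arg (- ?u) = Arg ?u - pi" by (simp add: Arg_minus)
 moreover have "- ?u = \<i> * (p - q)" by (simp add: algebra_simps)
 ultimately show ?thesis by (simp add: ang_def)
qed

text \<open>The angles of a subword can be computed with the labels of the large word, because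
  \<open>rank_in A\<close> preserves the order on \<open>A\<close>.\<close>

lemma wcover_nths:
 fixes W :: "'i::{finite,linorder} list"
 defines "I \<equiv> \<lambda>A. A \<inter> {..<length W}" assumes P: "\<And>r. r \<in> I A ==> P' (rank_in A r) = P r"
 shows "wcover (nths W A) P' = (lab (I A) ((!) W) P,
  \<lambda>k\<in>coords. lab_angle (I A) (wpairs (length W) \<inter> I A \<times> I A) ((!) W) P k)"
proof -
 let ?n = "length W" and ?w = "nths W A" and ?f = "rank_in A"
 let ?Q = "wpairs ?n \<inter> I A \<times> I A"
 have im: "{..<length ?w} = ?f ` I A" and inj: "inj_on ?f (I A)"
  using bij_rank_in[of A ?n] by (auto simp: bij_betw_def length_nths_rank I_def)
 have w: "?w ! ?f r = W ! r" if "r \<in> I A" for r using that nth_nths_rank[of r A W] by (simp add: I_def)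
 have 1: "lab {..<length ?w} ((!) ?w) P' = lab (I A) ((!) W) P"
  unfolding im lab_def by (rule ext) (auto simp: w P intro!: image_eqI)
 have mono: "?f r < ?f s \<longleftrightarrow> r < s" if "r \<in> I A" "s \<in> I A" for r s
  using that rank_in_le_iff[of s A r] rank_in_le_iff[of r A s] by (auto simp: I_def not_le[symmetric])
 have "colour_pairs ((!) ?w) (wpairs (length ?w)) i j = map_prod ?f ?f ` colour_pairs ((!) W) ?Q i j" for i j
 proof (rule Set.set_eqI)
  fix x :: "nat \<times> nat"
  obtain r s where x: "x = (r, s)" by (cases x)
  have "x \<in> colour_pairs ((!) ?w) (wpairs (length ?w)) i j \<longleftrightarrow> r < s \<and> r \<in> ?f ` I A \<and> s \<in> ?f ` I A \<and>
    (?w ! r = i \<and> ?w ! s = j \<or> ?w ! r = j \<and> ?w ! s = i)"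
   unfolding x im[symmetric] by (auto simp: colour_pairs_def wpairs_def)
  also have "\<dots> \<longleftrightarrow> (\<exists>a\<in>I A. \<exists>b\<in>I A. r = ?f a \<and> s = ?f b \<and> a < b \<and>
    (W ! a = i \<and> W ! b = j \<or> W ! a = j \<and> W ! b = i))" unfolding image_iff using mono w by (smt (verit))
  also have "\<dots> \<longleftrightarrow> x \<in> map_prod ?f ?f ` colour_pairs ((!) W) ?Q i j"
   unfolding x mem_map_prod_image by (auto simp: colour_pairs_def wpairs_def I_def)
  finally show "x \<in> colour_pairs ((!) ?w) (wpairs (length ?w)) i j \<longleftrightarrow> x \<in> map_prod ?f ?f ` colour_pairs ((!) W) ?Q i j" .
 qed
 moreover have "inj_on (map_prod ?f ?f) (colour_pairs ((!) W) ?Q i j)" for i j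
  by (rule inj_on_subset[of _ "I A \<times> I A"]) (use inj in \<open>auto simp: inj_on_def colour_pairs_def\<close>)
 ultimately have "lab_angle {..<length ?w} (wpairs (length ?w)) ((!) ?w) P' (i, j) =
   lab_angle (I A) ?Q ((!) W) P (i, j)" for i j
  unfolding lab_angle_def by (auto simp: sum.reindex o_def split_beta colour_pairs_def P intro!: sum.cong)
 then have "lab_angle {..<length ?w} (wpairs (length ?w)) ((!) ?w) P' = lab_angle (I A) ?Q ((!) W) P"
  by (intro ext) (simp only: split_paired_all)
 then show ?thesis unfolding wcover_def 1 by simp
qed

text \<open>A pair of points in which the left one lies in the lower disk contributes the angle \<open>2 * pi\<close>.\<close>

lemma stack_wcover:
 fixes W :: "'i::{finite,linorder} list"
 defines "n \<equiv> length W"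
 defines "Q \<equiv> \<lambda>P A r. if r \<in> A then upper (P r) else lower (P r)" assumes A: "A \<subseteq> {..<n}"
  and P1: "\<And>r. r \<in> A ==> P1 (rank_in A r) = P r"
  and P2: "\<And>r. r < n ==> r \<notin> A ==> P2 (rank_in (- A) r) = P r" and disk: "\<And>r. r < n ==> P r \<in> disk"
  and mono: "\<And>r s. r < s ==> s < n ==> Re (P r) \<le> Re (P s)" and inj: "inj_on P A" "inj_on P ({..<n} - A)"
 shows "stack_cover (wcover (nths W A) P1) (wcover (nths W (- A)) P2) =
  deck coords (\<lambda>(i, j). - int (card (colour_pairs ((!) W) (inv_pairs n A) i j))) (wcover W (Q P A))"
proof -
 let ?B = "{..<n} - A" and ?c = "(!) W" and ?Q = "Q P A"
 have I: "A \<inter> {..<length W} = A" "- A \<inter> {..<length W} = ?B" using A by (auto simp: n_def)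
 have fin: "finite A" "finite ?B" using A finite_subset by auto
 let ?QA = "wpairs n \<inter> A \<times> A" and ?QB = "wpairs n \<inter> ?B \<times> ?B"
 have tA: "tournament A ?QA" and tB: "tournament ?B ?QB" using tournament_sub[OF tournament_wpairs] A by auto
 have w1: "wcover (nths W A) P1 = (lab A ?c P, \<lambda>k\<in>coords. lab_angle A ?QA ?c P k)"
  using wcover_nths[of A W P1 P] P1 unfolding I n_def by simp
 have w2: "wcover (nths W (- A)) P2 = (lab ?B ?c P, \<lambda>k\<in>coords. lab_angle ?B ?QB ?c P k)"
  using wcover_nths[of "- A" W P2 P] P2 unfolding I n_def by simp
 have conf: "stack (lab A ?c P) (lab ?B ?c P) = lab {..<n} ?c ?Q"
 proof
  fix i
  show "stack (lab A ?c P) (lab ?B ?c P) i = lab {..<n} ?c ?Q i"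
   using A by (auto simp: stack_def lab_def Q_def image_iff split: if_splits)
 qed
 have angle: "lab_angle A ?QA ?c P (i, j) + lab_angle ?B ?QB ?c P (i, j) + rescale_angle upper (lab A ?c P) (i, j)
   + rescale_angle lower (lab ?B ?c P) (i, j) + cross_angle (lab A ?c P) (lab ?B ?c P) (i, j) =
   lab_angle {..<n} (wpairs n) ?c ?Q (i, j) + 2 * pi * of_int (- int (card (colour_pairs ?c (inv_pairs n A) i j)))"
  for i j
 proof -
  let ?g = "\<lambda>(r, s). ang (?Q r) (?Q s)" and ?C = "\<lambda>R. colour_pairs ?c R i j"
  define M where "M = {(r, s) \<in> A \<times> ?B. ?c r = i \<and> ?c s = j \<or> ?c r = j \<and> ?c s = i}"
  define M1 where "M1 = {(r, s) \<in> M. r < s}"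
  define M2 where "M2 = ?C (inv_pairs n A)"
  have finM: "finite M" by (rule finite_subset[of _ "A \<times> ?B"]) (use fin in \<open>auto simp: M_def\<close>)
  have finM1: "finite M1" by (rule finite_subset[OF _ finM]) (auto simp: M1_def)
  have finC: "finite (?C ?QA)" "finite (?C ?QB)"
   by (rule finite_colour_pairs[OF fin(1) tA], rule finite_colour_pairs[OF fin(2) tB])
  have finM2: "finite M2" by (rule finite_subset[OF _ finite_inv_pairs]) (auto simp: M2_def colour_pairs_def)
  \<comment> \<open>Within one disk the rescaling preserves real parts, hence the left to right
    order, and its angle corrects each pair exactly.\<close>
  have half: "lab_angle B (wpairs n \<inter> B \<times> B) ?c P (i, j) + rescale_angle h (lab B ?c P) (i, j) = sum ?g (?C (wpairs n \<inter> B \<times> B))"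
   if B: "tournament B (wpairs n \<inter> B \<times> B)" "inj_on P B" and h: "h = upper \<or> h = lower" "\<And>r. r \<in> B ==> ?Q r = h (P r)"
   for B h unfolding lab_angle_def split rescale_angle_lab[OF B(2,1)] sum.distrib[symmetric]
  proof (rule sum.cong[OF refl])
   fix x assume x: "x \<in> ?C (wpairs n \<inter> B \<times> B)"
   obtain r s where rs: "x = (r, s)" by (cases x)
   have *: "r \<in> B" "s \<in> B" "r < s" "s < n" using x by (auto simp: rs colour_pairs_def wpairs_def)
   then have "P r \<noteq> P s" using inj_onD[OF B(2), of r s] by auto
   then have "ang (h (P r)) (h (P s)) = ang (P r) (P s) + 2 * Arg ((h (P s) - h (P r)) / (P s - P r))"
    using mono[OF *(3,4)] rescale_pos[of "P r" "P s"] h(1) by (intro ang_rescale) (auto simp: upper_def lower_def)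
   then show "(case x of (r, s) => ang (P r) (P s)) + (case x of (r, s) => 2 * Arg ((h (P s) - h (P r)) / (P s - P r))) = ?g x"
    using h(2)[OF *(1)] h(2)[OF *(2)] by (simp add: rs)
  qed
  have 1: "lab_angle A ?QA ?c P (i, j) + rescale_angle upper (lab A ?c P) (i, j) = sum ?g (?C ?QA)"
   by (intro half tA inj) (auto simp: Q_def)
  have 2: "lab_angle ?B ?QB ?c P (i, j) + rescale_angle lower (lab ?B ?c P) (i, j) = sum ?g (?C ?QB)"
   by (intro half tB inj) (auto simp: Q_def)
  have 3: "cross_angle (lab A ?c P) (lab ?B ?c P) (i, j) = sum ?g M"
   unfolding cross_angle_lab[OF fin inj] M_def by (rule sum.cong) (auto simp: Q_def)
  have M2: "(r, s) \<in> M2 \<longleftrightarrow> (r, s) \<in> M \<and> s < r" for r s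
   using A by (auto simp: M2_def M_def colour_pairs_def inv_pairs_def)
  have M1: "(r, s) \<in> M1 \<longleftrightarrow> (r, s) \<in> M \<and> r < s" for r s by (simp add: M1_def)
  have "r \<noteq> s" if "(r, s) \<in> M" for r s using that by (auto simp: M_def)
  then have "(r, s) \<in> M \<longleftrightarrow> (r, s) \<in> M1 \<union> M2" for r s
   unfolding Un_iff M1 M2 by (metis nat_neq_iff)
  then have M: "M = M1 \<union> M2" by (intro Set.set_eqI) (simp only: split_paired_all)
  have disj: "M1 \<inter> M2 = {}" using M1 M2 by (auto dest: less_asym)
  have 4: "sum ?g M = sum ?g M1 + sum ?g M2"
   by (rule trans[OF arg_cong[OF M, of "sum ?g"] sum.union_disjoint[OF finM1 finM2 disj]])
  \<comment> \<open>\<open>M2\<close> lists the mixed pairs in which the point of the lower disk has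
    the smaller number and so is not to the right. \<open>cross_angle\<close> measures them from the
    upper point and \<open>wcover\<close> from the point with the smaller number, hence the
    difference of 2 pi.\<close>
  have 5: "sum ?g (prod.swap ` M2) = sum ?g M2 + 2 * pi * real (card M2)"
  proof -
   have "?g (prod.swap x) = ?g x + 2 * pi" if "x \<in> M2" for x
   proof -
    obtain m m' where x: "x = (m, m')" by (cases x)
    have *: "m \<in> A" "m < n" "m' \<notin> A" "m' < m" using that by (auto simp: x M2_def colour_pairs_def inv_pairs_def)
    have "ang (lower (P m')) (upper (P m)) = ang (upper (P m)) (lower (P m')) + 2 * pi"
     using mono[OF *(4,2)] disk[of m] disk[of m'] * by (intro ang_swap) (auto simp: upper_def lower_def disk_def)
    then show ?thesis using * by (simp add: x Q_def)
   qed
   moreover have "inj_on prod.swap M2" by (auto simp: inj_on_def)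
   ultimately show ?thesis by (simp add: sum.reindex sum.distrib)
  qed
  have "?C (wpairs n) = (?C ?QA \<union> ?C ?QB) \<union> (M1 \<union> prod.swap ` M2)" (is "?L = ?R")
  proof (rule Set.set_eqI)
   fix x :: "nat \<times> nat"
   obtain r s where x: "x = (r, s)" by (cases x)
   have 0: "x \<in> prod.swap ` M2 \<longleftrightarrow> (s, r) \<in> M2" unfolding x by force
   show "x \<in> ?L \<longleftrightarrow> x \<in> ?R"
    unfolding Un_iff 0 unfolding x M1 M2 using A by (auto simp: M_def colour_pairs_def wpairs_def)
  qed
  moreover have "(?C ?QA \<union> ?C ?QB) \<inter> (M1 \<union> prod.swap ` M2) = {}"
   by (auto simp: M1 M2 M_def colour_pairs_def)
  moreover have "?C ?QA \<inter> ?C ?QB = {}" "M1 \<inter> prod.swap ` M2 = {}"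
   by (auto simp: M1 M2 M_def colour_pairs_def)
  ultimately have 6: "sum ?g (?C (wpairs n)) = (sum ?g (?C ?QA) + sum ?g (?C ?QB)) + (sum ?g M1 + sum ?g (prod.swap ` M2))"
   by (simp only: sum.union_disjoint finC finM1 finM2 finite_UnI finite_imageI)
  have "lab_angle {..<n} (wpairs n) ?c ?Q (i, j) = sum ?g (?C (wpairs n))" by (simp add: lab_angle_def)
  then show ?thesis using 1 2 3 4 5 6 by (simp add: M2_def)
 qed
 have fst: "fst (stack_cover (wcover (nths W A) P1) (wcover (nths W (- A)) P2)) = fst (wcover W ?Q)"
  unfolding stack_cover_simps w1 w2 by (simp add: conf) (simp add: n_def)
 have snd: "snd (stack_cover (wcover (nths W A) P1) (wcover (nths W (- A)) P2)) = (\<lambda>k\<in>coords. snd (wcover W ?Q) k +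
   2 * pi * of_int ((\<lambda>(i, j). - int (card (colour_pairs ?c (inv_pairs n A) i j))) k))"
  unfolding stack_cover_simps w1 w2 fst_conv snd_conv unfolding wcover_def n_def[symmetric]
  by (rule restrict_ext) (use angle in \<open>auto simp: split_beta\<close>)
 show ?thesis using fst snd by (simp add: deck_def split_beta prod_eq_iff)
qed

lemma inj_rank_in: "inj_on (rank_in A) A" by (rule linorder_inj_onI) (auto dest: rank_in_less)

text \<open>\<open>stack_wcover\<close> for whole simplices: every simplex in the product of two
  word cells is a deck translate of the word cell of a shuffle, with other heights.\<close>

lemma stack_hsimp:
 fixes W :: "'i::{finite,linorder} list"
 defines "n \<equiv> length W" assumes A: "A \<subseteq> {..<n}"
  and Y: "inj_on Y {..<rank_in A n}" "\<And>r. r < rank_in A n ==> \<bar>Y r\<bar> \<le> 1"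
  and Y': "inj_on Y' {..<rank_in (- A) n}" "\<And>r. r < rank_in (- A) n ==> \<bar>Y' r\<bar> \<le> 1"
 shows "stack_simplex n A (hsimp (nths W A) Y) (hsimp (nths W (- A)) Y') =
  restrict (deck coords (\<lambda>(i, j). - int (card (colour_pairs ((!) W) (inv_pairs n A) i j))) \<circ>
   hsimp W (\<lambda>r. if r \<in> A then (Y (rank_in A r) + 2) / 3 else (Y' (rank_in (- A) r) - 2) / 3)) (standard_simplex n)" (is "?L = ?R")
proof (rule ext)
 fix x
 let ?P = "\<lambda>r. Complex (- 1 + 2 * psum r x) (if r \<in> A then Y (rank_in A r) else Y' (rank_in (- A) r))"
 have l: "length (nths W A) = rank_in A n" "length (nths W (- A)) = rank_in (- A) n"
  by (simp_all add: length_nths_rank n_def)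
 show "?L x = ?R x"
 proof (cases "x \<in> standard_simplex n")
  case x: True
  have inj: "inj_on ?P I"
   if "inj_on Z (rank_in B ` I)" "I \<subseteq> B" "\<And>r. r \<in> I ==> (if r \<in> A then Y (rank_in A r) else Y' (rank_in (- A) r)) = Z (rank_in B r)" for I B Z
  proof (rule inj_onI)
   fix r s assume rs: "r \<in> I" "s \<in> I" "?P r = ?P s"
   then have "Z (rank_in B r) = Z (rank_in B s)" using that(3)[OF rs(1)] that(3)[OF rs(2)] by simp
   then have "rank_in B r = rank_in B s" by (rule inj_onD[OF that(1)]) (rule imageI, rule rs)+
   then show "r = s" by (rule inj_onD[OF inj_rank_in[of B]]) (rule subsetD[OF that(2)], rule rs)+
  qed
  have AI: "A \<inter> {..<n} = A" "- A \<inter> {..<n} = {..<n} - A" using A by auto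
  have im: "rank_in A ` A = {..<rank_in A n}" "rank_in (- A) ` ({..<n} - A) = {..<rank_in (- A) n}"
   using bij_rank_in[of A n] bij_rank_in[of "- A" n] unfolding AI bij_betw_def by auto
  have inj1: "inj_on ?P A" by (rule inj[of Y A]) (use Y im in auto)
  have inj2: "inj_on ?P ({..<n} - A)" by (rule inj[of Y' "- A"]) (use Y' im in auto)
  have disk: "?P r \<in> disk" if "r < n" for r
  proof -
   have "r \<in> A ==> \<bar>Y (rank_in A r)\<bar> \<le> 1" "r \<notin> A ==> \<bar>Y' (rank_in (- A) r)\<bar> \<le> 1"
    using Y(2)[of "rank_in A r"] Y'(2)[of "rank_in (- A) r"] rank_in_less[of r A n] rank_in_less[of r "- A" n] that by auto
   then show ?thesis using psum_bounds[OF x, of r] that by (auto simp: disk_def abs_le_iff)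
  qed
  have mono: "Re (?P r) \<le> Re (?P s)" if "r < s" "s < n" for r s using psum_mono[OF x, of r s] that by simp
  have 1: "Complex (- 1 + 2 * psum (rank_in A r) (vertex_map n (rank_in A) x)) (Y (rank_in A r)) = ?P r" if "r \<in> A" for r
   using that A psum_vertex_map[of r A n x] by auto
  have 2: "Complex (- 1 + 2 * psum (rank_in (- A) r) (vertex_map n (rank_in (- A)) x)) (Y' (rank_in (- A) r)) = ?P r" if "r < n" "r \<notin> A" for r
   using that psum_vertex_map[of r "- A" n x] by auto
  have v: "vertex_map n (rank_in B) x \<in> standard_simplex (rank_in B n)" for B
   by (rule vertex_map_in_simplex[OF x rank_in_mono])
  have "stack_simplex n A (hsimp (nths W A) Y) (hsimp (nths W (- A)) Y') x =
    stack_cover (wcover (nths W A) (\<lambda>r. Complex (- 1 + 2 * psum r (vertex_map n (rank_in A) x)) (Y r)))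
     (wcover (nths W (- A)) (\<lambda>r. Complex (- 1 + 2 * psum r (vertex_map n (rank_in (- A)) x)) (Y' r)))"
   using x v[of A] v[of "- A"] by (simp add: stack_simplex_def hsimp_def wsimp_def l rank_in_Compl[symmetric] rank_in_def[symmetric])
  also have "\<dots> = deck coords (\<lambda>(i, j). - int (card (colour_pairs ((!) W) (inv_pairs n A) i j)))
    (wcover W (\<lambda>r. if r \<in> A then upper (?P r) else lower (?P r)))"
   unfolding n_def by (rule stack_wcover) (use A 1 2 disk mono inj1 inj2 in \<open>simp_all add: n_def\<close>)
  also have "(\<lambda>r. if r \<in> A then upper (?P r) else lower (?P r)) =
    (\<lambda>r. Complex (- 1 + 2 * psum r x) (if r \<in> A then (Y (rank_in A r) + 2) / 3 else (Y' (rank_in (- A) r) - 2) / 3))"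
   by (auto simp: upper_def lower_def)
  also have "wcover W \<dots> = hsimp W (\<lambda>r. if r \<in> A then (Y (rank_in A r) + 2) / 3 else (Y' (rank_in (- A) r) - 2) / 3) x"
   using x by (simp add: hsimp_def wsimp_def n_def)
  finally show ?thesis by (simp only: o_def restrict_apply x if_True)
 qed (simp add: stack_simplex_def)
qed

subsection \<open>The monodromy of a shuffle\<close>

lemma conf_mono_0: "conf_mono a d (\<lambda>_. 0) = 1" by (simp add: conf_mono_def split_beta)

lemma conf_mono_add: "conf_mono a d (\<lambda>k. m k + n k) = conf_mono a d m * conf_mono a d n"
proof -
 have 1: "(\<Prod>i\<in>UNIV. (if even (m (i, i) + n (i, i)) then 1 else - 1) * vpow (2 * int (d i) * (m (i, i) + n (i, i)))) =
   (\<Prod>i\<in>UNIV. (if even (m (i, i)) then 1 else - 1) * vpow (2 * int (d i) * m (i, i))) *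
   (\<Prod>i\<in>UNIV. (if even (n (i, i)) then 1 else - 1) * vpow (2 * int (d i) * n (i, i)))"
  unfolding prod.distrib[symmetric] by (rule prod.cong) (auto simp: distrib_left vpow_add)
 have 2: "(\<Prod>(i, j)\<in>{(i, j). i < j}. vpow (int (d i) * a i j * (m (i, j) + n (i, j)))) =
   (\<Prod>(i, j)\<in>{(i, j). i < j}. vpow (int (d i) * a i j * m (i, j))) *
   (\<Prod>(i, j)\<in>{(i, j). i < j}. vpow (int (d i) * a i j * n (i, j)))"
  unfolding prod.distrib[symmetric] by (rule prod.cong) (auto simp: distrib_left vpow_add)
 show ?thesis unfolding conf_mono_def 1 2 by (simp only: mult_ac)
qed

text \<open>The monodromy of one negative turn of a pair of points, without the sign that occurs for
  equal colours. That sign is treated together with the orientations.\<close>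

definition braid :: "('i => 'i => int) => ('i => nat) => 'i => 'i => laurent" where
 "braid a d i j = vpow (- (int (d i) * a i j))"

text \<open>For equal colours the inverse of -q^d appears, and 2 d is the inner product of the root
  with itself. For different colours the torus coordinate has the smaller colour first, and symmetry
  of \<open>d i * a i j\<close> covers the other order.\<close>

lemma conf_mono_pair:
 fixes x y :: "'i::{finite,linorder}" assumes "cartan_datum a d"
 shows "conf_mono a d (\<lambda>(i, j). if x = i \<and> y = j \<or> x = j \<and> y = i then - 1 else 0) =
  (if x = y then - 1 else 1) * braid a d x y"
proof -
 let ?n = "\<lambda>x y (i, j). if x = i \<and> y = j \<or> x = j \<and> y = i then - 1 else (0 :: int)"
 have sym: "int (d i) * a i j = int (d j) * a j i" and two: "a i i = 2" for i j
  using assms by (auto simp: cartan_datum_def)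
 have *: "conf_mono a d (?n x y) = braid a d x y" if "x < y" for x y
 proof -
  have "(\<Prod>i\<in>UNIV. (if even (?n x y (i, i)) then 1 else - 1) * vpow (2 * int (d i) * ?n x y (i, i))) = 1"
   by (rule prod.neutral) (use that in auto)
  moreover have "(\<Prod>(i, j)\<in>{(i, j). i < j}. vpow (int (d i) * a i j * ?n x y (i, j))) =
    (\<Prod>k\<in>{(i, j). i < j}. if k = (x, y) then braid a d x y else 1)"
  proof (rule prod.cong[OF refl])
   fix k :: "'i \<times> 'i" assume k: "k \<in> {(i, j). i < j}"
   obtain i j where ij: "k = (i, j)" by (cases k)
   have "?n x y (i, j) = (if k = (x, y) then - 1 else 0)" using that k ij by auto
   then show "(case k of (i, j) => vpow (int (d i) * a i j * ?n x y (i, j))) = (if k = (x, y) then braid a d x y else 1)"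
    unfolding ij prod.case by (simp add: braid_def)
  qed
  moreover have "(\<Prod>k\<in>{(i, j). i < j}. if k = (x, y) then braid a d x y else 1) = braid a d x y"
   using that by (subst prod.delta) auto
  ultimately show ?thesis by (simp only: conf_mono_def) simp
 qed
 consider "x = y" | "x < y" | "y < x" by fastforce
 then show ?thesis
 proof cases
  case 1
  have "(\<Prod>i\<in>UNIV. (if even (?n x x (i, i)) then 1 else - 1) * vpow (2 * int (d i) * ?n x x (i, i))) =
    (\<Prod>i\<in>UNIV. if i = x then - braid a d x x else 1)" by (rule prod.cong) (auto simp: braid_def two mult.commute)
  moreover have "(\<Prod>(i, j)\<in>{(i, j). i < j}. vpow (int (d i) * a i j * ?n x x (i, j))) = 1"
   by (rule prod.neutral) auto
  ultimately show ?thesis using 1 by (simp add: conf_mono_def prod.delta)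
 next
  case 2
  then show ?thesis using * by auto
 next
  case 3
  have "?n x y = ?n y x" by (auto simp: fun_eq_iff)
  then show ?thesis using * 3 sym[of x y] by (auto simp: braid_def)
 qed
qed

lemma conf_mono_pairs: assumes "cartan_datum a d" "finite R"
 shows "conf_mono a d (\<lambda>(i, j). - int (card (colour_pairs col R i j))) =
  (\<Prod>(m, m')\<in>R. (if col m = col m' then - 1 else 1) * braid a d (col m) (col m'))" using assms(2)
proof (induction R)
 case empty
 then show ?case by (simp add: colour_pairs_def case_prod_unfold conf_mono_0)
next
 case (insert x R)
 obtain m m' where x: "x = (m, m')" by (cases x)
 have "colour_pairs col (insert x R) i j =
   (if col m = i \<and> col m' = j \<or> col m = j \<and> col m' = i then insert x (colour_pairs col R i j) else colour_pairs col R i j)" for i j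
  by (auto simp: colour_pairs_def x)
 moreover have "x \<notin> colour_pairs col R i j" "finite (colour_pairs col R i j)" for i j
  using insert(1,2) finite_subset[of "colour_pairs col R i j" R] by (auto simp: colour_pairs_def)
 ultimately have "(\<lambda>(i, j). - int (card (colour_pairs col (insert x R) i j))) =
   (\<lambda>k. (\<lambda>(i, j). if col m = i \<and> col m' = j \<or> col m = j \<and> col m' = i then - 1 else 0) k +
    (\<lambda>(i, j). - int (card (colour_pairs col R i j))) k)" by (auto simp: fun_eq_iff)
 then show ?case using insert conf_mono_pair[OF assms(1), of "col m" "col m'"] by (simp add: conf_mono_add x)
qed

subsection \<open>Signs\<close>

definition descents :: "'i::linorder list => (nat \<times> nat) set" where
 "descents w = {(r, s). r < s \<and> s < length w \<and> w ! s < w ! r}"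

text \<open>The descents give the sign between the left to right order of the points and the order
  colour by colour that orients products; the length gives the orientation of barycentric
  coordinates, as in \<open>F_chain\<close>.\<close>

definition wsign :: "'i::linorder list => laurent" where
 "wsign w = (- 1) ^ (length w + card (descents w))"

lemma card_descents_nths:
 fixes W :: "'i::linorder list"
 shows "card (descents (nths W A)) = card {(r, s) \<in> descents W. r \<in> A \<and> s \<in> A}"
proof -
 let ?f = "rank_in A" and ?I = "A \<inter> {..<length W}" and ?D = "{(r, s) \<in> descents W. r \<in> A \<and> s \<in> A}"
 have im: "{..<length (nths W A)} = ?f ` ?I"
  using bij_rank_in[of A "length W"] by (auto simp: bij_betw_def length_nths_rank)
 have w: "nths W A ! ?f r = W ! r" if "r \<in> ?I" for r using that nth_nths_rank[of r A W] by simp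
 have mono: "?f r < ?f s \<longleftrightarrow> r < s" if "r \<in> ?I" "s \<in> ?I" for r s
  using that rank_in_le_iff[of r A s] by (auto simp: not_le[symmetric])
 have "descents (nths W A) = map_prod ?f ?f ` ?D"
 proof (rule Set.set_eqI)
  fix x :: "nat \<times> nat"
  obtain r s where x: "x = (r, s)" by (cases x)
  have "x \<in> descents (nths W A) \<longleftrightarrow> r < s \<and> r \<in> ?f ` ?I \<and> s \<in> ?f ` ?I \<and> nths W A ! s < nths W A ! r"
   unfolding x im[symmetric] by (auto simp: descents_def)
  also have "\<dots> \<longleftrightarrow> (\<exists>a\<in>?I. \<exists>b\<in>?I. r = ?f a \<and> s = ?f b \<and> a < b \<and> W ! b < W ! a)"
   unfolding image_iff using mono w by (smt (verit))
  also have "\<dots> \<longleftrightarrow> x \<in> map_prod ?f ?f ` ?D"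
   unfolding x mem_map_prod_image by (auto simp: descents_def)
  finally show "x \<in> descents (nths W A) \<longleftrightarrow> x \<in> map_prod ?f ?f ` ?D" .
 qed
 moreover have "inj_on (map_prod ?f ?f) ?D"
  by (rule inj_on_subset[of _ "A \<times> A"]) (use inj_rank_in[of A] in \<open>auto simp: inj_on_def\<close>)
 ultimately show ?thesis by (simp add: card_image)
qed

text \<open>The products of multiplicities in \<open>colour_sign\<close> count the mixed pairs of
  letters whose colours are in the wrong order, wherever these letters stand in the word.\<close>

lemma colour_sign_cards:
 fixes W :: "'i::{finite,linorder} list" shows "colour_sign (wt (nths W A)) (wt (nths W (- A))) =
  (- 1) ^ card {(m, m'). m \<in> A \<and> m' \<notin> A \<and> m < length W \<and> m' < length W \<and> W ! m' < W ! m}"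
proof -
 let ?n = "length W"
 define S where "S = {(m, m'). m \<in> A \<and> m' \<notin> A \<and> m < ?n \<and> m' < ?n \<and> W ! m' < W ! m}"
 have fin: "finite S" by (rule finite_subset[of _ "{..<?n} \<times> {..<?n}"]) (auto simp: S_def)
 have wt: "wt (nths W B) i = card {m \<in> B. m < ?n \<and> W ! m = i}" for B i
 proof -
  have "wt (nths W B) i = card {r. r < length (nths W B) \<and> nths W B ! r = i}" by (simp add: card_letters)
  also have "{r. r < length (nths W B) \<and> nths W B ! r = i} = rank_in B ` {m \<in> B. m < ?n \<and> W ! m = i}"
  proof (rule Set.set_eqI)
   fix r
   have im: "{..<length (nths W B)} = rank_in B ` (B \<inter> {..<?n})"
    using bij_rank_in[of B ?n] by (auto simp: bij_betw_def length_nths_rank)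
   have "r \<in> {r. r < length (nths W B) \<and> nths W B ! r = i} \<longleftrightarrow> r \<in> rank_in B ` (B \<inter> {..<?n}) \<and> nths W B ! r = i"
    unfolding im[symmetric] by auto
   then show "r \<in> {r. r < length (nths W B) \<and> nths W B ! r = i} \<longleftrightarrow> r \<in> rank_in B ` {m \<in> B. m < ?n \<and> W ! m = i}"
    by (auto simp: nth_nths_rank)
  qed
  also have "card \<dots> = card {m \<in> B. m < ?n \<and> W ! m = i}"
   by (intro card_image inj_on_subset[OF inj_rank_in]) auto
  finally show ?thesis .
 qed
 have "(\<Sum>(i, j)\<in>{(i, j). i < j}. wt (nths W (- A)) i * wt (nths W A) j) =
   (\<Sum>k\<in>{(i, j). i < j}. \<Sum>x\<in>{x \<in> S. (W ! snd x, W ! fst x) = k}. 1)"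
 proof (rule sum.cong[OF refl])
  fix k :: "'i \<times> 'i" assume k: "k \<in> {(i, j). i < j}"
  obtain i j where ij: "k = (i, j)" by (cases k)
  have "{x \<in> S. (W ! snd x, W ! fst x) = k} = {m \<in> A. m < ?n \<and> W ! m = j} \<times> {m \<in> - A. m < ?n \<and> W ! m = i}"
   using k by (auto simp: S_def ij)
  then show "(case k of (i, j) => wt (nths W (- A)) i * wt (nths W A) j) = (\<Sum>x\<in>{x \<in> S. (W ! snd x, W ! fst x) = k}. 1)"
   unfolding ij prod.case wt by (simp add: card_cartesian_product mult.commute)
 qed
 also have "\<dots> = card S" by (subst sum.group[OF fin finite]) (auto simp: S_def)
 finally show ?thesis by (simp add: colour_sign_def S_def)
qed

text \<open>A parity count. Mixed pairs of letters are sorted by position and colour into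
  \<open>x0\<close>, \<open>x1\<close>, \<open>x2\<close>, \<open>x3\<close>. The colour sign, the
  shuffle sign, the signs of the subwords and the monodromy signs of equal colours together exceed
  the exponent of \<open>wsign W\<close> by the even number
  \<open>2 * (card x2 + card x0)\<close>.\<close>

lemma sign_shuffle:
 fixes W :: "'i::{finite,linorder} list" assumes A: "A \<subseteq> {..<length W}"
 shows "colour_sign (wt (nths W A)) (wt (nths W (- A))) * shuffle_sign (length W) A *
   (wsign (nths W A) * wsign (nths W (- A))) * (\<Prod>(m, m')\<in>inv_pairs (length W) A. if W ! m = W ! m' then - 1 else 1) = wsign W"
proof -
 let ?n = "length W" and ?I = "inv_pairs (length W) A"
 have fin: "finite B" if "B \<subseteq> {..<?n} \<times> {..<?n}" for B :: "(nat \<times> nat) set"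
  using that by (rule finite_subset) auto
 define x1 where "x1 = {(m, m'). m \<in> A \<and> m' \<notin> A \<and> m < m' \<and> m' < ?n \<and> W ! m' < W ! m}"
 define x2 where "x2 = {(m, m') \<in> ?I. W ! m' < W ! m}"
 define x3 where "x3 = {(m, m') \<in> ?I. W ! m < W ! m'}"
 define x0 where "x0 = {(m, m') \<in> ?I. W ! m = W ! m'}"
 define dA where "dA = {(r, s) \<in> descents W. r \<in> A \<and> s \<in> A}"
 define dB where "dB = {(r, s) \<in> descents W. r \<in> - A \<and> s \<in> - A}"
 note defs = x1_def x2_def x3_def x0_def dA_def dB_def inv_pairs_def descents_def
 have f: "finite x1" "finite x2" "finite x3" "finite x0" "finite dA" "finite dB"
  by (rule fin; use A in \<open>auto simp: defs\<close>)+
 have c0: "card {(m, m'). m \<in> A \<and> m' \<notin> A \<and> m < ?n \<and> m' < ?n \<and> W ! m' < W ! m} = card x1 + card x2"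
 proof -
  have "{(m, m'). m \<in> A \<and> m' \<notin> A \<and> m < ?n \<and> m' < ?n \<and> W ! m' < W ! m} = x1 \<union> x2"
   by (auto simp: defs) (metis nat_neq_iff)
  moreover have "x1 \<inter> x2 = {}" by (auto simp: defs)
  ultimately show ?thesis using f by (simp add: card_Un_disjoint)
 qed
 have c1: "card ?I = card x0 + card x2 + card x3"
 proof -
  have "?I = x0 \<union> x2 \<union> x3" by (auto simp: defs)
  moreover have "(x0 \<union> x2) \<inter> x3 = {}" "x0 \<inter> x2 = {}" by (auto simp: defs)
  ultimately show ?thesis using f by (simp add: card_Un_disjoint)
 qed
 have c2: "card (descents W) = card dA + card dB + card x1 + card x3"
 proof -
  have "descents W = ((dA \<union> dB) \<union> x1) \<union> prod.swap ` x3"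
  proof (rule Set.set_eqI)
   fix x :: "nat \<times> nat"
   obtain r s where x: "x = (r, s)" by (cases x)
   have "x \<in> prod.swap ` x3 \<longleftrightarrow> (s, r) \<in> x3" unfolding x by force
   then show "x \<in> descents W \<longleftrightarrow> x \<in> ((dA \<union> dB) \<union> x1) \<union> prod.swap ` x3"
    unfolding Un_iff x by (auto simp: defs)
  qed
  moreover have "((dA \<union> dB) \<union> x1) \<inter> prod.swap ` x3 = {}" "(dA \<union> dB) \<inter> x1 = {}" "dA \<inter> dB = {}"
   by (auto simp: defs)
  moreover have "card (prod.swap ` x3) = card x3" by (intro card_image) (auto simp: inj_on_def)
  ultimately show ?thesis using f by (simp add: card_Un_disjoint)
 qed
 have p: "(\<Prod>(m, m')\<in>?I. if W ! m = W ! m' then - 1 else 1) = ((- 1) ^ card x0 :: laurent)"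
 proof -
  have "(\<Prod>(m, m')\<in>?I. if W ! m = W ! m' then - 1 else (1 :: laurent)) = (\<Prod>k\<in>x0. - 1)"
   by (rule prod.mono_neutral_cong_right) (auto simp: x0_def split: if_splits)
  then show ?thesis by simp
 qed
 have l: "length (nths W A) + length (nths W (- A)) = ?n"
 proof -
  have "(\<Sum>i\<in>UNIV. wt (nths W A) i + wt (nths W (- A)) i) = (\<Sum>i\<in>UNIV. wt W i)" by (simp add: wt_nths)
  then show ?thesis using degree_of_wt[of W] degree_of_wt[of "nths W A"] degree_of_wt[of "nths W (- A)"]
   by (simp add: degree_of_def sum.distrib)
 qed
 have "colour_sign (wt (nths W A)) (wt (nths W (- A))) * shuffle_sign ?n A *
   (wsign (nths W A) * wsign (nths W (- A))) * (\<Prod>(m, m')\<in>?I. if W ! m = W ! m' then - 1 else 1) =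
   (- 1) ^ (card x1 + card x2 + card ?I + (length (nths W A) + card dA + (length (nths W (- A)) + card dB)) + card x0)"
  unfolding colour_sign_cards c0 p shuffle_sign_inv[OF A] wsign_def card_descents_nths dA_def[symmetric] dB_def[symmetric]
  by (simp only: power_add)
 also have "card x1 + card x2 + card ?I + (length (nths W A) + card dA + (length (nths W (- A)) + card dB)) + card x0 =
   (?n + card (descents W)) + 2 * (card x2 + card x0)" using c1 c2 l by simp
 also have "(- 1 :: laurent) ^ \<dots> = wsign W" by (simp add: power_add power_mult wsign_def)
 finally show ?thesis .
qed

section \<open>Symbols of homology classes\<close>

text \<open>The heights are just a uniform choice of distinct numbers in the disk; by
  \<open>hsimp_heights\<close> another choice gives the same class relative to the complement of
  \<open>spread\<close>.\<close>

definition esimp :: "'i::linorder list => (nat => real) => 'i conf_cover" where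
 "esimp w = hsimp w (\<lambda>r. 1 / real (r + 1))"

definition words :: "'i colouring => 'i list set" where
 "words c = {w. wt w = c}"

lemma finite_words [simp]: "finite (words (c :: 'i::finite colouring))"
 by (rule finite_subset[OF _ finite_lists_length_eq[OF finite_class.finite_UNIV, of "degree_of c"]])
  (auto simp: words_def degree_of_wt)

definition rep :: "('i::{finite,linorder} list => laurent) => 'i colouring => 'i conf_cover lchain" where
 "rep S c = (\<Sum>w\<in>words c. single (esimp w) (wsign w * S w))"

text \<open>A relation, not a function on classes. It asks that one and the same combination of word
  cells represents the class at \<open>spread c \<epsilon>\<close> for every
  \<open>\<epsilon>\<close>; the factor \<open>wsign\<close> in \<open>rep\<close> makes products of
  symbols free of signs.\<close>

definition has_symbol :: "('i::{finite,linorder} => 'i => int) => ('i => nat)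
  => ('i colouring => 'i conf_bm) => ('i list => laurent) => bool" where
 "has_symbol a d x S \<longleftrightarrow> x \<in> carrier (H_BM a d) \<and> (\<forall>c. \<forall>\<epsilon>>0. rep S c \<in> x c (spread c \<epsilon>))"

lemma spread_compacts: "0 < \<epsilon> ==> spread c \<epsilon> \<in> compacts (conf_twisted a d c)"
 by (simp add: compactin_spread)

lemma std_heights: "inj_on (\<lambda>r. 1 / real (r + 1)) B" "\<bar>1 / real (r + 1)\<bar> \<le> 1"
 by (auto simp: inj_on_def field_simps)

text \<open>Stacking gives a deck translate of a word cell with unusual heights. The monodromy
  relation removes the translation, and \<open>hsimp_heights\<close> restores the standard
  heights.\<close>

lemma esimp_shuffle:
 fixes W :: "'i::{finite,linorder} list" and a :: "'i => 'i => int" and d :: "'i => nat"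
 defines "n \<equiv> length W" and "T \<equiv> conf_twisted a d (wt W)"
 assumes A: "A \<subseteq> {..<n}" and \<epsilon>: "0 < \<epsilon>" and ad: "cartan_datum a d"
 shows "single (stack_simplex n A (esimp (nths W A)) (esimp (nths W (- A)))) r
   - single (esimp W) ((\<Prod>(m, m')\<in>inv_pairs n A. (if W ! m = W ! m' then - 1 else 1) * braid a d (W ! m) (W ! m')) * r)
  \<in> tw_boundaries T (off T (spread (wt W) \<epsilon>)) n"
proof -
 define h :: "nat => real" where "h = (\<lambda>r. 1 / real (r + 1))"
 have esimp: "esimp w = hsimp w h" for w :: "'i list" by (simp add: esimp_def h_def)
 have std: "inj_on h B" "\<bar>h r\<bar> \<le> 1" for B r unfolding h_def by (rule std_heights)+
 let ?N = "\<lambda>(i, j). - int (card (colour_pairs ((!) W) (inv_pairs n A) i j))"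
 let ?Y = "\<lambda>r. if r \<in> A then (h (rank_in A r) + 2) / 3 else (h (rank_in (- A) r) - 2) / 3"
 let ?q = "\<Prod>(m, m')\<in>inv_pairs n A. (if W ! m = W ! m' then - 1 else 1) * braid a d (W ! m) (W ! m')"
 have 1: "stack_simplex n A (esimp (nths W A)) (esimp (nths W (- A))) = simplex_map n (deck coords ?N) (hsimp W ?Y)"
  unfolding esimp n_def simplex_map_def by (rule stack_hsimp[OF A[unfolded n_def] std std])
 have 01: "0 < h r \<and> h r \<le> 1" for r by (simp add: h_def)
 \<comment> \<open>The rescaled heights are positive for points of the upper disk and negative for
   those of the lower one, so they can only agree within one disk.\<close>
 have Y: "inj_on ?Y {..<n}" "\<And>r. \<bar>?Y r\<bar> \<le> 1"
 proof -
  show "\<bar>?Y r\<bar> \<le> 1" for r using 01[of "rank_in A r"] 01[of "rank_in (- A) r"] by (cases "r \<in> A") (auto simp: abs_le_iff)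
  show "inj_on ?Y {..<n}"
  proof (rule inj_onI)
   fix r s assume eq: "?Y r = ?Y s"
   have rs: "r \<in> A \<longleftrightarrow> s \<in> A"
    using eq 01[of "rank_in A r"] 01[of "rank_in (- A) r"] 01[of "rank_in A s"] 01[of "rank_in (- A) s"]
    by (auto split: if_splits)
   show "r = s"
   proof (cases "r \<in> A")
    case True
    then have "rank_in A r = rank_in A s" using eq rs inj_onD[OF std(1)[of UNIV]] by simp
    then show ?thesis using inj_onD[OF inj_rank_in] True rs by blast
   next
    case False
    then have "rank_in (- A) r = rank_in (- A) s" using eq rs inj_onD[OF std(1)[of UNIV]] by simp
    then show ?thesis using inj_onD[OF inj_rank_in] False rs by blast
   qed
  qed
 qed
 have "singular_simplex n (torus_cover T) (hsimp W ?Y)"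
  unfolding n_def T_def by (rule singular_simplex_hsimp) (use Y in \<open>simp_all add: n_def\<close>)
 from mono_relations_gen[OF this, of ?N r]
 have "single (stack_simplex n A (esimp (nths W A)) (esimp (nths W (- A)))) r - single (hsimp W ?Y) (conf_mono a d ?N * r)
   \<in> mono_relations T n" by (simp add: mono_gen_def 1 T_def)
 then have "single (stack_simplex n A (esimp (nths W A)) (esimp (nths W (- A)))) r - single (hsimp W ?Y) (?q * r)
   \<in> tw_boundaries T (off T (spread (wt W) \<epsilon>)) n"
  unfolding conf_mono_pairs[OF ad finite_inv_pairs] using tw_null_boundaries tw_nullI2 by blast
 moreover have "single (hsimp W ?Y) (?q * r) - single (esimp W) (?q * r) \<in> tw_boundaries T (off T (spread (wt W) \<epsilon>)) n"
  unfolding esimp n_def T_def by (rule hsimp_heights) (use Y std \<epsilon> in \<open>simp_all add: n_def\<close>)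
 ultimately show ?thesis by (rule submod_diff_trans[OF submod_tw_boundaries])
qed

text \<open>Two words with a shuffle amount to one word with a set of positions whose letters have
  weight \<open>c\<close>; \<open>merge\<close> and \<open>nths\<close> are mutually
  inverse.\<close>

lemma shuffle_words:
 fixes c c' :: "'i::{finite,linorder} colouring"
 defines "p \<equiv> degree_of c" and "q \<equiv> degree_of c'"
 shows "(\<Sum>w\<in>words c. \<Sum>u\<in>words c'. \<Sum>A\<in>shuffles_of p q. F w u A) =
  (\<Sum>W\<in>words (\<lambda>i. c i + c' i). \<Sum>A\<in>{A \<in> Pow {..<length W}. wt (nths W A) = c}. F (nths W A) (nths W (- A)) A)"
proof -
 have card: "card A = rank_in A n" "rank_in A n + rank_in (- A) n = n" if "A \<subseteq> {..<n}" for A n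
 proof -
  show "card A = rank_in A n" unfolding rank_in_def using that by (simp add: Int_absorb2)
  have "card (A \<inter> {..<n}) + card (- A \<inter> {..<n}) = card ((A \<inter> {..<n}) \<union> (- A \<inter> {..<n}))"
   by (rule card_Un_disjoint[symmetric]) auto
  also have "(A \<inter> {..<n}) \<union> (- A \<inter> {..<n}) = {..<n}" by auto
  finally show "rank_in A n + rank_in (- A) n = n" by (simp add: rank_in_def)
 qed
 have rank: "rank_in A (p + q) = p" "rank_in (- A) (p + q) = q" if "A \<in> shuffles_of p q" for A
  using that card[of A "p + q"] by (auto simp: shuffles_of_def)
 have len: "length w = degree_of b" if "w \<in> words b" for w and b :: "'i colouring"
  using that degree_of_wt[of w] by (simp add: words_def)
 have "(\<Sum>w\<in>words c. \<Sum>u\<in>words c'. \<Sum>A\<in>shuffles_of p q. F w u A) =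
   (\<Sum>(w, u, A)\<in>words c \<times> words c' \<times> shuffles_of p q. F w u A)" by (simp add: sum.cartesian_product)
 also have "\<dots> = (\<Sum>(W, A)\<in>(SIGMA W:words (\<lambda>i. c i + c' i). {A \<in> Pow {..<length W}. wt (nths W A) = c}).
   F (nths W A) (nths W (- A)) A)"
 proof (rule sum.reindex_bij_witness[where i = "\<lambda>(W, A). (nths W A, nths W (- A), A)" and j = "\<lambda>(w, u, A). (merge (p + q) A w u, A)"])
  fix x assume "x \<in> words c \<times> words c' \<times> shuffles_of p q"
  then obtain w u A where x: "x = (w, u, A)" "w \<in> words c" "u \<in> words c'" "A \<in> shuffles_of p q" by auto
  have n: "nths (merge (p + q) A w u) A = w" "nths (merge (p + q) A w u) (- A) = u"
   using x nths_merge[of w A "p + q" u] rank[OF x(4)] len[OF x(2)] len[OF x(3)] by (auto simp: p_def q_def nths_merge)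
  then show "(\<lambda>(W, A). (nths W A, nths W (- A), A)) ((\<lambda>(w, u, A). (merge (p + q) A w u, A)) x) = x"
   "(case (\<lambda>(w, u, A). (merge (p + q) A w u, A)) x of (W, A) => F (nths W A) (nths W (- A)) A) = (case x of (w, u, A) => F w u A)"
   by (simp_all add: x)
  have "wt (merge (p + q) A w u) = (\<lambda>i. c i + c' i)"
   using wt_nths[of "merge (p + q) A w u" A] x(2,3) by (auto simp: n words_def)
  then show "(\<lambda>(w, u, A). (merge (p + q) A w u, A)) x \<in> (SIGMA W:words (\<lambda>i. c i + c' i). {A \<in> Pow {..<length W}. wt (nths W A) = c})"
   using x n by (auto simp: words_def shuffles_of_def)
 next
  fix x assume "x \<in> (SIGMA W:words (\<lambda>i. c i + c' i). {A \<in> Pow {..<length W}. wt (nths W A) = c})"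
  then obtain W A where x: "x = (W, A)" "W \<in> words (\<lambda>i. c i + c' i)" "A \<subseteq> {..<length W}" "wt (nths W A) = c" by auto
  have l: "length W = p + q" using len[OF x(2)] by (simp add: degree_of_add p_def q_def)
  then show "(\<lambda>(w, u, A). (merge (p + q) A w u, A)) ((\<lambda>(W, A). (nths W A, nths W (- A), A)) x) = x"
   using merge_nths[of W A] by (simp add: x)
  have "wt (nths W (- A)) = c'" using wt_nths[of W A] x(2,4) by (auto simp: words_def fun_eq_iff)
  moreover have "card A = p" using card(1)[OF x(3)] degree_of_wt[of "nths W A"] x(4) by (simp add: length_nths_rank p_def)
  ultimately show "(\<lambda>(W, A). (nths W A, nths W (- A), A)) x \<in> words c \<times> words c' \<times> shuffles_of p q"
   using x l by (simp add: words_def shuffles_of_def)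
 qed
 also have "\<dots> = (\<Sum>W\<in>words (\<lambda>i. c i + c' i). \<Sum>A\<in>{A \<in> Pow {..<length W}. wt (nths W A) = c}. F (nths W A) (nths W (- A)) A)"
  by (rule sum.Sigma[symmetric]) auto
 finally show ?thesis .
qed

text \<open>\<open>esimp_shuffle\<close> summed over all words and shuffles. By
  \<open>sign_shuffle\<close> the signs combine to \<open>wsign W\<close>, and only the braiding
  factors remain.\<close>

lemma cross_rep:
 fixes c c' :: "'i::{finite,linorder} colouring" and a :: "'i => 'i => int" and d :: "'i => nat"
 defines "T \<equiv> conf_twisted a d (\<lambda>i. c i + c' i)" and "n \<equiv> degree_of c + degree_of c'"
 assumes \<epsilon>: "0 < \<epsilon>" and ad: "cartan_datum a d"
 shows "smul (colour_sign c c') (cross stack_cover (degree_of c) (degree_of c') (rep S c) (rep S' c'))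
  - (\<Sum>W\<in>words (\<lambda>i. c i + c' i). \<Sum>A\<in>{A \<in> Pow {..<length W}. wt (nths W A) = c}.
    single (esimp W) (wsign W * (S (nths W A) * S' (nths W (- A)) * (\<Prod>(m, m')\<in>inv_pairs (length W) A. braid a d (W ! m) (W ! m')))))
  \<in> tw_boundaries T (off T (spread (\<lambda>i. c i + c' i) \<epsilon>)) n"
proof -
 let ?p = "degree_of c" and ?q = "degree_of c'"
 let ?W = "words (\<lambda>i. c i + c' i)" and ?A = "\<lambda>W. {A \<in> Pow {..<length W}. wt (nths W A) = c}"
 let ?s = "\<lambda>w u A. single (stack_simplex n A (esimp w) (esimp u))
   (colour_sign c c' * (shuffle_sign n A * (wsign w * S w * (wsign u * S' u))))"
 have "smul (colour_sign c c') (cross stack_cover ?p ?q (rep S c) (rep S' c')) =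
   (\<Sum>w\<in>words c. \<Sum>u\<in>words c'. \<Sum>A\<in>shuffles_of ?p ?q. ?s w u A)"
  by (simp add: rep_def cross_sum cross_single_shuffles smul_sum n_def) (rule sum.swap)
 also have "\<dots> = (\<Sum>W\<in>?W. \<Sum>A\<in>?A W. ?s (nths W A) (nths W (- A)) A)" by (rule shuffle_words)
 finally have eq: "smul (colour_sign c c') (cross stack_cover ?p ?q (rep S c) (rep S' c')) =
   (\<Sum>W\<in>?W. \<Sum>A\<in>?A W. ?s (nths W A) (nths W (- A)) A)" .
 have "?s (nths W A) (nths W (- A)) A - single (esimp W) (wsign W * (S (nths W A) * S' (nths W (- A)) *
   (\<Prod>(m, m')\<in>inv_pairs (length W) A. braid a d (W ! m) (W ! m')))) \<in> tw_boundaries T (off T (spread (\<lambda>i. c i + c' i) \<epsilon>)) n"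
  if W: "W \<in> ?W" and A: "A \<in> ?A W" for W A
 proof -
  have wt: "wt W = (\<lambda>i. c i + c' i)" "wt (nths W A) = c" using W A by (simp_all add: words_def)
  have wt': "wt (nths W (- A)) = c'" using wt_nths[of W A] wt by (simp add: fun_eq_iff)
  have n: "n = length W" using degree_of_wt[of W] by (simp add: n_def wt degree_of_add)
  let ?P = "\<Prod>(m, m')\<in>inv_pairs (length W) A. if W ! m = W ! m' then - 1 else (1 :: laurent)"
   and ?B = "\<Prod>(m, m')\<in>inv_pairs (length W) A. braid a d (W ! m) (W ! m')"
  have "(\<Prod>(m, m')\<in>inv_pairs (length W) A. (if W ! m = W ! m' then - 1 else 1) * braid a d (W ! m) (W ! m')) *
    (colour_sign c c' * (shuffle_sign n A * (wsign (nths W A) * S (nths W A) * (wsign (nths W (- A)) * S' (nths W (- A)))))) =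
    (colour_sign c c' * shuffle_sign n A * (wsign (nths W A) * wsign (nths W (- A))) * ?P) *
    (S (nths W A) * S' (nths W (- A)) * ?B)" by (simp add: case_prod_unfold prod.distrib mult_ac)
  also have "colour_sign c c' * shuffle_sign n A * (wsign (nths W A) * wsign (nths W (- A))) * ?P = wsign W"
   using sign_shuffle[of A W] A by (simp add: wt(2) wt' n)
  finally have e: "(\<Prod>(m, m')\<in>inv_pairs (length W) A. (if W ! m = W ! m' then - 1 else 1) * braid a d (W ! m) (W ! m')) *
    (colour_sign c c' * (shuffle_sign n A * (wsign (nths W A) * S (nths W A) * (wsign (nths W (- A)) * S' (nths W (- A)))))) =
    wsign W * (S (nths W A) * S' (nths W (- A)) * ?B)" .
  have "A \<subseteq> {..<length W}" using A by simp
  from esimp_shuffle[OF this \<epsilon> ad, of "colour_sign c c' * (shuffle_sign n A * (wsign (nths W A) * S (nths W A) * (wsign (nths W (- A)) * S' (nths W (- A)))))"]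
  show ?thesis unfolding wt(1) T_def n[symmetric] unfolding e[unfolded n[symmetric]] .
 qed
 then show ?thesis unfolding eq sum_subtractf[symmetric] by (intro submod_sum[OF submod_tw_boundaries])
qed

section \<open>Products in the direct sum over all colourings\<close>

lemma finite_below: "finite {c'. c' \<le> (c :: 'i::finite colouring)}"
proof -
 have "{c'. c' \<le> c} = (\<Pi>\<^sub>E i\<in>UNIV. {..c i})" by (auto simp: le_fun_def)
 then show ?thesis by (simp add: finite_PiE)
qed

lemma carrier_H_BM: "x \<in> carrier (H_BM a d) \<longleftrightarrow> (\<forall>c. x c \<in> conf_homology a d c) \<and> finite {c. x c \<noteq> conf_zero a d c}"
 by (simp add: H_BM_def)

text \<open>Nonemptiness matters: an empty sum of sets is the set containing only 0, which need not
  be a coset.\<close>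

lemma sum_tw_class:
 "finite I ==> I \<noteq> {} ==> (\<Sum>i\<in>I. tw_class T A p (z i)) = tw_class T A p (\<Sum>i\<in>I. z i)"
 by (induction I rule: finite_ne_induct) (simp_all add: tw_class_add)

lemma below_split: "c' \<le> c ==> (\<lambda>i. c' i + (c i - c' i)) = (c :: 'i colouring)" by (auto simp: le_fun_def)

lemma degree_below:
 fixes c c' :: "'i::finite colouring" assumes "c' \<le> c"
 shows "degree_of c' + degree_of (\<lambda>i. c i - c' i) = degree_of c"
 using arg_cong[OF below_split[OF assms], of degree_of] by (simp add: degree_of_add)

context
 fixes a :: "'i::{finite,linorder} => 'i => int" and d :: "'i => nat" and x y :: "'i colouring => 'i conf_bm"
 assumes x: "\<And>c. x c \<in> conf_homology a d c" and y: "\<And>c. y c \<in> conf_homology a d c"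
begin

lemma H_mult_class: assumes K: "K \<in> compacts (conf_twisted a d c)"
  and z: "\<And>c'. c' \<le> c ==> z c' \<in> conf_mult a d c' (\<lambda>i. c i - c' i) (x c') (y (\<lambda>i. c i - c' i)) K"
 shows "H_mult a d x y c K = tw_class (conf_twisted a d c) (off (conf_twisted a d c) K) (degree_of c) (\<Sum>c'\<in>{c'. c' \<le> c}. z c')"
  and "(\<Sum>c'\<in>{c'. c' \<le> c}. z c') \<in> tw_cycles (conf_twisted a d c) (off (conf_twisted a d c) K) (degree_of c)"
proof -
 let ?T = "conf_twisted a d c"
 have *: "conf_mult a d c' (\<lambda>i. c i - c' i) (x c') (y (\<lambda>i. c i - c' i)) K = tw_class ?T (off ?T K) (degree_of c) (z c')"
  "z c' \<in> tw_cycles ?T (off ?T K) (degree_of c)" if c': "c' \<le> c" for c'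
  using bm_homology_class[OF conf_mult_in[OF x y, unfolded conf_homology_def], of K c' "\<lambda>i. c i - c' i" "z c'"] K z[OF c']
  unfolding below_split[OF c'] by simp_all
 have "H_mult a d x y c K = (\<Sum>c'\<in>{c'. c' \<le> c}. tw_class ?T (off ?T K) (degree_of c) (z c'))"
  using K unfolding H_mult_def by (simp del: mem_Collect_eq) (rule sum.cong[OF refl], rule *(1), simp)
 also have "\<dots> = tw_class ?T (off ?T K) (degree_of c) (\<Sum>c'\<in>{c'. c' \<le> c}. z c')"
  by (rule sum_tw_class[OF finite_below]) auto
 finally show "H_mult a d x y c K = tw_class ?T (off ?T K) (degree_of c) (\<Sum>c'\<in>{c'. c' \<le> c}. z c')" .
 show "(\<Sum>c'\<in>{c'. c' \<le> c}. z c') \<in> tw_cycles ?T (off ?T K) (degree_of c)"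
  by (intro submod_sum[OF submod_tw_cycles] *(2)) auto
qed

lemma conf_mult_ex: assumes "K \<in> compacts (conf_twisted a d c)"
 obtains z where "\<forall>c'\<le>c. z c' \<in> conf_mult a d c' (\<lambda>i. c i - c' i) (x c') (y (\<lambda>i. c i - c' i)) K"
proof -
 have "\<exists>z. z \<in> conf_mult a d c' (\<lambda>i. c i - c' i) (x c') (y (\<lambda>i. c i - c' i)) K" if c': "c' \<le> c" for c'
 proof -
  have "K \<in> compacts (conf_twisted a d (\<lambda>i. c' i + (c i - c' i)))" using assms unfolding below_split[OF c'] .
  from bm_homology_nonempty[OF conf_mult_in[OF x y, unfolded conf_homology_def] this] show ?thesis by blast
 qed
 then show ?thesis using that by metis
qed

lemma H_mult_homology: "H_mult a d x y c \<in> conf_homology a d c" unfolding conf_homology_def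
proof (rule bm_homologyI)
 let ?T = "conf_twisted a d c"
 show "\<exists>z\<in>tw_cycles ?T (off ?T K) (degree_of c). H_mult a d x y c K = tw_class ?T (off ?T K) (degree_of c) z"
  if K: "K \<in> compacts ?T" for K
 proof -
  obtain z where z: "\<forall>c'\<le>c. z c' \<in> conf_mult a d c' (\<lambda>i. c i - c' i) (x c') (y (\<lambda>i. c i - c' i)) K"
   by (rule conf_mult_ex[OF K])
  show ?thesis using H_mult_class[OF K, of z] z by blast
 qed
 show "H_mult a d x y c K' \<inter> H_mult a d x y c K \<noteq> {}"
  if K: "K \<in> compacts ?T" "K' \<in> compacts ?T" "K \<subseteq> K'" for K K'
 proof -
  obtain z where z: "\<forall>c'\<le>c. z c' \<in> conf_mult a d c' (\<lambda>i. c i - c' i) (x c') (y (\<lambda>i. c i - c' i)) K'"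
   by (rule conf_mult_ex[OF K(2)])
  have z': "z c' \<in> conf_mult a d c' (\<lambda>i. c i - c' i) (x c') (y (\<lambda>i. c i - c' i)) K" if c': "c' \<le> c" for c'
  proof -
   have "conf_mult a d c' (\<lambda>i. c i - c' i) (x c') (y (\<lambda>i. c i - c' i)) K' \<subseteq>
     conf_mult a d c' (\<lambda>i. c i - c' i) (x c') (y (\<lambda>i. c i - c' i)) K"
    by (rule bm_homology_antimono[OF conf_mult_in[OF x y, unfolded conf_homology_def]])
     (use K in \<open>simp_all only: below_split[OF c']\<close>)
   then show ?thesis using z c' by blast
  qed
  have "(\<Sum>c'\<in>{c'. c' \<le> c}. z c') \<in> H_mult a d x y c K'"
   by (subst H_mult_class(1)[OF K(2), of z]) (use z in \<open>simp_all add: tw_class_self\<close>)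
  moreover have "(\<Sum>c'\<in>{c'. c' \<le> c}. z c') \<in> H_mult a d x y c K"
   by (subst H_mult_class(1)[OF K(1), of z]) (use z' in \<open>simp_all add: tw_class_self\<close>)
  ultimately show ?thesis by blast
 qed
qed (simp add: H_mult_def)

lemma H_mult_zero:
 assumes "\<And>c'. c' \<le> c ==> x c' = conf_zero a d c' \<or> y (\<lambda>i. c i - c' i) = conf_zero a d (\<lambda>i. c i - c' i)"
 shows "H_mult a d x y c = conf_zero a d c"
proof
 fix K
 let ?T = "conf_twisted a d c"
 show "H_mult a d x y c K = conf_zero a d c K"
 proof (cases "K \<in> compacts ?T")
  case K: True
  have "0 \<in> conf_mult a d c' (\<lambda>i. c i - c' i) (x c') (y (\<lambda>i. c i - c' i)) K" if c': "c' \<le> c" for c'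
  proof -
   let ?c = "\<lambda>i. c i - c' i"
   have K': "K \<in> compacts (conf_twisted a d (\<lambda>i. c' i + ?c i))" using K unfolding below_split[OF c'] .
   have c: "upper_part c' ?c K \<in> compacts (conf_twisted a d c')" "lower_part c' ?c K \<in> compacts (conf_twisted a d ?c)"
    using compactin_parts[of c' ?c K] K' by simp_all
   obtain u where u: "u \<in> x c' (upper_part c' ?c K)"
    by (rule bm_homology_nonempty[OF x[unfolded conf_homology_def] c(1)])
   obtain v where v: "v \<in> y ?c (lower_part c' ?c K)"
    by (rule bm_homology_nonempty[OF y[unfolded conf_homology_def] c(2)])
   have zero: "0 \<in> conf_zero a d b L" if "L \<in> compacts (conf_twisted a d b)" for b L
    using that by (simp add: conf_zero_def bm_zero_def submod_0[OF submod_tw_boundaries])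
   have "\<exists>u v. u \<in> x c' (upper_part c' ?c K) \<and> v \<in> y ?c (lower_part c' ?c K) \<and> (u = 0 \<or> v = 0)"
   proof (cases "x c' = conf_zero a d c'")
    case True
    then show ?thesis using zero[OF c(1)] v by auto
   next
    case False
    then have "0 \<in> y ?c (lower_part c' ?c K)" using assms[OF c'] zero[OF c(2)] by simp
    then show ?thesis using u by auto
   qed
   then obtain u v where uv: "u \<in> x c' (upper_part c' ?c K)" "v \<in> y ?c (lower_part c' ?c K)" "u = 0 \<or> v = 0"
    by blast
   have "cross stack_cover (degree_of c') (degree_of ?c) u v = 0" using uv(3) by auto
   then show ?thesis
    unfolding conf_mult_class(1)[OF x y K' uv(1,2)] by (simp add: tw_class_0 submod_0[OF submod_tw_boundaries])
  qed
  from H_mult_class(1)[OF K this] show ?thesis using K by (simp add: tw_class_0 conf_zero_def bm_zero_def)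
 qed (simp add: H_mult_def conf_zero_def bm_zero_def)
qed

end

text \<open>A colouring with nonzero product is a sum of two colourings from the supports of the
  factors, so the support of the product is finite.\<close>

lemma H_mult_carrier: assumes "x \<in> carrier (H_BM a d)" "y \<in> carrier (H_BM a d)"
 shows "H_mult a d x y \<in> carrier (H_BM a d)"
proof -
 have x: "\<And>c. x c \<in> conf_homology a d c" and y: "\<And>c. y c \<in> conf_homology a d c"
  and fin: "finite {c. x c \<noteq> conf_zero a d c}" "finite {c. y c \<noteq> conf_zero a d c}"
  using assms by (auto simp: carrier_H_BM)
 let ?F = "(\<lambda>(c, c') i. c i + c' i) ` ({c. x c \<noteq> conf_zero a d c} \<times> {c. y c \<noteq> conf_zero a d c})"
 have "c \<in> ?F" if nz: "H_mult a d x y c \<noteq> conf_zero a d c" for c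
 proof -
  obtain c' where c': "c' \<le> c" "x c' \<noteq> conf_zero a d c'" "y (\<lambda>i. c i - c' i) \<noteq> conf_zero a d (\<lambda>i. c i - c' i)"
   using H_mult_zero[OF x y, of c] nz by blast
  then show ?thesis by (intro image_eqI[of _ _ "(c', \<lambda>i. c i - c' i)"]) (simp_all add: below_split)
 qed
 then have "{c. H_mult a d x y c \<noteq> conf_zero a d c} \<subseteq> ?F" by (intro subsetI) (simp only: mem_Collect_eq)
 moreover have "finite ?F" by (rule finite_imageI[OF finite_cartesian_product[OF fin]])
 ultimately have "finite {c. H_mult a d x y c \<noteq> conf_zero a d c}" by (rule finite_subset)
 then show ?thesis unfolding carrier_H_BM by (intro conjI allI H_mult_homology x y)
qed

text \<open>Stacking preserves real parts, so parts of spread configurations are spread with the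
  same bound. Hence the combination of cells that represents a factor at \<open>spread\<close> also
  represents it at the parts.\<close>

lemma spread_parts: "upper_part c c' (spread (\<lambda>i. c i + c' i) \<epsilon>) \<subseteq> spread c \<epsilon>"
 "lower_part c c' (spread (\<lambda>i. c i + c' i) \<epsilon>) \<subseteq> spread c' \<epsilon>"
proof -
 have *: "z \<in> spread b \<epsilon>"
  if s: "stack u w \<in> spread (\<lambda>i. c i + c' i) \<epsilon>" and z: "z \<in> Conf b" and f: "inj f" "\<And>p. Re (f p) = Re p"
   and sub: "f ` pts z \<subseteq> pts (stack u w)" for z u w b f
 proof -
  have fp: "f p \<in> pts (stack u w)" if "p \<in> pts z" for p using subsetD[OF sub imageI[OF that]] .
  have s': "\<forall>p\<in>pts (stack u w). \<bar>Re p\<bar> \<le> 1 - \<epsilon>"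
   "\<forall>p\<in>pts (stack u w). \<forall>q\<in>pts (stack u w). p \<noteq> q \<longrightarrow> \<epsilon> \<le> \<bar>Re p - Re q\<bar>"
   using s by (simp_all add: spread_def)
  have "\<bar>Re p\<bar> \<le> 1 - \<epsilon>" if "p \<in> pts z" for p
   using bspec[OF s'(1) fp[OF that]] by (simp add: f(2))
  moreover have "\<epsilon> \<le> \<bar>Re p - Re q\<bar>" if "p \<in> pts z" "q \<in> pts z" "p \<noteq> q" for p q
   using bspec[OF bspec[OF s'(2) fp[OF that(1)]] fp[OF that(2)]] that(3) by (simp add: f(2) inj_eq[OF f(1)])
  ultimately show ?thesis using z by (simp add: spread_def)
 qed
 show "upper_part c c' (spread (\<lambda>i. c i + c' i) \<epsilon>) \<subseteq> spread c \<epsilon>"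
 proof
  fix z assume "z \<in> upper_part c c' (spread (\<lambda>i. c i + c' i) \<epsilon>)"
  then obtain w where "z \<in> Conf c" "stack z w \<in> spread (\<lambda>i. c i + c' i) \<epsilon>"
   by (auto simp: upper_part_def)
  then show "z \<in> spread c \<epsilon>"
   using *[OF _ _ inj_upper, of z w z] by (simp add: pts_stack) (simp add: upper_def)
 qed
 show "lower_part c c' (spread (\<lambda>i. c i + c' i) \<epsilon>) \<subseteq> spread c' \<epsilon>"
 proof
  fix w assume "w \<in> lower_part c c' (spread (\<lambda>i. c i + c' i) \<epsilon>)"
  then obtain z where "w \<in> Conf c'" "stack z w \<in> spread (\<lambda>i. c i + c' i) \<epsilon>"
   by (auto simp: lower_part_def)
  then show "w \<in> spread c' \<epsilon>"
   using *[OF _ _ inj_lower, of z w w] by (simp add: pts_stack) (simp add: lower_def)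
 qed
qed

lemma single_sum: "single k (sum f A) = (\<Sum>a\<in>A. single k (f a))"
 by (induction A rule: infinite_finite_induct) (simp_all add: single_add)

text \<open>Sorting the sets \<open>A\<close> of positions by the weight of the subword on
  \<open>A\<close> splits the shuffle product according to the decompositions of the colouring over
  which \<open>H_mult\<close> sums; each piece is \<open>cross_rep\<close>.\<close>

theorem has_symbol_mult: assumes ad: "cartan_datum a d" and x: "has_symbol a d x S" and y: "has_symbol a d y S'"
 shows "has_symbol a d (H_mult a d x y) (shp (braid a d) S S')"
proof -
 have xc: "\<And>c. x c \<in> conf_homology a d c" and yc: "\<And>c. y c \<in> conf_homology a d c"
  using x y by (auto simp: has_symbol_def carrier_H_BM)
 have "rep (shp (braid a d) S S') c \<in> H_mult a d x y c (spread c \<epsilon>)" if \<epsilon>: "0 < \<epsilon>" for c \<epsilon>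
 proof -
  let ?T = "conf_twisted a d c" and ?K = "spread c \<epsilon>"
  define z where "z = (\<lambda>c'. smul (colour_sign c' (\<lambda>i. c i - c' i))
   (cross stack_cover (degree_of c') (degree_of (\<lambda>i. c i - c' i)) (rep S c') (rep S' (\<lambda>i. c i - c' i))))"
  define t where "t = (\<lambda>W A. single (esimp W) (wsign W * (S (nths W A) * S' (nths W (- A)) *
   (\<Prod>(m, m')\<in>inv_pairs (length W) A. braid a d (W ! m) (W ! m')))))"
  have K: "?K \<in> compacts ?T" by (rule spread_compacts[OF \<epsilon>])
  have z: "z c' \<in> conf_mult a d c' (\<lambda>i. c i - c' i) (x c') (y (\<lambda>i. c i - c' i)) ?K" if c': "c' \<le> c" for c'
  proof -
   let ?c = "\<lambda>i. c i - c' i"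
   have K': "?K \<in> compacts (conf_twisted a d (\<lambda>i. c' i + ?c i))" using K unfolding below_split[OF c'] .
   have c: "upper_part c' ?c ?K \<in> compacts (conf_twisted a d c')" "lower_part c' ?c ?K \<in> compacts (conf_twisted a d ?c)"
    using compactin_parts[of c' ?c ?K] K' by simp_all
   have 1: "rep S c' \<in> x c' (upper_part c' ?c ?K)"
    using bm_homology_antimono[OF xc[unfolded conf_homology_def] c(1) spread_compacts[OF \<epsilon>]] spread_parts(1)[of c' ?c \<epsilon>]
     x \<epsilon> unfolding below_split[OF c'] by (auto simp: has_symbol_def)
   have 2: "rep S' ?c \<in> y ?c (lower_part c' ?c ?K)"
    using bm_homology_antimono[OF yc[unfolded conf_homology_def] c(2) spread_compacts[OF \<epsilon>]] spread_parts(2)[of c' ?c \<epsilon>]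
     y \<epsilon> unfolding below_split[OF c'] by (auto simp: has_symbol_def)
   show ?thesis unfolding z_def conf_mult_class(1)[OF xc yc K' 1 2] by (rule tw_class_self)
  qed
  have "rep (shp (braid a d) S S') c = (\<Sum>W\<in>words c. \<Sum>A\<in>Pow {..<length W}. t W A)"
   unfolding rep_def shp_sum t_def by (intro sum.cong refl) (simp add: sum_distrib_left single_sum)
  also have "\<dots> = (\<Sum>W\<in>words c. \<Sum>c'\<in>{c'. c' \<le> c}. \<Sum>A\<in>{A \<in> Pow {..<length W}. wt (nths W A) = c'}. t W A)"
  proof (intro sum.cong refl sum.group[symmetric] finite_below)
   show "(\<lambda>A. wt (nths W A)) ` Pow {..<length W} \<subseteq> {c'. c' \<le> c}" if "W \<in> words c" for W
   proof -
    have "wt (nths W A) i \<le> c i" for A i using wt_nths[of W A i] that by (simp add: words_def)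
    then show ?thesis by (auto simp: le_fun_def)
   qed
  qed simp
  also have "\<dots> = (\<Sum>c'\<in>{c'. c' \<le> c}. \<Sum>W\<in>words c. \<Sum>A\<in>{A \<in> Pow {..<length W}. wt (nths W A) = c'}. t W A)"
   by (rule sum.swap)
  finally have rep: "rep (shp (braid a d) S S') c = \<dots>" .
  have "z c' - (\<Sum>W\<in>words c. \<Sum>A\<in>{A \<in> Pow {..<length W}. wt (nths W A) = c'}. t W A)
    \<in> tw_boundaries ?T (off ?T ?K) (degree_of c)" if c': "c' \<le> c" for c'
   using cross_rep[OF \<epsilon> ad, of c' "\<lambda>i. c i - c' i" S S']
   unfolding below_split[OF c'] degree_below[OF c'] z_def t_def .
  then have "(\<Sum>c'\<in>{c'. c' \<le> c}. z c') - rep (shp (braid a d) S S') c \<in> tw_boundaries ?T (off ?T ?K) (degree_of c)"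
   unfolding rep sum_subtractf[symmetric] by (intro submod_sum[OF submod_tw_boundaries]) auto
  then have "rep (shp (braid a d) S S') c - (\<Sum>c'\<in>{c'. c' \<le> c}. z c') \<in> tw_boundaries ?T (off ?T ?K) (degree_of c)"
   by (rule submod_diff_commute[OF submod_tw_boundaries])
  then show ?thesis by (subst H_mult_class(1)[OF xc yc K, of z]) (use z in \<open>simp_all add: mem_tw_class\<close>)
 qed
 then show ?thesis using H_mult_carrier[of x a d y] x y by (simp add: has_symbol_def)
qed

section \<open>Classes with the same symbol are equal\<close>

text \<open>The disk is squeezed vertically, and horizontally the points are moved away from the configuration with
 equal gaps \<open>\<beta>\<close>, until a point reaches one of the sides or two points have horizontal distance at most \<open>\<eta>\<close>.\<close>

definition clamp :: "real => real" where
 "clamp s = max 0 (min 1 s)"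

text \<open>A continuous substitute for the rank of \<open>p\<close> from the left, counted from 1.
  It is the true rank once all horizontal distances are at least \<open>\<eta>\<close>.\<close>

definition soft_rank :: "real => complex set => complex => real" where
 "soft_rank \<eta> Z p = 1 + (\<Sum>q\<in>Z. clamp ((Re p - Re q) / \<eta>))"

text \<open>Normalised to be 0 at the equal spacing \<open>\<beta>\<close> and 1 at contact. The
  case \<open>p = q\<close> measures contact with a side, the other case a pair at horizontal
  distance \<open>\<eta>\<close>.\<close>

definition closeness :: "real => real => complex => complex => real" where
 "closeness \<eta> \<beta> p q = (if p = q then (\<beta> - (1 - \<bar>Re p\<bar>)) / \<beta> else (\<beta> - \<bar>Re p - Re q\<bar>) / (\<beta> - \<eta>))"

text \<open>The number \<open>\<delta>\<close> is inserted because \<open>stretch\<close> divides by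
  this maximum.\<close>

definition crowd :: "real => real => real => complex set => real" where
 "crowd \<eta> \<beta> \<delta> Z = Max (insert \<delta> ((\<lambda>(p, q). closeness \<eta> \<beta> p q) ` (Z \<times> Z)))"

text \<open>At \<open>t = 1\<close> deviations from the equal spacing are multiplied by
  \<open>1 / crowd\<close>, which raises the largest closeness to 1 when it is at least
  \<open>\<delta>\<close> and below 1. Crowded configurations, with maximum at least 1, are not
  stretched.\<close>

definition stretch :: "real => real => real => complex set => real => real" where
 "stretch \<eta> \<beta> \<delta> Z t = t * (1 / min 1 (crowd \<eta> \<beta> \<delta> Z) - 1)"

text \<open>\<open>\<beta> * soft_rank \<eta> Z p - 1\<close> is the place of \<open>p\<close> in
  the equally spaced configuration, the centre of the expansion. Heights are finally scaled by
  \<open>\<eta>\<close>.\<close>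

definition squeeze :: "real => real => real => complex set => real => complex => complex" where
 "squeeze \<eta> \<beta> \<delta> Z t p = Complex (Re p + stretch \<eta> \<beta> \<delta> Z t * (Re p - (\<beta> * soft_rank \<eta> Z p - 1))) ((1 - t * (1 - \<eta>)) * Im p)"

section \<open>Estimates for the motion of a single configuration\<close>

context
 fixes \<eta> \<beta> \<delta> t :: real and Z :: "complex set"
 assumes fin: "finite Z" and \<beta>: "\<beta> = 2 / real (card Z + 1)" and \<eta>: "0 < \<eta>" "\<eta> < \<beta>" "\<eta> < 1" and \<delta>: "0 < \<delta>"
  and t: "0 \<le> t" "t \<le> 1" and Z: "Z \<subseteq> disk"
begin

private abbreviation (input) "crowdZ \<equiv> crowd \<eta> \<beta> \<delta> Z"
private abbreviation (input) "stretchZ \<equiv> stretch \<eta> \<beta> \<delta> Z t"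
private abbreviation (input) "squeezeZ \<equiv> squeeze \<eta> \<beta> \<delta> Z t"
private abbreviation (input) "closeness' \<equiv> closeness \<eta> \<beta>"

lemma crowd_ge: "\<delta> \<le> crowdZ" "p \<in> Z ==> q \<in> Z ==> closeness' p q \<le> crowdZ"
 unfolding crowd_def using fin by (auto intro!: Max_ge)

lemma crowd_pos: "0 < crowdZ" using crowd_ge(1) \<delta> by linarith

lemma stretch_nonneg: "0 \<le> stretchZ" using t crowd_pos by (simp add: stretch_def le_divide_eq)

lemma stretch_crowded: "1 \<le> crowdZ ==> stretchZ = 0" by (simp add: stretch_def)

lemma stretch_le: "crowdZ < 1 ==> (1 + stretchZ) * crowdZ \<le> 1"
proof -
 let ?M = "crowdZ"
 assume M: "?M < 1"
 have "t * (1 / ?M - 1) \<le> 1 * (1 / ?M - 1)" using t M crowd_pos by (intro mult_right_mono) (auto simp: field_simps)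
 moreover have "stretchZ = t * (1 / ?M - 1)" using M by (simp add: stretch_def)
 ultimately have "stretchZ \<le> 1 * (1 / ?M - 1)" by (simp only:)
 then have "1 + stretchZ \<le> 1 / ?M" by simp
 then have "(1 + stretchZ) * ?M \<le> (1 / ?M) * ?M" using crowd_pos by (intro mult_right_mono) auto
 then show ?thesis using crowd_pos by simp
qed

lemma separated: assumes "crowdZ < 1" "p \<in> Z" "q \<in> Z" "p \<noteq> q"
 shows "\<eta> < \<bar>Re p - Re q\<bar>" "\<beta> - \<bar>Re p - Re q\<bar> \<le> crowdZ * (\<beta> - \<eta>)"
proof -
 have "closeness' p q \<le> crowdZ" by (rule crowd_ge(2)[OF assms(2,3)])
 then show *: "\<beta> - \<bar>Re p - Re q\<bar> \<le> crowdZ * (\<beta> - \<eta>)"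
  using \<eta> assms(4) by (simp add: closeness_def pos_divide_le_eq)
 have "crowdZ * (\<beta> - \<eta>) < 1 * (\<beta> - \<eta>)" using assms(1) \<eta> by (intro mult_strict_right_mono) auto
 then show "\<eta> < \<bar>Re p - Re q\<bar>" using * by simp
qed

lemma soft_rank_eq: assumes "crowdZ < 1" "p \<in> Z"
 shows "soft_rank \<eta> Z p = 1 + real (card {q \<in> Z. Re q < Re p})"
proof -
 have "clamp ((Re p - Re q) / \<eta>) = (if Re q < Re p then 1 else 0)" if "q \<in> Z" for q
 proof (cases "p = q")
  case False
  then have s: "\<eta> < \<bar>Re p - Re q\<bar>" using separated(1)[OF assms(1,2) that] by simp
  show ?thesis
  proof (cases "Re q < Re p")
   case True
   then have "1 \<le> (Re p - Re q) / \<eta>" using s \<eta> by (simp add: le_divide_eq)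
   then show ?thesis using True by (simp add: clamp_def)
  next
   case False
   then have "(Re p - Re q) / \<eta> \<le> 0" using \<eta> by (simp add: divide_le_0_iff)
   then show ?thesis using False by (simp add: clamp_def)
  qed
 qed (simp add: clamp_def)
 then have "soft_rank \<eta> Z p = 1 + (\<Sum>q\<in>Z. if Re q < Re p then 1 else 0)" by (simp add: soft_rank_def)
 also have "(\<Sum>q\<in>Z. if Re q < Re p then 1 else (0::real)) = real (card {q \<in> Z. Re q < Re p})"
  by (simp add: fin flip: sum.inter_filter)
 finally show ?thesis .
qed

lemma soft_rank_less: assumes "crowdZ < 1" "p \<in> Z" "q \<in> Z" "Re p < Re q"
 shows "soft_rank \<eta> Z p + 1 \<le> soft_rank \<eta> Z q"
  and "(\<And>r. r \<in> Z ==> \<not> (Re p < Re r \<and> Re r < Re q)) ==> soft_rank \<eta> Z q = soft_rank \<eta> Z p + 1"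
proof -
 let ?L = "\<lambda>p. {q \<in> Z. Re q < Re p}"
 have "card (insert p (?L p)) \<le> card (?L q)" using assms fin by (intro card_mono) auto
 then show "soft_rank \<eta> Z p + 1 \<le> soft_rank \<eta> Z q" using fin by (simp add: soft_rank_eq assms)
 assume *: "\<And>r. r \<in> Z ==> \<not> (Re p < Re r \<and> Re r < Re q)"
 have "r = p" if "r \<in> Z" "Re r < Re q" "\<not> Re r < Re p" for r
 proof (rule ccontr)
  assume "r \<noteq> p"
  then have "Re r \<noteq> Re p" using separated(1)[OF assms(1) that(1) assms(2)] \<eta> by auto
  then show False using * that by auto
 qed
 then have "?L q = insert p (?L p)" using assms by auto
 then show "soft_rank \<eta> Z q = soft_rank \<eta> Z p + 1" using fin by (simp add: soft_rank_eq assms)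
qed

lemma Re_squeeze: "Re (squeezeZ p) = Re p + stretchZ * (Re p - (\<beta> * soft_rank \<eta> Z p - 1))"
 and Im_squeeze: "Im (squeezeZ p) = (1 - t * (1 - \<eta>)) * Im p" by (simp_all add: squeeze_def)

text \<open>Induction on the number of points in between reduces to neighbours, whose ranks differ
  by 1. The motion multiplies the deviation of their gap from \<open>\<beta>\<close> by
  \<open>1 + stretch\<close>, and \<open>stretch_le\<close> bounds the result by
  \<open>\<beta> - \<eta>\<close>, so the gap stays positive.\<close>

lemma squeeze_mono: assumes "crowdZ < 1" "p \<in> Z" "q \<in> Z" "Re p < Re q" shows "Re (squeezeZ p) < Re (squeezeZ q)"
 using assms(2-4)
proof (induction "card {r \<in> Z. Re p < Re r \<and> Re r < Re q}" arbitrary: p q rule: less_induct)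
 case less
 show ?case
 proof (cases "\<exists>r\<in>Z. Re p < Re r \<and> Re r < Re q")
  case True
  then obtain r where r: "r \<in> Z" "Re p < Re r" "Re r < Re q" by blast
  have "card {s \<in> Z. Re p < Re s \<and> Re s < Re r} < card {s \<in> Z. Re p < Re s \<and> Re s < Re q}"
   "card {s \<in> Z. Re r < Re s \<and> Re s < Re q} < card {s \<in> Z. Re p < Re s \<and> Re s < Re q}"
   by (intro psubset_card_mono; use fin r in auto)+
  then show ?thesis using less.hyps[of p r] less.hyps[of r q] less.prems r by simp
 next
  case False
  let ?\<kappa> = "stretchZ" and ?M = "crowdZ"
  have rank: "soft_rank \<eta> Z q = soft_rank \<eta> Z p + 1"
   using soft_rank_less(2)[OF assms(1) less.prems] False by blast
  have gap: "\<beta> - (Re q - Re p) \<le> ?M * (\<beta> - \<eta>)"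
   using separated(2)[OF assms(1), of q p] less.prems by fastforce
  have "(1 + ?\<kappa>) * (\<beta> - (Re q - Re p)) \<le> (1 + ?\<kappa>) * (?M * (\<beta> - \<eta>))"
   using gap stretch_nonneg by (intro mult_left_mono) auto
  also have "\<dots> \<le> 1 * (\<beta> - \<eta>)"
   using mult_right_mono[OF stretch_le[OF assms(1)], of "\<beta> - \<eta>"] \<eta> by (simp add: mult.assoc)
  also have "\<dots> < \<beta>" using \<eta> by simp
  finally have "0 < \<beta> - (1 + ?\<kappa>) * (\<beta> - (Re q - Re p))" by simp
  also have "\<dots> = Re (squeezeZ q) - Re (squeezeZ p)" by (simp add: Re_squeeze rank algebra_simps)
  finally show ?thesis by simp
 qed
qed

text \<open>By monotonicity the leftmost and the rightmost point control all the others. Their ranks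
  are 1 and \<open>card Z\<close>, and their closeness to the sides bounds how far the expansion
  carries them. Crowded configurations do not move horizontally.\<close>

lemma squeeze_disk: assumes "p \<in> Z" shows "squeezeZ p \<in> disk"
proof -
 let ?s = "squeezeZ" and ?\<kappa> = "stretchZ" and ?M = "crowdZ"
 have "0 \<le> 1 - t * (1 - \<eta>)" "1 - t * (1 - \<eta>) \<le> 1" using t \<eta> mult_le_one[of t "1 - \<eta>"] by auto
 then have "\<bar>Im (?s p)\<bar> \<le> 1"
  using assms Z mult_le_one[of "1 - t * (1 - \<eta>)" "\<bar>Im p\<bar>"] by (auto simp: Im_squeeze abs_mult disk_def)
 moreover have "\<bar>Re (?s p)\<bar> \<le> 1"
 proof (cases "1 \<le> ?M")
  case True
  then show ?thesis using assms Z by (auto simp: Re_squeeze stretch_crowded disk_def)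
 next
  case False
  then have M: "?M < 1" by simp
  have \<beta>0: "0 < \<beta>" using \<eta> by simp
  have end_bound: "(1 + ?\<kappa>) * (\<beta> - (1 - \<bar>Re r\<bar>)) \<le> \<beta>" if "r \<in> Z" for r
  proof -
   have "\<beta> - (1 - \<bar>Re r\<bar>) \<le> ?M * \<beta>"
    using crowd_ge(2)[OF that that] \<beta>0 by (simp add: closeness_def pos_divide_le_eq)
   then have "(1 + ?\<kappa>) * (\<beta> - (1 - \<bar>Re r\<bar>)) \<le> (1 + ?\<kappa>) * (?M * \<beta>)"
    using stretch_nonneg by (intro mult_left_mono) auto
   also have "\<dots> \<le> 1 * \<beta>"
    using mult_right_mono[OF stretch_le[OF M], of \<beta>] \<beta>0 by (simp add: mult.assoc)
   finally show ?thesis by simp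
  qed
  have arg: "finite (Re ` Z)" "Re ` Z \<noteq> {}" using fin assms by auto
  obtain l where l: "l \<in> Z" "Re l = Min (Re ` Z)" using Min_in[OF arg] by auto
  have l_le: "Re l \<le> Re r" if "r \<in> Z" for r using that fin by (simp add: l(2))
  obtain u where u: "u \<in> Z" "Re u = Max (Re ` Z)" using Max_in[OF arg] by auto
  have u_ge: "Re r \<le> Re u" if "r \<in> Z" for r using that fin by (simp add: u(2))
  have mono: "Re (?s r) \<le> Re (?s r')" if "r \<in> Z" "r' \<in> Z" "Re r \<le> Re r'" for r r'
  proof (cases "r = r'")
   case False
   then have "Re r < Re r'" using that separated(1)[OF M that(1,2)] \<eta> by auto
   then show ?thesis using squeeze_mono[OF M that(1,2)] by simp
  qed simp
  have 0: "{q \<in> Z. Re q < Re l} = {}" using l_le by (auto simp: not_less)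
  have rl: "soft_rank \<eta> Z l = 1" unfolding soft_rank_eq[OF M l(1)] 0 by simp
  have "Re q < Re u" if "q \<in> Z" "q \<noteq> u" for q
   using u_ge[OF that(1)] separated(1)[OF M that(1) u(1) that(2)] \<eta>(1) by simp
  then have 1: "{q \<in> Z. Re q < Re u} = Z - {u}" by auto
  have "card Z \<noteq> 0" using fin u(1) by auto
  then have "soft_rank \<eta> Z u = real (card Z)"
   unfolding soft_rank_eq[OF M u(1)] 1 using u(1) by (simp add: card_Diff_singleton)
  moreover have "\<beta> * (real (card Z) + 1) = 2"
   using \<beta> nonzero_eq_divide_eq[of "real (card Z + 1)" \<beta> 2] by (simp add: add.commute)
  ultimately have ru: "\<beta> * soft_rank \<eta> Z u - 1 = 1 - \<beta>" by (simp add: algebra_simps)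
  have "(1 + ?\<kappa>) * (\<beta> - 1 - Re l) \<le> (1 + ?\<kappa>) * (\<beta> - (1 - \<bar>Re l\<bar>))"
   using stretch_nonneg by (intro mult_left_mono) auto
  then have "- 1 \<le> Re (?s l)" using end_bound[OF l(1)] by (simp add: Re_squeeze rl algebra_simps)
  have "(1 + ?\<kappa>) * (\<beta> - 1 + Re u) \<le> (1 + ?\<kappa>) * (\<beta> - (1 - \<bar>Re u\<bar>))"
   using stretch_nonneg by (intro mult_left_mono) auto
  then have "Re (?s u) \<le> 1" using end_bound[OF u(1)] unfolding Re_squeeze ru by (simp add: algebra_simps)
  then show ?thesis
   using \<open>- 1 \<le> Re (?s l)\<close> mono[OF l(1) assms l_le[OF assms]] mono[OF assms u(1) u_ge[OF assms]] by simp
 qed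
 ultimately show ?thesis by (simp add: disk_def)
qed

text \<open>The order of real parts is preserved and heights are scaled by a positive factor, so old
  and new difference vectors have positive scalar product. This gives injectivity of the motion and
  continuity of its angles.\<close>

lemma squeeze_pos: assumes "p \<in> Z" "q \<in> Z" "p \<noteq> q" shows "0 < Re ((squeezeZ q - squeezeZ p) / (q - p))"
proof (rule Re_divide_pos)
 let ?s = "squeezeZ"
 have "t * (1 - \<eta>) \<le> 1 * (1 - \<eta>)" using t \<eta> by (intro mult_right_mono) auto
 also have "\<dots> < 1" using \<eta> by simp
 finally have c: "0 < 1 - t * (1 - \<eta>)" by simp
 have Im: "Im (?s q - ?s p) * Im (q - p) = (1 - t * (1 - \<eta>)) * (Im q - Im p)\<^sup>2"
  by (simp add: Im_squeeze power2_eq_square algebra_simps)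
 have Im0: "0 \<le> Im (?s q - ?s p) * Im (q - p)" unfolding Im using c by simp
 show "0 < Re (?s q - ?s p) * Re (q - p) + Im (?s q - ?s p) * Im (q - p)"
 proof (cases "1 \<le> crowdZ")
  case True
  then have Re: "Re (?s q - ?s p) * Re (q - p) = (Re q - Re p)\<^sup>2"
   by (simp add: Re_squeeze stretch_crowded power2_eq_square)
  have "Re p \<noteq> Re q \<or> Im p \<noteq> Im q" using assms(3) by (auto simp: complex_eq_iff)
  then show ?thesis unfolding Re Im using c by (auto intro: add_pos_nonneg add_nonneg_pos)
 next
  case False
  then have M: "crowdZ < 1" by simp
  have "Re p \<noteq> Re q" using separated(1)[OF M assms] \<eta> by auto
  then consider "Re p < Re q" | "Re q < Re p" by linarith
  then have "0 < Re (?s q - ?s p) * Re (q - p)"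
  proof cases
   case 1
   then show ?thesis using squeeze_mono[OF M assms(1,2)] by simp
  next
   case 2
   then show ?thesis using squeeze_mono[OF M assms(2,1)] by (simp add: mult_neg_neg)
  qed
  then show ?thesis using Im0 by simp
 qed
qed

text \<open>A point on a side makes the configuration crowded, so nothing moves
  horizontally.\<close>

lemma squeeze_side: assumes "p \<in> Z" "\<bar>Re p\<bar> = 1" shows "\<bar>Re (squeezeZ p)\<bar> = 1"
proof -
 have "closeness' p p = 1" using assms(2) \<eta> by (simp add: closeness_def)
 then have "1 \<le> crowdZ" using crowd_ge(2)[OF assms(1,1)] by simp
 then show ?thesis using assms(2) by (simp add: Re_squeeze stretch_crowded)
qed

lemma dist_squeeze_crowded: assumes "1 \<le> crowdZ" shows "dist (squeezeZ p) (squeezeZ q) \<le> dist p q"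
proof -
 have "0 \<le> 1 - t * (1 - \<eta>)" "1 - t * (1 - \<eta>) \<le> 1" using t \<eta> mult_le_one[of t "1 - \<eta>"] by auto
 then have "\<bar>(1 - t * (1 - \<eta>)) * (Im p - Im q)\<bar> \<le> 1 * \<bar>Im p - Im q\<bar>"
  unfolding abs_mult by (intro mult_right_mono) auto
 then have "\<bar>(1 - t * (1 - \<eta>)) * Im p - (1 - t * (1 - \<eta>)) * Im q\<bar> \<le> \<bar>Im p - Im q\<bar>"
  by (simp add: right_diff_distrib)
 then show ?thesis
  by (simp add: dist_complex_def cmod_def Re_squeeze Im_squeeze stretch_crowded[OF assms] abs_le_square_iff)
qed

text \<open>Two points at distance below \<open>\<eta>\<close> have closeness above 1, which
  switches the stretching off; what remains of the motion only shrinks heights.\<close>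

lemma squeeze_close: assumes "p \<in> Z" "q \<in> Z" "p \<noteq> q" "dist p q < \<eta>"
 shows "dist (squeezeZ p) (squeezeZ q) < \<eta>"
proof -
 have "\<bar>Re p - Re q\<bar> < \<eta>" using assms(4) abs_Re_le_cmod[of "p - q"] by (simp add: dist_complex_def)
 then have "\<not> crowdZ < 1" using separated(1)[OF _ assms(1-3)] by auto
 then show ?thesis using dist_squeeze_crowded[of p q] assms(4) by simp
qed

lemma crowd_attained: assumes "\<exists>p\<in>Z. \<exists>q\<in>Z. \<delta> \<le> closeness' p q"
 obtains p q where "p \<in> Z" "q \<in> Z" "crowdZ = closeness' p q"
proof -
 obtain p q where pq: "p \<in> Z" "q \<in> Z" "\<delta> \<le> closeness' p q" using assms by blast
 have "crowdZ \<in> insert \<delta> ((\<lambda>(p, q). closeness' p q) ` (Z \<times> Z))"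
  unfolding crowd_def using fin by (intro Max_in) auto
 then show ?thesis
 proof
  assume "crowdZ = \<delta>"
  then show ?thesis using that[OF pq(1,2)] crowd_ge(2)[OF pq(1,2)] pq(3) by simp
 qed (use that in auto)
qed

text \<open>A pair that attains the maximum reaches contact at \<open>t = 1\<close>. For distinct
  points the horizontal distance is then at most \<open>\<eta>\<close> and the vertical one at most
  \<open>2 * \<eta>\<close>, since heights are scaled by \<open>\<eta>\<close>; the bound 3 exceeds
  the square root of 5.\<close>

lemma squeeze_final: assumes "\<exists>p\<in>Z. \<exists>q\<in>Z. \<delta> \<le> closeness' p q" and t1: "t = 1"
 shows "(\<exists>p\<in>Z. \<bar>Re (squeezeZ p)\<bar> = 1) \<or>
  (\<exists>p\<in>Z. \<exists>q\<in>Z. p \<noteq> q \<and> dist (squeezeZ p) (squeezeZ q) < 3 * \<eta>)"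
proof -
 let ?s = "squeezeZ" and ?M = "crowdZ" and ?\<kappa> = "stretchZ"
 have near: "dist (?s p) (?s q) < 3 * \<eta>" if "p \<in> Z" "q \<in> Z" "\<bar>Re (?s p) - Re (?s q)\<bar> \<le> \<eta>" for p q
 proof -
  have "\<bar>Im p - Im q\<bar> \<le> 2" using subsetD[OF Z that(1)] subsetD[OF Z that(2)] unfolding disk_def mem_Collect_eq by linarith
  then have "\<eta> * \<bar>Im p - Im q\<bar> \<le> \<eta> * 2" using \<eta> by (intro mult_left_mono) auto
  moreover have "Im (?s p) - Im (?s q) = \<eta> * (Im p - Im q)"
   unfolding Im_squeeze unfolding t1 by (simp add: right_diff_distrib)
  ultimately have "\<bar>Im (?s p) - Im (?s q)\<bar> \<le> 2 * \<eta>" using \<eta> by (simp add: abs_mult)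
  then have "(Im (?s p) - Im (?s q))\<^sup>2 \<le> (2 * \<eta>)\<^sup>2" using \<eta> unfolding abs_le_square_iff[symmetric] by simp
  moreover have "(Re (?s p) - Re (?s q))\<^sup>2 \<le> \<eta>\<^sup>2" using that(3) \<eta> unfolding abs_le_square_iff[symmetric] by simp
  ultimately have "(Re (?s p) - Re (?s q))\<^sup>2 + (Im (?s p) - Im (?s q))\<^sup>2 \<le> 5 * \<eta>\<^sup>2"
   by (simp add: power_mult_distrib)
  also have "\<dots> < (3 * \<eta>)\<^sup>2" using \<eta> by (simp add: power_mult_distrib)
  finally have "cmod (?s p - ?s q) < 3 * \<eta>"
   unfolding cmod_def minus_complex.sel using \<eta> by (intro real_less_lsqrt) auto
  then show ?thesis by (simp add: dist_complex_def)
 qed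
 obtain p q where pq: "p \<in> Z" "q \<in> Z" "?M = closeness' p q" by (rule crowd_attained[OF assms(1)])
 have \<beta>0: "0 < \<beta>" "0 < \<beta> - \<eta>" using \<eta> by auto
 show ?thesis
 proof (cases "1 \<le> ?M")
  case True
  then have \<kappa>: "Re (?s r) = Re r" for r by (simp add: Re_squeeze stretch_crowded)
  show ?thesis
  proof (cases "p = q")
   case True
   then have "1 \<le> \<bar>Re p\<bar>" using \<open>1 \<le> ?M\<close> \<beta>0 by (simp add: pq(3) closeness_def le_divide_eq)
   then have "\<bar>Re p\<bar> = 1" using pq(1) Z by (auto simp: disk_def)
   then show ?thesis using pq(1) \<kappa> by auto
  next
   case False
   then have "\<bar>Re p - Re q\<bar> \<le> \<eta>" using \<open>1 \<le> ?M\<close> \<beta>0 by (simp add: pq(3) closeness_def le_divide_eq)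
   then show ?thesis using near[OF pq(1,2)] pq(1,2) False \<kappa> by auto
  qed
 next
  case False
  then have M: "?M < 1" by simp
  then have \<kappa>: "(1 + ?\<kappa>) * ?M = 1" using crowd_pos by (simp add: stretch_def t1)
  show ?thesis
  proof (cases "p = q")
   case True
   let ?k = "soft_rank \<eta> Z p"
   have "\<beta> - (1 - \<bar>Re p\<bar>) = ?M * \<beta>" using \<beta>0 by (simp add: pq(3) True closeness_def)
   then have "(1 + ?\<kappa>) * (\<beta> - (1 - \<bar>Re p\<bar>)) = \<beta>" using \<kappa> by (simp flip: mult.assoc)
   then have e: "\<bar>Re p\<bar> + ?\<kappa> * (\<bar>Re p\<bar> - (1 - \<beta>)) = 1" by (simp add: algebra_simps)
   have "card {q \<in> Z. Re q < Re p} \<le> card (Z - {p})" using fin by (intro card_mono) auto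
   moreover have "card Z \<noteq> 0" using fin pq(1) by auto
   ultimately have "card {q \<in> Z. Re q < Re p} + 1 \<le> card Z" using pq(1) by (simp add: card_Diff_singleton)
   then have k: "1 \<le> ?k" "?k \<le> real (card Z)" unfolding soft_rank_eq[OF M pq(1)] by simp_all
   have "\<beta> * (real (card Z) + 1) = 2"
    using \<beta> nonzero_eq_divide_eq[of "real (card Z + 1)" \<beta> 2] by (simp add: add.commute)
   then have two: "\<beta> * real (card Z) = 2 - \<beta>" by (simp add: algebra_simps)
   have bk: "\<beta> \<le> \<beta> * ?k" "\<beta> * ?k \<le> 2 - \<beta>"
    using mult_left_mono[OF k(1), of \<beta>] mult_left_mono[OF k(2), of \<beta>] \<beta>0 two by auto
   \<comment> \<open>The equally spaced place of \<open>p\<close> lies between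
     \<open>\<beta> - 1\<close> and \<open>1 - \<beta>\<close>, so \<open>p\<close> is pushed
     outwards at least as far as by an expansion about the extreme place on its side, which by
     \<open>e\<close> would reach the side exactly.\<close>
   have "1 \<le> \<bar>Re (?s p)\<bar>"
   proof (cases "0 \<le> Re p")
    case True
    have "?\<kappa> * (Re p - (1 - \<beta>)) \<le> ?\<kappa> * (Re p - (\<beta> * ?k - 1))"
     using bk stretch_nonneg by (intro mult_left_mono) auto
    then show ?thesis using e True by (simp add: Re_squeeze)
   next
    case False
    have "?\<kappa> * (- Re p - (1 - \<beta>)) \<le> ?\<kappa> * (- (Re p - (\<beta> * ?k - 1)))"
     using bk stretch_nonneg by (intro mult_left_mono) auto
    then have "?\<kappa> * (- Re p - (1 - \<beta>)) \<le> - (?\<kappa> * (Re p - (\<beta> * ?k - 1)))"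
     by (simp only: mult_minus_right)
    moreover have "- Re p + ?\<kappa> * (- Re p - (1 - \<beta>)) = 1" using e False by simp
    ultimately have "1 \<le> - Re (?s p)" unfolding Re_squeeze by simp
    then show ?thesis by simp
   qed
   moreover have "\<bar>Re (?s p)\<bar> \<le> 1" using squeeze_disk[OF pq(1)] by (simp add: disk_def)
   ultimately show ?thesis using pq(1) by (intro disjI1 bexI[of _ p]) auto
  next
   case False
   have *: "\<bar>Re (?s p) - Re (?s q)\<bar> \<le> \<eta>"
    if pq: "p \<in> Z" "q \<in> Z" "Re p < Re q" "?M = closeness' p q" for p q
   proof -
    have "\<beta> - (Re q - Re p) = ?M * (\<beta> - \<eta>)" using \<beta>0 pq(3) by (auto simp: pq(4) closeness_def)
    then have "(1 + ?\<kappa>) * (\<beta> - (Re q - Re p)) = \<beta> - \<eta>" using \<kappa> by (simp flip: mult.assoc)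
    then have e: "Re q - Re p + ?\<kappa> * (Re q - Re p - \<beta>) = \<eta>" by (simp add: algebra_simps)
    have "\<beta> * 1 \<le> \<beta> * (soft_rank \<eta> Z q - soft_rank \<eta> Z p)"
     using soft_rank_less(1)[OF M pq(1-3)] \<beta>0 by (intro mult_left_mono) auto
    then have "?\<kappa> * (Re q - Re p - \<beta> * (soft_rank \<eta> Z q - soft_rank \<eta> Z p)) \<le> ?\<kappa> * (Re q - Re p - \<beta>)"
     using stretch_nonneg by (intro mult_left_mono) auto
    then have "Re (?s q) - Re (?s p) \<le> \<eta>" using e by (simp add: Re_squeeze algebra_simps)
    then show ?thesis using squeeze_mono[OF M pq(1-3)] by simp
   qed
   have "Re p \<noteq> Re q" using separated(1)[OF M pq(1,2) False] \<eta> by auto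
   then consider "Re p < Re q" | "Re q < Re p" by linarith
   then have "\<bar>Re (?s p) - Re (?s q)\<bar> \<le> \<eta>"
   proof cases
    case 1
    then show ?thesis using *[OF pq(1,2)] pq(3) by simp
   next
    case 2
    have "closeness' p q = closeness' q p" by (auto simp: closeness_def abs_minus_commute)
    then show ?thesis using *[OF pq(2,1) 2] pq(3) by (simp add: abs_minus_commute)
   qed
   then show ?thesis using near[OF pq(1,2)] pq(1,2) False by blast
  qed
 qed
qed

end

section \<open>The flow on configurations and its lift to the cover\<close>

lemma squeeze_0 [simp]: "squeeze \<eta> \<beta> \<delta> Z 0 p = p" by (simp add: squeeze_def stretch_def)

lemma card_pts:
 fixes c :: "'i::finite colouring" assumes "z \<in> Conf c" shows "card (pts z) = degree_of c"
proof -
 obtain x where x: "z = lab (Ind c) fst x" "x \<in> OConf c" "inj_on x (Ind c)" "x ` Ind c \<subseteq> disk"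
  by (rule conf_lab[OF assms])
 have "card (pts z) = card (Ind c)" using x by (simp add: card_image)
 also have "\<dots> = degree_of c" by (simp add: Ind_def degree_of_def)
 finally show ?thesis .
qed

context
 fixes c :: "'i::{finite,linorder} colouring" and a :: "'i => 'i => int" and d :: "'i => nat" and \<eta> \<beta> \<delta> :: real
 assumes \<beta>: "\<beta> = 2 / real (degree_of c + 1)" and \<eta>: "0 < \<eta>" "\<eta> < \<beta>" "\<eta> < 1"
begin

private abbreviation (input) "squeeze' \<equiv> squeeze \<eta> \<beta> \<delta>"

lemma continuous_map_crowd: assumes x: "\<And>r. r \<in> Ind c ==> continuous_map Y euclidean (x r)"
  and inj: "\<And>y. y \<in> topspace Y ==> inj_on (\<lambda>r. x r y) (Ind c)"
 shows "continuous_map Y euclideanreal (\<lambda>y. crowd \<eta> \<beta> \<delta> ((\<lambda>r. x r y) ` Ind c))"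
 unfolding crowd_def closeness_def
 by (rule continuous_map_Max_pairs[OF x inj]) (use \<eta> in \<open>auto simp: case_prod_beta intro!: continuous_intros\<close>)

lemma continuous_map_squeeze:
 assumes \<delta>: "0 < \<delta>" and x: "\<And>r. r \<in> Ind c ==> continuous_map Y euclidean (x r)"
  and inj: "\<And>y. y \<in> topspace Y ==> inj_on (\<lambda>r. x r y) (Ind c)"
  and \<tau>: "continuous_map Y euclideanreal \<tau>" and r: "r \<in> Ind c"
 shows "continuous_map Y euclidean (\<lambda>y. squeeze' ((\<lambda>r. x r y) ` Ind c) (\<tau> y) (x r y))"
proof -
 have rank: "continuous_map Y euclideanreal (\<lambda>y. soft_rank \<eta> ((\<lambda>r. x r y) ` Ind c) (x r y))"
 proof (rule continuous_map_eq)
  show "continuous_map Y euclideanreal (\<lambda>y. 1 + (\<Sum>s\<in>Ind c. max 0 (min 1 ((Re (x r y) - Re (x s y)) / \<eta>))))"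
   using \<eta>(1) x r by (intro continuous_map_add continuous_map_sum continuous_map_real_max continuous_map_real_min
    continuous_map_real_divide continuous_map_diff continuous_map_Re) auto
  show "1 + (\<Sum>s\<in>Ind c. max 0 (min 1 ((Re (x r y) - Re (x s y)) / \<eta>))) = soft_rank \<eta> ((\<lambda>r. x r y) ` Ind c) (x r y)"
   if "y \<in> topspace Y" for y unfolding soft_rank_def clamp_def sum.reindex[OF inj[OF that]] o_def ..
 qed
 have pos: "crowd \<eta> \<beta> \<delta> ((\<lambda>r. x r y) ` Ind c) \<noteq> 0" for y
 proof -
  have "\<delta> \<le> crowd \<eta> \<beta> \<delta> ((\<lambda>r. x r y) ` Ind c)" unfolding crowd_def by (rule Max_ge) auto
  then show ?thesis using \<delta> by simp
 qed
 show ?thesis unfolding squeeze_def stretch_def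
  by (intro continuous_map_Complex continuous_map_add continuous_map_diff continuous_map_real_mult
    continuous_map_real_divide continuous_map_real_min continuous_map_Re continuous_map_Im rank \<tau> x r continuous_map_crowd inj)
   (use pos in \<open>auto simp: min_def\<close>)
qed

lemma conf_squeeze: assumes z: "z \<in> Conf c"
 obtains x where "z = lab (Ind c) fst x" "inj_on x (Ind c)" "pts z = x ` Ind c" "finite (pts z)"
  "\<beta> = 2 / real (card (pts z) + 1)" "pts z \<subseteq> disk"
proof -
 obtain x where x: "z = lab (Ind c) fst x" "x \<in> OConf c" "inj_on x (Ind c)" "x ` Ind c \<subseteq> disk"
  by (rule conf_lab[OF z])
 then show ?thesis using that[of x] pts_conf[OF z] card_pts[OF z] \<beta> by simp
qed

definition flow :: "'i conf => real => 'i conf" where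
 "flow z t = (\<lambda>i. squeeze' (pts z) t ` z i)"

lemma flow_lab: "flow (lab I col P) t = lab I col (\<lambda>r. squeeze' (P ` I) t (P r))"
 unfolding flow_def pts_lab by (rule ext) (simp add: lab_def image_image)

lemma pts_flow: "pts (flow z t) = squeeze' (pts z) t ` pts z" by (auto simp: pts_def flow_def)

text \<open>The rescaling angles vanish at \<open>t = 0\<close> and are continuous by
  \<open>squeeze_pos\<close>, so this is the lift of the motion that starts at the given point of
  the cover.\<close>

definition flow_cover :: "'i conf_cover => real => 'i conf_cover" where
 "flow_cover e t = (flow (fst e) t, \<lambda>k\<in>coords. snd e k + rescale_angle (squeeze' (pts (fst e)) t) (fst e) k)"

context assumes \<delta>: "0 < \<delta>"
begin

lemma squeeze_inj: assumes z: "z \<in> Conf c" and t: "0 \<le> t" "t \<le> 1" shows "inj_on (squeeze' (pts z) t) (pts z)"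
proof (rule inj_onI, rule ccontr)
 fix p q assume *: "p \<in> pts z" "q \<in> pts z" "squeeze' (pts z) t p = squeeze' (pts z) t q" "p \<noteq> q"
 obtain x where x: "z = lab (Ind c) fst x" "inj_on x (Ind c)" "pts z = x ` Ind c" "finite (pts z)"
  "\<beta> = 2 / real (card (pts z) + 1)" "pts z \<subseteq> disk" by (rule conf_squeeze[OF z])
 show False using squeeze_pos[OF x(4,5) \<eta> \<delta> t x(6) *(1,2,4)] *(3) by simp
qed

lemma flow_in_conf: assumes z: "z \<in> Conf c" and t: "0 \<le> t" "t \<le> 1" shows "flow z t \<in> Conf c"
proof -
 obtain x where x: "z = lab (Ind c) fst x" "inj_on x (Ind c)" "pts z = x ` Ind c" "finite (pts z)"
  "\<beta> = 2 / real (card (pts z) + 1)" "pts z \<subseteq> disk" by (rule conf_squeeze[OF z])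
 have "flow z t = lab (Ind c) fst (\<lambda>r. squeeze' (pts z) t (x r))" unfolding x(3) by (subst x(1)) (rule flow_lab)
 then show ?thesis
 proof (simp only:, intro lab_in_conf_Ind)
  show "(\<lambda>r. squeeze' (pts z) t (x r)) ` Ind c \<subseteq> disk"
   using squeeze_disk[OF x(4,5) \<eta> \<delta> t x(6)] x(3) by auto
  show "inj_on (\<lambda>r. squeeze' (pts z) t (x r)) (Ind c)"
   using comp_inj_on[OF x(2), of "squeeze' (pts z) t"] squeeze_inj[OF z t] by (simp add: x(3) o_def)
 qed
qed

lemma flow_cover_in: assumes e: "e \<in> topspace (cov a d c)" and t: "0 \<le> t" "t \<le> 1"
 shows "flow_cover e t \<in> topspace (cov a d c)"
proof -
 have z: "fst e \<in> Conf c" and W: "\<And>k. k \<in> coords ==> W_map (fst e) k = cis (snd e k)"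
  using e by (simp_all add: topspace_cov)
 obtain x where x: "fst e = lab (Ind c) fst x" "inj_on x (Ind c)" "pts (fst e) = x ` Ind c" "finite (pts (fst e))"
  "\<beta> = 2 / real (card (pts (fst e)) + 1)" "pts (fst e) \<subseteq> disk" by (rule conf_squeeze[OF z])
 let ?s = "squeeze' (pts (fst e)) t"
 have inj: "inj_on (\<lambda>r. ?s (x r)) (Ind c)"
  using comp_inj_on[OF x(2), of ?s] squeeze_inj[OF z t] by (simp add: x(3) o_def)
 have "W_map (flow (fst e) t) k = cis (snd e k + rescale_angle ?s (fst e) k)" if k: "k \<in> coords" for k
 proof -
  have "flow (fst e) t = lab (Ind c) fst (\<lambda>r. ?s (x r))" unfolding x(1) flow_lab by simp
  then have "W_map (flow (fst e) t) k = W_map (fst e) k * cis (rescale_angle ?s (fst e) k)"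
   using W_move[OF finite_Ind x(2) inj tournament_ind_pairs k, of fst] x(1) by simp
  then show ?thesis using W[OF k] by (simp add: cis_mult)
 qed
 then show ?thesis using flow_in_conf[OF z t] by (simp add: topspace_cov flow_cover_def)
qed

text \<open>Continuity is verified on ordered configurations, where the single points are available
  as functions, and descends to the quotient in the next lemma.\<close>

lemma continuous_map_ordered_flow:
 defines "Y \<equiv> prod_topology (ordered_conf c) (top_of_set {0..1::real})"
 shows "continuous_map Y (conf_space c) (\<lambda>y. flow (forget_order c (fst y)) (snd y))"
  and "continuous_map Y euclideanreal (\<lambda>y. rescale_angle (squeeze' (pts (forget_order c (fst y))) (snd y)) (forget_order c (fst y)) k)"
proof -
 have x: "continuous_map Y euclidean (\<lambda>y. fst y r)" if "r \<in> Ind c" for r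
  unfolding Y_def by (rule continuous_map_prod_fst[OF continuous_map_ordered_coord[OF that]])
 have \<tau>: "continuous_map Y euclideanreal snd"
  unfolding Y_def by (rule continuous_map_prod_snd[where g = "\<lambda>t. t"]) simp
 have inj: "inj_on (\<lambda>r. fst y r) (Ind c)" and t: "0 \<le> snd y" "snd y \<le> 1"
  and z: "lab (Ind c) fst (fst y) \<in> Conf c" if "y \<in> topspace Y" for y
  using that by (auto simp: Y_def topspace_ordered_conf intro!: lab_in_conf_Ind)
 have s: "continuous_map Y euclidean (\<lambda>y. squeeze' (pts (forget_order c (fst y))) (snd y) (fst y r))"
  if "r \<in> Ind c" for r
  unfolding forget_order_lab pts_lab by (rule continuous_map_squeeze[OF \<delta> x inj \<tau> that])
 have d: "squeeze' (pts (forget_order c (fst y))) (snd y) (fst y r) \<in> disk" if y: "y \<in> topspace Y" and r: "r \<in> Ind c" for y r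
 proof -
  obtain u where u: "lab (Ind c) fst (fst y) = lab (Ind c) fst u" "inj_on u (Ind c)" "pts (lab (Ind c) fst (fst y)) = u ` Ind c" "finite (pts (lab (Ind c) fst (fst y)))"
   "\<beta> = 2 / real (card (pts (lab (Ind c) fst (fst y))) + 1)" "pts (lab (Ind c) fst (fst y)) \<subseteq> disk" by (rule conf_squeeze[OF z[OF y]])
  show ?thesis unfolding forget_order_lab by (rule squeeze_disk[OF u(4,5) \<eta> \<delta> t[OF y] u(6)]) (use r in simp)
 qed
 show "continuous_map Y (conf_space c) (\<lambda>y. flow (forget_order c (fst y)) (snd y))"
 proof -
  have "continuous_map Y (conf_space c) (\<lambda>y. lab (Ind c) fst (\<lambda>r. squeeze' (pts (forget_order c (fst y))) (snd y) (fst y r)))"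
  proof (rule continuous_map_lab[OF finite_Ind card_Ind_fst s d])
   fix y assume y: "y \<in> topspace Y"
   show "inj_on (\<lambda>r. squeeze' (pts (forget_order c (fst y))) (snd y) (fst y r)) (Ind c)"
    using comp_inj_on[OF inj[OF y], of "squeeze' (pts (forget_order c (fst y))) (snd y)"] squeeze_inj[OF z[OF y] t[OF y]]
    by (simp add: forget_order_lab o_def)
  qed
  then show ?thesis by (simp add: forget_order_lab flow_lab)
 qed
 obtain i j where k: "k = (i, j)" by (cases k)
 show "continuous_map Y euclideanreal (\<lambda>y. rescale_angle (squeeze' (pts (forget_order c (fst y))) (snd y)) (forget_order c (fst y)) k)"
  unfolding k forget_order_lab
 proof (rule continuous_map_rescale_angle[OF x _ inj])
  show "continuous_map Y euclidean (\<lambda>y. squeeze' (pts (lab (Ind c) fst (fst y))) (snd y) (fst y r))" if "r \<in> Ind c" for r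
   using s[OF that] by (simp add: forget_order_lab)
  fix y r r' assume y: "y \<in> topspace Y" and r: "r \<in> Ind c" "r' \<in> Ind c" "r \<noteq> r'"
  obtain u where u: "lab (Ind c) fst (fst y) = lab (Ind c) fst u" "inj_on u (Ind c)" "pts (lab (Ind c) fst (fst y)) = u ` Ind c" "finite (pts (lab (Ind c) fst (fst y)))"
   "\<beta> = 2 / real (card (pts (lab (Ind c) fst (fst y))) + 1)" "pts (lab (Ind c) fst (fst y)) \<subseteq> disk" by (rule conf_squeeze[OF z[OF y]])
  have "fst y r \<noteq> fst y r'" using inj_onD[OF inj[OF y] _ r(1,2)] r(3) by auto
  then show "0 < Re ((squeeze' (pts (lab (Ind c) fst (fst y))) (snd y) (fst y r') -
    squeeze' (pts (lab (Ind c) fst (fst y))) (snd y) (fst y r)) / (fst y r' - fst y r))"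
   by (intro squeeze_pos[OF u(4,5) \<eta> \<delta> t[OF y] u(6)]) (use r in simp_all)
 qed
qed

lemma continuous_map_flow_cover:
 "continuous_map (prod_topology (cov a d c) (top_of_set {0..1})) (cov a d c) (\<lambda>(e, t). flow_cover e t)"
proof -
 let ?Y = "prod_topology (cov a d c) (top_of_set {0..1::real})"
 have p: "continuous_map ?Y (prod_topology (conf_space c) (top_of_set {0..1})) (\<lambda>y. (fst (fst y), snd y))"
  by (intro continuous_map_pairedI continuous_map_prod_fst[OF continuous_map_cov_fst] continuous_map_snd)
 have 1: "continuous_map (prod_topology (conf_space c) (top_of_set {0..1})) (conf_space c) (\<lambda>y. flow (fst y) (snd y))"
  by (rule continuous_map_conf_prod) (use continuous_map_ordered_flow(1) in \<open>simp add: case_prod_unfold\<close>)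
 have 2: "continuous_map (prod_topology (conf_space c) (top_of_set {0..1})) euclideanreal
   (\<lambda>y. rescale_angle (squeeze' (pts (fst y)) (snd y)) (fst y) k)" for k
  by (rule continuous_map_conf_prod) (use continuous_map_ordered_flow(2) in \<open>simp add: case_prod_unfold\<close>)
 have "continuous_map ?Y (conf_space c) (\<lambda>y. fst (flow_cover (fst y) (snd y)))"
  using continuous_map_compose[OF p 1] by (simp add: flow_cover_def o_def)
 moreover have "continuous_map ?Y euclideanreal (\<lambda>y. snd (flow_cover (fst y) (snd y)) k)" if "k \<in> coords" for k
  using continuous_map_add[OF continuous_map_prod_fst[OF continuous_map_cov_snd[OF that], of a d c "top_of_set {0..1}"] continuous_map_compose[OF p 2[of k]]]
   that by (simp add: flow_cover_def o_def)
 ultimately show ?thesis unfolding continuous_map_torus_cover by (auto simp: case_prod_unfold intro: flow_cover_in)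
qed

lemma flow_cover_deck: "flow_cover (deck coords n e) t = deck coords n (flow_cover e t)"
 by (auto simp: flow_cover_def deck_def split_beta fun_eq_iff)

lemma flow_cover_0: assumes e: "e \<in> topspace (cov a d c)" shows "flow_cover e 0 = e"
proof -
 have z: "fst e \<in> Conf c" and ext: "snd e \<in> extensional coords" using e by (simp_all add: topspace_cov)
 obtain x where x: "fst e = lab (Ind c) fst x" "inj_on x (Ind c)" "pts (fst e) = x ` Ind c" "finite (pts (fst e))"
  "\<beta> = 2 / real (card (pts (fst e)) + 1)" "pts (fst e) \<subseteq> disk" by (rule conf_squeeze[OF z])
 have "rescale_angle (squeeze' (pts (fst e)) 0) (fst e) k = 0" for k
 proof -
  obtain i j where k: "k = (i, j)" by (cases k)
  have "2 * Arg ((x r' - x r) / (x r' - x r)) = 0" for r r' by (cases "x r = x r'") (simp_all add: Arg_zero)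
  then show ?thesis unfolding k x(1) rescale_angle_lab[OF x(2) tournament_ind_pairs] squeeze_0 by (simp add: split_beta)
 qed
 then show ?thesis using ext by (simp add: flow_cover_def flow_def prod_eq_iff) (auto simp: extensional_def restrict_def)
qed

text \<open>Both reasons for being outside persist during the motion: a point on a side stays on a
  side, and points closer than \<open>\<eta>\<close> stay closer than \<open>\<eta>\<close>.\<close>

lemma flow_stays_off:
 assumes K: "K \<subseteq> far c \<eta>" and z: "z \<in> off (conf_twisted a d c) (far c \<eta>)" "z \<in> Conf c" and t: "0 \<le> t" "t \<le> 1"
 shows "flow z t \<in> off (conf_twisted a d c) K"
proof -
 obtain x where x: "z = lab (Ind c) fst x" "inj_on x (Ind c)" "pts z = x ` Ind c" "finite (pts z)"
  "\<beta> = 2 / real (card (pts z) + 1)" "pts z \<subseteq> disk" by (rule conf_squeeze[OF z(2)])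
 consider "z \<in> side_conf c" | "z \<notin> far c \<eta>" using z by (auto simp: off_def)
 then show ?thesis
 proof cases
  case 1
  then obtain i p where p: "p \<in> z i" "\<bar>Re p\<bar> = 1" by (auto simp: side_conf_def)
  then have "p \<in> pts z" by (auto simp: pts_def)
  from squeeze_side[OF x(4,5) \<eta> \<delta> t x(6) this p(2)] have "flow z t \<in> side_conf c"
   using flow_in_conf[OF z(2) t] p(1) by (auto simp: side_conf_def flow_def intro!: exI[of _ i] bexI[of _ p])
  then show ?thesis by (simp add: off_def)
 next
  case 2
  then obtain p q where pq: "p \<in> pts z" "q \<in> pts z" "p \<noteq> q" "dist p q < \<eta>"
   using z(2) by (auto simp: far_def not_le)
  have "squeeze' (pts z) t p \<noteq> squeeze' (pts z) t q"
   using inj_onD[OF squeeze_inj[OF z(2) t] _ pq(1,2)] pq(3) by blast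
  then have "flow z t \<notin> far c \<eta>"
   using squeeze_close[OF x(4,5) \<eta> \<delta> t x(6) pq] pq(1,2) by (force simp: far_def pts_flow)
  then show ?thesis using K flow_in_conf[OF z(2) t] by (auto simp: off_def)
 qed
qed

lemma flow_leaves: assumes K: "K \<subseteq> far c (3 * \<eta>)" and z: "z \<in> Conf c"
  and close: "\<exists>p\<in>pts z. \<exists>q\<in>pts z. \<delta> \<le> closeness \<eta> \<beta> p q"
 shows "flow z 1 \<in> off (conf_twisted a d c) K"
proof -
 obtain x where x: "z = lab (Ind c) fst x" "inj_on x (Ind c)" "pts z = x ` Ind c" "finite (pts z)"
  "\<beta> = 2 / real (card (pts z) + 1)" "pts z \<subseteq> disk" by (rule conf_squeeze[OF z])
 have t: "0 \<le> (1::real)" "(1::real) \<le> 1" by simp_all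
 from squeeze_final[OF x(4,5) \<eta> \<delta> t x(6) close refl] show ?thesis
 proof
  assume "\<exists>p\<in>pts z. \<bar>Re (squeeze' (pts z) 1 p)\<bar> = 1"
  then obtain i p where "p \<in> z i" "\<bar>Re (squeeze' (pts z) 1 p)\<bar> = 1" by (auto simp: pts_def)
  then have "flow z 1 \<in> side_conf c"
   using flow_in_conf[OF z t] by (auto simp: side_conf_def flow_def intro!: exI[of _ i] bexI[of _ p])
  then show ?thesis by (simp add: off_def)
 next
  assume "\<exists>p\<in>pts z. \<exists>q\<in>pts z. p \<noteq> q \<and> dist (squeeze' (pts z) 1 p) (squeeze' (pts z) 1 q) < 3 * \<eta>"
  then obtain p q where pq: "p \<in> pts z" "q \<in> pts z" "p \<noteq> q" "dist (squeeze' (pts z) 1 p) (squeeze' (pts z) 1 q) < 3 * \<eta>"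
   by blast
  have "squeeze' (pts z) 1 p \<noteq> squeeze' (pts z) 1 q" using inj_onD[OF squeeze_inj[OF z t] _ pq(1,2)] pq(3) by blast
  then have "flow z 1 \<notin> far c (3 * \<eta>)" using pq by (force simp: far_def pts_flow)
  then show ?thesis using K flow_in_conf[OF z t] by (auto simp: off_def)
 qed
qed

end

end

section \<open>Homological consequences of the flow\<close>

lemma push_in_lchains:
 assumes "continuous_map E E' f" "e \<in> lchains p E" "\<And>\<sigma> x. \<sigma> \<in> keys e ==> x \<in> standard_simplex p ==> f (\<sigma> x) \<in> S"
 shows "push p f e \<in> lchains p (subtopology E' S)" unfolding push_def
proof (rule lext_in_submod[OF submod_lchains single_in_lchains])
 fix \<sigma> assume \<sigma>: "\<sigma> \<in> keys e"
 have "singular_simplex p E' (simplex_map p f \<sigma>)"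
  using singular_simplex_simplex_map[OF lchains_singular[OF assms(2) \<sigma>] assms(1)] .
 then show "singular_simplex p (subtopology E' S) (simplex_map p f \<sigma>)"
  using assms(3)[OF \<sigma>] by (auto simp: singular_simplex_subtopology simplex_map_def)
qed

lemma push_id: assumes e: "e \<in> lchains p E" and f: "\<And>x. x \<in> topspace E ==> f x = x" shows "push p f e = e"
proof -
 have "simplex_map p f \<sigma> = \<sigma>" if "\<sigma> \<in> keys e" for \<sigma>
 proof
  fix x
  have \<sigma>: "singular_simplex p E \<sigma>" by (rule lchains_singular[OF e that])
  show "simplex_map p f \<sigma> x = \<sigma> x" using f[OF singular_simplex_in_topspace[OF \<sigma>]] \<sigma>
   by (cases "x \<in> standard_simplex p") (auto simp: simplex_map_def singular_simplex_def extensional_def)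
 qed
 then have "push p f e = lext (\<lambda>\<sigma>. single \<sigma> 1) e" unfolding push_def by (intro lext_cong) simp
 then show ?thesis by (simp add: lext_id)
qed

text \<open>A violated inequality of \<open>spread c \<beta>\<close>, or a point on a side, is a
  positive closeness. Compactness of simplices turns this strict bound into a uniform one.\<close>

lemma spread_off_close:
 fixes c :: "'i::{finite,linorder} colouring"
 assumes z: "z \<in> off (conf_twisted a d c) (spread c \<beta>)" "z \<in> Conf c" and "0 < \<eta>" "\<eta> < \<beta>"
 shows "\<exists>p\<in>pts z. \<exists>q\<in>pts z. 0 < closeness \<eta> \<beta> p q"
proof -
 consider "z \<in> side_conf c" | "z \<notin> spread c \<beta>" using z(1) by (auto simp: off_def)
 then show ?thesis
 proof cases
  case 1
  then obtain i p where "p \<in> z i" "\<bar>Re p\<bar> = 1" by (auto simp: side_conf_def)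
  then have "p \<in> pts z" "0 < closeness \<eta> \<beta> p p" using assms(3,4) by (auto simp: pts_def closeness_def)
  then show ?thesis by blast
 next
  case 2
  then have "(\<exists>p\<in>pts z. 1 - \<beta> < \<bar>Re p\<bar>) \<or> (\<exists>p\<in>pts z. \<exists>q\<in>pts z. p \<noteq> q \<and> \<bar>Re p - Re q\<bar> < \<beta>)"
   using z(2) by (auto simp: spread_def not_le)
  then show ?thesis
  proof
   assume "\<exists>p\<in>pts z. 1 - \<beta> < \<bar>Re p\<bar>"
   then obtain p where p: "p \<in> pts z" "1 - \<beta> < \<bar>Re p\<bar>" by blast
   then have "0 < closeness \<eta> \<beta> p p" using assms(3,4) by (simp add: closeness_def)
   then show ?thesis using p by blast
  next
   assume "\<exists>p\<in>pts z. \<exists>q\<in>pts z. p \<noteq> q \<and> \<bar>Re p - Re q\<bar> < \<beta>"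
   then obtain p q where p: "p \<in> pts z" "q \<in> pts z" "p \<noteq> q" "\<bar>Re p - Re q\<bar> < \<beta>" by blast
   then have "0 < closeness \<eta> \<beta> p q" using assms(3,4) by (simp add: closeness_def)
   then show ?thesis using p by blast
  qed
 qed
qed

text \<open>The function \<open>crowd\<close> with lower bound 0 is continuous and positive on the
  compact images of the simplices of \<open>e\<close>. Its minimum over these finitely many images,
  cut off at 1, is the number \<open>\<delta>\<close> for the flow.\<close>

lemma uniformly_close:
 fixes c :: "'i::{finite,linorder} colouring"
 assumes e: "e \<in> lchains m (subtopology (cov a d c) (off (conf_twisted a d c) (spread c \<beta>) \<times> UNIV))"
  and \<beta>: "\<beta> = 2 / real (degree_of c + 1)" and \<eta>: "0 < \<eta>" "\<eta> < \<beta>" "\<eta> < 1"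
 obtains \<delta> where "0 < \<delta>" "\<forall>\<sigma>\<in>keys e. \<forall>x\<in>standard_simplex m.
   \<exists>p\<in>pts (fst (\<sigma> x)). \<exists>q\<in>pts (fst (\<sigma> x)). \<delta> \<le> closeness \<eta> \<beta> p q"
proof -
 let ?F = "\<lambda>z. crowd \<eta> \<beta> 0 (pts z)"
 have "continuous_map (ordered_conf c) euclideanreal (\<lambda>x. ?F (forget_order c x))"
  unfolding forget_order_lab pts_lab
  by (rule continuous_map_crowd[OF \<beta> \<eta> continuous_map_ordered_coord]) (auto simp: topspace_ordered_conf)
 then have F: "continuous_map (conf_space c) euclideanreal ?F" by (rule continuous_map_conf)
 have e1: "e \<in> lchains m (cov a d c)" and off: "\<And>\<sigma> x. \<sigma> \<in> keys e ==> x \<in> standard_simplex m ==> fst (\<sigma> x) \<in> off (conf_twisted a d c) (spread c \<beta>)"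
  using e by (auto simp: lchains_subtopology image_subset_iff mem_Times_iff)
 have top: "fst (\<sigma> x) \<in> Conf c" if "\<sigma> \<in> keys e" "x \<in> standard_simplex m" for \<sigma> x
  using singular_simplex_in_topspace[OF lchains_singular[OF e1 that(1)] that(2)] by (simp add: topspace_cov)
 have ge: "closeness \<eta> \<beta> p q \<le> ?F z" if "z \<in> Conf c" "p \<in> pts z" "q \<in> pts z" for z p q
  unfolding crowd_def using that pts_conf[OF that(1)] by (intro Max_ge) auto
 have "\<exists>\<delta>>0. \<forall>x\<in>standard_simplex m. \<delta> \<le> ?F (fst (\<sigma> x))" if \<sigma>: "\<sigma> \<in> keys e" for \<sigma>
 proof -
  have "continuous_map (simplex_top m) (cov a d c) \<sigma>"
   using lchains_singular[OF e1 \<sigma>] by (simp add: singular_simplex_def)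
  from continuous_map_compose[OF continuous_map_compose[OF this continuous_map_cov_fst] F]
  have cont: "continuous_map (simplex_top m) euclideanreal (\<lambda>x. ?F (fst (\<sigma> x)))" by (simp add: o_def)
  have "compactin (simplex_top m) (standard_simplex m)"
   using compactin_standard_simplex by (simp add: compactin_subtopology)
  from image_compactin[OF this cont] have "compact ((\<lambda>x. ?F (fst (\<sigma> x))) ` standard_simplex m)" by simp
  from compact_attains_inf[OF this] nonempty_standard_simplex[of m]
  obtain x where x: "x \<in> standard_simplex m" "\<forall>y\<in>standard_simplex m. ?F (fst (\<sigma> x)) \<le> ?F (fst (\<sigma> y))"
   by (auto simp: image_iff)
  have "0 < ?F (fst (\<sigma> x))"
   using spread_off_close[OF off[OF \<sigma> x(1)] top[OF \<sigma> x(1)] \<eta>(1,2)] ge[OF top[OF \<sigma> x(1)]] by fastforce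
  then show ?thesis using x(2) by blast
 qed
 then obtain D where D: "\<forall>\<sigma>\<in>keys e. 0 < D \<sigma> \<and> (\<forall>x\<in>standard_simplex m. D \<sigma> \<le> ?F (fst (\<sigma> x)))"
  by metis
 define \<delta> where "\<delta> = Min (insert 1 (D ` keys e))"
 have \<delta>: "0 < \<delta>" using D by (simp add: \<delta>_def)
 have "\<exists>p\<in>pts (fst (\<sigma> x)). \<exists>q\<in>pts (fst (\<sigma> x)). \<delta> \<le> closeness \<eta> \<beta> p q" if \<sigma>: "\<sigma> \<in> keys e" and x: "x \<in> standard_simplex m" for \<sigma> x
 proof -
  let ?Z = "pts (fst (\<sigma> x))"
  have "\<delta> \<le> D \<sigma>" unfolding \<delta>_def using \<sigma> by (intro Min_le) auto
  then have le: "\<delta> \<le> ?F (fst (\<sigma> x))" using D \<sigma> x by fastforce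
  have "?F (fst (\<sigma> x)) \<in> insert 0 ((\<lambda>(p, q). closeness \<eta> \<beta> p q) ` (?Z \<times> ?Z))"
   unfolding crowd_def using pts_conf[OF top[OF \<sigma> x]] by (intro Max_in) auto
  then obtain p q where "p \<in> ?Z" "q \<in> ?Z" "?F (fst (\<sigma> x)) = closeness \<eta> \<beta> p q"
   using le \<delta> by auto
  then show ?thesis using le by (intro bexI[of _ p] bexI[of _ q]) simp_all
 qed
 then show ?thesis using that[OF \<delta>] by blast
qed

text \<open>Modulo a boundary and a monodromy relation the cycle is a chain \<open>e\<close> over
  the complement of \<open>spread c \<beta>\<close>. The flow deforms \<open>e\<close> into a chain
  outside \<open>K\<close>, while the boundary of \<open>e\<close>, null relative to
  \<open>far c \<eta>\<close>, stays outside \<open>K\<close> all the time; so \<open>e\<close> is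
  itself a boundary relative to the complement of \<open>K\<close>.\<close>

proposition spread_boundaries:
 fixes c :: "'i::{finite,linorder} colouring" and a :: "'i => 'i => int" and d :: "'i => nat"
 defines "T \<equiv> conf_twisted a d c" and "m \<equiv> degree_of c"
 assumes \<beta>: "\<beta> = 2 / real (degree_of c + 1)" and \<eta>: "0 < \<eta>" "\<eta> < \<beta>" "\<eta> < 1" and K: "K \<subseteq> far c (3 * \<eta>)"
  and cycle: "x \<in> tw_cycles T (off T (far c \<eta>)) m" and bdry: "x \<in> tw_boundaries T (off T (spread c \<beta>)) m"
 shows "x \<in> tw_boundaries T (off T K) m"
proof -
 let ?A = "off T K" and ?V = "off T (spread c \<beta>)"
 obtain b n where b: "b \<in> lchains (Suc m) (torus_cover T)" "n \<in> tw_null T ?V m" "x = lboundary (Suc m) b + n"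
  by (rule tw_boundariesE[OF bdry])
 obtain e \<rho> where e: "e \<in> lchains m (subtopology (torus_cover T) (?V \<times> UNIV))" and \<rho>: "\<rho> \<in> mono_relations T m" and n: "n = e + \<rho>"
  using b(2) by (auto simp: tw_null_def set_plus_def)
 have e1: "e \<in> lchains m (torus_cover T)" using e by (simp add: lchains_subtopology)
 have "lboundary m e = lboundary m x - lboundary m \<rho>"
  using lboundary_lboundary[OF b(1)] by (simp add: b(3) n lboundary_add)
 \<comment> \<open>Here the cycle condition for the larger compact set enters: it controls the sides
   of the prism swept out by \<open>e\<close>.\<close>
 then have de: "lboundary m e \<in> tw_null T (off T (far c \<eta>)) (m - 1)"
  using cycle tw_nullI2[OF lboundary_mono_relations[OF \<rho>]]
  by (auto simp: tw_cycles_def intro: submod_diff[OF submod_tw_null])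
 \<comment> \<open>The number \<open>\<delta>\<close> has to be fixed before the flow, whose speed
   it bounds, and it depends on the chain \<open>e\<close>.\<close>
 obtain \<delta> where \<delta>: "0 < \<delta>" and close: "\<forall>\<sigma>\<in>keys e. \<forall>x\<in>standard_simplex m.
   \<exists>p\<in>pts (fst (\<sigma> x)). \<exists>q\<in>pts (fst (\<sigma> x)). \<delta> \<le> closeness \<eta> \<beta> p q"
  by (rule uniformly_close[OF e[unfolded T_def] \<beta> \<eta>])
 let ?\<mu> = "flow_cover \<eta> \<beta> \<delta> :: 'i conf_cover => real => 'i conf_cover"
 have cont: "continuous_map (prod_topology (torus_cover T) (top_of_set {0..1})) (torus_cover T) (\<lambda>(e, t). ?\<mu> e t)"
  unfolding T_def by (rule continuous_map_flow_cover[OF \<beta> \<eta> \<delta>])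
 have K': "K \<subseteq> far c \<eta>" using K far_antimono[of \<eta> "3 * \<eta>" c] \<eta> by auto
 have "push m (\<lambda>e. ?\<mu> e 1) e - push m (\<lambda>e. ?\<mu> e 0) e \<in> tw_boundaries T ?A m"
 proof (rule homotopy_boundaries[OF cont e1])
  assume m: "m > 0"
  have "cross ?\<mu> (m - 1) 1 (lboundary m e) unit_chain \<in> tw_null T ?A (m - 1 + 1)"
  proof (rule additive_tw_null[OF submod_tw_null cross_add(1) _ _ de])
   show "cross ?\<mu> (m - 1) 1 y unit_chain \<in> tw_null T ?A (m - 1 + 1)"
    if "y \<in> lchains (m - 1) (subtopology (torus_cover T) (off T (far c \<eta>) \<times> UNIV))" for y
   proof (intro tw_nullI1 cross_lchains_subtopology[OF cont that, where S' = UNIV])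
    fix u t assume "u \<in> topspace (torus_cover T)" "u \<in> off T (far c \<eta>) \<times> UNIV" "t \<in> topspace (top_of_set {0..1::real})"
    then show "?\<mu> u t \<in> ?A \<times> UNIV"
     using flow_stays_off[OF \<beta> \<eta> \<delta> K', of "fst u" a d t] by (simp add: T_def topspace_cov flow_cover_def[OF \<beta> \<eta>] mem_Times_iff)
   qed (simp only: subtopology_UNIV unit_chain_in)
   show "cross ?\<mu> (m - 1) 1 y unit_chain \<in> tw_null T ?A (m - 1 + 1)" if "y \<in> mono_relations T (m - 1)" for y
    by (rule tw_nullI2, rule cross_mono_relations_left[OF cont refl _ that unit_chain_in])
     (simp add: T_def flow_cover_deck[OF \<beta> \<eta> \<delta>])
  qed
  then show "cross ?\<mu> (m - 1) 1 (lboundary m e) unit_chain \<in> tw_null T ?A m" using m by simp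
 qed
 moreover have "push m (\<lambda>e. ?\<mu> e 0) e = e"
  by (rule push_id[OF e1]) (simp add: T_def flow_cover_0[OF \<beta> \<eta> \<delta>])
 moreover have "push m (\<lambda>e. ?\<mu> e 1) e \<in> tw_boundaries T ?A m"
 proof -
  have "continuous_map (torus_cover T) (torus_cover T) (\<lambda>e. ?\<mu> e 1)"
   using continuous_map_compose[OF _ cont, of "torus_cover T" "\<lambda>e. (e, 1)"]
   by (simp add: o_def continuous_map_pairedI)
  then have "push m (\<lambda>e. ?\<mu> e 1) e \<in> lchains m (subtopology (torus_cover T) (?A \<times> UNIV))"
  proof (rule push_in_lchains[OF _ e1])
   fix \<sigma> y assume *: "\<sigma> \<in> keys e" "y \<in> standard_simplex m"
   have "fst (\<sigma> y) \<in> Conf c"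
    using singular_simplex_in_topspace[OF lchains_singular[OF e1 *(1)] *(2)] by (simp add: T_def topspace_cov)
   then show "?\<mu> (\<sigma> y) 1 \<in> ?A \<times> UNIV"
    using flow_leaves[OF \<beta> \<eta> \<delta> K _ bspec[OF bspec[OF close *(1)] *(2)]] by (simp add: T_def flow_cover_def[OF \<beta> \<eta>] mem_Times_iff)
  qed
  then show ?thesis by (rule subsetD[OF tw_null_boundaries tw_nullI1])
 qed
 ultimately have "e \<in> tw_boundaries T ?A m"
  using submod_diff[OF submod_tw_boundaries, of "push m (\<lambda>e. ?\<mu> e 1) e" T ?A m "push m (\<lambda>e. ?\<mu> e 1) e - e"] by simp
 moreover have "lboundary (Suc m) b \<in> tw_boundaries T ?A m" by (rule lboundary_in_tw_boundaries[OF b(1)])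
 moreover have "\<rho> \<in> tw_boundaries T ?A m" by (rule subsetD[OF tw_null_boundaries tw_nullI2[OF \<rho>]])
 ultimately show ?thesis unfolding b(3) n by (intro submod_add[OF submod_tw_boundaries])
qed

text \<open>Representatives are taken at \<open>far c \<eta>\<close>, a compact set that contains
  both \<open>K\<close> and \<open>spread c \<beta>\<close>. Their difference is a cycle there and,
  by the common symbol, a boundary relative to the complement of
  \<open>spread c \<beta>\<close>.\<close>

theorem symbol_inj: assumes x: "has_symbol a d x S" and y: "has_symbol a d y S" shows "x = y"
proof (rule ext, rule ext)
 fix c K
 let ?T = "conf_twisted a d c" and ?m = "degree_of c"
 have xc: "x c \<in> bm_homology ?T ?m" and yc: "y c \<in> bm_homology ?T ?m"
  using x y by (auto simp: has_symbol_def carrier_H_BM conf_homology_def)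
 show "x c K = y c K"
 proof (cases "K \<in> compacts ?T")
  case K: True
  define \<beta> where "\<beta> = 2 / real (?m + 1)"
  obtain \<epsilon> where \<epsilon>: "0 < \<epsilon>" "K \<subseteq> far c \<epsilon>" using compact_subset_far[of c K] K by auto
  \<comment> \<open>A third of \<open>\<epsilon>\<close>, because the flow only brings points to a
    distance below \<open>3 * \<eta>\<close>; the other bounds are those required of the
    flow.\<close>
  define \<eta> where "\<eta> = min (\<epsilon> / 3) (min (\<beta> / 2) (1 / 2))"
  have \<beta>: "0 < \<beta>" by (simp add: \<beta>_def)
  have \<eta>: "0 < \<eta>" "\<eta> < \<beta>" "\<eta> < 1" "3 * \<eta> \<le> \<epsilon>" using \<epsilon> \<beta> by (auto simp: \<eta>_def min_def)
  have K3: "K \<subseteq> far c (3 * \<eta>)" using \<epsilon>(2) far_antimono[OF \<eta>(4)] by blast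
  have far: "far c \<eta> \<in> compacts ?T" and spread: "spread c \<beta> \<in> compacts ?T"
   using compactin_far[OF \<eta>(1)] spread_compacts[OF \<beta>] by simp_all
  have sub: "K \<subseteq> far c \<eta>" "spread c \<beta> \<subseteq> far c \<eta>"
   using K3 far_antimono[of \<eta> "3 * \<eta>" c] far_antimono[of \<eta> \<beta> c] spread_far[of c \<beta>] \<eta> by auto
  obtain u where u: "u \<in> x c (far c \<eta>)" by (rule bm_homology_nonempty[OF xc far])
  obtain v where v: "v \<in> y c (far c \<eta>)" by (rule bm_homology_nonempty[OF yc far])
  have "u - v \<in> tw_cycles ?T (off ?T (far c \<eta>)) ?m"
   using bm_homology_class(2)[OF xc far u] bm_homology_class(2)[OF yc far v] by (rule submod_diff[OF submod_tw_cycles])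
  moreover have "u - v \<in> tw_boundaries ?T (off ?T (spread c \<beta>)) ?m"
  proof -
   have r: "rep S c \<in> x c (spread c \<beta>)" "rep S c \<in> y c (spread c \<beta>)"
    using x y \<beta> by (simp_all add: has_symbol_def)
   have "u \<in> x c (spread c \<beta>)" "v \<in> y c (spread c \<beta>)"
    using bm_homology_antimono[OF xc spread far sub(2)] bm_homology_antimono[OF yc spread far sub(2)] u v by blast+
   then have "u - rep S c \<in> tw_boundaries ?T (off ?T (spread c \<beta>)) ?m" "v - rep S c \<in> tw_boundaries ?T (off ?T (spread c \<beta>)) ?m"
    using bm_homology_class(1)[OF xc spread r(1)] bm_homology_class(1)[OF yc spread r(2)] by (simp_all add: mem_tw_class)
   then show ?thesis
    using submod_diff[OF submod_tw_boundaries, of "u - rep S c" ?T "off ?T (spread c \<beta>)" ?m "v - rep S c"] by simp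
  qed
  ultimately have "u - v \<in> tw_boundaries ?T (off ?T K) ?m" by (rule spread_boundaries[OF \<beta>_def \<eta>(1-3) K3])
  then have "tw_class ?T (off ?T K) ?m u = tw_class ?T (off ?T K) ?m v" by (simp only: tw_class_eq_iff)
  moreover have "x c K = tw_class ?T (off ?T K) ?m u"
   by (rule bm_homology_class(1)[OF xc K subsetD[OF bm_homology_antimono[OF xc K far sub(1)] u]])
  moreover have "y c K = tw_class ?T (off ?T K) ?m v"
   by (rule bm_homology_class(1)[OF yc K subsetD[OF bm_homology_antimono[OF yc K far sub(1)] v]])
  ultimately show ?thesis by simp
 next
  case False
  then show ?thesis using bm_homology_extensional[OF xc] bm_homology_extensional[OF yc] by (simp add: extensional_def)
 qed
qed

section \<open>The symbol of a divided power\<close>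

lemma single_tw_cycle: assumes \<sigma>: "singular_simplex p (torus_cover T) \<sigma>"
  and face: "\<And>x k. x \<in> standard_simplex p ==> k \<le> p ==> x k = 0 ==> fst (\<sigma> x) \<in> A"
 shows "single \<sigma> r \<in> tw_cycles T A p"
proof -
 have "lboundary p (single \<sigma> r) \<in> tw_null T A (p - 1)"
 proof (cases "p = 0")
  case False
  have "singular_simplex (p - 1) (subtopology (torus_cover T) (A \<times> UNIV)) (singular_face p k \<sigma>)" if k: "k \<le> p" for k
  proof -
   have "singular_simplex (p - 1) (torus_cover T) (singular_face p k \<sigma>)"
    using singular_simplex_singular_face[OF \<sigma>] False k by simp
   moreover have "fst (singular_face p k \<sigma> x) \<in> A" if x: "x \<in> standard_simplex (p - 1)" for x
   proof -
    have "simplical_face k x \<in> standard_simplex p"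
     using simplical_face_in_standard_simplex[of p k x] False k x by simp
    then show ?thesis
     using face[of "simplical_face k x" k] k x by (simp add: singular_face_def) (simp add: simplical_face_def)
   qed
   ultimately show ?thesis by (simp add: singular_simplex_subtopology image_subset_iff mem_Times_iff)
  qed
  then show ?thesis unfolding lboundary_single using False
   by (auto intro!: tw_nullI1 submod_sum[OF submod_lchains] single_in_lchains)
 qed (simp add: lboundary_single submod_0[OF submod_tw_null])
 then show ?thesis using single_in_lchains[OF \<sigma>] by (simp add: tw_cycles_def)
qed

text \<open>The difference of the two lifts has connected image and consists of multiples of 2 pi.
  If it were nonzero somewhere, it would also take a nonzero value of modulus at most pi, and the
  cosine of such a number is not 1.\<close>

lemma cis_unique_lift:
 fixes f g :: "'a => real"
 assumes conn: "connectedin Y (topspace Y)" and f: "continuous_map Y euclideanreal f" and g: "continuous_map Y euclideanreal g"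
  and cis: "\<And>y. y \<in> topspace Y ==> cis (f y) = cis (g y)" and yy: "yy \<in> topspace Y" "f yy = g yy" and y: "y \<in> topspace Y"
 shows "f y = g y"
proof (rule ccontr)
 assume neq: "f y \<noteq> g y"
 let ?h = "\<lambda>y. f y - g y"
 have "continuous_map Y euclideanreal ?h" by (rule continuous_map_diff[OF f g])
 from connectedin_continuous_map_image[OF this conn] have conn': "connected (?h ` topspace Y)" by simp
 define m where "m = min \<bar>?h y\<bar> pi"
 define v where "v = (if 0 < ?h y then m else - m)"
 have m: "0 < m" "m \<le> pi" "m \<le> \<bar>?h y\<bar>" using neq by (auto simp: m_def)
 have h0: "0 \<in> ?h ` topspace Y" "?h y \<in> ?h ` topspace Y" using yy y by (auto intro!: image_eqI[of _ _ yy])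
 have "v \<in> ?h ` topspace Y"
 proof (cases "0 < ?h y")
  case True
  then show ?thesis using connectedD_interval[OF conn' h0, of v] m by (simp add: v_def)
 next
  case False
  then show ?thesis using connectedD_interval[OF conn' h0(2,1), of v] m by (simp add: v_def)
 qed
 then obtain u where u: "u \<in> topspace Y" "v = ?h u" by auto
 have "cis v = 1" using cis[OF u(1)] u(2) by (simp add: cis_divide[symmetric])
 then have "cos v = 1" by (metis cis.sel(1) one_complex.sel(1))
 then have "cos m = 1" by (auto simp: v_def split: if_splits)
 then show False using cos_monotone_0_pi[of 0 m] m by simp
qed

section \<open>Truncated segment simplices and their deformation\<close>

context
 fixes \<alpha> :: "'i::{finite,linorder}" and k :: nat
begin

abbreviation (input) "wrd \<equiv> replicate k \<alpha>"

lemma wt_replicate: "wt (replicate k \<alpha>) = mono_colouring \<alpha> k"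
 by (induction k) (auto simp: mono_colouring_def fun_eq_iff)

private abbreviation (input) "mcol \<equiv> mono_colouring \<alpha> k"

lemma coloured_lab: "coloured \<alpha> k P = lab {..<length wrd} ((!) wrd) P"
 by (auto simp: coloured_def lab_def fun_eq_iff)

text \<open>Room for \<open>k\<close> points with gaps \<open>e\<close>: the scale factor
  \<open>1 - (k - 1) * e\<close> in \<open>seg_param\<close> is then nonnegative. The bound is
  convex in \<open>e\<close>, and it allows \<open>e = 0\<close>.\<close>

definition good :: "real => bool" where
 "good e \<longleftrightarrow> 0 \<le> e \<and> real k * e \<le> 1"

lemma good_bounds: assumes "good e" shows "0 \<le> e" "0 \<le> 1 - (real k - 1) * e"
proof -
 show "0 \<le> e" using assms by (simp add: good_def)
 then show "0 \<le> 1 - (real k - 1) * e" using assms by (simp add: good_def left_diff_distrib)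
qed

lemma seg_param_eq: "seg_param k e x j = real j * e + (1 - (real k - 1) * e) * psum j x"
 by (simp add: seg_param_def psum_def)

lemma seg_param_mono: assumes "good e" "x \<in> standard_simplex k" "r < s"
 shows "seg_param k e x r + e \<le> seg_param k e x s"
proof -
 have "(1 - (real k - 1) * e) * psum r x \<le> (1 - (real k - 1) * e) * psum s x"
  using psum_mono[OF assms(2), of r s] assms(3) good_bounds[OF assms(1)] by (intro mult_left_mono) auto
 moreover have "(real r + 1) * e \<le> real s * e" using assms(3) good_bounds[OF assms(1)] by (intro mult_right_mono) auto
 ultimately show ?thesis by (simp add: seg_param_eq distrib_right)
qed

lemma seg_param_bounds: assumes e: "good e" and x: "x \<in> standard_simplex k" and r: "r < k"
 shows "0 \<le> seg_param k e x r" "seg_param k e x r \<le> 1"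
proof -
 have p: "0 \<le> psum r x" "psum r x \<le> 1" using psum_bounds[OF x] r by simp_all
 show "0 \<le> seg_param k e x r" using p good_bounds[OF e] by (simp add: seg_param_eq)
 have "(1 - (real k - 1) * e) * psum r x \<le> (1 - (real k - 1) * e) * 1"
  using p good_bounds[OF e] by (intro mult_left_mono) auto
 moreover have "real r * e \<le> (real k - 1) * e" using r good_bounds[OF e] by (intro mult_right_mono) auto
 ultimately show "seg_param k e x r \<le> 1" by (simp add: seg_param_eq)
qed

lemma seg_param_face: assumes x: "x \<in> standard_simplex k" "j \<le> k" "x j = 0"
 shows "j = 0 ==> seg_param k e x 0 = 0" "j = k ==> 0 < k ==> seg_param k e x (k - 1) = 1"
  "0 < j ==> j < k ==> seg_param k e x j = seg_param k e x (j - 1) + e"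
proof -
 note f = psum_face[OF x(1,3,2)]
 show "j = 0 ==> seg_param k e x 0 = 0" using f(1) by (simp add: seg_param_eq)
 show "seg_param k e x (k - 1) = 1" if j: "j = k" "0 < k"
 proof -
  obtain n where "k = Suc n" using j by (cases k) auto
  then show ?thesis unfolding seg_param_eq f(3)[OF j] by simp
 qed
 show "seg_param k e x j = seg_param k e x (j - 1) + e" if j: "0 < j"
 proof -
  obtain n where "j = Suc n" using j by (cases j) auto
  then show ?thesis unfolding seg_param_eq f(2)[OF j] by (simp add: distrib_right)
 qed
qed

lemma seg_param_affine: "seg_param k ((1 - s) * e0 + s * e1) x j = (1 - s) * seg_param k e0 x j + s * seg_param k e1 x j"
 by (simp add: seg_param_eq algebra_simps)

lemma continuous_map_seg_param: "continuous_map (simplex_top k) euclideanreal (\<lambda>x. seg_param k e x j)"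
 unfolding seg_param_eq by (intro continuous_map_add continuous_map_real_mult_left continuous_map_psum) simp

text \<open>Interpolates between two cells: \<open>e > 0\<close>, \<open>y = 0\<close> gives the
  truncated segment simplex of \<open>F_chain\<close>, and \<open>e = 0\<close>,
  \<open>y = 1\<close> gives the word cell of a constant word. A positive value of either parameter
  keeps the points distinct.\<close>

definition seg_point :: "real => real => nat => (nat => real) => complex" where
 "seg_point e y r x = Complex (- 1 + 2 * seg_param k e x r) (y * (1 / real (r + 1)))"

abbreviation seg_simplex :: "real => real => (nat => real) => 'i conf_cover" where
 "seg_simplex e y \<equiv> wsimp wrd (seg_point e y)"

lemma seg_point_facts:
 assumes e: "good e" and y: "0 \<le> y" "y \<le> 1" and ey: "0 < e \<or> 0 < y" and x: "x \<in> standard_simplex k"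
 shows "r < k ==> seg_point e y r x \<in> disk"
  and "r < s ==> Re (seg_point e y r x) \<le> Re (seg_point e y s x) \<and> seg_point e y r x \<noteq> seg_point e y s x"
proof -
 show "seg_point e y r x \<in> disk" if "r < k"
 proof -
  have "y * (1 / real (r + 1)) \<le> 1 * 1" using y by (intro mult_mono) auto
  moreover have "0 \<le> y * (1 / real (r + 1))" using y by simp
  ultimately show ?thesis
   using seg_param_bounds[OF e x that] unfolding seg_point_def disk_def mem_Collect_eq complex.sel by linarith
 qed
 show "Re (seg_point e y r x) \<le> Re (seg_point e y s x) \<and> seg_point e y r x \<noteq> seg_point e y s x" if "r < s"
 proof
  have le: "seg_param k e x r + e \<le> seg_param k e x s" by (rule seg_param_mono[OF e x that])
  then show "Re (seg_point e y r x) \<le> Re (seg_point e y s x)" using good_bounds[OF e] by (simp add: seg_point_def)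
  show "seg_point e y r x \<noteq> seg_point e y s x"
  proof (cases "0 < e")
   case True
   then show ?thesis using le by (simp add: seg_point_def)
  next
   case False
   then have "0 < y" using ey by simp
   then have "y * (1 / real (r + 1)) \<noteq> y * (1 / real (s + 1))" using that by (simp add: field_simps)
   then show ?thesis by (auto simp: seg_point_def)
  qed
 qed
qed

lemma singular_seg_simplex: assumes "good e" "0 \<le> y" "y \<le> 1" "0 < e \<or> 0 < y"
 shows "singular_simplex k (cov a d mcol) (seg_simplex e y)"
proof -
 have "singular_simplex (length wrd) (cov a d (wt wrd)) (seg_simplex e y)"
 proof (rule singular_simplex_wsimp)
  show "continuous_map (simplex_top (length wrd)) euclidean (seg_point e y r)" for r
   unfolding seg_point_def using continuous_map_seg_param[of e r]
   by (intro continuous_map_Complex continuous_map_add continuous_map_real_mult_left) auto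
 qed (use seg_point_facts[OF assms] in simp_all)
 then show ?thesis unfolding wt_replicate by simp
qed

lemma fst_seg_simplex:
 "x \<in> standard_simplex k ==> fst (seg_simplex e y x) = lab {..<length wrd} ((!) wrd) (\<lambda>r. seg_point e y r x)"
 by (simp add: wsimp_def)

text \<open>On an inner face two neighbours have horizontal distance \<open>2 * e\<close>. The
  condition on \<open>K\<close> stays abstract because it is used both for subsets of
  \<open>far\<close>, where the equal heights for \<open>y = 0\<close> matter, and for
  \<open>spread\<close>, where real parts decide.\<close>

lemma seg_simplex_face:
 assumes e: "good e" and y: "0 \<le> y" "y \<le> 1" and ey: "0 < e \<or> 0 < y" and x: "x \<in> standard_simplex k" "j \<le> k" "x j = 0"
  and K: "\<And>z p q. z \<in> K ==> p \<in> pts z ==> q \<in> pts z ==> p \<noteq> q ==> Re q - Re p = 2 * e ==> (y = 0 ==> Im p = Im q) ==> False"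
 shows "fst (seg_simplex e y x) \<in> off (conf_twisted a d mcol) K"
proof -
 let ?P = "\<lambda>r. seg_point e y r x"
 let ?z = "lab {..<length wrd} ((!) wrd) ?P"
 have z: "?z \<in> Conf mcol"
 proof -
  have "inj_on ?P {..<length wrd}" by (rule linorder_inj_onI) (use seg_point_facts(2)[OF e y ey x(1)] in auto)
  then show ?thesis
   using wcover_in[of wrd ?P] seg_point_facts(1)[OF e y ey x(1)] unfolding wt_replicate by (simp add: topspace_cov)
 qed
 have side: "?z \<in> off (conf_twisted a d mcol) K" if "r < k" "\<bar>Re (?P r)\<bar> = 1" for r
 proof -
  have "?z \<in> side_conf mcol"
   using z that unfolding side_conf_def by (auto simp: lab_def intro!: exI[of _ \<alpha>] bexI[of _ "?P r"])
  then show ?thesis by (simp add: off_def)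
 qed
 have k: "0 < k"
 proof (rule ccontr)
  assume "\<not> 0 < k"
  then have "k = 0" by simp
  then show False using x unfolding standard_simplex_def by simp
 qed
 consider "j = 0" | "j = k" | "0 < j" "j < k" using x(2) by linarith
 then have "?z \<in> off (conf_twisted a d mcol) K"
 proof cases
  case 1
  show ?thesis by (rule side[OF k]) (simp add: seg_point_def seg_param_face(1)[OF x 1])
 next
  case 2
  show ?thesis by (rule side[of "k - 1"]) (use k in \<open>simp_all add: seg_point_def seg_param_face(2)[OF x 2, simplified]\<close>)
 next
  case 3
  have "?z \<notin> K"
  proof
   assume "?z \<in> K"
   then show False
   proof (rule K)
    show "?P (j - 1) \<in> pts ?z" "?P j \<in> pts ?z" using 3 by (auto simp del: One_nat_def)
    show "?P (j - 1) \<noteq> ?P j" using seg_point_facts(2)[OF e y ey x(1), of "j - 1" j] 3 by auto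
    show "Re (?P j) - Re (?P (j - 1)) = 2 * e" using seg_param_face(3)[OF x 3] by (simp add: seg_point_def)
    show "y = 0 ==> Im (?P (j - 1)) = Im (?P j)" by (simp add: seg_point_def)
   qed
  qed
  then show ?thesis using z by (simp add: off_def)
 qed
 then show ?thesis unfolding fst_seg_simplex[OF x(1)] .
qed

lemma seg_simplex_homotopy: assumes e: "good e0" "good e1" and y: "0 \<le> y0" "y0 \<le> 1" "0 \<le> y1" "y1 \<le> 1"
  and ey: "\<And>s. 0 \<le> s ==> s \<le> 1 ==> 0 < (1 - s) * e0 + s * e1 \<or> 0 < (1 - s) * y0 + s * y1"
  and K: "\<And>z p q s. z \<in> K ==> p \<in> pts z ==> q \<in> pts z ==> p \<noteq> q ==> 0 \<le> s ==> s \<le> 1 ==>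
   Re q - Re p = 2 * ((1 - s) * e0 + s * e1) ==> ((1 - s) * y0 + s * y1 = 0 ==> Im p = Im q) ==> False"
 shows "single (seg_simplex e1 y1) c - single (seg_simplex e0 y0) c
  \<in> tw_boundaries (conf_twisted a d mcol) (off (conf_twisted a d mcol) K) k"
proof -
 let ?e = "\<lambda>s. (1 - s) * e0 + s * e1" and ?y = "\<lambda>s. (1 - s) * y0 + s * y1"
 let ?T = "conf_twisted a d (wt wrd)"
 have good: "good (?e s)" if "0 \<le> s" "s \<le> 1" for s
 proof -
  have "(1 - s) * (real k * e0) + s * (real k * e1) \<le> (1 - s) * 1 + s * 1"
   using e that by (intro add_mono mult_left_mono) (auto simp: good_def)
  moreover have "(1 - s) * (real k * e0) + s * (real k * e1) = real k * ?e s" by (simp add: algebra_simps)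
  ultimately show ?thesis using e that by (simp add: good_def)
 qed
 have y01: "0 \<le> ?y s" "?y s \<le> 1" if "0 \<le> s" "s \<le> 1" for s
  using y that convex_bound_le[of y0 1 y1 "1 - s" s] by auto
 have "single (wsimp wrd (\<lambda>r x. seg_point (?e 1) (?y 1) r x)) c - single (wsimp wrd (\<lambda>r x. seg_point (?e 0) (?y 0) r x)) c
   \<in> tw_boundaries ?T (off ?T K) (length wrd)"
 proof (rule wsimp_homotopy[where P = "\<lambda>r x s. seg_point (?e s) (?y s) r x"])
  fix r
  have 1: "continuous_map (prod_topology (simplex_top (length wrd)) (top_of_set {0..1})) euclideanreal (\<lambda>u. seg_param k e (fst u) r)" for e
   by (rule continuous_map_prod_fst) (use continuous_map_seg_param in simp)
  have 2: "continuous_map (prod_topology (simplex_top (length wrd)) (top_of_set {0..1})) euclideanreal snd"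
   by (rule continuous_map_prod_snd[where g = "\<lambda>t. t"]) simp
  show "continuous_map (prod_topology (simplex_top (length wrd)) (top_of_set {0..1})) euclidean (\<lambda>u. seg_point (?e (snd u)) (?y (snd u)) r (fst u))"
   unfolding seg_point_def seg_param_affine
   by (intro continuous_map_Complex continuous_map_add continuous_map_diff continuous_map_real_mult 1 2; simp)
 next
  fix r x and s :: real assume "r < length wrd" "x \<in> standard_simplex (length wrd)" "0 \<le> s" "s \<le> 1"
  then show "seg_point (?e s) (?y s) r x \<in> disk" using seg_point_facts(1)[OF good y01 ey, of s x r] by simp
 next
  fix r r' x and s :: real assume "r < r'" "r' < length wrd" "x \<in> standard_simplex (length wrd)" "0 \<le> s" "s \<le> 1"
  then show "Re (seg_point (?e s) (?y s) r x) \<le> Re (seg_point (?e s) (?y s) r' x) \<and> seg_point (?e s) (?y s) r x \<noteq> seg_point (?e s) (?y s) r' x"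
   using seg_point_facts(2)[OF good y01 ey, of s x r r'] by simp
 next
  fix x j and s :: real assume x: "x \<in> standard_simplex (length wrd)" "j \<le> length wrd" "x j = 0" and s: "0 \<le> s" "s \<le> 1"
  then have x': "x \<in> standard_simplex k" "j \<le> k" by simp_all
  have "fst (seg_simplex (?e s) (?y s) x) \<in> off (conf_twisted a d mcol) K"
   by (rule seg_simplex_face[OF good[OF s] y01[OF s] ey[OF s] x' x(3)]) (rule K[OF _ _ _ _ s])
  then show "lab {..<length wrd} ((!) wrd) (\<lambda>r. seg_point (?e s) (?y s) r x) \<in> off ?T K"
   unfolding fst_seg_simplex[OF x'(1)] wt_replicate .
 qed
 then show ?thesis unfolding wt_replicate by simp
qed

section \<open>The handle and the lift that it determines\<close>

lemma barycentre_simplex: "barycentre k \<in> standard_simplex k" by (simp add: standard_simplex_def barycentre_def)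

text \<open>Along the handle the points keep their left to right order, so the angles of
  \<open>wcover\<close> form a continuous lift. It starts at 0 because the initial points are
  vertically aligned and numbered from the top.\<close>

lemma lift_end_seg_handle: assumes e: "good e" "0 < e"
 shows "lift_end (conf_twisted a d mcol) (seg_handle \<alpha> k (seg_param k e (barycentre k))) (snd (seg_simplex e 0 (barycentre k)))"
proof -
 let ?b = "barycentre k" and ?T = "conf_twisted a d mcol"
 define t where "t = seg_param k e ?b"
 define y where "y = (\<lambda>j. (real k - real j) / (real k + 1))"
 \<comment> \<open>Both phases in one formula: \<open>min s (1 / 2)\<close> runs the horizontal
   motion and \<open>max s (1 / 2)\<close> the vertical one.\<close>
 define H where "H = (\<lambda>j s. Complex (1 - 2 * min s (1 / 2) * (2 - 2 * t j)) ((2 - 2 * max s (1 / 2)) * y j))"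
 define \<phi> where "\<phi> = (\<lambda>s. snd (wcover wrd (\<lambda>j. H j s)))"
 have t01: "0 \<le> t j" "t j \<le> 1" if "j < k" for j
  using seg_param_bounds[OF e(1) barycentre_simplex that] by (simp_all add: t_def)
 have t_less: "t r < t s" if "r < s" for r s
  using seg_param_mono[OF e(1) barycentre_simplex that] e(2) by (simp add: t_def)
 have y01: "0 \<le> y j" "y j \<le> 1" if "j < k" for j using that by (simp_all add: y_def)
 have y_less: "y s < y r" if "r < s" for r s unfolding y_def using that by (intro divide_strict_right_mono) auto
 have handle: "seg_handle \<alpha> k t s = lab {..<length wrd} ((!) wrd) (\<lambda>j. H j s)" if "0 \<le> s" "s \<le> 1" for s
 proof -
  have "(let y = (real k - real j) / (real k + 1) in if s \<le> 1 / 2 then Complex (1 - 2 * s * (2 - 2 * t j)) y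
    else Complex (- 1 + 2 * t j) ((2 - 2 * s) * y)) = H j s" for j by (auto simp: H_def y_def Let_def min_def max_def)
  then show ?thesis unfolding seg_handle_def coloured_lab by presburger
 qed
 have disk: "H j s \<in> disk" if j: "j < k" and s: "0 \<le> s" "s \<le> 1" for j s
 proof -
  have "0 \<le> 2 * min s (1 / 2) * (2 - 2 * t j)" using s t01[OF j] by simp
  moreover have "(2 * min s (1 / 2)) * (2 - 2 * t j) \<le> 1 * 2" using s t01[OF j] by (intro mult_mono) auto
  moreover have "0 \<le> (2 - 2 * max s (1 / 2)) * y j" using s y01[OF j] by simp
  moreover have "(2 - 2 * max s (1 / 2)) * y j \<le> 1 * 1" using s y01[OF j] by (intro mult_mono) auto
  ultimately show ?thesis unfolding H_def disk_def mem_Collect_eq complex.sel by linarith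
 qed
 have ord: "Re (H r s) \<le> Re (H r' s) \<and> H r s \<noteq> H r' s" if r: "r < r'" and s: "0 \<le> s" "s \<le> 1" for r r' s
 proof
  have "2 * min s (1 / 2) * (2 - 2 * t r') \<le> 2 * min s (1 / 2) * (2 - 2 * t r)"
   using t_less[OF r] s by (intro mult_left_mono) auto
  then show "Re (H r s) \<le> Re (H r' s)" by (simp add: H_def)
  show "H r s \<noteq> H r' s"
  proof (cases "s < 1")
   case True
   then have "(2 - 2 * max s (1 / 2)) * y r' < (2 - 2 * max s (1 / 2)) * y r"
    using y_less[OF r] by (intro mult_strict_left_mono) auto
   then show ?thesis by (auto simp: H_def)
  next
   case False
   then have "s = 1" using s by simp
   then show ?thesis using t_less[OF r] by (auto simp: H_def)
  qed
 qed
 have "continuous_map (top_of_set {0..1}) (cov a d (wt wrd)) (\<lambda>s. wcover wrd (\<lambda>j. H j s))"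
 proof (rule continuous_map_wcover)
  show "continuous_map (top_of_set {0..1}) euclidean (H r)" for r
   unfolding H_def by (auto intro!: continuous_map_Complex continuous_intros)
 qed (use disk ord in auto)
 then have cont: "continuous_map (top_of_set {0..1}) (cov a d mcol) (\<lambda>s. wcover wrd (\<lambda>j. H j s))"
  unfolding wt_replicate .
 have "continuous_map (top_of_set {0..1}) (product_topology (\<lambda>_. euclideanreal) coords) \<phi>"
  unfolding continuous_map_componentwise
 proof (intro conjI ballI)
  show "\<phi> ` topspace (top_of_set {0..1}) \<subseteq> extensional coords" by (auto simp: \<phi>_def wcover_def)
  show "continuous_map (top_of_set {0..1}) euclideanreal (\<lambda>s. \<phi> s p)" if "p \<in> coords" for p
   using continuous_map_compose[OF cont continuous_map_cov_snd[OF that]] by (simp add: \<phi>_def o_def)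
 qed
 moreover have "W_map (seg_handle \<alpha> k t s) p = cis (\<phi> s p)" if s: "s \<in> {0..1}" and p: "p \<in> coords" for s p
 proof -
  have "wcover wrd (\<lambda>j. H j s) \<in> topspace (cov a d mcol)"
   using continuous_map_image_subset_topspace[OF cont] s by auto
  then show ?thesis using p handle[of s] s by (simp add: topspace_cov \<phi>_def)
 qed
 moreover have "\<phi> 0 = (\<lambda>p\<in>coords. 0)"
 proof -
  have "ang (H r 0) (H r' 0) = 0" if "r < r'" for r r'
  proof -
   have "\<i> * (H r' 0 - H r 0) = of_real (y r - y r')" by (simp add: H_def complex_eq_iff)
   then show ?thesis unfolding ang_def using y_less[OF that] by (simp del: of_real_diff)
  qed
  then have "lab_angle {..<length wrd} (wpairs (length wrd)) ((!) wrd) (\<lambda>j. H j 0) p = 0" for p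
   unfolding lab_angle_def by (auto simp: split_beta colour_pairs_def wpairs_def intro!: sum.neutral)
  then show ?thesis unfolding \<phi>_def wcover_def snd_conv by (intro restrict_ext)
 qed
 moreover have "\<phi> 1 = snd (seg_simplex e 0 ?b)"
 proof -
  have "H j 1 = seg_point e 0 j ?b" for j by (simp add: H_def seg_point_def t_def)
  then show ?thesis using barycentre_simplex by (simp add: \<phi>_def wsimp_def)
 qed
 ultimately show ?thesis unfolding lift_end_def t_def[symmetric] conf_twisted_simps by (intro exI[of _ \<phi>]) simp
qed

text \<open>Uniqueness for the description by \<open>THE\<close>: two lifts along the handle agree
  at its end, and lifts over the connected simplex that agree at the barycentre agree
  everywhere.\<close>

lemma handle_simplex_eq: assumes e: "good e" "0 < e"
 shows "handle_simplex (conf_twisted a d mcol) k (\<lambda>x. seg_conf \<alpha> k (seg_param k e x))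
   (seg_handle \<alpha> k (seg_param k e (barycentre k))) (barycentre k) = seg_simplex e 0" unfolding handle_simplex_def
proof (rule the_equality)
 let ?T = "conf_twisted a d mcol" and ?b = "barycentre k"
 let ?\<eta> = "seg_handle \<alpha> k (seg_param k e ?b)"
 have S: "singular_simplex k (cov a d mcol) (seg_simplex e 0)" by (rule singular_seg_simplex) (use e in auto)
 have fst: "fst (seg_simplex e 0 x) = seg_conf \<alpha> k (seg_param k e x)" if "x \<in> standard_simplex k" for x
  unfolding fst_seg_simplex[OF that] seg_conf_def coloured_lab by (simp add: seg_point_def)
 show "singular_simplex k (cov a d mcol) (seg_simplex e 0) \<and>
   (\<forall>x\<in>standard_simplex k. fst (seg_simplex e 0 x) = seg_conf \<alpha> k (seg_param k e x)) \<and> lift_end ?T ?\<eta> (snd (seg_simplex e 0 ?b))"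
  using S fst lift_end_seg_handle[OF e] by blast
 fix \<tau> assume \<tau>: "singular_simplex k (cov a d mcol) \<tau> \<and>
   (\<forall>x\<in>standard_simplex k. fst (\<tau> x) = seg_conf \<alpha> k (seg_param k e x)) \<and> lift_end ?T ?\<eta> (snd (\<tau> ?b))"
 have lift: "\<theta> p = \<theta>' p" if \<theta>: "lift_end ?T ?\<eta> \<theta>" and \<theta>': "lift_end ?T ?\<eta> \<theta>'" and p: "p \<in> coords" for \<theta> \<theta>' p
 proof -
  obtain \<phi> where \<phi>: "continuous_map (top_of_set {0..1}) (product_topology (\<lambda>_. euclideanreal) coords) \<phi>"
   "\<forall>s\<in>{0..1}. \<forall>p\<in>coords. W_map (?\<eta> s) p = cis (\<phi> s p)" "\<phi> 0 = (\<lambda>p\<in>coords. 0)" "\<phi> 1 = \<theta>"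
   using \<theta> unfolding lift_end_def by auto
  obtain \<phi>' where \<phi>': "continuous_map (top_of_set {0..1}) (product_topology (\<lambda>_. euclideanreal) coords) \<phi>'"
   "\<forall>s\<in>{0..1}. \<forall>p\<in>coords. W_map (?\<eta> s) p = cis (\<phi>' s p)" "\<phi>' 0 = (\<lambda>p\<in>coords. 0)" "\<phi>' 1 = \<theta>'"
   using \<theta>' unfolding lift_end_def by auto
  have "\<phi> 1 p = \<phi>' 1 p"
  proof (rule cis_unique_lift[where Y = "top_of_set {0..1}" and f = "\<lambda>s. \<phi> s p" and g = "\<lambda>s. \<phi>' s p" and yy = 0])
   show "connectedin (top_of_set {0..1}) (topspace (top_of_set {0..1::real}))" by (simp add: connectedin_subtopology)
   show "continuous_map (top_of_set {0..1}) euclideanreal (\<lambda>s. \<phi> s p)" "continuous_map (top_of_set {0..1}) euclideanreal (\<lambda>s. \<phi>' s p)"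
    using \<phi>(1) \<phi>'(1) p unfolding continuous_map_componentwise by auto
   show "cis (\<phi> s p) = cis (\<phi>' s p)" if "s \<in> topspace (top_of_set {0..1})" for s
    using \<phi>(2) \<phi>'(2) p that by auto
  qed (use \<phi>(3) \<phi>'(3) in auto)
  then show ?thesis using \<phi>(4) \<phi>'(4) by simp
 qed
 show "\<tau> = seg_simplex e 0"
 proof
  fix x
  show "\<tau> x = seg_simplex e 0 x"
  proof (cases "x \<in> standard_simplex k")
   case x: True
   have top: "\<tau> y \<in> topspace (cov a d mcol)" "seg_simplex e 0 y \<in> topspace (cov a d mcol)"
    if "y \<in> standard_simplex k" for y using singular_simplex_in_topspace[OF _ that] \<tau> S by auto
   have "snd (\<tau> x) p = snd (seg_simplex e 0 x) p" if p: "p \<in> coords" for p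
   proof (rule cis_unique_lift[where Y = "simplex_top k" and f = "\<lambda>x. snd (\<tau> x) p" and g = "\<lambda>x. snd (seg_simplex e 0 x) p" and yy = ?b])
    show "connectedin (simplex_top k) (topspace (simplex_top k))"
     using connectedin_standard_simplex[of k] by (simp add: connectedin_subtopology)
    have "continuous_map (simplex_top k) (cov a d mcol) \<tau>" "continuous_map (simplex_top k) (cov a d mcol) (seg_simplex e 0)"
     using \<tau> S by (simp_all add: singular_simplex_def)
    from this[THEN continuous_map_compose, OF continuous_map_cov_snd[OF p]]
    show "continuous_map (simplex_top k) euclideanreal (\<lambda>x. snd (\<tau> x) p)" "continuous_map (simplex_top k) euclideanreal (\<lambda>x. snd (seg_simplex e 0 x) p)"
     by (simp_all add: o_def)
    show "cis (snd (\<tau> y) p) = cis (snd (seg_simplex e 0 y) p)" if "y \<in> topspace (simplex_top k)" for y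
     using top[of y] \<tau> fst[of y] that p by (auto simp: topspace_cov)
    show "snd (\<tau> ?b) p = snd (seg_simplex e 0 ?b) p"
     by (rule lift[OF _ lift_end_seg_handle[OF e] p]) (use \<tau> in blast)
   qed (use x barycentre_simplex in simp_all)
   then have "snd (\<tau> x) = snd (seg_simplex e 0 x)"
    using top[OF x] by (intro extensionalityI[of _ coords]) (simp_all add: topspace_cov)
   moreover have "fst (\<tau> x) = fst (seg_simplex e 0 x)" using \<tau> x fst[OF x] by simp
   ultimately show ?thesis by (simp add: prod_eq_iff)
  next
   case False
   then show ?thesis using \<tau> S by (auto simp: singular_simplex_def extensional_def)
  qed
 qed
qed

section \<open>The class of a divided power and its symbol\<close>

abbreviation F_coeff :: "('i => nat) => laurent" where
 "F_coeff d \<equiv> vpow (- int (d \<alpha> * (k * (k - 1) div 2)))"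

lemma F_chain_eq:
 "good e ==> 0 < e ==> F_chain a d \<alpha> k e = single (seg_simplex e 0) ((- 1) ^ k * F_coeff d)"
 unfolding F_chain_def by (simp add: handle_simplex_eq)

lemma degree_mono_colouring: "degree_of mcol = k" using degree_of_wt[of wrd] unfolding wt_replicate by simp

lemma far_seg: assumes "K \<subseteq> far mcol \<eta>" "2 * e < \<eta>" "0 \<le> e"
  and "z \<in> K" "p \<in> pts z" "q \<in> pts z" "p \<noteq> q" "Re q - Re p = 2 * e" "Im p = Im q" shows False
proof -
 have "q - p = of_real (2 * e)" using assms(8,9) by (simp add: complex_eq_iff)
 then have "cmod (q - p) = 2 * e" using assms(3) by simp
 moreover have "\<eta> \<le> dist p q" using subsetD[OF assms(1,4)] assms(5-7) by (simp add: far_def)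
 ultimately show False using assms(2) by (simp add: dist_complex_def norm_minus_commute)
qed

text \<open>Sufficiently small truncations are homologous: while \<open>e\<close> varies, every face
  has a point on a side or two points closer than \<open>\<eta>\<close>, so it stays outside
  \<open>K\<close>. Thus eventual membership in \<open>F_class\<close> reduces to one value of
  \<open>e\<close>.\<close>

lemma F_class_eq:
 fixes a :: "'i => 'i => int" and d :: "'i => nat"
 defines "T \<equiv> conf_twisted a d mcol"
 assumes K: "K \<in> compacts T" "K \<subseteq> far mcol \<eta>" and e: "good e" "0 < e" "2 * e < \<eta>"
 shows "F_class a d \<alpha> k K = tw_class T (off T K) k (F_chain a d \<alpha> k e)"
  and "F_chain a d \<alpha> k e \<in> tw_cycles T (off T K) k"
proof -
 have same: "tw_class T (off T K) k (F_chain a d \<alpha> k e') = tw_class T (off T K) k (F_chain a d \<alpha> k e)"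
  if e': "good e'" "0 < e'" "2 * e' < \<eta>" for e'
  unfolding tw_class_eq_iff F_chain_eq[OF e(1,2)] F_chain_eq[OF e'(1,2)] T_def
 proof (rule seg_simplex_homotopy[OF e(1) e'(1)])
  fix s :: real assume s: "0 \<le> s" "s \<le> 1"
  show "0 < (1 - s) * e + s * e' \<or> 0 < (1 - s) * 0 + s * (0::real)"
  proof (cases "s = 0")
   case False
   then have "0 < s * e'" using s e' by simp
   moreover have "0 \<le> (1 - s) * e" using s e by simp
   ultimately show ?thesis by simp
  qed (use e in simp)
  fix z p q assume *: "z \<in> K" "p \<in> pts z" "q \<in> pts z" "p \<noteq> q" "Re q - Re p = 2 * ((1 - s) * e + s * e')"
   "(1 - s) * 0 + s * (0::real) = 0 ==> Im p = Im q"
  have "2 * ((1 - s) * e + s * e') < \<eta>"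
   using convex_bound_lt[of "2 * e" \<eta> "2 * e'" "1 - s" s] s e(3) e'(3) by (simp add: algebra_simps)
  then show False using far_seg[OF K(2), of "(1 - s) * e + s * e'" z p q] * s e(2) e'(2) by simp
 qed simp_all
 have ev: "\<forall>\<^sub>F e' in at_right 0. good e' \<and> 0 < e' \<and> 2 * e' < \<eta>"
  unfolding eventually_at_right_field
 proof (intro exI[of _ "min (1 / real (k + 1)) (\<eta> / 2)"] conjI allI impI)
  show "0 < min (1 / real (k + 1)) (\<eta> / 2)" using e by simp
  fix e' :: real assume e': "0 < e'" "e' < min (1 / real (k + 1)) (\<eta> / 2)"
  then have "e' * real (k + 1) < 1" by (simp add: pos_less_divide_eq)
  then show "good e'" using e' by (simp add: good_def algebra_simps)
  show "0 < e'" "2 * e' < \<eta>" using e' by auto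
 qed
 have "(\<forall>\<^sub>F e' in at_right 0. x \<in> tw_class T (off T K) k (F_chain a d \<alpha> k e')) \<longleftrightarrow> x \<in> tw_class T (off T K) k (F_chain a d \<alpha> k e)" for x
 proof -
  have "(\<forall>\<^sub>F e' in at_right 0. x \<in> tw_class T (off T K) k (F_chain a d \<alpha> k e')) \<longleftrightarrow>
    (\<forall>\<^sub>F e' in at_right (0::real). x \<in> tw_class T (off T K) k (F_chain a d \<alpha> k e))"
   by (rule eventually_cong[OF ev]) (use same in blast)
  then show ?thesis by (simp add: eventually_const_iff)
 qed
 then show "F_class a d \<alpha> k K = tw_class T (off T K) k (F_chain a d \<alpha> k e)"
  using K(1) by (auto simp: F_class_def Let_def T_def)
 show "F_chain a d \<alpha> k e \<in> tw_cycles T (off T K) k" unfolding F_chain_eq[OF e(1,2)] T_def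
 proof (rule single_tw_cycle)
  show "singular_simplex k (cov a d mcol) (seg_simplex e 0)" by (rule singular_seg_simplex) (use e in auto)
  fix x j assume x: "x \<in> standard_simplex k" "j \<le> k" "x j = 0"
  show "fst (seg_simplex e 0 x) \<in> off (conf_twisted a d mcol) K"
   by (rule seg_simplex_face[OF e(1) _ _ _ x]) (use e far_seg[OF K(2) e(3)] in auto)
 qed
qed

lemma small_good: assumes "0 < \<eta>" obtains e where "good e" "0 < e" "2 * e < \<eta>"
proof
 let ?e = "min (1 / real (k + 1)) (\<eta> / 3)"
 have "real k * ?e \<le> real k * (1 / real (k + 1))" by (intro mult_left_mono) auto
 then have "real k * ?e \<le> 1" by (rule order_trans) simp
 then show "good ?e" using assms by (simp add: good_def)
 show "0 < ?e" "2 * ?e < \<eta>" using assms by (auto simp: min_def)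
qed

lemma F_class_homology: "F_class a d \<alpha> k \<in> conf_homology a d mcol"
 unfolding conf_homology_def degree_mono_colouring
proof (rule bm_homologyI)
 let ?T = "conf_twisted a d mcol"
 show "\<exists>x\<in>tw_cycles ?T (off ?T K) k. F_class a d \<alpha> k K = tw_class ?T (off ?T K) k x" if K: "K \<in> compacts ?T" for K
 proof -
  obtain \<eta> where \<eta>: "0 < \<eta>" "K \<subseteq> far mcol \<eta>" using compact_subset_far[of mcol K] K by auto
  obtain e where e: "good e" "0 < e" "2 * e < \<eta>" by (rule small_good[OF \<eta>(1)])
  show ?thesis using F_class_eq[OF K \<eta>(2) e] by blast
 qed
 show "F_class a d \<alpha> k K' \<inter> F_class a d \<alpha> k K \<noteq> {}"
  if K: "K \<in> compacts ?T" "K' \<in> compacts ?T" "K \<subseteq> K'" for K K'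
 proof -
  obtain \<eta> where \<eta>: "0 < \<eta>" "K' \<subseteq> far mcol \<eta>" using compact_subset_far[of mcol K'] K by auto
  obtain e where e: "good e" "0 < e" "2 * e < \<eta>" by (rule small_good[OF \<eta>(1)])
  have "F_chain a d \<alpha> k e \<in> F_class a d \<alpha> k K'" "F_chain a d \<alpha> k e \<in> F_class a d \<alpha> k K"
   unfolding F_class_eq(1)[OF K(2) \<eta>(2) e] F_class_eq(1)[OF K(1) order_trans[OF K(3) \<eta>(2)] e] by (rule tw_class_self)+
  then show ?thesis by blast
 qed
qed (simp add: F_class_def Let_def)

lemma words_mono_colouring: "words mcol = {wrd}"
proof -
 have "w = wrd" if "wt w = mono_colouring \<alpha> k" for w
 proof -
  have "set w \<subseteq> {\<alpha>}"
  proof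
   fix i assume "i \<in> set w"
   then have "wt w i \<noteq> 0" by (simp add: count_list_0_iff)
   then show "i \<in> {\<alpha>}" using that by (auto simp: mono_colouring_def split: if_splits)
  qed
  then have "\<forall>i\<in>set w. i = \<alpha>" by blast
  then have "replicate (length w) \<alpha> = w" by (rule replicate_length_same)
  moreover have "length w = k" using degree_of_wt[of w] unfolding that degree_mono_colouring by (rule sym)
  ultimately show ?thesis by simp
 qed
 then show ?thesis unfolding words_def using wt_replicate by blast
qed

lemma descents_replicate: "descents wrd = {}" by (auto simp: descents_def)

text \<open>The gaps are traded for heights. While \<open>e\<close> decreases to 0 and
  \<open>y\<close> grows to 1, neighbours on an inner face keep a horizontal distance of at most
  \<open>2 * e\<close>, which is below \<open>\<epsilon>\<close>, so these faces avoid
  \<open>spread\<close>.\<close>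

lemma F_class_symbol: assumes "0 < \<epsilon>"
 shows "single (esimp wrd) ((- 1) ^ k * F_coeff d) \<in> F_class a d \<alpha> k (spread mcol \<epsilon>)"
proof -
 let ?c = mcol
 let ?T = "conf_twisted a d ?c" and ?K = "spread ?c \<epsilon>" and ?r = "(- 1) ^ k * F_coeff d"
 have K: "?K \<in> compacts ?T" by (rule spread_compacts[OF assms])
 obtain e where e: "good e" "0 < e" "2 * e < \<epsilon>" by (rule small_good[OF assms])
 have good0: "good 0" by (simp add: good_def)
 have "single (seg_simplex 0 1) ?r - single (seg_simplex e 0) ?r \<in> tw_boundaries ?T (off ?T ?K) k"
 proof (rule seg_simplex_homotopy[OF e(1) good0])
  fix s :: real assume s: "0 \<le> s" "s \<le> 1"
  show "0 < (1 - s) * e + s * 0 \<or> 0 < (1 - s) * 0 + s * 1" using s e by (cases "s = 0") auto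
  fix z p q assume *: "z \<in> ?K" "p \<in> pts z" "q \<in> pts z" "p \<noteq> q" "Re q - Re p = 2 * ((1 - s) * e + s * 0)"
  have "(1 - s) * e \<le> 1 * e" using s e by (intro mult_right_mono) auto
  moreover have "0 \<le> (1 - s) * e" using s e by simp
  moreover have "Re q - Re p = 2 * ((1 - s) * e)" using *(5) by simp
  moreover have "\<epsilon> \<le> \<bar>Re p - Re q\<bar>" using *(1-4) by (simp add: spread_def)
  ultimately show False using e(3) by (simp add: abs_minus_commute[of "Re p"])
 qed simp_all
 moreover have "seg_simplex 0 1 = esimp wrd"
  unfolding esimp_def hsimp_def by (simp add: seg_point_def[abs_def] seg_param_eq)
 ultimately show ?thesis unfolding F_class_eq(1)[OF K spread_far e] mem_tw_class F_chain_eq[OF e(1,2)] by simp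
qed

end

text \<open>The power of \<open>v\<close> is the normalising factor of the class. The sign
  \<open>(-1) ^ k\<close> of \<open>F_chain\<close> is absorbed by \<open>wsign\<close>, since a
  constant word has no descents.\<close>

definition F_symbol :: "('i => nat) => 'i => nat => 'i list => laurent" where
 "F_symbol d \<alpha> k w = (if w = replicate k \<alpha> then vpow (- int (d \<alpha> * (k * (k - 1) div 2))) else 0)"

lemma conf_zero_homology: "conf_zero a d c \<in> conf_homology a d c"
 by (simp add: conf_zero_def conf_homology_def bm_zero_in)

lemma zero_in_conf_zero: "K \<in> compacts (conf_twisted a d c) ==> 0 \<in> conf_zero a d c K"
 by (simp add: conf_zero_def bm_zero_def submod_0[OF submod_tw_boundaries])

lemma H_single_carrier: "h \<in> conf_homology a d c ==> H_single a d c h \<in> carrier (H_BM a d)"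
proof -
 assume "h \<in> conf_homology a d c"
 moreover have "finite {c'. H_single a d c h c' \<noteq> conf_zero a d c'}"
  by (rule finite_subset[of _ "{c}"]) (auto simp: H_single_def)
 ultimately show ?thesis unfolding carrier_H_BM by (auto simp: H_single_def conf_zero_homology)
qed

lemma H_single_symbol:
 assumes h: "h \<in> conf_homology a d c" and sym: "\<And>\<epsilon>. 0 < \<epsilon> ==> rep S c \<in> h (spread c \<epsilon>)"
  and S: "\<And>w. wt w \<noteq> c ==> S w = 0" shows "has_symbol a d (H_single a d c h) S"
proof -
 have "rep S c' = 0" if "c' \<noteq> c" for c'
  unfolding rep_def by (rule sum.neutral) (use S that in \<open>auto simp: words_def\<close>)
 then have "rep S c' \<in> H_single a d c h c' (spread c' \<epsilon>)" if "0 < \<epsilon>" for c' \<epsilon>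
  by (cases "c' = c") (simp_all add: H_single_def sym that zero_in_conf_zero compactin_spread)
 then show ?thesis using H_single_carrier[OF h] by (simp add: has_symbol_def)
qed

theorem F_div_symbol: "has_symbol a d (F_div a d \<alpha> k) (F_symbol d \<alpha> k)" unfolding F_div_def
proof (rule H_single_symbol[OF F_class_homology])
 have "rep (F_symbol d \<alpha> k) (mono_colouring \<alpha> k) =
   single (esimp (replicate k \<alpha>)) ((- 1) ^ k * vpow (- int (d \<alpha> * (k * (k - 1) div 2))))"
  unfolding rep_def words_mono_colouring by (simp add: wsign_def descents_replicate F_symbol_def)
 then show "rep (F_symbol d \<alpha> k) (mono_colouring \<alpha> k) \<in> F_class a d \<alpha> k (spread (mono_colouring \<alpha> k) \<epsilon>)" if "0 < \<epsilon>" for \<epsilon>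
  using F_class_symbol[OF that] by simp
 show "F_symbol d \<alpha> k w = 0" if "wt w \<noteq> mono_colouring \<alpha> k" for w
  using that wt_replicate by (auto simp: F_symbol_def)
qed

section \<open>Module operations on symbols\<close>

lemma rep_zero: "rep (\<lambda>_. 0) c = 0" by (simp add: rep_def)

lemma rep_add: "rep (\<lambda>w. S w + S' w) c = rep S c + rep S' c"
 by (simp add: rep_def distrib_left single_add sum.distrib)

lemma rep_smul: "rep (\<lambda>w. r * S w) c = smul r (rep S c)" by (simp add: rep_def smul_sum mult.left_commute)

lemma bm_add_zero: assumes "h \<in> bm_homology T p" shows "bm_add T (bm_zero T p) h = h"
proof
 fix K
 show "bm_add T (bm_zero T p) h K = h K"
 proof (cases "K \<in> compacts T")
  case True
  obtain x where "h K = tw_class T (off T K) p x" using assms True unfolding bm_homology_iff by blast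
  then show ?thesis using True by (simp add: bm_add_def bm_zero_def tw_class_add flip: tw_class_0)
 next
  case False
  then show ?thesis using bm_homology_extensional[OF assms] by (simp add: bm_add_def extensional_def)
 qed
qed

lemma bm_smult_zero: "bm_smult T p r (bm_zero T p) = bm_zero T p"
proof
 fix K
 show "bm_smult T p r (bm_zero T p) K = bm_zero T p K"
 proof (cases "K \<in> compacts T")
  case True
  have "0 \<in> bm_zero T p K" using True by (simp add: bm_zero_def submod_0[OF submod_tw_boundaries])
  then have "bm_smult T p r (bm_zero T p) K = tw_class T (off T K) p (smul r 0)" by (rule bm_smult_eq[OF bm_zero_in True])
  also have "\<dots> = bm_zero T p K" using True by (simp add: tw_class_0 bm_zero_def)
  finally show ?thesis .
 qed (simp add: bm_smult_def bm_zero_def)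
qed

lemma H_BM_simps [simp]:
 "monoid.mult (H_BM a d) = H_mult a d" "\<one>\<^bsub>H_BM a d\<^esub> = H_single a d (\<lambda>_. 0) (empty_class a d)"
 "\<zero>\<^bsub>H_BM a d\<^esub> = conf_zero a d" "x \<oplus>\<^bsub>H_BM a d\<^esub> y = (\<lambda>c. bm_add (conf_twisted a d c) (x c) (y c))"
 "r \<odot>\<^bsub>H_BM a d\<^esub> x = (\<lambda>c. bm_smult (conf_twisted a d c) (degree_of c) r (x c))"
 by (simp_all add: H_BM_def)

lemma zero_carrier: "conf_zero a d \<in> carrier (H_BM a d)" by (simp add: carrier_H_BM conf_zero_homology)

lemma add_carrier: assumes "x \<in> carrier (H_BM a d)" "y \<in> carrier (H_BM a d)"
 shows "x \<oplus>\<^bsub>H_BM a d\<^esub> y \<in> carrier (H_BM a d)"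
proof -
 have "finite ({c. x c \<noteq> conf_zero a d c} \<union> {c. y c \<noteq> conf_zero a d c})"
  using assms by (simp add: carrier_H_BM)
 moreover have "{c. (x \<oplus>\<^bsub>H_BM a d\<^esub> y) c \<noteq> conf_zero a d c} \<subseteq> {c. x c \<noteq> conf_zero a d c} \<union> {c. y c \<noteq> conf_zero a d c}"
  by (auto simp: conf_zero_def bm_add_zero[OF bm_zero_in])
 ultimately have "finite {c. (x \<oplus>\<^bsub>H_BM a d\<^esub> y) c \<noteq> conf_zero a d c}" by (rule rev_finite_subset)
 then show ?thesis using assms unfolding carrier_H_BM conf_homology_def by (auto intro: bm_add_in)
qed

lemma smult_carrier: assumes "x \<in> carrier (H_BM a d)"
 shows "r \<odot>\<^bsub>H_BM a d\<^esub> x \<in> carrier (H_BM a d)"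
proof -
 have "finite {c. x c \<noteq> conf_zero a d c}" using assms by (simp add: carrier_H_BM)
 moreover have "{c. (r \<odot>\<^bsub>H_BM a d\<^esub> x) c \<noteq> conf_zero a d c} \<subseteq> {c. x c \<noteq> conf_zero a d c}"
  by (auto simp: conf_zero_def bm_smult_zero)
 ultimately have "finite {c. (r \<odot>\<^bsub>H_BM a d\<^esub> x) c \<noteq> conf_zero a d c}" by (rule rev_finite_subset)
 then show ?thesis using assms unfolding carrier_H_BM conf_homology_def by (auto intro: bm_smult_in)
qed

text \<open>Provides the calculus of finite sums in which the Serre relations are stated.\<close>

lemma abelian_monoid_H_BM: "abelian_monoid (H_BM a d)"
proof (rule abelian_monoidI)
 fix x y z assume x: "x \<in> carrier (H_BM a d)" and y: "y \<in> carrier (H_BM a d)" and z: "z \<in> carrier (H_BM a d)"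
 show "\<zero>\<^bsub>H_BM a d\<^esub> \<oplus>\<^bsub>H_BM a d\<^esub> x = x"
 proof -
  have xc: "x c \<in> bm_homology (conf_twisted a d c) (degree_of c)" for c
   using x by (simp add: carrier_H_BM conf_homology_def)
  show ?thesis by (simp add: conf_zero_def bm_add_zero[OF xc])
 qed
 show "x \<oplus>\<^bsub>H_BM a d\<^esub> y \<oplus>\<^bsub>H_BM a d\<^esub> z = x \<oplus>\<^bsub>H_BM a d\<^esub> (y \<oplus>\<^bsub>H_BM a d\<^esub> z)"
  by (auto simp: bm_add_def add.assoc fun_eq_iff)
 show "x \<oplus>\<^bsub>H_BM a d\<^esub> y = y \<oplus>\<^bsub>H_BM a d\<^esub> x"
  by (auto simp: bm_add_def add.commute fun_eq_iff)
qed (use add_carrier zero_carrier in auto)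

lemma has_symbol_zero: "has_symbol a d (conf_zero a d) (\<lambda>_. 0)"
 by (simp add: has_symbol_def zero_carrier rep_zero zero_in_conf_zero compactin_spread)

lemma has_symbol_add: assumes "has_symbol a d x S" "has_symbol a d y S'"
 shows "has_symbol a d (x \<oplus>\<^bsub>H_BM a d\<^esub> y) (\<lambda>w. S w + S' w)"
 using assms add_carrier[of x a d y]
 by (auto simp: has_symbol_def rep_add bm_add_def compactin_spread intro: set_plus_intro)

lemma has_symbol_smult: assumes x: "has_symbol a d x S"
 shows "has_symbol a d (r \<odot>\<^bsub>H_BM a d\<^esub> x) (\<lambda>w. r * S w)"
proof -
 have "rep (\<lambda>w. r * S w) c \<in> (r \<odot>\<^bsub>H_BM a d\<^esub> x) c (spread c \<epsilon>)" if "0 < \<epsilon>" for c \<epsilon>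
 proof -
  have h: "x c \<in> bm_homology (conf_twisted a d c) (degree_of c)" and "rep S c \<in> x c (spread c \<epsilon>)"
   using x that by (simp_all add: has_symbol_def carrier_H_BM conf_homology_def)
  from bm_smult_eq[OF h spread_compacts[OF that] this(2)] show ?thesis by (simp add: rep_smul tw_class_self)
 qed
 then show ?thesis using x smult_carrier[of x a d r] by (simp add: has_symbol_def del: H_BM_simps)
qed

text \<open>The empty configuration is the word cell of the empty word, so the unit has a symbol
  like the other classes.\<close>

lemma empty_class_homology: "empty_class a d \<in> conf_homology a d (\<lambda>_. 0)"
 and empty_class_esimp: "K \<in> compacts (conf_twisted a d (\<lambda>_. 0)) ==>
  empty_class a d K = tw_class (conf_twisted a d (\<lambda>_. 0)) (off (conf_twisted a d (\<lambda>_. 0)) K) 0 (single (esimp []) 1)"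
proof -
 let ?T = "conf_twisted a d (\<lambda>_. 0)"
 have e: "(\<lambda>x\<in>standard_simplex 0. (\<lambda>_. {}, \<lambda>k\<in>coords. 0)) = esimp []"
  by (auto simp: esimp_def hsimp_def wsimp_def wcover_def lab_def lab_angle_def colour_pairs_def wpairs_def fun_eq_iff restrict_def)
 then show eq: "empty_class a d K = tw_class ?T (off ?T K) 0 (single (esimp []) 1)" if "K \<in> compacts ?T" for K
  unfolding empty_class_def Let_def e using that by simp
 have wt0: "wt [] = (\<lambda>_. 0)" by auto
 have deg: "degree_of (\<lambda>_. 0) = 0" by (simp add: degree_of_def)
 show "empty_class a d \<in> conf_homology a d (\<lambda>_. 0)" unfolding conf_homology_def deg
 proof (rule bm_homologyI)
  fix K assume K: "K \<in> compacts ?T"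
  have "single (esimp []) 1 \<in> tw_cycles ?T (off ?T K) 0"
  proof (rule single_tw_cycle)
   show "singular_simplex 0 (torus_cover ?T) (esimp [])"
    using singular_simplex_hsimp[of "\<lambda>r. 1 / real (r + 1)" "[]" a d] by (simp add: esimp_def wt0)
  qed (simp add: standard_simplex_0)
  then show "\<exists>x\<in>tw_cycles ?T (off ?T K) 0. empty_class a d K = tw_class ?T (off ?T K) 0 x"
   using eq[OF K] by blast
 next
  fix K K' assume "K \<in> compacts ?T" "K' \<in> compacts ?T"
  then show "empty_class a d K' \<inter> empty_class a d K \<noteq> {}" using eq tw_class_self by blast
 qed (simp add: empty_class_def Let_def)
qed

definition eps :: "'i list => 'r::zero_neq_one" where
 "eps w = (if w = [] then 1 else 0)"

lemma has_symbol_one: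
 fixes a :: "'i::{finite,linorder} => 'i => int" shows "has_symbol a d \<one>\<^bsub>H_BM a d\<^esub> eps"
 unfolding H_BM_simps
proof (rule H_single_symbol[OF empty_class_homology])
 fix \<epsilon> :: real assume "0 < \<epsilon>"
 then have K: "spread (\<lambda>_. 0) \<epsilon> \<in> compacts (conf_twisted a d (\<lambda>_. 0))" by (rule spread_compacts)
 have "words (\<lambda>_. 0) = {[] :: 'i list}" by (auto simp: words_def fun_eq_iff count_list_0_iff)
 then have "rep eps (\<lambda>_ :: 'i. 0) = single (esimp []) 1" by (simp add: rep_def eps_def wsign_def descents_def)
 then show "rep eps (\<lambda>_. 0) \<in> empty_class a d (spread (\<lambda>_. 0) \<epsilon>)"
  unfolding empty_class_esimp[OF K] by (simp add: tw_class_self)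
qed (auto simp: eps_def)

section \<open>The quantum shuffle algebra\<close>

lemma shp_add: "shp b (\<lambda>w. f w + f' w) g W = shp b f g W + shp b f' g W"
 "shp b f (\<lambda>w. g w + g' w) W = shp b f g W + shp b f g' W"
proof -
 show "shp b (\<lambda>w. f w + f' w) g W = shp b f g W + shp b f' g W"
  by (induction W arbitrary: f f' g) (simp_all add: distrib_left distrib_right)
 show "shp b f (\<lambda>w. g w + g' w) W = shp b f g W + shp b f g' W"
  by (induction W arbitrary: f g g') (simp_all add: distrib_left)
qed

lemma shp_scale: "shp b (\<lambda>w. c * f w) g W = c * shp b f g W" "shp b f (\<lambda>w. c * g w) W = c * shp b f g W"
proof -
 show "shp b (\<lambda>w. c * f w) g W = c * shp b f g W"
  by (induction W arbitrary: f g) (simp_all add: distrib_left mult.left_commute[of _ c] mult.assoc)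
 show "shp b f (\<lambda>w. c * g w) W = c * shp b f g W"
  by (induction W arbitrary: f g) (simp_all add: distrib_left mult.left_commute[of _ c])
qed

lemma shp_zero: "shp b (\<lambda>_. 0) g W = 0" "shp b f (\<lambda>_. 0) W = 0"
 using shp_scale(1)[of b 0 "\<lambda>_. 0" g W] shp_scale(2)[of b f 0 "\<lambda>_. 0" W] by simp_all

lemma tw_simps [simp]: "tw b i [] = 1" "tw b i (j # w) = b j i * tw b i w" by (simp_all add: tw_def)

lemma shp_eps:
 fixes b :: "'i => 'i => 'r::comm_ring_1" shows "shp b eps g W = g W" "shp b f eps W = f W"
proof -
 have [simp]: "eps (i # w) = (0 :: 'r)" "tw b i w * eps w = eps w" for i w by (auto simp: eps_def)
 show "shp b eps g W = g W" by (induction W arbitrary: g) (simp_all add: shp_zero, simp add: eps_def)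
 show "shp b f eps W = f W" by (induction W arbitrary: f) (simp_all add: shp_zero, simp add: eps_def)
qed

text \<open>The letters of a shuffle are those of its two parts, so the factor for passing a shuffle
  is the product of the factors for passing the parts.\<close>

lemma tw_shp: "tw b i W * shp b f g W = shp b (\<lambda>u. tw b i u * f u) (\<lambda>w. tw b i w * g w) W"
proof (induction W arbitrary: f g)
 case (Cons j W)
 have "tw b i (j # W) * shp b f g (j # W) =
   b j i * (tw b i W * shp b (\<lambda>u. f (j # u)) g W) + b j i * (tw b i W * shp b (\<lambda>u. tw b j u * f u) (\<lambda>w. g (j # w)) W)"
  by (simp add: algebra_simps)
 also have "\<dots> = shp b (\<lambda>u. tw b i u * f u) (\<lambda>w. tw b i w * g w) (j # W)"
  unfolding Cons by (simp add: mult.assoc mult.left_commute[of "tw b i _"] shp_scale)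
 finally show ?case .
qed simp

text \<open>The first letter comes from one of three factors; \<open>tw_shp\<close> rewrites the
  factor for passing a product, and both bracketings give the same three terms.\<close>

lemma shp_assoc: "shp b (shp b f g) h W = shp b f (shp b g h) W"
proof (induction W arbitrary: f g h)
 case (Cons i W)
 show ?case by (simp add: shp_add tw_shp Cons add.assoc)
qed (simp add: mult.assoc)

subsection \<open>Divided powers\<close>

context
 fixes a :: "'i::{finite,linorder} => 'i => int" and d :: "'i => nat" assumes ad: "cartan_datum a d"
begin

abbreviation (input) "br \<equiv> braid a d"
abbreviation (input) "\<phi> \<equiv> F_symbol d"

lemma braid_diag: "br i i = vpow (- 2 * int (d i))" and braid_sym: "br i j = br j i"
 using ad by (simp_all add: braid_def cartan_datum_def)

lemma triangle_Suc: "d' * (Suc k * (Suc k - 1) div 2) = d' * (k * (k - 1) div 2) + d' * k"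
proof -
 have "Suc k * k = k * (k - 1) + 2 * k" by (cases k) simp_all
 then have "Suc k * (Suc k - 1) div 2 = k * (k - 1) div 2 + k" by simp
 then show ?thesis by (simp only: distrib_left)
qed

lemma F_symbol_0: "\<phi> i 0 = eps" by (simp add: F_symbol_def eps_def fun_eq_iff)

lemma F_symbol_Cons: "\<phi> i k (j # w) = (if j = i \<and> 0 < k then vpow (- int (d i * (k - 1))) * \<phi> i (k - 1) w else 0)"
proof (cases k)
 case (Suc m)
 have "vpow (- int (d i * (k * (k - 1) div 2))) = vpow (- int (d i * (k - 1))) * vpow (- int (d i * (m * (m - 1) div 2)))"
  unfolding Suc triangle_Suc vpow_add[symmetric] by simp
 then show ?thesis using Suc by (auto simp: F_symbol_def)
qed (simp add: F_symbol_def)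

lemma tw_replicate: "tw b j (replicate k i) = b i j ^ k" by (induction k) simp_all

lemma tw_F_symbol: "tw b j w * \<phi> i k w = b i j ^ k * \<phi> i k w" by (simp add: F_symbol_def tw_replicate)

lemma vpow_power: "vpow n ^ k = vpow (int k * n)" by (induction k) (simp_all add: vpow_add[symmetric] distrib_right)

lemma qint_Suc: "qint n (Suc k) = vpow n * qint n k + vpow (- (n * int k))"
proof -
 have "vpow n * qint n k = (\<Sum>m<k. vpow (n * (int k - 2 * int m)))"
  unfolding qint_def sum_distrib_left vpow_add[symmetric] by (intro sum.cong) (simp_all add: algebra_simps)
 then show ?thesis by (simp add: qint_def algebra_simps)
qed

text \<open>The first letter is either taken from the power or is the added one. After collecting
  exponents the two contributions form the recursion \<open>qint_Suc\<close>.\<close>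

lemma shp_divided: "shp br (\<phi> i k) (\<phi> i 1) W = qint (int (d i)) (Suc k) * \<phi> i (Suc k) W"
proof (induction W arbitrary: k)
 case Nil
 then show ?case by (simp add: F_symbol_def)
next
 case (Cons j W)
 let ?d = "int (d i)"
 show ?case
 proof (cases "j = i")
  case True
  have 1: "shp br (\<lambda>u. \<phi> i k (i # u)) (\<phi> i 1) W = vpow (- ?d * (int k - 1)) * (qint ?d k * \<phi> i k W)"
  proof (cases k)
   case 0
   then show ?thesis by (simp add: F_symbol_Cons shp_zero qint_def)
  next
   case (Suc m)
   then show ?thesis using Cons[of m] by (simp add: F_symbol_Cons shp_scale)
  qed
  have 2: "shp br (\<lambda>u. tw br i u * \<phi> i k u) (\<lambda>w. \<phi> i 1 (i # w)) W = vpow (- 2 * ?d * int k) * \<phi> i k W"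
   by (simp add: tw_F_symbol F_symbol_Cons shp_scale F_symbol_0 shp_eps braid_diag vpow_power mult.commute[of "int k"])
  have "shp br (\<phi> i k) (\<phi> i 1) (j # W) = (vpow (- ?d * (int k - 1)) * qint ?d k + vpow (- 2 * ?d * int k)) * \<phi> i k W"
   using True 1 2 by (simp add: distrib_right mult.assoc)
  also have "vpow (- ?d * (int k - 1)) * qint ?d k + vpow (- 2 * ?d * int k) = vpow (- ?d * int k) * qint ?d (Suc k)"
   unfolding qint_Suc distrib_left mult.assoc[symmetric] vpow_add[symmetric] by (simp add: algebra_simps)
  finally show ?thesis using True by (simp add: F_symbol_Cons mult_ac)
 next
  case False
  then show ?thesis by (simp add: F_symbol_Cons shp_zero)
 qed
qed

lemma shp_F_F_Cons: "shp br (\<phi> i m) (\<phi> i k) (j # W) = (if j = i then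
  (if 0 < m then vpow (- int (d i * (m - 1))) * shp br (\<phi> i (m - 1)) (\<phi> i k) W else 0) +
  (if 0 < k then vpow (- 2 * int (d i * m) - int (d i * (k - 1))) * shp br (\<phi> i m) (\<phi> i (k - 1)) W else 0) else 0)"
proof (cases "j = i")
 case True
 have "br i i ^ m * vpow (- int (d i * (k - 1))) = vpow (- 2 * int (d i * m) - int (d i * (k - 1)))"
  unfolding braid_diag vpow_power vpow_add[symmetric] by (simp add: algebra_simps)
 then have "shp br (\<lambda>u. tw br i u * \<phi> i m u) (\<lambda>w. \<phi> i k (i # w)) W =
   (if 0 < k then vpow (- 2 * int (d i * m) - int (d i * (k - 1))) * shp br (\<phi> i m) (\<phi> i (k - 1)) W else 0)"
  unfolding tw_F_symbol by (cases k) (simp_all add: F_symbol_Cons shp_zero shp_scale mult.assoc[symmetric])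
 moreover have "shp br (\<lambda>u. \<phi> i m (i # u)) (\<phi> i k) W =
   (if 0 < m then vpow (- int (d i * (m - 1))) * shp br (\<phi> i (m - 1)) (\<phi> i k) W else 0)"
  by (simp add: F_symbol_Cons shp_zero shp_scale)
 ultimately show ?thesis using True by simp
qed (simp add: F_symbol_Cons shp_zero)

subsection \<open>Quantum Serre relations\<close>

text \<open>The shuffle form of the vanishing alternating sum of Gaussian binomial coefficients.
  Splitting off the first letter reduces the sum for \<open>Suc n\<close> to the sum for
  \<open>n\<close>, multiplied by a difference of opposite powers of \<open>v\<close> with exponent
  \<open>int (d i) * int n\<close>; for \<open>n = 0\<close> this factor itself is 0.\<close>

lemma alternating_divided: assumes "0 < n"
 shows "(\<Sum>m\<le>n. (- 1) ^ m * (vpow (int (d i) * (int m * (int n - 1))) * shp br (\<phi> i m) (\<phi> i (n - m)) W)) = 0"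
 using assms
proof (induction n arbitrary: W)
 case (Suc n)
 let ?p = "int (d i)"
 show ?case
 proof (cases W)
  case Nil
  have "\<phi> i m [] * \<phi> i (Suc n - m) [] = 0" if "m \<le> Suc n" for m by (cases m) (simp_all add: F_symbol_def)
  then show ?thesis by (simp add: Nil del: mult_eq_0_iff)
 next
  case (Cons j w)
  show ?thesis
  proof (cases "j = i")
   case True
   let ?C = "\<lambda>m. shp br (\<phi> i m) (\<phi> i (n - m)) w" and ?c = "\<lambda>m. (- 1) ^ m * vpow (?p * (int m * int n))"
   have "(\<Sum>m\<le>Suc n. (- 1) ^ m * (vpow (?p * (int m * (int (Suc n) - 1))) * shp br (\<phi> i m) (\<phi> i (Suc n - m)) W)) =
     (\<Sum>m\<le>Suc n. ?c m * (if 0 < m then vpow (- int (d i * (m - 1))) * shp br (\<phi> i (m - 1)) (\<phi> i (Suc n - m)) w else 0)) +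
     (\<Sum>m\<le>Suc n. ?c m * (if 0 < Suc n - m then vpow (- 2 * int (d i * m) - int (d i * (Suc n - m - 1))) * shp br (\<phi> i m) (\<phi> i (Suc n - m - 1)) w else 0))"
    unfolding Cons shp_F_F_Cons sum.distrib[symmetric] using True by (intro sum.cong) (simp_all add: distrib_left mult.assoc del: of_nat_mult)
   also have "(\<Sum>m\<le>Suc n. ?c m * (if 0 < m then vpow (- int (d i * (m - 1))) * shp br (\<phi> i (m - 1)) (\<phi> i (Suc n - m)) w else 0)) =
     (\<Sum>m\<le>n. ?c (Suc m) * (vpow (- int (d i * m)) * ?C m))" unfolding sum.atMost_Suc_shift by simp
   also have "(\<Sum>m\<le>Suc n. ?c m * (if 0 < Suc n - m then vpow (- 2 * int (d i * m) - int (d i * (Suc n - m - 1))) * shp br (\<phi> i m) (\<phi> i (Suc n - m - 1)) w else 0)) =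
     (\<Sum>m\<le>n. ?c m * (vpow (- 2 * int (d i * m) - int (d i * (n - m))) * ?C m))"
    by (simp add: Suc_diff_le del: of_nat_mult)
   also have "(\<Sum>m\<le>n. ?c (Suc m) * (vpow (- int (d i * m)) * ?C m)) + \<dots> =
     (vpow (- ?p * int n) - vpow (?p * int n)) * (\<Sum>m\<le>n. (- 1) ^ m * (vpow (?p * (int m * (int n - 1))) * ?C m))"
    unfolding sum.distrib[symmetric] sum_distrib_left
   proof (rule sum.cong[OF refl])
    fix m assume "m \<in> {..n}"
    then have "int (n - m) = int n - int m" by simp
    then have 1: "vpow (?p * (int (Suc m) * int n)) * vpow (- int (d i * m)) = vpow (?p * int n) * vpow (?p * (int m * (int n - 1)))"
     "vpow (?p * (int m * int n)) * vpow (- 2 * int (d i * m) - int (d i * (n - m))) = vpow (- ?p * int n) * vpow (?p * (int m * (int n - 1)))"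
     unfolding vpow_add[symmetric] by (simp_all add: algebra_simps)
    let ?v = "vpow (?p * (int m * (int n - 1)))"
    have E: "?c (Suc m) * (vpow (- int (d i * m)) * ?C m) = - (vpow (?p * int n) * ((- 1) ^ m * (?v * ?C m)))"
     using arg_cong[OF 1(1), of "\<lambda>x. - ((- 1) ^ m * x * ?C m)"] by (simp add: mult_ac)
    have E': "?c m * (vpow (- 2 * int (d i * m) - int (d i * (n - m))) * ?C m) = vpow (- ?p * int n) * ((- 1) ^ m * (?v * ?C m))"
     using arg_cong[OF 1(2), of "\<lambda>x. (- 1) ^ m * x * ?C m"] by (simp add: mult_ac)
    show "?c (Suc m) * (vpow (- int (d i * m)) * ?C m) + ?c m * (vpow (- 2 * int (d i * m) - int (d i * (n - m))) * ?C m) =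
      (vpow (- ?p * int n) - vpow (?p * int n)) * ((- 1) ^ m * (?v * ?C m))" unfolding E E' left_diff_distrib by simp
   qed
   also have "\<dots> = 0" using Suc.IH[of w] by (cases "n = 0") simp_all
   finally show ?thesis .
  qed (simp add: Cons shp_F_F_Cons del: shp.simps)
 qed
qed simp

text \<open>By the first letter of the word. If it is \<open>j\<close>, it has passed the left
  power, and since \<open>n\<close> is minus the Cartan entry this produces the weights of
  \<open>alternating_divided\<close>. If it is \<open>i\<close>, taking it from the left power at
  \<open>m + 1\<close> cancels taking it from the right power at \<open>m\<close>. Any other letter
  gives 0.\<close>

lemma serre_shuffle: assumes "i \<noteq> j"
 shows "(\<Sum>m\<le>nat (1 - a i j). (- 1) ^ m * shp br (\<phi> i m) (shp br (\<phi> j 1) (\<phi> i (nat (1 - a i j) - m))) W) = 0"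
proof -
 define n where "n = nat (- a i j)"
 let ?p = "int (d i)"
 define \<psi> where "\<psi> = \<phi> j 1"
 have "a i j \<le> 0" using ad assms by (simp add: cartan_datum_def)
 then have n: "nat (1 - a i j) = Suc n" "int n = - a i j" by (simp_all add: n_def)
 have bij: "br i j = vpow (?p * int n)" "br j i = vpow (?p * int n)"
  unfolding braid_sym[of j i] by (simp_all add: braid_def n)
 have "(\<Sum>m\<le>Suc n. (- 1) ^ m * shp br (\<phi> i m) (shp br \<psi> (\<phi> i (Suc n - m))) W) = 0"
 proof (cases W)
  case Nil
  then show ?thesis by (simp add: \<psi>_def F_symbol_def)
 next
  case (Cons l w)
  have \<psi>: "\<psi> (l # u) = (if l = j then eps u else 0)" for l u by (simp add: \<psi>_def F_symbol_Cons F_symbol_0)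
  have tw_eps: "(\<lambda>u. tw br i u * \<psi> u) = (\<lambda>u. br j i * \<psi> u)"
   using tw_F_symbol[of br i _ j 1] by (simp add: fun_eq_iff \<psi>_def)
  consider "l = j" | "l = i" | "l \<noteq> i" "l \<noteq> j" by blast
  then show ?thesis
  proof cases
   case 1
   have *: "shp br (\<phi> i m) (shp br \<psi> (\<phi> i k)) W = vpow (?p * (int m * (int (Suc n) - 1))) * shp br (\<phi> i m) (\<phi> i k) w" for m k
   proof -
    have v: "br i j ^ m = vpow (?p * (int m * (int (Suc n) - 1)))"
     unfolding bij vpow_power by (simp add: mult.left_commute)
    show ?thesis
     unfolding v[symmetric] using assms 1 by (simp add: Cons \<psi> F_symbol_Cons[of i] shp_zero shp_eps tw_F_symbol shp_scale)
   qed
   show ?thesis using alternating_divided[OF zero_less_Suc, of i n w] unfolding * .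
  next
   case 2
   let ?D = "\<lambda>m. shp br (\<phi> i m) (shp br \<psi> (\<phi> i (n - m))) w"
   have *: "shp br (\<phi> i m) (shp br \<psi> (\<phi> i k)) W =
     (if 0 < m then vpow (- int (d i * (m - 1))) * shp br (\<phi> i (m - 1)) (shp br \<psi> (\<phi> i k)) w else 0) +
     (if 0 < k then br i i ^ m * (br j i * vpow (- int (d i * (k - 1)))) * shp br (\<phi> i m) (shp br \<psi> (\<phi> i (k - 1))) w else 0)" for m k
   proof -
    have "shp br (\<lambda>u. \<phi> i m (i # u)) (shp br \<psi> (\<phi> i k)) w =
      (if 0 < m then vpow (- int (d i * (m - 1))) * shp br (\<phi> i (m - 1)) (shp br \<psi> (\<phi> i k)) w else 0)"
     by (simp add: F_symbol_Cons shp_zero shp_scale)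
    moreover have "shp br (\<lambda>u. tw br i u * \<phi> i m u) (\<lambda>u. shp br \<psi> (\<phi> i k) (i # u)) w =
      (if 0 < k then br i i ^ m * (br j i * vpow (- int (d i * (k - 1)))) * shp br (\<phi> i m) (shp br \<psi> (\<phi> i (k - 1))) w else 0)"
     unfolding shp.simps tw_F_symbol tw_eps using 2 assms
     by (cases k) (simp_all add: \<psi> F_symbol_Cons shp_zero shp_scale mult.assoc del: shp.simps)
    ultimately show ?thesis using 2 by (simp add: Cons)
   qed
   have "(\<Sum>m\<le>Suc n. (- 1) ^ m * shp br (\<phi> i m) (shp br \<psi> (\<phi> i (Suc n - m))) W) =
     (\<Sum>m\<le>Suc n. (- 1) ^ m * (if 0 < m then vpow (- int (d i * (m - 1))) * shp br (\<phi> i (m - 1)) (shp br \<psi> (\<phi> i (Suc n - m))) w else 0)) +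
     (\<Sum>m\<le>Suc n. (- 1) ^ m * (if 0 < Suc n - m then br i i ^ m * (br j i * vpow (- int (d i * (Suc n - m - 1)))) *
      shp br (\<phi> i m) (shp br \<psi> (\<phi> i (Suc n - m - 1))) w else 0))"
    unfolding * sum.distrib[symmetric] distrib_left ..
   also have "(\<Sum>m\<le>Suc n. (- 1) ^ m * (if 0 < m then vpow (- int (d i * (m - 1))) * shp br (\<phi> i (m - 1)) (shp br \<psi> (\<phi> i (Suc n - m))) w else 0)) =
     (\<Sum>m\<le>n. - ((- 1) ^ m * (vpow (- int (d i * m)) * ?D m)))" unfolding sum.atMost_Suc_shift by simp
   also have "(\<Sum>m\<le>Suc n. (- 1) ^ m * (if 0 < Suc n - m then br i i ^ m * (br j i * vpow (- int (d i * (Suc n - m - 1)))) *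
      shp br (\<phi> i m) (shp br \<psi> (\<phi> i (Suc n - m - 1))) w else 0)) =
     (\<Sum>m\<le>n. (- 1) ^ m * (br i i ^ m * (br j i * vpow (- int (d i * (n - m)))) * ?D m))"
    by (simp add: Suc_diff_le del: of_nat_mult)
   also have "\<dots> = (\<Sum>m\<le>n. (- 1) ^ m * (vpow (- int (d i * m)) * ?D m))"
   proof (rule sum.cong[OF refl])
    fix m assume "m \<in> {..n}"
    then have "int (n - m) = int n - int m" by simp
    then have "br i i ^ m * (br j i * vpow (- int (d i * (n - m)))) = vpow (- int (d i * m))"
     unfolding braid_diag bij vpow_power vpow_add[symmetric] by (simp add: algebra_simps)
    then show "(- 1) ^ m * (br i i ^ m * (br j i * vpow (- int (d i * (n - m)))) * ?D m) = (- 1) ^ m * (vpow (- int (d i * m)) * ?D m)"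
     by simp
   qed
   finally show ?thesis by (simp add: sum_negf)
  next
   case 3
   then show ?thesis by (simp add: Cons \<psi> F_symbol_Cons[of i] shp_zero)
  qed
 qed
 then show ?thesis unfolding n \<psi>_def .
qed

end

section \<open>Relations and the homomorphism\<close>

lemma has_symbol_finsum: assumes "finite I" "\<forall>m\<in>I. has_symbol a d (x m) (S m)"
 shows "has_symbol a d (finsum (H_BM a d) x I) (\<lambda>w. \<Sum>m\<in>I. S m w)"
proof -
 interpret abelian_monoid "H_BM a d" by (rule abelian_monoid_H_BM)
 show ?thesis using assms
 proof (induction I)
  case empty
  then show ?case by (simp only: finsum_empty H_BM_simps sum.empty has_symbol_zero)
 next
  case (insert m I)
  then have "x \<in> I \<rightarrow> carrier (H_BM a d)" "x m \<in> carrier (H_BM a d)" by (auto simp: has_symbol_def)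
  then have "finsum (H_BM a d) x (insert m I) = x m \<oplus>\<^bsub>H_BM a d\<^esub> finsum (H_BM a d) x I"
   using insert by (intro finsum_insert) auto
  then show ?case
   using has_symbol_add[of a d "x m" "S m" "finsum (H_BM a d) x I" "\<lambda>w. \<Sum>m\<in>I. S m w"] insert
   by (simp del: H_BM_simps)
 qed
qed

lemma qfact_Suc: "qfact n (Suc k) = qfact n k * qint n (Suc k)" by (simp add: qfact_def)

lemma qfact_nonzero: assumes "0 < n" shows "qfact n k \<noteq> 0"
proof (induction k)
 case (Suc k)
 have "- (n * int (Suc k)) \<noteq> n * int (Suc k)" using assms mult_pos_pos[of n "int (Suc k)"] by linarith
 then have "qint n (Suc k) \<noteq> 0" using qint_times[of n "Suc k"] by (metis mult_zero_left right_minus_eq vpow_eq_iff)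
 then show ?case using Suc by (simp add: qfact_Suc)
qed (simp add: qfact_def)

lemma to_qv_simps:
 "to_qv (x * y) = to_qv x * to_qv y" "to_qv (x + y) = to_qv x + to_qv y" "to_qv 0 = 0" "to_qv 1 = 1"
 "to_qv x = to_qv y \<longleftrightarrow> x = y" "to_qv (- x) = - to_qv x"
 by (simp_all add: to_qv_def One_fract_def Zero_fract_def eq_fract)

lemma tw_to_qv: "tw (\<lambda>i j. to_qv (b i j)) i w = to_qv (tw b i w)" by (induction w) (simp_all add: to_qv_simps)

lemma shp_to_qv:
 "shp (\<lambda>i j. to_qv (b i j)) (\<lambda>w. to_qv (f w)) (\<lambda>w. to_qv (g w)) W = to_qv (shp b f g W)"
proof (induction W arbitrary: f g)
 case (Cons i W)
 show ?case by (simp add: tw_to_qv to_qv_simps Cons flip: to_qv_simps(1))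
qed (simp add: to_qv_simps)

subsection \<open>The free algebra in the shuffle algebra\<close>

text \<open>The product of the letters of a word in the shuffle algebra. Hence
  \<open>sh_eval\<close> is the evaluation homomorphism of the free algebra at the letters.\<close>

primrec shw :: "('i => 'i => 'r::comm_ring_1) => 'i list => 'i list => 'r" where
 "shw b [] = eps"
| "shw b (i # w) = shp b (\<lambda>u. if u = [i] then 1 else 0) (shw b w)"

lemma shw_append: "shw b (u @ w) = shp b (shw b u) (shw b w)"
proof (induction u)
 case (Cons i u)
 show ?case
 proof
  fix W
  show "shw b ((i # u) @ w) W = shp b (shw b (i # u)) (shw b w) W"
   using shp_assoc[of b "\<lambda>u. if u = [i] then 1 else 0" "shw b u" "shw b w" W] by (simp add: Cons)
 qed
qed (simp add: fun_eq_iff shp_eps)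

definition sh_eval :: "('i => 'i => 'r::comm_ring_1) => ('i word \<Rightarrow>\<^sub>0 'r) => 'i list => 'r" where
 "sh_eval b y W = (\<Sum>w\<in>keys y. lookup y w * shw b (letters w) W)"

lemma sh_eval_superset: assumes "finite A" "keys y \<subseteq> A"
 shows "sh_eval b y W = (\<Sum>w\<in>A. lookup y w * shw b (letters w) W)"
 unfolding sh_eval_def using assms by (intro sum.mono_neutral_left) (auto simp: in_keys_iff)

lemma sh_eval_add: "sh_eval b (y + z) W = sh_eval b y W + sh_eval b z W"
proof -
 let ?A = "keys y \<union> keys z"
 have "sh_eval b u W = (\<Sum>w\<in>?A. lookup u w * shw b (letters w) W)" if "u = y \<or> u = z \<or> u = y + z" for u
  using that keys_add[of y z] by (intro sh_eval_superset) auto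
 then show ?thesis by (simp add: lookup_add distrib_right sum.distrib)
qed

lemma sh_eval_0: "sh_eval b 0 W = 0" by (simp add: sh_eval_def)

lemma sh_eval_uminus: "sh_eval b (- y) W = - sh_eval b y W"
 using sh_eval_add[of b y "- y" W] by (simp add: sh_eval_0 eq_neg_iff_add_eq_0 add.commute)

lemma sh_eval_sum: "sh_eval b (sum y I) W = (\<Sum>i\<in>I. sh_eval b (y i) W)"
 by (induction I rule: infinite_finite_induct) (simp_all add: sh_eval_0 sh_eval_add)

lemma sh_eval_single: "sh_eval b (single w c) W = c * shw b (letters w) W" by (simp add: sh_eval_def)

lemma sh_eval_const: "sh_eval b (free_const c) W = c * eps W" by (simp add: free_const_def sh_eval_single zero_word_def)

lemma poly_mapping_single_induct [case_names zero single add]: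
 fixes y :: "'k \<Rightarrow>\<^sub>0 'r::comm_ring_1"
 assumes "P 0" "\<And>k c. P (single k c)" "\<And>f g. P f ==> P g ==> P (f + g)" shows "P y"
proof -
 have "P (\<Sum>k\<in>I. single k (lookup y k))" for I by (induction I rule: infinite_finite_induct) (simp_all add: assms)
 then show ?thesis by (subst sum_monomials)
qed

lemma sh_eval_mult: "sh_eval b (y * z) W = shp b (sh_eval b y) (sh_eval b z) W"
proof -
 have *: "sh_eval b (single u r * single w s) W =
   shp b (sh_eval b (single u r)) (sh_eval b (single w s)) W" for u w r s
  by (simp add: mult_single sh_eval_single[abs_def] shp_scale plus_word_def shw_append mult.assoc)
 have **: "sh_eval b (single u r * z) W = shp b (sh_eval b (single u r)) (sh_eval b z) W" for u r
 proof (induction z rule: poly_mapping_single_induct)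
  case zero
  then show ?case by (simp add: sh_eval_0 sh_eval_0[abs_def] shp_zero)
 next
  case (add f g)
  then show ?case by (simp add: distrib_left sh_eval_add sh_eval_add[abs_def] shp_add)
 qed (rule *)
 show ?thesis
 proof (induction y rule: poly_mapping_single_induct)
  case zero
  then show ?case by (simp add: sh_eval_0 sh_eval_0[abs_def] shp_zero)
 next
  case (add f g)
  then show ?case by (simp add: distrib_right sh_eval_add sh_eval_add[abs_def] shp_add)
 qed (rule **)
qed

lemma sh_eval_minus_1_power: "sh_eval b ((- 1) ^ m * y) W = (- 1) ^ m * sh_eval b y W"
 by (induction m) (simp_all add: sh_eval_uminus mult.assoc)

lemma ring_ring_of_type_algebra: "ring (ring_of_type_algebra :: 'a::ring_1 ring)"
proof -
 have "\<exists>y. x + y = 0" for x :: 'a by (rule exI[of _ "- x"]) simp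
 then show ?thesis unfolding ring_of_type_algebra_def by unfold_locales (auto simp: algebra_simps Units_def)
qed

section \<open>From the free algebra to homology\<close>

context
 fixes a :: "'i::{finite,linorder} => 'i => int" and d :: "'i => nat" assumes ad: "cartan_datum a d"
begin

abbreviation (input) "E \<equiv> sh_eval (\<lambda>i j. to_qv (braid a d i j))"

lemma has_symbol_power:
 "has_symbol a d (F_div a d \<alpha> 1 [^]\<^bsub>H_BM a d\<^esub> k) (\<lambda>w. qfact (int (d \<alpha>)) k * F_symbol d \<alpha> k w)"
proof (induction k)
 case 0
 then show ?case using has_symbol_one[of a d] by (simp add: nat_pow_def qfact_def F_symbol_0[OF ad])
next
 case (Suc k)
 have "shp (braid a d) (\<lambda>w. qfact (int (d \<alpha>)) k * F_symbol d \<alpha> k w) (F_symbol d \<alpha> 1) =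
   (\<lambda>w. qfact (int (d \<alpha>)) (Suc k) * F_symbol d \<alpha> (Suc k) w)"
  unfolding fun_eq_iff shp_scale shp_divided[OF ad] qfact_Suc by (simp add: mult.assoc)
 then show ?case using has_symbol_mult[OF ad Suc F_div_symbol[of a d \<alpha> 1]] by (simp add: nat_pow_def)
qed

lemma sh_eval_gen_power: "E (free_gen i ^ k) W = to_qv (qfact (int (d i)) k * F_symbol d i k W)"
proof (induction k arbitrary: W)
 case 0
 then show ?case using sh_eval_const[of "\<lambda>i j. to_qv (braid a d i j)" 1 W]
  by (simp add: qfact_def F_symbol_0[OF ad] free_const_def eps_def to_qv_simps)
next
 case (Suc k)
 have "E (free_gen i) W = to_qv (F_symbol d i 1 W)" for W
  by (simp add: free_gen_def sh_eval_single shp_eps F_symbol_def to_qv_simps)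
 then have "E (free_gen i ^ Suc k) W = shp (\<lambda>i j. to_qv (braid a d i j))
   (\<lambda>w. to_qv (qfact (int (d i)) k * F_symbol d i k w)) (\<lambda>w. to_qv (F_symbol d i 1 w)) W"
  unfolding power_Suc2 sh_eval_mult using Suc by presburger
 also have "\<dots> = to_qv (qfact (int (d i)) (Suc k) * F_symbol d i (Suc k) W)"
  unfolding shp_to_qv shp_scale shp_divided[OF ad] qfact_Suc by (simp add: mult.assoc)
 finally show ?case .
qed

text \<open>The denominators cancel: the power of a letter in the shuffle algebra is the quantum
  factorial times \<open>F_symbol\<close>. So divided powers have symbols over
  \<int>[v, 1/v].\<close>

lemma sh_eval_divpow: "E (free_divpow d i k) W = to_qv (F_symbol d i k W)"
proof -
 have "to_qv (qfact (int (d i)) k) \<noteq> 0"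
  using qfact_nonzero[of "int (d i)" k] ad unfolding to_qv_simps(3)[symmetric] to_qv_simps(5) cartan_datum_def by simp
 then show ?thesis unfolding free_divpow_def sh_eval_mult
  by (simp add: sh_eval_const[abs_def] shp_scale shp_eps sh_eval_gen_power to_qv_simps)
qed

lemma sh_eval_serre_element: assumes "i \<noteq> j" shows "E (serre_element a d i j) W = 0"
proof -
 define N where "N = nat (1 - a i j)"
 have g: "E (free_gen j) = (\<lambda>w. to_qv (F_symbol d j 1 w))"
  using sh_eval_gen_power[of j 1] by (simp add: qfact_def qint_def fun_eq_iff)
 have "E (serre_element a d i j) W = (\<Sum>m\<le>N. (- 1) ^ m *
   to_qv (shp (braid a d) (F_symbol d i m) (shp (braid a d) (F_symbol d j 1) (F_symbol d i (N - m))) W))"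
  unfolding serre_element_def N_def[symmetric] sh_eval_sum mult.assoc sh_eval_minus_1_power
  unfolding sh_eval_mult[abs_def] g sh_eval_divpow[abs_def] shp_to_qv by (rule refl)
 also have "(\<Sum>m\<le>N. (- 1) ^ m * to_qv (shp (braid a d) (F_symbol d i m)
   (shp (braid a d) (F_symbol d j 1) (F_symbol d i (N - m))) W)) = to_qv (\<Sum>m\<le>N. (- 1) ^ m *
   shp (braid a d) (F_symbol d i m) (shp (braid a d) (F_symbol d j 1) (F_symbol d i (N - m))) W)"
 proof -
  have [simp]: "to_qv (sum f A) = (\<Sum>x\<in>A. to_qv (f x))" for f and A :: "nat set"
   by (induction A rule: infinite_finite_induct) (simp_all add: to_qv_simps)
  have [simp]: "to_qv ((- 1) ^ m) = (- 1) ^ m" for m by (induction m) (simp_all add: to_qv_simps)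
  show ?thesis by (simp add: to_qv_simps)
 qed
 finally show ?thesis using serre_shuffle[OF ad assms] by (simp add: N_def to_qv_simps)
qed

text \<open>Evaluation is additive and multiplicative, so the elements of value 0 form a two-sided
  ideal; it contains the Serre elements by \<open>serre_shuffle\<close>.\<close>

lemma sh_eval_serre_ideal: assumes "y \<in> serre_ideal a d" shows "E y W = 0"
proof -
 let ?I = "{y. \<forall>W. E y W = 0}"
 interpret R: ring "ring_of_type_algebra :: ('i word \<Rightarrow>\<^sub>0 qv) ring" by (rule ring_ring_of_type_algebra)
 have zero: "\<zero>\<^bsub>ring_of_type_algebra\<^esub> = (0 :: 'i word \<Rightarrow>\<^sub>0 qv)"
  by (simp add: ring_of_type_algebra_def)
 have "ideal ?I (ring_of_type_algebra :: ('i word \<Rightarrow>\<^sub>0 qv) ring)"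
 proof (rule idealI[OF R.ring_axioms])
  show "subgroup ?I (add_monoid (ring_of_type_algebra :: ('i word \<Rightarrow>\<^sub>0 qv) ring))"
  proof (rule group.subgroupI[OF R.add.group_axioms])
   fix y assume y: "y \<in> ?I"
   have "\<ominus>\<^bsub>ring_of_type_algebra\<^esub> y = - y"
    by (rule R.minus_equality) (simp_all add: ring_of_type_algebra_def)
   then show "inv\<^bsub>add_monoid ring_of_type_algebra\<^esub> y \<in> ?I"
    using y by (simp add: a_inv_def sh_eval_uminus)
  qed (auto simp: ring_of_type_algebra_def sh_eval_add sh_eval_0 intro!: exI[of _ 0])
 qed (simp_all add: ring_of_type_algebra_def sh_eval_mult, simp_all add: shp_zero flip: fun_eq_iff)
 then have "serre_ideal a d \<subseteq> ?I"
  unfolding serre_ideal_def by (rule R.genideal_minimal) (auto simp: sh_eval_serre_element)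
 then show ?thesis using assms by blast
qed

lemma Uq_class_ops:
 "Uq_class a d x \<oplus>\<^bsub>Uq_neg a d\<^esub> Uq_class a d y = Uq_class a d (x + y)"
 "Uq_class a d x \<otimes>\<^bsub>Uq_neg a d\<^esub> Uq_class a d y = Uq_class a d (x * y)"
 "\<one>\<^bsub>Uq_neg a d\<^esub> = Uq_class a d 1"
 "x \<in> Uq_class a d x"
proof -
 interpret R: ring "ring_of_type_algebra :: ('i word \<Rightarrow>\<^sub>0 qv) ring" by (rule ring_ring_of_type_algebra)
 interpret I: ideal "serre_ideal a d" "ring_of_type_algebra :: ('i word \<Rightarrow>\<^sub>0 qv) ring"
  unfolding serre_ideal_def by (rule R.genideal_ideal) (simp add: ring_of_type_algebra_def)
 have c: "x \<in> carrier ring_of_type_algebra" for x :: "'i word \<Rightarrow>\<^sub>0 qv"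
  by (simp add: ring_of_type_algebra_def)
 note h = I.rcos_ring_hom
 show "Uq_class a d x \<oplus>\<^bsub>Uq_neg a d\<^esub> Uq_class a d y = Uq_class a d (x + y)"
  using ring_hom_add[OF h c c, of x y] by (simp add: Uq_class_def Uq_neg_def) (simp add: ring_of_type_algebra_def)
 show "Uq_class a d x \<otimes>\<^bsub>Uq_neg a d\<^esub> Uq_class a d y = Uq_class a d (x * y)"
  using ring_hom_mult[OF h c c, of x y] by (simp add: Uq_class_def Uq_neg_def) (simp add: ring_of_type_algebra_def)
 show "\<one>\<^bsub>Uq_neg a d\<^esub> = Uq_class a d 1"
  using ring_hom_one[OF h] by (simp add: Uq_class_def Uq_neg_def) (simp add: ring_of_type_algebra_def)
 show "x \<in> Uq_class a d x" unfolding Uq_class_def by (rule I.a_rcos_self[OF c])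
qed

lemma sh_eval_Uq_class: assumes "Uq_class a d x = Uq_class a d y" shows "E x W = E y W"
proof -
 have "x \<in> Uq_class a d y" using Uq_class_ops(4)[of x] assms by simp
 then obtain s where s: "s \<in> serre_ideal a d" and x: "x = s + y"
  by (auto simp: Uq_class_def a_r_coset_def' ring_of_type_algebra_def)
 then show ?thesis using sh_eval_serre_ideal[OF s] by (simp add: sh_eval_add)
qed

text \<open>The graph of the homomorphism to be built: the same symbol is computed on one side by
  evaluation over \<rat>(v), on the other side from a homology class over \<int>[v, 1/v].\<close>

definition corresponds :: "('i word \<Rightarrow>\<^sub>0 qv) set => ('i colouring => 'i conf_bm) => bool" where
 "corresponds x h \<longleftrightarrow>
   (\<exists>y S. x = Uq_class a d y \<and> (\<forall>W. E y W = to_qv (S W)) \<and> has_symbol a d h S)"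

lemma correspondsI: assumes "\<forall>W. E y W = to_qv (S W)" "has_symbol a d h S" shows "corresponds (Uq_class a d y) h"
 unfolding corresponds_def using assms by blast

text \<open>Evaluation is well defined modulo the Serre ideal, \<int>[v, 1/v] embeds into \<rat>(v),
  and \<open>symbol_inj\<close> passes from symbols to classes.\<close>

lemma corresponds_unique: assumes "corresponds x h" "corresponds x h'" shows "h = h'"
proof -
 obtain y S where y: "x = Uq_class a d y" "\<forall>W. E y W = to_qv (S W)" "has_symbol a d h S"
  using assms(1) unfolding corresponds_def by blast
 obtain y' S' where y': "x = Uq_class a d y'" "\<forall>W. E y' W = to_qv (S' W)" "has_symbol a d h' S'"
  using assms(2) unfolding corresponds_def by blast
 have "to_qv (S W) = to_qv (S' W)" for W using sh_eval_Uq_class[of y y' W] y y' by simp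
 then have "S = S'" by (simp add: to_qv_simps fun_eq_iff)
 then show ?thesis using symbol_inj[of a d h S h'] y(3) y'(3) by simp
qed

lemma corresponds_gen: "corresponds (Uv_gen a d i k) (F_div a d i k)" unfolding corresponds_def Uv_gen_def
 by (intro exI[of _ "free_divpow d i k"] exI[of _ "F_symbol d i k"] conjI allI refl sh_eval_divpow F_div_symbol)

lemma corresponds_one: "corresponds \<one>\<^bsub>Uq_neg a d\<^esub> \<one>\<^bsub>H_BM a d\<^esub>"
proof -
 have "E 1 W = to_qv (eps W)" for W
  using sh_eval_const[of "\<lambda>i j. to_qv (braid a d i j)" 1 W] by (simp add: free_const_def eps_def to_qv_simps)
 then show ?thesis unfolding corresponds_def using has_symbol_one[of a d] Uq_class_ops(3) by blast
qed

lemma corresponds_add: assumes "corresponds x h" "corresponds x' h'"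
 shows "corresponds (x \<oplus>\<^bsub>Uq_neg a d\<^esub> x') (h \<oplus>\<^bsub>H_BM a d\<^esub> h')"
proof -
 obtain y S where y: "x = Uq_class a d y" "\<forall>W. E y W = to_qv (S W)" "has_symbol a d h S"
  using assms(1) unfolding corresponds_def by blast
 obtain y' S' where y': "x' = Uq_class a d y'" "\<forall>W. E y' W = to_qv (S' W)" "has_symbol a d h' S'"
  using assms(2) unfolding corresponds_def by blast
 have "\<forall>W. E (y + y') W = to_qv (S W + S' W)" using y y' by (simp add: sh_eval_add to_qv_simps)
 then show ?thesis unfolding y(1) y'(1) Uq_class_ops by (rule correspondsI[OF _ has_symbol_add[OF y(3) y'(3)]])
qed

lemma corresponds_mult: assumes "corresponds x h" "corresponds x' h'"
 shows "corresponds (x \<otimes>\<^bsub>Uq_neg a d\<^esub> x') (h \<otimes>\<^bsub>H_BM a d\<^esub> h')"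
proof -
 obtain y S where y: "x = Uq_class a d y" "\<forall>W. E y W = to_qv (S W)" "has_symbol a d h S"
  using assms(1) unfolding corresponds_def by blast
 obtain y' S' where y': "x' = Uq_class a d y'" "\<forall>W. E y' W = to_qv (S' W)" "has_symbol a d h' S'"
  using assms(2) unfolding corresponds_def by blast
 have "E y = (\<lambda>W. to_qv (S W))" "E y' = (\<lambda>W. to_qv (S' W))" using y y' by auto
 then have "\<forall>W. E (y * y') W = to_qv (shp (braid a d) S S' W)" by (simp add: sh_eval_mult shp_to_qv)
 moreover have "has_symbol a d (h \<otimes>\<^bsub>H_BM a d\<^esub> h') (shp (braid a d) S S')"
  using has_symbol_mult[OF ad y(3) y'(3)] by simp
 ultimately show ?thesis unfolding y(1) y'(1) Uq_class_ops by (rule correspondsI)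
qed

lemma corresponds_smult: assumes "corresponds x h"
 shows "corresponds (Uq_smult a d r x) (r \<odot>\<^bsub>H_BM a d\<^esub> h)"
proof -
 obtain y S where y: "x = Uq_class a d y" "\<forall>W. E y W = to_qv (S W)" "has_symbol a d h S"
  using assms(1) unfolding corresponds_def by blast
 have "\<forall>W. E (free_const (to_qv r) * y) W = to_qv (r * S W)"
  using y by (simp add: sh_eval_mult sh_eval_const[abs_def] shp_scale shp_eps to_qv_simps)
 then show ?thesis unfolding y(1) Uq_smult_def Uq_class_ops by (rule correspondsI[OF _ has_symbol_smult[OF y(3)]])
qed

text \<open>Induction over the generation of the integral form, which starts from divided powers;
  other elements over \<rat>(v) may have symbols with denominators.\<close>

lemma corresponds_exists: assumes "x \<in> Uv_set a d" shows "\<exists>h. corresponds x h" using assms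
proof induction
 case (gen i k)
 show ?case by (rule exI, rule corresponds_gen)
next
 case one
 show ?case by (rule exI, rule corresponds_one)
next
 case (add x y)
 then obtain h h' where h: "corresponds x h" "corresponds y h'" by blast
 show ?case by (rule exI, rule corresponds_add[OF h])
next
 case (mult x y)
 then obtain h h' where h: "corresponds x h" "corresponds y h'" by blast
 show ?case by (rule exI, rule corresponds_mult[OF h])
next
 case (smult x r)
 then obtain h where h: "corresponds x h" by blast
 show ?case by (rule exI, rule corresponds_smult[OF h])
qed

text \<open>On the integral form the graph is total and single valued, and since it is closed under
  all operations the resulting function is a homomorphism.\<close>

lemma ex_alg_hom:
 "\<exists>h \<in> alg_hom (Uv_neg a d) (H_BM a d). \<forall>\<alpha> (k::nat). h (Uv_gen a d \<alpha> k) = F_div a d \<alpha> k"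
proof -
 define h where "h = (\<lambda>x. SOME h. corresponds x h)"
 have h: "corresponds x (h x)" if "x \<in> Uv_set a d" for x
  unfolding h_def using corresponds_exists[OF that] by (rule someI_ex)
 have eq: "h x = y" if "x \<in> Uv_set a d" "corresponds x y" for x y using corresponds_unique[OF h[OF that(1)] that(2)] .
 have "h (Uv_gen a d \<alpha> k) = F_div a d \<alpha> k" for \<alpha> k by (rule eq[OF Uv_set.gen corresponds_gen])
 moreover have "h \<in> ring_hom (Uv_neg a d) (H_BM a d)"
 proof (rule ring_hom_memI)
  fix x assume "x \<in> carrier (Uv_neg a d)"
  then have "corresponds x (h x)" using h by (simp add: Uv_neg_def)
  then show "h x \<in> carrier (H_BM a d)" by (auto simp: corresponds_def has_symbol_def)
 next
  fix x y assume "x \<in> carrier (Uv_neg a d)" "y \<in> carrier (Uv_neg a d)"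
  then have xy: "x \<in> Uv_set a d" "y \<in> Uv_set a d" by (simp_all add: Uv_neg_def)
  show "h (x \<otimes>\<^bsub>Uv_neg a d\<^esub> y) = h x \<otimes>\<^bsub>H_BM a d\<^esub> h y"
   using eq[OF Uv_set.mult[OF xy] corresponds_mult[OF h[OF xy(1)] h[OF xy(2)]]] by (simp add: Uv_neg_def)
  show "h (x \<oplus>\<^bsub>Uv_neg a d\<^esub> y) = h x \<oplus>\<^bsub>H_BM a d\<^esub> h y"
   using eq[OF Uv_set.add[OF xy] corresponds_add[OF h[OF xy(1)] h[OF xy(2)]]] by (simp add: Uv_neg_def)
 next
  show "h \<one>\<^bsub>Uv_neg a d\<^esub> = \<one>\<^bsub>H_BM a d\<^esub>"
   using eq[OF Uv_set.one corresponds_one] by (simp add: Uv_neg_def)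
 qed
 moreover have "h (r \<odot>\<^bsub>Uv_neg a d\<^esub> x) = r \<odot>\<^bsub>H_BM a d\<^esub> h x" if x: "x \<in> carrier (Uv_neg a d)" for r x
 proof -
  have "x \<in> Uv_set a d" using x by (simp add: Uv_neg_def)
  from eq[OF Uv_set.smult[OF this] corresponds_smult[OF h[OF this]]] show ?thesis by (simp add: Uv_neg_def)
 qed
 ultimately show ?thesis unfolding alg_hom_def by blast
qed

lemma divided_power_relation:
 "F_div a d \<alpha> 1 [^]\<^bsub>H_BM a d\<^esub> k = qfact (int (d \<alpha>)) k \<odot>\<^bsub>H_BM a d\<^esub> F_div a d \<alpha> k"
 by (rule symbol_inj[OF has_symbol_power has_symbol_smult[OF F_div_symbol]])

text \<open>The triple product is bracketed to the left here and to the right in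
  \<open>serre_shuffle\<close>; the change of brackets is made on symbols, by
  \<open>shp_assoc\<close>.\<close>

lemma serre_relation: assumes "i \<noteq> j"
 shows "(\<Oplus>\<^bsub>H_BM a d\<^esub> m\<in>{0..nat (1 - a i j)}. (- 1) ^ m \<odot>\<^bsub>H_BM a d\<^esub>
   (F_div a d i m \<otimes>\<^bsub>H_BM a d\<^esub> F_div a d j 1 \<otimes>\<^bsub>H_BM a d\<^esub> F_div a d i (nat (1 - a i j) - m)))
  = \<zero>\<^bsub>H_BM a d\<^esub>"
proof -
 define N where "N = nat (1 - a i j)"
 let ?S = "\<lambda>m w. (- 1) ^ m * shp (braid a d) (shp (braid a d) (F_symbol d i m) (F_symbol d j 1)) (F_symbol d i (N - m)) w"
 have "has_symbol a d ((- 1) ^ m \<odot>\<^bsub>H_BM a d\<^esub>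
   (F_div a d i m \<otimes>\<^bsub>H_BM a d\<^esub> F_div a d j 1 \<otimes>\<^bsub>H_BM a d\<^esub> F_div a d i (N - m))) (?S m)" for m
  unfolding H_BM_simps(1) by (intro has_symbol_smult has_symbol_mult[OF ad] F_div_symbol)
 then have "has_symbol a d (\<Oplus>\<^bsub>H_BM a d\<^esub> m\<in>{0..N}. (- 1) ^ m \<odot>\<^bsub>H_BM a d\<^esub>
   (F_div a d i m \<otimes>\<^bsub>H_BM a d\<^esub> F_div a d j 1 \<otimes>\<^bsub>H_BM a d\<^esub> F_div a d i (N - m)))
   (\<lambda>w. \<Sum>m\<in>{0..N}. ?S m w)" by (intro has_symbol_finsum ballI) simp_all
 also have "(\<lambda>w. \<Sum>m\<in>{0..N}. ?S m w) = (\<lambda>_. 0)"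
  using serre_shuffle[OF ad assms] unfolding shp_assoc N_def atLeast0AtMost by simp
 finally show ?thesis unfolding N_def H_BM_simps(3) by (rule symbol_inj[OF _ has_symbol_zero])
qed

end

theorem theorem1p1:
  fixes a :: "'i::{finite,linorder} \<Rightarrow> 'i \<Rightarrow> int" and d :: "'i \<Rightarrow> nat"
  assumes "cartan_datum a d"
  shows "(\<forall>\<alpha> (k::nat). F_div a d \<alpha> 1 [^]\<^bsub>H_BM a d\<^esub> k
            = qfact (int (d \<alpha>)) k \<odot>\<^bsub>H_BM a d\<^esub> F_div a d \<alpha> k) \<and>
         (\<forall>i j. i \<noteq> j \<longrightarrow>
            (\<Oplus>\<^bsub>H_BM a d\<^esub> m\<in>{0..nat (1 - a i j)}. (- 1) ^ m \<odot>\<^bsub>H_BM a d\<^esub>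
               (F_div a d i m \<otimes>\<^bsub>H_BM a d\<^esub> F_div a d j 1
                  \<otimes>\<^bsub>H_BM a d\<^esub> F_div a d i (nat (1 - a i j) - m)))
            = \<zero>\<^bsub>H_BM a d\<^esub>) \<and>
         (\<exists>h \<in> alg_hom (Uv_neg a d) (H_BM a d).
            \<forall>\<alpha> (k::nat). h (Uv_gen a d \<alpha> k) = F_div a d \<alpha> k)"
  using divided_power_relation[OF assms] serre_relation[OF assms] ex_alg_hom[OF assms] by blast

end
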